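(* Let $\mathcal{A}$ be a complete bornological $K$-algebra, and let $(\mathcal L(\mathcal A)^\bullet,\delta_\bullet)$ be the complex with $\mathcal L(\mathcal A)^n=\underline{\operatorname{Hom}}_{\widehat{\mathcal{B}}c_K}(\widehat{\otimes}_K^n\mathcal{A},\mathcal{A})$. The TH (Taylor–Hochschild) cohomology spaces of $\mathcal{A}$ are the bornological spaces $$\operatorname{HH}_{\operatorname{T}}^n(\mathcal{A})=\operatorname{Coker}\left(J(\mathcal{L}(\mathcal{A})^{n-1})\rightarrow J(\operatorname{Ker}(\delta_n))\right).$$ They satisfy: (i) $\operatorname{HH}_{\operatorname{T}}^0(\mathcal{A})=\operatorname{Z}(\mathcal{A})$, the center of $\mathcal A$. (ii) $\operatorname{HH}_{\operatorname{T}}^1(\mathcal{A})=\underline{\operatorname{Out}}(\mathcal{A}):= \underline{\operatorname{Der}}_K(\mathcal{A})/\underline{\operatorname{Inn}}(\mathcal{A})$. (iii) $\operatorname{HH}_{\operatorname{T}}^2(\mathcal{A})=\mathcal{E}xt(\mathcal{A})$, i.e. the map $\mathcal{E}xt(\mathcal A)\to \operatorname{HH}^2_{\operatorname T}(\mathcal A)$ sending the class of an infinitesimal deformation with reduction $\sigma:\mathcal B\to\mathcal A$ modulo $t$ to the class of the cocycle $a\otimes b\mapsto \rho(a)\rho(b)-\rho(ab)$, for any bounded $K$-linear section $\rho:\mathcal A\to \mathcal B$ of $\sigma$, is a bijection.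
   Context: $K$ is a complete non-archimedean field of mixed characteristic $(0,p)$ with valuation ring $\mathcal R$. A bornology on a $K$-vector space is a family of ("bounded") subsets containing singletons and closed under subsets, finite unions, scalar multiples and passing to the generated $\mathcal R$-submodule; $\mathcal Bc_K$ is the category of bornological $K$-vector spaces and bounded linear maps, and $J:\widehat{\mathcal B}c_K\to\mathcal Bc_K$ is the inclusion of the full subcategory of complete ones (filtered colimits in $\mathcal Bc_K$ of Banach spaces). $\widehat\otimes_K$ is the completed projective bornological tensor product (completion of $V\otimes_KW$ with bornology generated by $B_1\otimes_{\mathcal R}B_2$ for bounded $\mathcal R$-submodules $B_i$), and $\underline{\operatorname{Hom}}_{\widehat{\mathcal B}c_K}(V,W)$ is the space of bounded maps with bornology of the sets $U$ such that $\bigcup_{f\in U}f(B)$ is bounded for all bounded $B\subset V$. Cokernels in $\mathcal Bc_K$ are vector space quotients with the quotient bornology. A complete bornological algebra is a (unital, associative) monoid in $(\widehat{\mathcal B}c_K,\widehat\otimes_K)$. The differential is $\delta_nf(a_0\otimes\cdots\otimes a_n)=a_0f(a_1\otimes\cdots\otimes a_n)+\sum_{i=1}^n(-1)^if(a_0\otimes\cdots\otimes a_{i-1}a_i\otimes\cdots\otimes a_n)+(-1)^{n+1}f(a_0\otimes\cdots\otimes a_{n-1})a_n$ (with $\mathcal L(\mathcal A)^{-1}=0$). $\underline{\operatorname{Der}}_K(\mathcal A)$ is the space of bounded $K$-linear derivations $\mathcal A\to\mathcal A$ and $\underline{\operatorname{Inn}}(\mathcal A)$ the inner derivations $a\mapsto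 am-ma$, with bornologies induced from $\underline{\operatorname{Hom}}_{\widehat{\mathcal B}c_K}(\mathcal A,\mathcal A)$. An infinitesimal deformation of $\mathcal A$ is a complete bornological $K[t]/(t^2)$-algebra structure $\mathcal B$ on $\mathcal A\otimes_KK[t]/(t^2)$ which reduces to $\mathcal A$ modulo $t$; here $t\mathcal B\cong\mathcal A$ is a square-zero ideal. Two are isomorphic if there is a bounded isomorphism of $K[t]/(t^2)$-algebras between them which is the identity modulo $t$. $\mathcal{E}xt(\mathcal A)$ is the set of isomorphism classes. (In (iii), $\rho(a)\rho(b)-\rho(ab)\in t\mathcal B\cong\mathcal A$.) *)

theory Defs
  imports Complex_Main "HOL-Computational_Algebra.Primes" "HOL-Algebra.Module" "HOL-Algebra.AbelCoset"
begin

section \<open>The ground field\<close>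

record 'k valued_ring = "'k ring" +
  absval :: "'k \<Rightarrow> real"

definition val_ring :: "'k valued_ring \<Rightarrow> 'k valued_ring" where
  "val_ring K = K\<lparr>carrier := {c \<in> carrier K. absval K c \<le> 1}\<rparr>"

definition cauchy_complete :: "('v, 'm) ring_scheme \<Rightarrow> 'v set \<Rightarrow> ('v \<Rightarrow> real) \<Rightarrow> bool" where
  "cauchy_complete V E \<nu> \<longleftrightarrow>
     (\<forall>x :: nat \<Rightarrow> 'v. range x \<subseteq> E \<and>
        (\<forall>e>0. \<exists>N. \<forall>i\<ge>N. \<forall>j\<ge>N. \<nu> (x i \<ominus>\<^bsub>V\<^esub> x j) < e)
        \<longrightarrow> (\<exists>l\<in>E. (\<lambda>i. \<nu> (x i \<ominus>\<^bsub>V\<^esub> l)) \<longlonglongrightarrow> 0))"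

text \<open>The last two assumptions say that \<open>p\<close> lies in the maximal ideal of the valuation ring,
  i.e. that the residue field has characteristic \<open>p\<close>.  Since \<open>p \<noteq> 0\<close> in \<open>K\<close>, the absolute value
  is then automatically nontrivial.\<close>

locale mixed_char_complete_field = field K for K :: "'k valued_ring" (structure) +
  fixes p :: nat
  assumes absval_nonneg: "x \<in> carrier K \<Longrightarrow> 0 \<le> absval K x"
    and absval_eq_0: "x \<in> carrier K \<Longrightarrow> absval K x = 0 \<longleftrightarrow> x = \<zero>"
    and absval_mult: "\<lbrakk>x \<in> carrier K; y \<in> carrier K\<rbrakk> \<Longrightarrow>
          absval K (x \<otimes> y) = absval K x * absval K y"
    and absval_add: "\<lbrakk>x \<in> carrier K; y \<in> carrier K\<rbrakk> \<Longrightarrow>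
          absval K (x \<oplus> y) \<le> max (absval K x) (absval K y)"
    and absval_complete: "cauchy_complete K (carrier K) (absval K)"
    and char_0: "0 < n \<Longrightarrow> [(n::nat)] \<cdot> \<one> \<noteq> \<zero>"
    and prime_p: "Factorial_Ring.prime p"
    and residue_char_p: "absval K ([p] \<cdot> \<one>) < 1"


section \<open>Bornological vector spaces\<close>

text \<open>The fields \<open>mult\<close> and \<open>one\<close>, inherited from the ring record underlying \<open>module\<close>,
  are meaningful only for algebras.\<close>

record ('k, 'v) born_space = "('k, 'v) module" +
  bornology :: "'v set set"

definition module_span ::
    "('k, 'r) ring_scheme \<Rightarrow> ('k, 'v, 'm) module_scheme \<Rightarrow> 'v set \<Rightarrow> 'v set" where
  "module_span R M S = \<Inter> {N. submodule N R M \<and> S \<subseteq> N}"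

definition is_bornology ::
    "'k valued_ring \<Rightarrow> ('k, 'v, 'm) module_scheme \<Rightarrow> 'v set set \<Rightarrow> bool" where
  "is_bornology K M \<B> \<longleftrightarrow>
     \<B> \<subseteq> Pow (carrier M) \<and>
     (\<forall>x\<in>carrier M. {x} \<in> \<B>) \<and>
     (\<forall>B\<in>\<B>. \<forall>B'. B' \<subseteq> B \<longrightarrow> B' \<in> \<B>) \<and>
     (\<forall>B\<in>\<B>. \<forall>B'\<in>\<B>. B \<union> B' \<in> \<B>) \<and>
     (\<forall>c\<in>carrier K. \<forall>B\<in>\<B>. (\<lambda>x. c \<odot>\<^bsub>M\<^esub> x) ` B \<in> \<B>) \<and>
     (\<forall>B\<in>\<B>. module_span (val_ring K) M B \<in> \<B>)"

definition generated_bornology ::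
    "'k valued_ring \<Rightarrow> ('k, 'v, 'm) module_scheme \<Rightarrow> 'v set set \<Rightarrow> 'v set set" where
  "generated_bornology K M \<G> = \<Inter> {\<B>. is_bornology K M \<B> \<and> \<G> \<subseteq> \<B>}"

definition bornological_space :: "'k valued_ring \<Rightarrow> ('k, 'v) born_space \<Rightarrow> bool" where
  "bornological_space K V \<longleftrightarrow> module K V \<and> is_bornology K V (bornology V)"

definition bounded_submodules :: "'k valued_ring \<Rightarrow> ('k, 'v) born_space \<Rightarrow> 'v set set" where
  "bounded_submodules K V = {B \<in> bornology V. submodule B (val_ring K) V}"

definition bounded_linear_map ::
    "'k valued_ring \<Rightarrow> ('k, 'v) born_space \<Rightarrow> ('k, 'w) born_space \<Rightarrow> ('v \<Rightarrow> 'w) \<Rightarrow> bool" where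
  "bounded_linear_map K V W f \<longleftrightarrow>
     f \<in> hom (add_monoid V) (add_monoid W) \<and>
     (\<forall>c\<in>carrier K. \<forall>x\<in>carrier V. f (c \<odot>\<^bsub>V\<^esub> x) = c \<odot>\<^bsub>W\<^esub> f x) \<and>
     (\<forall>B\<in>bornology V. f ` B \<in> bornology W)"

definition born_iso ::
    "'k valued_ring \<Rightarrow> ('k, 'v) born_space \<Rightarrow> ('k, 'w) born_space \<Rightarrow> ('v \<Rightarrow> 'w) \<Rightarrow> bool" where
  "born_iso K V W f \<longleftrightarrow>
     bounded_linear_map K V W f \<and> bij_betw f (carrier V) (carrier W) \<and>
     bounded_linear_map K W V (inv_into (carrier V) f)"

definition hom_space ::
    "'k valued_ring \<Rightarrow> ('k, 'v) born_space \<Rightarrow> ('k, 'w) born_space \<Rightarrow> ('k, 'v \<Rightarrow> 'w) born_space"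
  where
  "hom_space K V W =
     (let H = {f. bounded_linear_map K V W f \<and> f \<in> extensional (carrier V)} in
      \<lparr>carrier = H, mult = undefined, one = undefined,
       zero = (\<lambda>x\<in>carrier V. \<zero>\<^bsub>W\<^esub>),
       add = (\<lambda>f g. \<lambda>x\<in>carrier V. f x \<oplus>\<^bsub>W\<^esub> g x),
       smult = (\<lambda>c f. \<lambda>x\<in>carrier V. c \<odot>\<^bsub>W\<^esub> f x),
       bornology = {U. U \<subseteq> H \<and> (\<forall>B\<in>bornology V. (\<Union>f\<in>U. f ` B) \<in> bornology W)}\<rparr>)"

definition sub_space :: "('k, 'v) born_space \<Rightarrow> 'v set \<Rightarrow> ('k, 'v) born_space" where
  "sub_space V S = V\<lparr>carrier := S, bornology := {B \<in> bornology V. B \<subseteq> S}\<rparr>"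

text \<open>Quotient module, with cosets as elements.  In the scalar multiplication \<open>N\<close> is added
  because \<open>c \<odot> X\<close> alone is not a coset when \<open>c = 0\<close>.\<close>

definition quotient_module ::
    "('k, 'v, 'm) module_scheme \<Rightarrow> 'v set \<Rightarrow> ('k, 'v set) module" where
  "quotient_module V N =
     \<lparr>carrier = a_rcosets\<^bsub>V\<^esub> N, mult = undefined, one = undefined,
      zero = N,
      add = (\<lambda>X Y. X <+>\<^bsub>V\<^esub> Y),
      smult = (\<lambda>c X. N <+>\<^bsub>V\<^esub> ((\<lambda>x. c \<odot>\<^bsub>V\<^esub> x) ` X))\<rparr>"

definition with_bornology :: "('k, 'v) module \<Rightarrow> 'v set set \<Rightarrow> ('k, 'v) born_space" where
  "with_bornology M \<B> =
     \<lparr>carrier = carrier M, mult = mult M, one = one M, zero = zero M, add = add M,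
      smult = smult M, bornology = \<B>\<rparr>"

definition quotient_space :: "('k, 'v) born_space \<Rightarrow> 'v set \<Rightarrow> ('k, 'v set) born_space" where
  "quotient_space V N =
     with_bornology (quotient_module V N) {(\<lambda>x. N +>\<^bsub>V\<^esub> x) ` B | B. B \<in> bornology V}"


section \<open>Complete bornological spaces\<close>

definition banach_on ::
    "'k valued_ring \<Rightarrow> ('k, 'v) born_space \<Rightarrow> 'v set \<Rightarrow> ('v \<Rightarrow> real) \<Rightarrow> bool" where
  "banach_on K V E \<nu> \<longleftrightarrow>
     submodule E K V \<and>
     (\<forall>x\<in>E. 0 \<le> \<nu> x \<and> (\<nu> x = 0 \<longleftrightarrow> x = \<zero>\<^bsub>V\<^esub>)) \<and>
     (\<forall>c\<in>carrier K. \<forall>x\<in>E. \<nu> (c \<odot>\<^bsub>V\<^esub> x) = absval K c * \<nu> x) \<and>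
     (\<forall>x\<in>E. \<forall>y\<in>E. \<nu> (x \<oplus>\<^bsub>V\<^esub> y) \<le> max (\<nu> x) (\<nu> y)) \<and>
     cauchy_complete V E \<nu>"

text \<open>A filtered colimit, in bornological spaces, of Banach spaces with injective transition
  maps: up to isomorphism this is a directed union of subspaces carrying Banach norms, with
  bounded inclusions, in which a set is bounded iff it is norm-bounded in some member.\<close>

definition complete_bornological :: "'k valued_ring \<Rightarrow> ('k, 'v) born_space \<Rightarrow> bool" where
  "complete_bornological K V \<longleftrightarrow>
     bornological_space K V \<and>
     (\<exists>\<E> :: ('v set \<times> ('v \<Rightarrow> real)) set.
        \<E> \<noteq> {} \<and>
        (\<forall>(E, \<nu>)\<in>\<E>. banach_on K V E \<nu>) \<and>
        (\<forall>(E, \<nu>)\<in>\<E>. \<forall>(E', \<nu>')\<in>\<E>. \<exists>(E'', \<nu>'')\<in>\<E>.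
           E \<subseteq> E'' \<and> (\<exists>C. \<forall>x\<in>E. \<nu>'' x \<le> C * \<nu> x) \<and>
           E' \<subseteq> E'' \<and> (\<exists>C. \<forall>x\<in>E'. \<nu>'' x \<le> C * \<nu>' x)) \<and>
        carrier V = (\<Union>(E, \<nu>)\<in>\<E>. E) \<and>
        bornology V = {B. \<exists>(E, \<nu>)\<in>\<E>. B \<subseteq> E \<and> (\<exists>C. \<forall>x\<in>B. \<nu> x \<le> C)})"


section \<open>Completion\<close>

text \<open>Convergence and Cauchy sequences are taken with respect to the gauge of a bounded
  submodule \<open>B\<close> over the valuation ring; the sets \<open>c \<odot> B\<close> with \<open>c \<noteq> 0\<close> form a basis of
  neighbourhoods of \<open>0\<close> for it.\<close>

definition gauge_convergent ::
    "'k valued_ring \<Rightarrow> ('k, 'v) born_space \<Rightarrow> 'v set \<Rightarrow> (nat \<Rightarrow> 'v) \<Rightarrow> 'v \<Rightarrow> bool" where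
  "gauge_convergent K V B x l \<longleftrightarrow>
     (\<forall>c\<in>carrier K - {\<zero>\<^bsub>K\<^esub>}. \<exists>N. \<forall>i\<ge>N. x i \<ominus>\<^bsub>V\<^esub> l \<in> (\<lambda>b. c \<odot>\<^bsub>V\<^esub> b) ` B)"

definition gauge_cauchy ::
    "'k valued_ring \<Rightarrow> ('k, 'v) born_space \<Rightarrow> 'v set \<Rightarrow> (nat \<Rightarrow> 'v) \<Rightarrow> bool" where
  "gauge_cauchy K V B x \<longleftrightarrow>
     (\<forall>c\<in>carrier K - {\<zero>\<^bsub>K\<^esub>}. \<exists>N. \<forall>i\<ge>N. \<forall>j\<ge>N. x i \<ominus>\<^bsub>V\<^esub> x j \<in> (\<lambda>b. c \<odot>\<^bsub>V\<^esub> b) ` B)"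

definition born_convergent ::
    "'k valued_ring \<Rightarrow> ('k, 'v) born_space \<Rightarrow> (nat \<Rightarrow> 'v) \<Rightarrow> 'v \<Rightarrow> bool" where
  "born_convergent K V x l \<longleftrightarrow> (\<exists>B\<in>bounded_submodules K V. gauge_convergent K V B x l)"

definition closed_subspace :: "'k valued_ring \<Rightarrow> ('k, 'v) born_space \<Rightarrow> 'v set \<Rightarrow> bool" where
  "closed_subspace K V M \<longleftrightarrow>
     submodule M K V \<and>
     (\<forall>x l. range x \<subseteq> M \<and> l \<in> carrier V \<and> born_convergent K V x l \<longrightarrow> l \<in> M)"

definition closed_span :: "'k valued_ring \<Rightarrow> ('k, 'v) born_space \<Rightarrow> 'v set \<Rightarrow> 'v set" where
  "closed_span K V S = \<Inter> {M. closed_subspace K V M \<and> S \<subseteq> M}"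

text \<open>A sequence of elements of \<open>V\<close> that is Cauchy for the gauge of one bounded submodule is
  also Cauchy for, and has all its values in, a possibly larger one; so requiring the range to
  lie in \<open>B\<close> does not restrict the carrier, only the bornology.\<close>

definition cauchy_space ::
    "'k valued_ring \<Rightarrow> ('k, 'v) born_space \<Rightarrow> ('k, nat \<Rightarrow> 'v) born_space" where
  "cauchy_space K V =
     (let C = (\<lambda>B. {x. range x \<subseteq> B \<and> gauge_cauchy K V B x}) in
      \<lparr>carrier = (\<Union>B\<in>bounded_submodules K V. C B), mult = undefined, one = undefined,
       zero = (\<lambda>_. \<zero>\<^bsub>V\<^esub>),
       add = (\<lambda>x y i. x i \<oplus>\<^bsub>V\<^esub> y i),
       smult = (\<lambda>c x i. c \<odot>\<^bsub>V\<^esub> x i),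
       bornology = {S. \<exists>B\<in>bounded_submodules K V. S \<subseteq> C B}\<rparr>)"

definition null_sequences :: "'k valued_ring \<Rightarrow> ('k, 'v) born_space \<Rightarrow> (nat \<Rightarrow> 'v) set" where
  "null_sequences K V = {x \<in> carrier (cauchy_space K V). born_convergent K V x \<zero>\<^bsub>V\<^esub>}"

text \<open>The completion (left adjoint to the inclusion of complete bornological spaces).
  Cauchy sequences modulo null sequences form the colimit, over the bounded submodules \<open>B\<close>,
  of the Banach completions of the normed spaces \<open>V\<^sub>B\<close>.  The transition maps of that system need
  not be injective, so the colimit need not be separated; dividing by the closed span of the
  null sequences instead gives its largest separated quotient.\<close>

definition completion ::
    "'k valued_ring \<Rightarrow> ('k, 'v) born_space \<Rightarrow> ('k, (nat \<Rightarrow> 'v) set) born_space" where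
  "completion K V =
     quotient_space (cauchy_space K V) (closed_span K (cauchy_space K V) (null_sequences K V))"

definition to_completion ::
    "'k valued_ring \<Rightarrow> ('k, 'v) born_space \<Rightarrow> 'v \<Rightarrow> (nat \<Rightarrow> 'v) set" where
  "to_completion K V v =
     closed_span K (cauchy_space K V) (null_sequences K V) +>\<^bsub>cauchy_space K V\<^esub> (\<lambda>_. v)"


section \<open>Tensor powers\<close>

text \<open>The \<open>n\<close>-fold algebraic tensor power is the free vector space on the \<open>n\<close>-tuples (lists
  of length \<open>n\<close>), modulo the multilinearity relations.  For \<open>n = 0\<close> it is the free space on
  the empty list, i.e. \<open>K\<close>.\<close>

definition free_module :: "'k valued_ring \<Rightarrow> 's set \<Rightarrow> ('k, 's \<Rightarrow> 'k) module" where
  "free_module K S =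
     \<lparr>carrier = {\<phi>. (\<forall>s. \<phi> s \<in> carrier K) \<and> finite {s. \<phi> s \<noteq> \<zero>\<^bsub>K\<^esub>} \<and>
                   {s. \<phi> s \<noteq> \<zero>\<^bsub>K\<^esub>} \<subseteq> S},
      mult = undefined, one = undefined,
      zero = (\<lambda>_. \<zero>\<^bsub>K\<^esub>),
      add = (\<lambda>\<phi> \<psi> s. \<phi> s \<oplus>\<^bsub>K\<^esub> \<psi> s),
      smult = (\<lambda>c \<phi> s. c \<otimes>\<^bsub>K\<^esub> \<phi> s)\<rparr>"

definition free_gen :: "'k valued_ring \<Rightarrow> 's \<Rightarrow> 's \<Rightarrow> 'k" where
  "free_gen K s = (\<lambda>s'. if s' = s then \<one>\<^bsub>K\<^esub> else \<zero>\<^bsub>K\<^esub>)"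

definition tuples :: "('k, 'v) born_space \<Rightarrow> nat \<Rightarrow> 'v list set" where
  "tuples V n = {xs. length xs = n \<and> set xs \<subseteq> carrier V}"

definition multilinear_relations ::
    "'k valued_ring \<Rightarrow> ('k, 'v) born_space \<Rightarrow> nat \<Rightarrow> ('v list \<Rightarrow> 'k) set" where
  "multilinear_relations K V n =
     (let F = free_module K (tuples V n) in
      {free_gen K (xs[i := a \<oplus>\<^bsub>V\<^esub> b]) \<ominus>\<^bsub>F\<^esub> (free_gen K (xs[i := a]) \<oplus>\<^bsub>F\<^esub> free_gen K (xs[i := b])) | xs i a b.
         xs \<in> tuples V n \<and> i < n \<and> a \<in> carrier V \<and> b \<in> carrier V} \<union>
      {free_gen K (xs[i := c \<odot>\<^bsub>V\<^esub> a]) \<ominus>\<^bsub>F\<^esub> (c \<odot>\<^bsub>F\<^esub> free_gen K (xs[i := a])) | xs i c a.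
         xs \<in> tuples V n \<and> i < n \<and> c \<in> carrier K \<and> a \<in> carrier V})"

definition algebraic_tensor_power ::
    "'k valued_ring \<Rightarrow> ('k, 'v) born_space \<Rightarrow> nat \<Rightarrow> ('k, ('v list \<Rightarrow> 'k) set) module" where
  "algebraic_tensor_power K V n =
     (let F = free_module K (tuples V n) in
      quotient_module F (module_span K F (multilinear_relations K V n)))"

definition pure_tensor ::
    "'k valued_ring \<Rightarrow> ('k, 'v) born_space \<Rightarrow> 'v list \<Rightarrow> ('v list \<Rightarrow> 'k) set" where
  "pure_tensor K V xs =
     (let n = length xs; F = free_module K (tuples V n) in
      module_span K F (multilinear_relations K V n) +>\<^bsub>F\<^esub> free_gen K xs)"

text \<open>Projective tensor power: the bornology is generated by the images of
  \<open>B\<^sub>1 \<otimes> \<dots> \<otimes> B\<^sub>n\<close> for bounded submodules \<open>B\<^sub>i\<close> over the valuation ring.\<close>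

definition tensor_power ::
    "'k valued_ring \<Rightarrow> ('k, 'v) born_space \<Rightarrow> nat \<Rightarrow> ('k, ('v list \<Rightarrow> 'k) set) born_space" where
  "tensor_power K V n =
     (let T = algebraic_tensor_power K V n in
      with_bornology T (generated_bornology K T
        {module_span (val_ring K) T (pure_tensor K V ` listset Bs) | Bs.
           length Bs = n \<and> set Bs \<subseteq> bounded_submodules K V}))"

type_synonym ('k, 'v) ctensor = "(nat \<Rightarrow> ('v list \<Rightarrow> 'k) set) set"

definition completed_tensor_power ::
    "'k valued_ring \<Rightarrow> ('k, 'v) born_space \<Rightarrow> nat \<Rightarrow> ('k, ('k, 'v) ctensor) born_space" where
  "completed_tensor_power K V n = completion K (tensor_power K V n)"

definition ctensor ::
    "'k valued_ring \<Rightarrow> ('k, 'v) born_space \<Rightarrow> 'v list \<Rightarrow> ('k, 'v) ctensor" where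
  "ctensor K V xs = to_completion K (tensor_power K V (length xs)) (pure_tensor K V xs)"


section \<open>Complete bornological algebras\<close>

text \<open>The multiplication is a bounded linear map \<open>\<mu>\<close> on the completed tensor square; in
  particular it is \<open>K\<close>-bilinear.\<close>

definition complete_born_algebra :: "'k valued_ring \<Rightarrow> ('k, 'a) born_space \<Rightarrow> bool" where
  "complete_born_algebra K A \<longleftrightarrow>
     complete_bornological K A \<and> ring A \<and>
     (\<exists>\<mu>. bounded_linear_map K (completed_tensor_power K A 2) A \<mu> \<and>
        (\<forall>a\<in>carrier A. \<forall>b\<in>carrier A. \<mu> (ctensor K A [a, b]) = a \<otimes>\<^bsub>A\<^esub> b))"

definition algebra_center :: "('k, 'a) born_space \<Rightarrow> ('k, 'a) born_space" where
  "algebra_center A = sub_space A {z \<in> carrier A. \<forall>a\<in>carrier A. a \<otimes>\<^bsub>A\<^esub> z = z \<otimes>\<^bsub>A\<^esub> a}"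

definition derivations ::
    "'k valued_ring \<Rightarrow> ('k, 'a) born_space \<Rightarrow> ('k, 'a \<Rightarrow> 'a) born_space" where
  "derivations K A = sub_space (hom_space K A A)
     {f \<in> carrier (hom_space K A A). \<forall>a\<in>carrier A. \<forall>b\<in>carrier A.
        f (a \<otimes>\<^bsub>A\<^esub> b) = a \<otimes>\<^bsub>A\<^esub> f b \<oplus>\<^bsub>A\<^esub> f a \<otimes>\<^bsub>A\<^esub> b}"

definition inner_derivations ::
    "'k valued_ring \<Rightarrow> ('k, 'a) born_space \<Rightarrow> ('k, 'a \<Rightarrow> 'a) born_space" where
  "inner_derivations K A = sub_space (hom_space K A A)
     {\<lambda>a\<in>carrier A. a \<otimes>\<^bsub>A\<^esub> m \<ominus>\<^bsub>A\<^esub> m \<otimes>\<^bsub>A\<^esub> a | m. m \<in> carrier A}"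

definition outer_derivations ::
    "'k valued_ring \<Rightarrow> ('k, 'a) born_space \<Rightarrow> ('k, ('a \<Rightarrow> 'a) set) born_space" where
  "outer_derivations K A = quotient_space (derivations K A) (carrier (inner_derivations K A))"


section \<open>Taylor--Hochschild cohomology\<close>

definition cochains ::
    "'k valued_ring \<Rightarrow> ('k, 'a) born_space \<Rightarrow> nat \<Rightarrow> ('k, ('k, 'a) ctensor \<Rightarrow> 'a) born_space" where
  "cochains K A n = hom_space K (completed_tensor_power K A n) A"

definition contract :: "('k, 'a) born_space \<Rightarrow> nat \<Rightarrow> 'a list \<Rightarrow> 'a list" where
  "contract A i xs = take (i - 1) xs @ [xs ! (i - 1) \<otimes>\<^bsub>A\<^esub> xs ! i] @ drop (Suc i) xs"

text \<open>A bounded linear map on a completed tensor power is determined by its values on pure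
  tensors, which is how the differential is specified.  The list \<open>xs\<close> is \<open>[a\<^sub>0, \<dots>, a\<^sub>n]\<close>.\<close>

definition differential ::
    "'k valued_ring \<Rightarrow> ('k, 'a) born_space \<Rightarrow> nat \<Rightarrow>
     (('k, 'a) ctensor \<Rightarrow> 'a) \<Rightarrow> ('k, 'a) ctensor \<Rightarrow> 'a" where
  "differential K A n f =
     (THE g. g \<in> carrier (cochains K A (Suc n)) \<and>
        (\<forall>xs\<in>tuples A (Suc n).
           g (ctensor K A xs) =
             hd xs \<otimes>\<^bsub>A\<^esub> f (ctensor K A (tl xs))
             \<oplus>\<^bsub>A\<^esub> (\<Oplus>\<^bsub>A\<^esub>i\<in>{1..n}. ((\<ominus>\<^bsub>K\<^esub> \<one>\<^bsub>K\<^esub>) [^]\<^bsub>K\<^esub> i) \<odot>\<^bsub>A\<^esub> f (ctensor K A (contract A i xs)))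
             \<oplus>\<^bsub>A\<^esub> ((\<ominus>\<^bsub>K\<^esub> \<one>\<^bsub>K\<^esub>) [^]\<^bsub>K\<^esub> Suc n) \<odot>\<^bsub>A\<^esub> (f (ctensor K A (butlast xs)) \<otimes>\<^bsub>A\<^esub> last xs)))"

definition cocycles ::
    "'k valued_ring \<Rightarrow> ('k, 'a) born_space \<Rightarrow> nat \<Rightarrow> ('k, ('k, 'a) ctensor \<Rightarrow> 'a) born_space" where
  "cocycles K A n = sub_space (cochains K A n)
     (a_kernel (cochains K A n) (cochains K A (Suc n)) (differential K A n))"

definition coboundaries ::
    "'k valued_ring \<Rightarrow> ('k, 'a) born_space \<Rightarrow> nat \<Rightarrow> (('k, 'a) ctensor \<Rightarrow> 'a) set" where
  "coboundaries K A n =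
     (case n of 0 \<Rightarrow> {\<zero>\<^bsub>cochains K A 0\<^esub>}
      | Suc m \<Rightarrow> differential K A m ` carrier (cochains K A m))"

definition HH ::
    "'k valued_ring \<Rightarrow> ('k, 'a) born_space \<Rightarrow> nat \<Rightarrow> ('k, (('k, 'a) ctensor \<Rightarrow> 'a) set) born_space"
  where
  "HH K A n = quotient_space (cocycles K A n) (coboundaries K A n)"

definition cohomology_class ::
    "'k valued_ring \<Rightarrow> ('k, 'a) born_space \<Rightarrow> nat \<Rightarrow>
     (('k, 'a) ctensor \<Rightarrow> 'a) \<Rightarrow> (('k, 'a) ctensor \<Rightarrow> 'a) set" where
  "cohomology_class K A n f = coboundaries K A n +>\<^bsub>cocycles K A n\<^esub> f"


section \<open>Infinitesimal deformations\<close>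

text \<open>The bornological space \<open>A \<otimes> K[t]/(t\<^sup>2) = A \<oplus> A t\<close>, with \<open>(a, b)\<close> standing for \<open>a + b t\<close>.\<close>

definition dual_numbers :: "('k, 'a) born_space \<Rightarrow> ('k, 'a \<times> 'a) born_space" where
  "dual_numbers A =
     \<lparr>carrier = carrier A \<times> carrier A, mult = undefined, one = undefined,
      zero = (\<zero>\<^bsub>A\<^esub>, \<zero>\<^bsub>A\<^esub>),
      add = (\<lambda>(a, b) (a', b'). (a \<oplus>\<^bsub>A\<^esub> a', b \<oplus>\<^bsub>A\<^esub> b')),
      smult = (\<lambda>c (a, b). (c \<odot>\<^bsub>A\<^esub> a, c \<odot>\<^bsub>A\<^esub> b)),
      bornology = {S. S \<subseteq> carrier A \<times> carrier A \<and>
                      fst ` S \<in> bornology A \<and> snd ` S \<in> bornology A}\<rparr>"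

definition t_mult :: "('k, 'a) born_space \<Rightarrow> 'a \<times> 'a \<Rightarrow> 'a \<times> 'a" where
  "t_mult A x = (\<zero>\<^bsub>A\<^esub>, fst x)"

text \<open>Reduction modulo \<open>t\<close> is the map \<open>fst\<close>.\<close>

definition deformation ::
    "'k valued_ring \<Rightarrow> ('k, 'a) born_space \<Rightarrow> ('k, 'a \<times> 'a) born_space \<Rightarrow> bool" where
  "deformation K A B \<longleftrightarrow>
     B = (dual_numbers A)\<lparr>mult := mult B, one := one B\<rparr> \<and>
     complete_born_algebra K B \<and>
     (\<forall>x\<in>carrier B. \<forall>y\<in>carrier B.
        t_mult A x \<otimes>\<^bsub>B\<^esub> y = t_mult A (x \<otimes>\<^bsub>B\<^esub> y) \<and>
        x \<otimes>\<^bsub>B\<^esub> t_mult A y = t_mult A (x \<otimes>\<^bsub>B\<^esub> y)) \<and>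
     fst \<in> ring_hom B A"

definition deformation_iso ::
    "'k valued_ring \<Rightarrow> ('k, 'a) born_space \<Rightarrow>
     (('k, 'a \<times> 'a) born_space \<times> ('k, 'a \<times> 'a) born_space) set" where
  "deformation_iso K A =
     {(B, B'). deformation K A B \<and> deformation K A B' \<and>
        (\<exists>\<phi>. born_iso K B B' \<phi> \<and> \<phi> \<in> ring_hom B B' \<and>
           (\<forall>x\<in>carrier B. \<phi> (t_mult A x) = t_mult A (\<phi> x) \<and> fst (\<phi> x) = fst x))}"

definition Ext_classes ::
    "'k valued_ring \<Rightarrow> ('k, 'a) born_space \<Rightarrow> ('k, 'a \<times> 'a) born_space set set" where
  "Ext_classes K A = {B. deformation K A B} // deformation_iso K A"

definition is_section ::
    "'k valued_ring \<Rightarrow> ('k, 'a) born_space \<Rightarrow> ('k, 'a \<times> 'a) born_space \<Rightarrow> ('a \<Rightarrow> 'a \<times> 'a) \<Rightarrow> bool"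
  where
  "is_section K A B \<rho> \<longleftrightarrow>
     bounded_linear_map K A B \<rho> \<and> (\<forall>a\<in>carrier A. fst (\<rho> a) = a)"

text \<open>The element \<open>\<rho>(a)\<rho>(b) - \<rho>(ab)\<close> lies in \<open>tB\<close>, which is identified with \<open>A\<close> through
  \<open>c \<mapsto> (0, c)\<close>.\<close>

definition represents_defect ::
    "'k valued_ring \<Rightarrow> ('k, 'a) born_space \<Rightarrow> ('k, 'a \<times> 'a) born_space \<Rightarrow> ('a \<Rightarrow> 'a \<times> 'a) \<Rightarrow>
     (('k, 'a) ctensor \<Rightarrow> 'a) \<Rightarrow> bool" where
  "represents_defect K A B \<rho> f \<longleftrightarrow>
     (\<forall>a\<in>carrier A. \<forall>b\<in>carrier A.
        \<rho> a \<otimes>\<^bsub>B\<^esub> \<rho> b \<ominus>\<^bsub>B\<^esub> \<rho> (a \<otimes>\<^bsub>A\<^esub> b) = (\<zero>\<^bsub>A\<^esub>, f (ctensor K A [a, b])))"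

end

theory Submission
  imports Defs
begin

text \<open>
  A bounded linear map on a completed tensor power is the same as a bounded multilinear map:
  it extends to Cauchy sequences by taking limits, its kernel is closed because the target is
  separated, and it is determined by constant sequences.  The correspondence also matches
  equibounded families, so every statement about the complex can be checked on tuples of elements
  of \<open>A\<close>.  Cochains of degree 0 and 1 then become elements of \<open>A\<close> and bounded linear maps, and the
  first two differentials become the commutator and the defect of the Leibniz rule.

  A deformation multiplies \<open>a + b t\<close> and \<open>c + d t\<close> to \<open>a c + (g(a, c) + a d + b c) t\<close> for a bounded
  bilinear map \<open>g\<close>.  Associativity says that \<open>g\<close> is a cocycle, which also yields the unit
  \<open>1 - g(1, 1) t\<close>.  Isomorphisms of deformations and changes of section are both of the form
  \<open>a + b t \<mapsto> a + (b + h(a)) t\<close> and alter \<open>g\<close> by the coboundary of \<open>h\<close>.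
\<close>

section \<open>Modules, linear maps and quotients\<close>

text \<open>\<open>differential\<close> is a definite description over all bounded maps on a
  completed tensor power, so it says nothing until such maps are known to exist with prescribed
  multilinear values and to be unique. This is why the universal properties come before any
  computation in the complex. Degrees 0 and 1 ask for isomorphisms of bornological spaces, so
  boundedness is needed uniformly over families of maps. Hence a bound such as the one in
  \<open>limit_in_bounded\<close> is fixed before the map is chosen. Two tools connect gauges with
  norms. Powers of \<open>p\<close> are nonzero scalars of arbitrarily small absolute value, so
  membership in \<open>c B\<close> for all nonzero \<open>c\<close> and norm estimates can be
  exchanged. A complete space is then used mainly through two facts: it is separated, and all Cauchy
  sequences in one bounded submodule have limits in one bounded submodule. In degree 2 the unit of a
  deformation may have a nonzero \<open>t\<close> part, so cocycles do not have to be normalised.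
  Since the underlying space of a deformation is fixed, the embedding
  \<open>a \<mapsto> (a, 0)\<close> is a section of every deformation and serves as a base
  point.\<close>

lemmas (in abelian_group) ag_simps =
  a_ac minus_eq minus_add minus_minus r_neg l_neg r_neg1 r_neg2

lemma (in abelian_group) minus_eq_zero_iff:
  assumes "x \<in> carrier G" "y \<in> carrier G"
  shows "x \<ominus> y = \<zero> \<longleftrightarrow> x = y"
  using assms by (metis minus_eq r_neg minus_equality minus_minus a_inv_closed)

lemma (in abelian_group) uminus_zero: "\<ominus> \<zero> = \<zero>"
  using minus_equality[of \<zero> \<zero>] by simp

lemma (in abelian_group) minus_zero_right: "x \<in> carrier G \<Longrightarrow> x \<ominus> \<zero> = x"
  by (simp add: minus_eq uminus_zero)

text \<open>The module axioms read only carrier, zero, addition and scalars. So a module survives a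
  change of bornology, of the \<open>mult\<close> and \<open>one\<close> fields, or of the record
  type, which all the derived records here rely on.\<close>

lemma module_cong:
  assumes "module K M" "carrier M' = carrier M" "zero M' = zero M" "add M' = add M"
    "smult M' = smult M"
  shows "module K M'"
proof -
  interpret M: module K M by fact
  have "abelian_group M'"
  proof (rule abelian_groupI)
    fix x assume "x \<in> carrier M'"
    then show "\<exists>y\<in>carrier M'. y \<oplus>\<^bsub>M'\<^esub> x = \<zero>\<^bsub>M'\<^esub>"
      using assms M.M.l_neg M.M.a_inv_closed by auto
  qed (use assms in \<open>auto simp: M.M.a_ac\<close>)
  moreover have "cring K" ..
  ultimately show ?thesis
    using assms
    by (intro moduleI)
      (auto simp: M.smult_l_distr M.smult_r_distr M.smult_assoc1)
qed

section \<open>Linear maps, with and without boundedness\<close>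

definition linear_map ::
    "'k valued_ring \<Rightarrow> ('k, 'v, 'm) module_scheme \<Rightarrow> ('k, 'w, 'n) module_scheme \<Rightarrow> ('v \<Rightarrow> 'w) \<Rightarrow> bool"
  where
  "linear_map K V W f \<longleftrightarrow>
     (\<forall>x\<in>carrier V. f x \<in> carrier W) \<and>
     (\<forall>x\<in>carrier V. \<forall>y\<in>carrier V. f (x \<oplus>\<^bsub>V\<^esub> y) = f x \<oplus>\<^bsub>W\<^esub> f y) \<and>
     (\<forall>c\<in>carrier K. \<forall>x\<in>carrier V. f (c \<odot>\<^bsub>V\<^esub> x) = c \<odot>\<^bsub>W\<^esub> f x)"

text \<open>The algebraic half is split off because it also has to be applied to free modules and
  quotients that carry no bornology.\<close>

lemma bounded_linear_map_iff:
  "bounded_linear_map K V W f \<longleftrightarrow>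
     linear_map K V W f \<and> (\<forall>B\<in>bornology V. f ` B \<in> bornology W)"
  unfolding bounded_linear_map_def linear_map_def hom_def by auto

lemma bounded_linear_mapI:
  assumes "linear_map K V W f" "\<And>B. B \<in> bornology V \<Longrightarrow> f ` B \<in> bornology W"
  shows "bounded_linear_map K V W f"
  using assms by (simp add: bounded_linear_map_iff)

lemma bounded_linear_map_linear: "bounded_linear_map K V W f \<Longrightarrow> linear_map K V W f"
  and bounded_linear_map_bounded:
    "bounded_linear_map K V W f \<Longrightarrow> B \<in> bornology V \<Longrightarrow> f ` B \<in> bornology W"
  by (simp_all add: bounded_linear_map_iff)

lemma linear_mapI:
  assumes "\<And>x. x \<in> carrier V \<Longrightarrow> f x \<in> carrier W"
    "\<And>x y. x \<in> carrier V \<Longrightarrow> y \<in> carrier V \<Longrightarrow> f (x \<oplus>\<^bsub>V\<^esub> y) = f x \<oplus>\<^bsub>W\<^esub> f y"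
    "\<And>c x. c \<in> carrier K \<Longrightarrow> x \<in> carrier V \<Longrightarrow> f (c \<odot>\<^bsub>V\<^esub> x) = c \<odot>\<^bsub>W\<^esub> f x"
  shows "linear_map K V W f"
  using assms by (simp add: linear_map_def)

lemma
  assumes "linear_map K V W f"
  shows linear_map_closed: "x \<in> carrier V \<Longrightarrow> f x \<in> carrier W"
    and linear_map_add: "x \<in> carrier V \<Longrightarrow> y \<in> carrier V \<Longrightarrow> f (x \<oplus>\<^bsub>V\<^esub> y) = f x \<oplus>\<^bsub>W\<^esub> f y"
    and linear_map_smult: "c \<in> carrier K \<Longrightarrow> x \<in> carrier V \<Longrightarrow> f (c \<odot>\<^bsub>V\<^esub> x) = c \<odot>\<^bsub>W\<^esub> f x"
  using assms by (simp_all add: linear_map_def)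

lemma linear_map_comp:
  "linear_map K V W f \<Longrightarrow> linear_map K W X g \<Longrightarrow> linear_map K V X (\<lambda>x. g (f x))"
  by (simp add: linear_map_def)

lemma bounded_linear_map_comp:
  assumes "bounded_linear_map K V W f" "bounded_linear_map K W X g"
  shows "bounded_linear_map K V X (\<lambda>x. g (f x))"
proof (rule bounded_linear_mapI)
  show "linear_map K V X (\<lambda>x. g (f x))"
    by (rule linear_map_comp) (rule bounded_linear_map_linear assms)+
  fix B assume "B \<in> bornology V"
  then have "g ` f ` B \<in> bornology X"
    using bounded_linear_map_bounded[OF assms(2) bounded_linear_map_bounded[OF assms(1)]] by simp
  then show "(\<lambda>x. g (f x)) ` B \<in> bornology X" by (simp add: image_image)
qed

lemma linear_map_cong:
  assumes "linear_map K V W f" "\<And>x. x \<in> carrier V \<Longrightarrow> g x = f x" "module K V"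
  shows "linear_map K V W g"
proof -
  interpret V: module K V by fact
  show ?thesis using assms(1,2) by (simp add: linear_map_def)
qed

lemma
  assumes "linear_map K V W f" "module K V" "module K W"
  shows linear_map_zero: "f \<zero>\<^bsub>V\<^esub> = \<zero>\<^bsub>W\<^esub>"
    and linear_map_minus: "x \<in> carrier V \<Longrightarrow> y \<in> carrier V \<Longrightarrow> f (x \<ominus>\<^bsub>V\<^esub> y) = f x \<ominus>\<^bsub>W\<^esub> f y"
proof -
  interpret V: module K V by fact
  interpret W: module K W by fact
  note f = linear_map_closed[OF assms(1)] linear_map_add[OF assms(1)] linear_map_smult[OF assms(1)]
  have z: "f (\<zero>\<^bsub>K\<^esub> \<odot>\<^bsub>V\<^esub> \<zero>\<^bsub>V\<^esub>) = \<zero>\<^bsub>K\<^esub> \<odot>\<^bsub>W\<^esub> f \<zero>\<^bsub>V\<^esub>"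
    by (rule f(3)) auto
  then show "f \<zero>\<^bsub>V\<^esub> = \<zero>\<^bsub>W\<^esub>" using f(1) by simp
  have u: "f (\<ominus>\<^bsub>V\<^esub> x) = \<ominus>\<^bsub>W\<^esub> f x" if "x \<in> carrier V" for x
  proof -
    have "f ((\<ominus>\<^bsub>K\<^esub> \<one>\<^bsub>K\<^esub>) \<odot>\<^bsub>V\<^esub> x) = (\<ominus>\<^bsub>K\<^esub> \<one>\<^bsub>K\<^esub>) \<odot>\<^bsub>W\<^esub> f x"
      by (rule f(3)) (auto simp: that)
    then show ?thesis using that f(1) by (simp add: V.smult_l_minus W.smult_l_minus)
  qed
  show "x \<in> carrier V \<Longrightarrow> y \<in> carrier V \<Longrightarrow> f (x \<ominus>\<^bsub>V\<^esub> y) = f x \<ominus>\<^bsub>W\<^esub> f y"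
    using u f by (simp add: V.M.minus_eq W.M.minus_eq)
qed

text \<open>Unfolding \<open>set_add_def'\<close> presents a sum of two cosets as a double union of
  singletons. This rule turns its computation into two searches for witnesses.\<close>

lemma UN_UN_eq_imageI:
  assumes "\<And>h k. h \<in> A \<Longrightarrow> k \<in> B \<Longrightarrow> F h k \<in> G ` N"
    "\<And>n. n \<in> N \<Longrightarrow> \<exists>h\<in>A. \<exists>k\<in>B. G n = F h k"
  shows "(\<Union>h\<in>A. \<Union>k\<in>B. {F h k}) = G ` N"
proof (intro equalityI subsetI)
  fix x assume "x \<in> (\<Union>h\<in>A. \<Union>k\<in>B. {F h k})"
  then show "x \<in> G ` N" using assms(1) by auto
next
  fix x assume "x \<in> G ` N"
  then obtain n where "n \<in> N" "x = G n" by auto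
  then show "x \<in> (\<Union>h\<in>A. \<Union>k\<in>B. {F h k})" using assms(2)[of n] by simp
qed

lemma a_r_coset_eq: "N +>\<^bsub>V\<^esub> x = (\<lambda>n. n \<oplus>\<^bsub>V\<^esub> x) ` N"
  by (auto simp: a_r_coset_def')

section \<open>Quotient modules with cosets as elements\<close>

locale module_quotient = module K V for K :: "'k valued_ring" and V :: "('k, 'v, 'm) module_scheme" +
  fixes N :: "'v set"
  assumes sub: "submodule N K V"
begin

lemma N_subset: "N \<subseteq> carrier V"
  and N_zero: "\<zero>\<^bsub>V\<^esub> \<in> N"
  and N_add: "x \<in> N \<Longrightarrow> y \<in> N \<Longrightarrow> x \<oplus>\<^bsub>V\<^esub> y \<in> N"
  and N_uminus: "x \<in> N \<Longrightarrow> \<ominus>\<^bsub>V\<^esub> x \<in> N"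
  and N_smult: "c \<in> carrier K \<Longrightarrow> x \<in> N \<Longrightarrow> c \<odot>\<^bsub>V\<^esub> x \<in> N"
proof -
  interpret subgroup N "add_monoid V" using sub by (simp add: submodule_def)
  show "N \<subseteq> carrier V" "\<zero>\<^bsub>V\<^esub> \<in> N" using subset one_closed by simp_all
qed (simp_all add: submoduleE[OF sub])

lemma coset_self: "x \<in> carrier V \<Longrightarrow> x \<in> N +>\<^bsub>V\<^esub> x"
  unfolding a_r_coset_eq using N_zero M.l_zero by force

lemma coset_eq_iff:
  assumes "x \<in> carrier V" "y \<in> carrier V"
  shows "N +>\<^bsub>V\<^esub> x = N +>\<^bsub>V\<^esub> y \<longleftrightarrow> x \<ominus>\<^bsub>V\<^esub> y \<in> N"
proof
  assume "N +>\<^bsub>V\<^esub> x = N +>\<^bsub>V\<^esub> y"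
  then have "x \<in> N +>\<^bsub>V\<^esub> y" using coset_self assms by blast
  then obtain n where n: "n \<in> N" "x = n \<oplus>\<^bsub>V\<^esub> y" by (auto simp: a_r_coset_eq)
  have "n \<in> carrier V" using n N_subset by blast
  then have "x \<ominus>\<^bsub>V\<^esub> y = n" using n assms by (simp add: M.ag_simps)
  then show "x \<ominus>\<^bsub>V\<^esub> y \<in> N" using n by simp
next
  \<comment> \<open>One inclusion of cosets is enough, since \<open>N\<close> is closed under
    negation and the roles of \<open>x\<close> and \<open>y\<close> can be exchanged.\<close>
  have *: "N +>\<^bsub>V\<^esub> x \<subseteq> N +>\<^bsub>V\<^esub> y" if "x \<ominus>\<^bsub>V\<^esub> y \<in> N" "x \<in> carrier V" "y \<in> carrier V" for x y
  proof
    fix z assume "z \<in> N +>\<^bsub>V\<^esub> x"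
    then obtain n where n: "n \<in> N" "z = n \<oplus>\<^bsub>V\<^esub> x" by (auto simp: a_r_coset_eq)
    have "n \<in> carrier V" using n N_subset by blast
    then have "z = (n \<oplus>\<^bsub>V\<^esub> (x \<ominus>\<^bsub>V\<^esub> y)) \<oplus>\<^bsub>V\<^esub> y" using n that by (simp add: M.ag_simps)
    then show "z \<in> N +>\<^bsub>V\<^esub> y" using N_add[OF n(1) that(1)] by (auto simp: a_r_coset_eq)
  qed
  assume xy: "x \<ominus>\<^bsub>V\<^esub> y \<in> N"
  have "y \<ominus>\<^bsub>V\<^esub> x = \<ominus>\<^bsub>V\<^esub> (x \<ominus>\<^bsub>V\<^esub> y)" using assms by (simp add: M.ag_simps)
  then have "y \<ominus>\<^bsub>V\<^esub> x \<in> N" using N_uminus[OF xy] by simp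
  then show "N +>\<^bsub>V\<^esub> x = N +>\<^bsub>V\<^esub> y" using *[OF xy] * assms by blast
qed

lemma coset_add:
  assumes "x \<in> carrier V" "y \<in> carrier V"
  shows "(N +>\<^bsub>V\<^esub> x) <+>\<^bsub>V\<^esub> (N +>\<^bsub>V\<^esub> y) = N +>\<^bsub>V\<^esub> (x \<oplus>\<^bsub>V\<^esub> y)"
proof -
  have "h \<oplus>\<^bsub>V\<^esub> x \<oplus>\<^bsub>V\<^esub> (k \<oplus>\<^bsub>V\<^esub> y) \<in> (\<lambda>n. n \<oplus>\<^bsub>V\<^esub> (x \<oplus>\<^bsub>V\<^esub> y)) ` N" if "h \<in> N" "k \<in> N" for h k
    using that N_subset assms by (intro image_eqI[OF _ N_add[OF that]]) (simp add: M.a_ac subset_iff)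
  moreover have "\<exists>h\<in>N. \<exists>k\<in>N. n \<oplus>\<^bsub>V\<^esub> (x \<oplus>\<^bsub>V\<^esub> y) = h \<oplus>\<^bsub>V\<^esub> x \<oplus>\<^bsub>V\<^esub> (k \<oplus>\<^bsub>V\<^esub> y)" if "n \<in> N" for n
    using that N_subset assms
    by (intro bexI[OF _ that] bexI[OF _ N_zero]) (simp add: M.a_ac subset_iff)
  ultimately show ?thesis
    unfolding a_r_coset_eq set_add_def'
  proof (intro UN_UN_eq_imageI, goal_cases)
    case (1 h k)
    then obtain h' k' where "h' \<in> N" "h = h' \<oplus>\<^bsub>V\<^esub> x" "k' \<in> N" "k = k' \<oplus>\<^bsub>V\<^esub> y" by blast
    then show ?case using 1(1) by simp
  next
    case (2 n)
    then show ?case by simp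
  qed
qed

lemma coset_smult:
  assumes "c \<in> carrier K" "x \<in> carrier V"
  shows "N <+>\<^bsub>V\<^esub> ((\<lambda>x. c \<odot>\<^bsub>V\<^esub> x) ` (N +>\<^bsub>V\<^esub> x)) = N +>\<^bsub>V\<^esub> (c \<odot>\<^bsub>V\<^esub> x)"
proof -
  have "h \<oplus>\<^bsub>V\<^esub> c \<odot>\<^bsub>V\<^esub> (k \<oplus>\<^bsub>V\<^esub> x) \<in> (\<lambda>n. n \<oplus>\<^bsub>V\<^esub> (c \<odot>\<^bsub>V\<^esub> x)) ` N" if "h \<in> N" "k \<in> N" for h k
    using that N_subset assms
    by (intro image_eqI[OF _ N_add[OF that(1) N_smult[OF assms(1) that(2)]]])
      (simp add: M.a_ac subset_iff smult_r_distr)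
  \<comment> \<open>The summand \<open>N\<close> in the scalar multiplication provides
    \<open>n\<close> itself, with \<open>k\<close> zero; for \<open>c = 0\<close> the scaled coset
    alone would be a single point.\<close>
  moreover have "\<exists>h\<in>N. \<exists>k\<in>N. n \<oplus>\<^bsub>V\<^esub> (c \<odot>\<^bsub>V\<^esub> x) = h \<oplus>\<^bsub>V\<^esub> c \<odot>\<^bsub>V\<^esub> (k \<oplus>\<^bsub>V\<^esub> x)" if "n \<in> N" for n
    using that N_subset assms
    by (intro bexI[OF _ that] bexI[OF _ N_zero]) (simp add: M.a_ac subset_iff)
  ultimately show ?thesis
    unfolding a_r_coset_eq set_add_def'
  proof (intro UN_UN_eq_imageI, goal_cases)
    case (1 h k)
    then obtain h' k' where "h' \<in> N" "h = h'" "k' \<in> N" "k = c \<odot>\<^bsub>V\<^esub> (k' \<oplus>\<^bsub>V\<^esub> x)" by blast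
    then show ?case using 1(1) by simp
  next
    case (2 n)
    then show ?case by simp
  qed
qed

lemma N_coset_zero: "N +>\<^bsub>V\<^esub> \<zero>\<^bsub>V\<^esub> = N"
  using N_subset by (rule M.a_coset_add_zero)

abbreviation "Q \<equiv> quotient_module V N"

lemma carrier_Q: "carrier Q = (\<lambda>x. N +>\<^bsub>V\<^esub> x) ` carrier V"
  by (auto simp: quotient_module_def A_RCOSETS_def')

lemma zero_Q: "\<zero>\<^bsub>Q\<^esub> = N +>\<^bsub>V\<^esub> \<zero>\<^bsub>V\<^esub>"
  using N_coset_zero by (simp add: quotient_module_def)

lemma add_Q:
  "x \<in> carrier V \<Longrightarrow> y \<in> carrier V \<Longrightarrow> (N +>\<^bsub>V\<^esub> x) \<oplus>\<^bsub>Q\<^esub> (N +>\<^bsub>V\<^esub> y) = N +>\<^bsub>V\<^esub> (x \<oplus>\<^bsub>V\<^esub> y)"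
  by (simp add: quotient_module_def coset_add)

lemma smult_Q:
  "c \<in> carrier K \<Longrightarrow> x \<in> carrier V \<Longrightarrow> c \<odot>\<^bsub>Q\<^esub> (N +>\<^bsub>V\<^esub> x) = N +>\<^bsub>V\<^esub> (c \<odot>\<^bsub>V\<^esub> x)"
  by (simp add: quotient_module_def coset_smult)

lemma module_Q: "module K Q"
proof (rule moduleI)
  show "cring K" ..
  show "abelian_group Q"
  proof (rule abelian_groupI)
    fix X assume "X \<in> carrier Q"
    then obtain x where x: "x \<in> carrier V" "X = N +>\<^bsub>V\<^esub> x" by (auto simp: carrier_Q)
    show "\<exists>Y\<in>carrier Q. Y \<oplus>\<^bsub>Q\<^esub> X = \<zero>\<^bsub>Q\<^esub>"
      using x by (intro bexI[of _ "N +>\<^bsub>V\<^esub> (\<ominus>\<^bsub>V\<^esub> x)"])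
        (auto simp: carrier_Q add_Q zero_Q M.l_neg)
  qed (auto simp: carrier_Q add_Q zero_Q M.a_ac)
qed (auto simp: carrier_Q add_Q smult_Q smult_l_distr smult_r_distr smult_assoc1)

lemma linear_coset: "linear_map K V Q (\<lambda>x. N +>\<^bsub>V\<^esub> x)"
  by (auto simp: linear_map_def carrier_Q add_Q smult_Q)

text \<open>The value on a coset is taken at a representative chosen by \<open>SOME\<close>; two
  representatives differ by an element of \<open>N\<close>, where \<open>f\<close> vanishes.\<close>

lemma descend:
  assumes f: "linear_map K V W f" and "module K W" and ker: "\<And>x. x \<in> N \<Longrightarrow> f x = \<zero>\<^bsub>W\<^esub>"
  obtains g where "linear_map K Q W g" "\<And>x. x \<in> carrier V \<Longrightarrow> g (N +>\<^bsub>V\<^esub> x) = f x"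
proof -
  interpret W: module K W by fact
  have V: "module K V" ..
  note fc = linear_map_closed[OF f] linear_map_add[OF f] linear_map_smult[OF f]
  let ?g = "\<lambda>X. f (SOME x. x \<in> carrier V \<and> X = N +>\<^bsub>V\<^esub> x)"
  have g: "?g (N +>\<^bsub>V\<^esub> x) = f x" if x: "x \<in> carrier V" for x
  proof -
    let ?y = "SOME y. y \<in> carrier V \<and> N +>\<^bsub>V\<^esub> x = N +>\<^bsub>V\<^esub> y"
    have y: "?y \<in> carrier V" "N +>\<^bsub>V\<^esub> x = N +>\<^bsub>V\<^esub> ?y"
      using someI[of "\<lambda>y. y \<in> carrier V \<and> N +>\<^bsub>V\<^esub> x = N +>\<^bsub>V\<^esub> y"] x by blast+
    then have "f (x \<ominus>\<^bsub>V\<^esub> ?y) = \<zero>\<^bsub>W\<^esub>" using ker coset_eq_iff x by blast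
    then have "f x \<ominus>\<^bsub>W\<^esub> f ?y = \<zero>\<^bsub>W\<^esub>"
      using linear_map_minus[OF f V assms(2)] x y by simp
    then show ?thesis
      using x y fc(1) W.M.minus_eq_zero_iff[of "f x" "f ?y"] by simp
  qed
  have "linear_map K Q W ?g"
    by (rule linear_mapI) (auto simp: carrier_Q add_Q smult_Q g fc)
  then show ?thesis using g that by blast
qed

end

lemma with_bornology_simps [simp]:
  "carrier (with_bornology M \<B>) = carrier M" "add (with_bornology M \<B>) = add M"
  "zero (with_bornology M \<B>) = zero M" "smult (with_bornology M \<B>) = smult M"
  "bornology (with_bornology M \<B>) = \<B>"
  by (simp_all add: with_bornology_def)

lemma module_with_bornology: "module K M \<Longrightarrow> module K (with_bornology M \<B>)"
  by (rule module_cong) simp_all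

lemma linear_map_with_bornology [simp]:
  "linear_map K (with_bornology M \<B>) W f \<longleftrightarrow> linear_map K M W f"
  "linear_map K V (with_bornology M' \<B>') g \<longleftrightarrow> linear_map K V M' g"
  by (simp_all add: linear_map_def)

lemma hom_space_simps:
  "carrier (hom_space K V W) = {f. bounded_linear_map K V W f \<and> f \<in> extensional (carrier V)}"
  "add (hom_space K V W) = (\<lambda>f g. \<lambda>x\<in>carrier V. f x \<oplus>\<^bsub>W\<^esub> g x)"
  "zero (hom_space K V W) = (\<lambda>x\<in>carrier V. \<zero>\<^bsub>W\<^esub>)"
  "smult (hom_space K V W) = (\<lambda>c f. \<lambda>x\<in>carrier V. c \<odot>\<^bsub>W\<^esub> f x)"
  "bornology (hom_space K V W) =
     {U. U \<subseteq> carrier (hom_space K V W) \<and> (\<forall>B\<in>bornology V. (\<Union>f\<in>U. f ` B) \<in> bornology W)}"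
  by (simp_all add: hom_space_def Let_def)

lemma sub_space_simps [simp]:
  "carrier (sub_space V S) = S" "add (sub_space V S) = add V" "zero (sub_space V S) = zero V"
  "smult (sub_space V S) = smult V" "bornology (sub_space V S) = {B \<in> bornology V. B \<subseteq> S}"
  by (simp_all add: sub_space_def)

lemma module_sub_space:
  assumes "module K V" "submodule S K V"
  shows "module K (sub_space V S)"
proof (rule module_cong)
  show "module K (V\<lparr>carrier := S\<rparr>)"
    using submodule.submodule_is_module assms by blast
qed simp_all

section \<open>Bornologies\<close>

context mixed_char_complete_field
begin

lemma absval_one: "absval K \<one> = 1"
proof -
  have "absval K \<one> = absval K \<one> * absval K \<one>"
    using absval_mult[of \<one> \<one>] by simp
  moreover have "absval K \<one> \<noteq> 0" using absval_eq_0[of \<one>] by simp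
  ultimately show ?thesis by simp
qed

text \<open>This places \<open>\<ominus> \<one>\<close> in the valuation ring, so closure under its
  scalars already includes closure under negation.\<close>

lemma absval_minus_one: "absval K (\<ominus> \<one>) = 1"
proof -
  have "\<ominus> \<one> \<otimes> \<ominus> \<one> = \<one>" by (simp add: l_minus)
  then have "absval K (\<ominus> \<one>) * absval K (\<ominus> \<one>) = 1"
    using absval_mult[of "\<ominus> \<one>" "\<ominus> \<one>"] absval_one by simp
  then have "(absval K (\<ominus> \<one>))\<^sup>2 = 1" by (simp add: power2_eq_square)
  then show ?thesis using absval_nonneg[of "\<ominus> \<one>"] by (auto simp: power2_eq_1_iff)
qed

lemma absval_pow: "x \<in> carrier K \<Longrightarrow> absval K (x [^] (n::nat)) = absval K x ^ n"
  by (induction n) (simp_all add: absval_one absval_mult)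

text \<open>Mixed characteristic enters here: \<open>p\<close> is nonzero in \<open>K\<close>
  because the characteristic is 0, and its powers tend to 0 because its absolute value is below
  1.\<close>

lemma ex_small_scalar:
  assumes "0 < (e::real)"
  obtains c where "c \<in> carrier K - {\<zero>}" "absval K c < e"
proof -
  let ?P = "[p] \<cdot> \<one>"
  have P: "?P \<in> carrier K" "?P \<noteq> \<zero>"
    using char_0 prime_p prime_gt_0_nat by auto
  obtain n where "absval K ?P ^ n < e"
    using real_arch_pow_inv[OF assms residue_char_p] by blast
  moreover have "?P [^] n \<noteq> \<zero>" using P absval_pow[of ?P n] absval_eq_0[of ?P] absval_eq_0[of "?P [^] n"]
    by auto
  ultimately show ?thesis using P that[of "?P [^] n"] by (simp add: absval_pow)
qed

lemma scalar_inv: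
  assumes "c \<in> carrier K - {\<zero>}"
  shows "inv c \<in> carrier K" "inv c \<otimes> c = \<one>" "c \<otimes> inv c = \<one>"
proof -
  have "c \<in> Units K" using assms field_Units by simp
  then show "inv c \<in> carrier K" "inv c \<otimes> c = \<one>" "c \<otimes> inv c = \<one>" by simp_all
qed

text \<open>Linear subspaces and modules over the valuation ring obey the same closure conditions,
  so \<open>R\<close> ranges over both rings at once. Inverses come from scaling by
  \<open>\<ominus> \<one>\<close>.\<close>

lemma submodule_iff:
  assumes "module K V" "R \<in> {K, val_ring K}"
  shows "submodule H R V \<longleftrightarrow> H \<subseteq> carrier V \<and> \<zero>\<^bsub>V\<^esub> \<in> H \<and>
    (\<forall>x\<in>H. \<forall>y\<in>H. x \<oplus>\<^bsub>V\<^esub> y \<in> H) \<and> (\<forall>c\<in>carrier R. \<forall>x\<in>H. c \<odot>\<^bsub>V\<^esub> x \<in> H)"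
    (is "_ \<longleftrightarrow> ?rhs")
proof -
  interpret V: module K V by fact
  have m1: "\<ominus> \<one> \<in> carrier R" using assms(2) absval_minus_one by (auto simp: val_ring_def)
  show ?thesis
  proof
    assume "submodule H R V"
    then interpret submodule H R V .
    show ?rhs using subset m_closed one_closed smult_closed by simp
  next
    assume r: ?rhs
    have "inv\<^bsub>add_monoid V\<^esub> x \<in> H" if "x \<in> H" for x
    proof -
      have "\<ominus> \<one> \<odot>\<^bsub>V\<^esub> x \<in> H" using r m1 that by blast
      moreover have "x \<in> carrier V" using r that by blast
      ultimately show ?thesis by (simp add: V.smult_l_minus a_inv_def[symmetric])
    qed
    then show "submodule H R V"
      using r by (intro submodule.intro subgroup.intro submodule_axioms.intro) simp_all
  qed
qed

lemma
  assumes "module K V" "R \<in> {K, val_ring K}" "submodule H R V"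
  shows submodule_subset: "H \<subseteq> carrier V"
    and submodule_zero: "\<zero>\<^bsub>V\<^esub> \<in> H"
    and submodule_add: "x \<in> H \<Longrightarrow> y \<in> H \<Longrightarrow> x \<oplus>\<^bsub>V\<^esub> y \<in> H"
    and submodule_smult: "c \<in> carrier R \<Longrightarrow> x \<in> H \<Longrightarrow> c \<odot>\<^bsub>V\<^esub> x \<in> H"
    and submodule_uminus: "x \<in> H \<Longrightarrow> \<ominus>\<^bsub>V\<^esub> x \<in> H"
    and submodule_minus: "x \<in> H \<Longrightarrow> y \<in> H \<Longrightarrow> x \<ominus>\<^bsub>V\<^esub> y \<in> H"
proof -
  interpret V: module K V by fact
  have m1: "\<ominus> \<one> \<in> carrier R" using assms(2) absval_minus_one by (auto simp: val_ring_def)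
  note h = submodule_iff[OF assms(1,2), of H, THEN iffD1, OF assms(3)]
  show "H \<subseteq> carrier V" "\<zero>\<^bsub>V\<^esub> \<in> H" "x \<in> H \<Longrightarrow> y \<in> H \<Longrightarrow> x \<oplus>\<^bsub>V\<^esub> y \<in> H"
     "c \<in> carrier R \<Longrightarrow> x \<in> H \<Longrightarrow> c \<odot>\<^bsub>V\<^esub> x \<in> H" using h by blast+
  have u: "\<ominus>\<^bsub>V\<^esub> x \<in> H" if "x \<in> H" for x
  proof -
    have "\<ominus> \<one> \<odot>\<^bsub>V\<^esub> x \<in> H" using h m1 that by blast
    moreover have "x \<in> carrier V" using h that by blast
    ultimately show ?thesis by (simp add: V.smult_l_minus)
  qed
  then show "x \<in> H \<Longrightarrow> \<ominus>\<^bsub>V\<^esub> x \<in> H" .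
  show "x \<in> H \<Longrightarrow> y \<in> H \<Longrightarrow> x \<ominus>\<^bsub>V\<^esub> y \<in> H" using u h by (simp add: V.M.minus_eq)
qed

text \<open>The family has to be nonempty: the intersection of no sets is the whole type and may
  leave the carrier.\<close>

lemma submodule_Inter:
  assumes "module K V" "R \<in> {K, val_ring K}" "\<S> \<noteq> {}" "\<And>H. H \<in> \<S> \<Longrightarrow> submodule H R V"
  shows "submodule (\<Inter>\<S>) R V"
proof -
  note m = submodule_subset[OF assms(1,2)] submodule_zero[OF assms(1,2)]
    submodule_add[OF assms(1,2)] submodule_smult[OF assms(1,2)]
  obtain H0 where H0: "H0 \<in> \<S>" using assms(3) by blast
  show ?thesis
    unfolding submodule_iff[OF assms(1,2)]
  proof (intro conjI ballI InterI)
    show "\<Inter>\<S> \<subseteq> carrier V" using m(1)[OF assms(4)[OF H0]] Inter_lower[OF H0] by (rule subset_trans[rotated])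
  next
    fix H assume "H \<in> \<S>"
    then show "\<zero>\<^bsub>V\<^esub> \<in> H" using m(2)[OF assms(4)] by simp
  next
    fix x y H assume "x \<in> \<Inter>\<S>" "y \<in> \<Inter>\<S>" "H \<in> \<S>"
    then show "x \<oplus>\<^bsub>V\<^esub> y \<in> H" using m(3)[OF assms(4)] by simp
  next
    fix c x H assume "c \<in> carrier R" "x \<in> \<Inter>\<S>" "H \<in> \<S>"
    then show "c \<odot>\<^bsub>V\<^esub> x \<in> H" using m(4)[OF assms(4)] by simp
  qed
qed

lemma submodule_carrier:
  assumes "module K V" "R \<in> {K, val_ring K}"
  shows "submodule (carrier V) R V"
proof -
  interpret V: module K V by fact
  show ?thesis using assms(2) by (subst submodule_iff[OF assms]) (auto simp: val_ring_def)
qed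

lemma
  assumes "module K V" "R \<in> {K, val_ring K}" "S \<subseteq> carrier V"
  shows submodule_span: "submodule (module_span R V S) R V"
    and span_superset: "S \<subseteq> module_span R V S"
proof -
  have "carrier V \<in> {N. submodule N R V \<and> S \<subseteq> N}"
    using submodule_carrier[OF assms(1,2)] assms(3) by simp
  then have "{N. submodule N R V \<and> S \<subseteq> N} \<noteq> {}" by blast
  then show "submodule (module_span R V S) R V"
    unfolding module_span_def by (rule submodule_Inter[OF assms(1,2)]) simp
  show "S \<subseteq> module_span R V S" unfolding module_span_def by blast
qed

lemma span_least: "submodule N R V \<Longrightarrow> S \<subseteq> N \<Longrightarrow> module_span R V S \<subseteq> N"
  unfolding module_span_def by blast

lemma submodule_vimage:
  assumes "module K V" "module K W" "R \<in> {K, val_ring K}" "linear_map K V W f" "submodule N R W"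
  shows "submodule {x \<in> carrier V. f x \<in> N} R V"
proof -
  interpret V: module K V by fact
  interpret W: module K W by fact
  have R: "carrier R \<subseteq> carrier K" using assms(3) by (auto simp: val_ring_def)
  note n = submodule_iff[OF assms(2,3), of N, THEN iffD1, OF assms(5)]
  show ?thesis
    unfolding submodule_iff[OF assms(1,3)]
    using n R assms(4) linear_map_zero[OF assms(4,1,2)] V.smult_closed
    by (auto simp: linear_map_def)
qed

lemma submodule_image:
  assumes "module K V" "module K W" "R \<in> {K, val_ring K}" "linear_map K V W f" "submodule N R V"
  shows "submodule (f ` N) R W"
proof -
  interpret V: module K V by fact
  have R: "carrier R \<subseteq> carrier K" using assms(3) by (auto simp: val_ring_def)
  note n = submodule_iff[OF assms(1,3), of N, THEN iffD1, OF assms(5)]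
  then have sub: "x \<in> N \<Longrightarrow> x \<in> carrier V" for x by blast
  show ?thesis
    unfolding submodule_iff[OF assms(2,3)]
  proof (intro conjI ballI)
    show "f ` N \<subseteq> carrier W" using sub linear_map_closed[OF assms(4)] by blast
    show "\<zero>\<^bsub>W\<^esub> \<in> f ` N" using n linear_map_zero[OF assms(4,1,2)] by force
  next
    fix x y assume "x \<in> f ` N" "y \<in> f ` N"
    then obtain a b where ab: "a \<in> N" "b \<in> N" "x = f a" "y = f b" by blast
    then have "x \<oplus>\<^bsub>W\<^esub> y = f (a \<oplus>\<^bsub>V\<^esub> b)" using linear_map_add[OF assms(4)] sub by simp
    then show "x \<oplus>\<^bsub>W\<^esub> y \<in> f ` N" using n ab by blast
  next
    fix c x assume "c \<in> carrier R" "x \<in> f ` N"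
    then obtain a where a: "a \<in> N" "x = f a" "c \<in> carrier R" by blast
    then have "c \<odot>\<^bsub>W\<^esub> x = f (c \<odot>\<^bsub>V\<^esub> a)" using linear_map_smult[OF assms(4)] sub R by auto
    then show "c \<odot>\<^bsub>W\<^esub> x \<in> f ` N" using n a by blast
  qed
qed

lemma is_bornologyI:
  assumes "\<And>B. B \<in> \<B> \<Longrightarrow> B \<subseteq> carrier V" "\<And>x. x \<in> carrier V \<Longrightarrow> {x} \<in> \<B>"
    "\<And>B B'. B \<in> \<B> \<Longrightarrow> B' \<subseteq> B \<Longrightarrow> B' \<in> \<B>" "\<And>B B'. B \<in> \<B> \<Longrightarrow> B' \<in> \<B> \<Longrightarrow> B \<union> B' \<in> \<B>"
    "\<And>c B. c \<in> carrier K \<Longrightarrow> B \<in> \<B> \<Longrightarrow> (\<lambda>x. c \<odot>\<^bsub>V\<^esub> x) ` B \<in> \<B>"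
    "\<And>B. B \<in> \<B> \<Longrightarrow> module_span (val_ring K) V B \<in> \<B>"
  shows "is_bornology K V \<B>"
  unfolding is_bornology_def by (intro conjI ballI allI impI subsetI PowI) (use assms in auto)

lemma is_bornologyD:
  assumes "is_bornology K V \<B>"
  shows "B \<in> \<B> \<Longrightarrow> B \<subseteq> carrier V" "x \<in> carrier V \<Longrightarrow> {x} \<in> \<B>"
    "B \<in> \<B> \<Longrightarrow> B' \<subseteq> B \<Longrightarrow> B' \<in> \<B>" "B \<in> \<B> \<Longrightarrow> B' \<in> \<B> \<Longrightarrow> B \<union> B' \<in> \<B>"
    "c \<in> carrier K \<Longrightarrow> B \<in> \<B> \<Longrightarrow> (\<lambda>x. c \<odot>\<^bsub>V\<^esub> x) ` B \<in> \<B>"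
    "B \<in> \<B> \<Longrightarrow> module_span (val_ring K) V B \<in> \<B>"
  using assms unfolding is_bornology_def by auto

text \<open>The coarsest bornology. It shows that the intersection defining
  \<open>generated_bornology\<close> runs over a nonempty family.\<close>

lemma is_bornology_Pow: "module K V \<Longrightarrow> is_bornology K V (Pow (carrier V))"
proof -
  assume V: "module K V"
  then interpret V: module K V .
  have "module_span (val_ring K) V B \<subseteq> carrier V" if "B \<subseteq> carrier V" for B
    using span_least[OF submodule_carrier[OF V]] that by simp
  then show ?thesis unfolding is_bornology_def by auto
qed

lemma
  assumes "module K V" "\<G> \<subseteq> Pow (carrier V)"
  shows is_bornology_generated: "is_bornology K V (generated_bornology K V \<G>)"
    and generated_superset: "\<G> \<subseteq> generated_bornology K V \<G>"
proof -
  have P: "is_bornology K V (Pow (carrier V)) \<and> \<G> \<subseteq> Pow (carrier V)"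
    using is_bornology_Pow assms by blast
  show "\<G> \<subseteq> generated_bornology K V \<G>" unfolding generated_bornology_def by blast
  have "is_bornology K V (\<Inter>\<C>)"
    if ne: "\<exists>\<B>0. \<B>0 \<in> \<C>" and b: "\<And>\<B>. \<B> \<in> \<C> \<Longrightarrow> is_bornology K V \<B>" for \<C>
  proof (rule is_bornologyI)
    obtain \<B>0 where "\<B>0 \<in> \<C>" using ne by blast
    then show "B \<subseteq> carrier V" if "B \<in> \<Inter>\<C>" for B
      using is_bornologyD(1)[OF b] that by simp
    show "B' \<in> \<Inter>\<C>" if "B \<in> \<Inter>\<C>" "B' \<subseteq> B" for B B'
      using is_bornologyD(3)[OF b _ that(2)] that(1) by simp
  qed (simp_all add: is_bornologyD[OF b])
  then show "is_bornology K V (generated_bornology K V \<G>)"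
    unfolding generated_bornology_def
  proof this
    show "\<exists>\<B>. \<B> \<in> {\<B>. is_bornology K V \<B> \<and> \<G> \<subseteq> \<B>}"
      using P by (intro exI[of _ "Pow (carrier V)"]) simp
  qed simp
qed

lemma generated_least:
  "is_bornology K V \<B> \<Longrightarrow> \<G> \<subseteq> \<B> \<Longrightarrow> generated_bornology K V \<G> \<subseteq> \<B>"
  unfolding generated_bornology_def by blast

end

section \<open>Bounded submodules and convergence for their gauges\<close>

locale bornological = mixed_char_complete_field K p + module K V
  for K :: "'k valued_ring" (structure) and p and V :: "('k, 'v) born_space" +
  assumes born: "is_bornology K V (bornology V)"
begin

lemma module_V: "module K V" ..

lemmas bounded_subset_carrier = is_bornologyD(1)[OF born]
  and bounded_singleton = is_bornologyD(2)[OF born]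
  and bounded_mono = is_bornologyD(3)[OF born]
  and bounded_Un = is_bornologyD(4)[OF born]
  and bounded_scale = is_bornologyD(5)[OF born]
  and bounded_span = is_bornologyD(6)[OF born]

lemma bsub_span: "B \<in> bornology V \<Longrightarrow> module_span (val_ring K) V B \<in> bounded_submodules K V"
  using bounded_span submodule_span[OF module_V _ bounded_subset_carrier]
  by (simp add: bounded_submodules_def)

lemma bounded_obtain_bsub:
  assumes "B \<in> bornology V"
  obtains S where "S \<in> bounded_submodules K V" "B \<subseteq> S"
  using bsub_span[OF assms] span_superset[OF module_V _ bounded_subset_carrier[OF assms]] by blast

lemma
  assumes "B \<in> bounded_submodules K V"
  shows bsub_bounded: "B \<in> bornology V"
    and bsub_submodule: "submodule B (val_ring K) V"
    and bsub_subset: "B \<subseteq> carrier V"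
    and bsub_zero: "\<zero>\<^bsub>V\<^esub> \<in> B"
    and bsub_add: "x \<in> B \<Longrightarrow> y \<in> B \<Longrightarrow> x \<oplus>\<^bsub>V\<^esub> y \<in> B"
    and bsub_minus: "x \<in> B \<Longrightarrow> y \<in> B \<Longrightarrow> x \<ominus>\<^bsub>V\<^esub> y \<in> B"
proof -
  show b: "B \<in> bornology V" and s: "submodule B (val_ring K) V"
    using assms by (auto simp: bounded_submodules_def)
  show "B \<subseteq> carrier V" using bounded_subset_carrier[OF b] .
  have R: "val_ring K \<in> {K, val_ring K}" by simp
  note m = submodule_zero[OF module_V R s] submodule_add[OF module_V R s]
    submodule_minus[OF module_V R s]
  show "\<zero>\<^bsub>V\<^esub> \<in> B" "x \<in> B \<Longrightarrow> y \<in> B \<Longrightarrow> x \<oplus>\<^bsub>V\<^esub> y \<in> B" "x \<in> B \<Longrightarrow> y \<in> B \<Longrightarrow> x \<ominus>\<^bsub>V\<^esub> y \<in> B"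
    by (auto intro: m)
qed

text \<open>Sums are not mentioned in the axioms of a bornology. They are bounded because both sets
  lie in the bounded submodule spanned by their union.\<close>

lemma bounded_sum:
  assumes "S \<in> bornology V" "T \<in> bornology V"
  shows "{x \<oplus>\<^bsub>V\<^esub> y | x y. x \<in> S \<and> y \<in> T} \<in> bornology V"
proof -
  obtain B where B: "B \<in> bounded_submodules K V" "S \<union> T \<subseteq> B"
    using bounded_obtain_bsub bounded_Un assms by metis
  have "{x \<oplus>\<^bsub>V\<^esub> y | x y. x \<in> S \<and> y \<in> T} \<subseteq> B" using bsub_add[OF B(1)] B(2) by blast
  then show ?thesis using bounded_mono bsub_bounded B(1) by blast
qed

lemma bsub_directed:
  assumes "S \<in> bounded_submodules K V" "T \<in> bounded_submodules K V"
  obtains B where "B \<in> bounded_submodules K V" "S \<subseteq> B" "T \<subseteq> B"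
  using bounded_obtain_bsub[of "S \<union> T"] bounded_Un bsub_bounded assms by (metis Un_subset_iff)

lemma linear_scale: "c \<in> carrier K \<Longrightarrow> linear_map K V V (\<lambda>x. c \<odot>\<^bsub>V\<^esub> x)"
  by (rule linear_mapI) (auto simp: smult_r_distr smult_assoc1[symmetric] m_comm)

lemma bsub_scale:
  assumes "c \<in> carrier K" "B \<in> bounded_submodules K V"
  shows "(\<lambda>x. c \<odot>\<^bsub>V\<^esub> x) ` B \<in> bounded_submodules K V"
  using bounded_scale[OF assms(1) bsub_bounded[OF assms(2)]]
    submodule_image[OF module_V module_V _ linear_scale[OF assms(1)] bsub_submodule[OF assms(2)]]
  by (simp add: bounded_submodules_def)

lemma gauge_convergent_mono:
  "gauge_convergent K V B x l \<Longrightarrow> B \<subseteq> B' \<Longrightarrow> gauge_convergent K V B' x l"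
  unfolding gauge_convergent_def by (meson image_mono subsetD)

lemma gauge_cauchy_mono:
  "gauge_cauchy K V B x \<Longrightarrow> B \<subseteq> B' \<Longrightarrow> gauge_cauchy K V B' x"
  unfolding gauge_cauchy_def by (meson image_mono subsetD)

text \<open>A scaled bounded submodule is again a submodule, so the basic neighbourhoods
  \<open>c B\<close> are closed under sums. This is the ultrametric inequality for gauges, and it is
  why no smaller \<open>c\<close> has to be chosen when limits are added.\<close>

lemma scaled_bsub_add:
  assumes "B \<in> bounded_submodules K V" "c \<in> carrier K"
    "x \<in> (\<lambda>b. c \<odot>\<^bsub>V\<^esub> b) ` B" "y \<in> (\<lambda>b. c \<odot>\<^bsub>V\<^esub> b) ` B"
  shows "x \<oplus>\<^bsub>V\<^esub> y \<in> (\<lambda>b. c \<odot>\<^bsub>V\<^esub> b) ` B" "x \<ominus>\<^bsub>V\<^esub> y \<in> (\<lambda>b. c \<odot>\<^bsub>V\<^esub> b) ` B"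
  using bsub_scale[OF assms(2,1)] bsub_add bsub_minus assms(3,4) by blast+

lemma minus_add_minus:
  assumes "a \<in> carrier V" "b \<in> carrier V" "c \<in> carrier V" "d \<in> carrier V"
  shows "(a \<oplus>\<^bsub>V\<^esub> b) \<ominus>\<^bsub>V\<^esub> (c \<oplus>\<^bsub>V\<^esub> d) = (a \<ominus>\<^bsub>V\<^esub> c) \<oplus>\<^bsub>V\<^esub> (b \<ominus>\<^bsub>V\<^esub> d)"
  using assms by (simp add: M.minus_eq M.minus_add M.a_ac)

lemma smult_minus:
  assumes "c \<in> carrier K" "a \<in> carrier V" "b \<in> carrier V"
  shows "c \<odot>\<^bsub>V\<^esub> (a \<ominus>\<^bsub>V\<^esub> b) = c \<odot>\<^bsub>V\<^esub> a \<ominus>\<^bsub>V\<^esub> c \<odot>\<^bsub>V\<^esub> b"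
  using assms by (simp add: M.minus_eq smult_r_distr smult_r_minus)

text \<open>Scaling a sequence by \<open>d\<close> moves its convergence from the gauge of
  \<open>B\<close> to the gauge of \<open>d B\<close>. Nothing is divided by \<open>d\<close>, so
  \<open>d = 0\<close> is covered.\<close>

lemma smult_image_commute:
  assumes "c \<in> carrier K" "d \<in> carrier K" "B \<subseteq> carrier V" "x \<in> (\<lambda>b. c \<odot>\<^bsub>V\<^esub> b) ` B"
  shows "d \<odot>\<^bsub>V\<^esub> x \<in> (\<lambda>b. c \<odot>\<^bsub>V\<^esub> b) ` (\<lambda>b. d \<odot>\<^bsub>V\<^esub> b) ` B"
proof -
  obtain b where b: "b \<in> B" "x = c \<odot>\<^bsub>V\<^esub> b" using assms(4) by blast
  then have "d \<odot>\<^bsub>V\<^esub> x = c \<odot>\<^bsub>V\<^esub> (d \<odot>\<^bsub>V\<^esub> b)"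
    using assms by (auto simp: smult_assoc1[symmetric] m_comm)
  then show ?thesis using b by blast
qed

lemma gauge_convergent_add:
  assumes "B \<in> bounded_submodules K V" "gauge_convergent K V B x l" "gauge_convergent K V B y m"
    "range x \<subseteq> carrier V" "range y \<subseteq> carrier V" "l \<in> carrier V" "m \<in> carrier V"
  shows "gauge_convergent K V B (\<lambda>i. x i \<oplus>\<^bsub>V\<^esub> y i) (l \<oplus>\<^bsub>V\<^esub> m)"
  unfolding gauge_convergent_def
proof
  fix c assume c: "c \<in> carrier K - {\<zero>}"
  then obtain N1 N2 where N: "\<forall>i\<ge>N1. x i \<ominus>\<^bsub>V\<^esub> l \<in> (\<lambda>b. c \<odot>\<^bsub>V\<^esub> b) ` B"
    "\<forall>i\<ge>N2. y i \<ominus>\<^bsub>V\<^esub> m \<in> (\<lambda>b. c \<odot>\<^bsub>V\<^esub> b) ` B"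
    using assms(2,3) unfolding gauge_convergent_def by blast
  show "\<exists>N. \<forall>i\<ge>N. (x i \<oplus>\<^bsub>V\<^esub> y i) \<ominus>\<^bsub>V\<^esub> (l \<oplus>\<^bsub>V\<^esub> m) \<in> (\<lambda>b. c \<odot>\<^bsub>V\<^esub> b) ` B"
  proof (intro exI[of _ "max N1 N2"] allI impI)
    fix i assume "max N1 N2 \<le> i"
    moreover have "x i \<in> carrier V" "y i \<in> carrier V" using assms(4,5) by auto
    ultimately show "(x i \<oplus>\<^bsub>V\<^esub> y i) \<ominus>\<^bsub>V\<^esub> (l \<oplus>\<^bsub>V\<^esub> m) \<in> (\<lambda>b. c \<odot>\<^bsub>V\<^esub> b) ` B"
      using N c assms(6,7) scaled_bsub_add(1)[OF assms(1)] by (simp add: minus_add_minus)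
  qed
qed

lemma born_convergent_add:
  assumes "born_convergent K V x l" "born_convergent K V y m"
    "range x \<subseteq> carrier V" "range y \<subseteq> carrier V" "l \<in> carrier V" "m \<in> carrier V"
  shows "born_convergent K V (\<lambda>i. x i \<oplus>\<^bsub>V\<^esub> y i) (l \<oplus>\<^bsub>V\<^esub> m)"
proof -
  obtain S T where ST: "S \<in> bounded_submodules K V" "gauge_convergent K V S x l"
    "T \<in> bounded_submodules K V" "gauge_convergent K V T y m"
    using assms(1,2) unfolding born_convergent_def by blast
  then obtain B where B: "B \<in> bounded_submodules K V" "S \<subseteq> B" "T \<subseteq> B" using bsub_directed by metis
  have "gauge_convergent K V B (\<lambda>i. x i \<oplus>\<^bsub>V\<^esub> y i) (l \<oplus>\<^bsub>V\<^esub> m)"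
    using ST B assms(3-6) by (intro gauge_convergent_add) (auto intro: gauge_convergent_mono)
  then show ?thesis using B(1) unfolding born_convergent_def by blast
qed

lemma born_convergent_smult:
  assumes "born_convergent K V x l" "range x \<subseteq> carrier V" "l \<in> carrier V" "d \<in> carrier K"
  shows "born_convergent K V (\<lambda>i. d \<odot>\<^bsub>V\<^esub> x i) (d \<odot>\<^bsub>V\<^esub> l)"
proof -
  obtain B where B: "B \<in> bounded_submodules K V" "gauge_convergent K V B x l"
    using assms(1) unfolding born_convergent_def by blast
  have "gauge_convergent K V ((\<lambda>b. d \<odot>\<^bsub>V\<^esub> b) ` B) (\<lambda>i. d \<odot>\<^bsub>V\<^esub> x i) (d \<odot>\<^bsub>V\<^esub> l)"
    unfolding gauge_convergent_def
  proof
    fix c assume c: "c \<in> carrier K - {\<zero>}"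
    then obtain N where N: "\<forall>i\<ge>N. x i \<ominus>\<^bsub>V\<^esub> l \<in> (\<lambda>b. c \<odot>\<^bsub>V\<^esub> b) ` B"
      using B(2) unfolding gauge_convergent_def by blast
    show "\<exists>N. \<forall>i\<ge>N. d \<odot>\<^bsub>V\<^esub> x i \<ominus>\<^bsub>V\<^esub> d \<odot>\<^bsub>V\<^esub> l \<in> (\<lambda>b. c \<odot>\<^bsub>V\<^esub> b) ` (\<lambda>b. d \<odot>\<^bsub>V\<^esub> b) ` B"
    proof (intro exI[of _ N] allI impI)
      fix i assume "N \<le> i"
      then have "d \<odot>\<^bsub>V\<^esub> (x i \<ominus>\<^bsub>V\<^esub> l) \<in> (\<lambda>b. c \<odot>\<^bsub>V\<^esub> b) ` (\<lambda>b. d \<odot>\<^bsub>V\<^esub> b) ` B"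
        using N c assms(4) bsub_subset[OF B(1)] by (intro smult_image_commute) auto
      moreover have "x i \<in> carrier V" using assms(2) by auto
      ultimately show "d \<odot>\<^bsub>V\<^esub> x i \<ominus>\<^bsub>V\<^esub> d \<odot>\<^bsub>V\<^esub> l \<in> (\<lambda>b. c \<odot>\<^bsub>V\<^esub> b) ` (\<lambda>b. d \<odot>\<^bsub>V\<^esub> b) ` B"
        using assms(3,4) by (simp add: smult_minus)
    qed
  qed
  then show ?thesis using bsub_scale[OF assms(4) B(1)] unfolding born_convergent_def by blast
qed

lemma born_convergent_const:
  assumes "l \<in> carrier V" "\<And>i. i \<ge> n \<Longrightarrow> x i = l"
  shows "born_convergent K V x l"
proof -
  obtain B where B: "B \<in> bounded_submodules K V"
    using bounded_obtain_bsub bounded_singleton[OF assms(1)] by blast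
  have "gauge_convergent K V B x l"
    unfolding gauge_convergent_def
    using bsub_zero[OF B] assms
    by (auto intro!: exI[of _ n] image_eqI[OF _ bsub_zero[OF B]] simp: M.minus_eq M.r_neg)
  then show ?thesis using B unfolding born_convergent_def by blast
qed

end

section \<open>Complete spaces and completions\<close>

lemma gauge_cauchyD:
  assumes "gauge_cauchy K V B x" "c \<in> carrier K - {\<zero>\<^bsub>K\<^esub>}"
  shows "\<exists>N. \<forall>i\<ge>N. \<forall>j\<ge>N. x i \<ominus>\<^bsub>V\<^esub> x j \<in> (\<lambda>b. c \<odot>\<^bsub>V\<^esub> b) ` B"
  using assms(1) unfolding gauge_cauchy_def by (rule bspec[OF _ assms(2)])

lemma gauge_convergentD:
  assumes "gauge_convergent K V B x l" "c \<in> carrier K - {\<zero>\<^bsub>K\<^esub>}"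
  shows "\<exists>N. \<forall>i\<ge>N. x i \<ominus>\<^bsub>V\<^esub> l \<in> (\<lambda>b. c \<odot>\<^bsub>V\<^esub> b) ` B"
  using assms(1) unfolding gauge_convergent_def by (rule bspec[OF _ assms(2)])

section \<open>Norms, separatedness and limits in complete spaces\<close>

locale complete_bornological_space = bornological +
  assumes complete: "complete_bornological K V"
begin

text \<open>From the presentation as a directed union of Banach spaces only this is kept: a bounded
  set lies in a ball of one Banach subspace, all of whose balls are bounded.\<close>

lemma bounded_norm:
  assumes "B \<in> bornology V"
  obtains E \<nu> C where "banach_on K V E \<nu>" "0 < C" "B \<subseteq> {x \<in> E. \<nu> x \<le> C}"
    "\<forall>D. {x \<in> E. \<nu> x \<le> D} \<in> bornology V"
proof -
  obtain \<E> where ban: "\<forall>(E, \<nu>)\<in>\<E>. banach_on K V E \<nu>"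
    and bor: "bornology V = {B. \<exists>(E, \<nu>)\<in>\<E>. B \<subseteq> E \<and> (\<exists>C. \<forall>x\<in>B. \<nu> x \<le> C)}"
    using complete unfolding complete_bornological_def by (elim conjE exE)
  obtain E \<nu> C where E: "(E, \<nu>) \<in> \<E>" "B \<subseteq> E" "\<forall>x\<in>B. \<nu> x \<le> C"
    using assms unfolding bor by blast
  have "{x \<in> E. \<nu> x \<le> D} \<in> bornology V" for D
    unfolding bor using E(1) by (intro CollectI bexI[of _ "(E, \<nu>)"]) auto
  \<comment> \<open>The radius is raised to at least 1 so that later estimates may divide by
    it.\<close>
  moreover have "B \<subseteq> {x \<in> E. \<nu> x \<le> max C 1}" using E(2,3) by fastforce
  moreover have "banach_on K V E \<nu>" using ban E(1) by auto
  moreover have "0 < max C 1" by simp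
  ultimately show ?thesis using that by blast
qed

lemma
  assumes "banach_on K V E \<nu>"
  shows banach_submodule: "submodule E K V"
    and banach_nonneg: "x \<in> E \<Longrightarrow> 0 \<le> \<nu> x"
    and banach_zero_iff: "x \<in> E \<Longrightarrow> \<nu> x = 0 \<longleftrightarrow> x = \<zero>\<^bsub>V\<^esub>"
    and banach_smult: "c \<in> carrier K \<Longrightarrow> x \<in> E \<Longrightarrow> \<nu> (c \<odot>\<^bsub>V\<^esub> x) = absval K c * \<nu> x"
    and banach_add: "x \<in> E \<Longrightarrow> y \<in> E \<Longrightarrow> \<nu> (x \<oplus>\<^bsub>V\<^esub> y) \<le> max (\<nu> x) (\<nu> y)"
    and banach_cauchy: "cauchy_complete V E \<nu>"
  using assms unfolding banach_on_def by blast+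

lemma banach_uminus:
  assumes "banach_on K V E \<nu>" "x \<in> E"
  shows "\<nu> (\<ominus>\<^bsub>V\<^esub> x) = \<nu> x"
proof -
  have "x \<in> carrier V" using submodule_subset[OF module_V _ banach_submodule[OF assms(1)]] assms(2) by blast
  then have "\<ominus>\<^bsub>V\<^esub> x = \<ominus> \<one> \<odot>\<^bsub>V\<^esub> x" by (simp add: smult_l_minus)
  then show ?thesis using banach_smult[OF assms(1) _ assms(2)] absval_minus_one by simp
qed

text \<open>Membership in \<open>c S\<close> bounds the norm of \<open>w\<close> by the absolute
  value of \<open>c\<close> times a fixed constant, and that absolute value can be made arbitrarily
  small.\<close>

lemma separated:
  assumes "S \<in> bornology V" "\<And>c. c \<in> carrier K - {\<zero>} \<Longrightarrow> w \<in> (\<lambda>x. c \<odot>\<^bsub>V\<^esub> x) ` S"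
  shows "w = \<zero>\<^bsub>V\<^esub>"
proof -
  obtain E \<nu> C where E: "banach_on K V E \<nu>" "0 < C" "S \<subseteq> {x \<in> E. \<nu> x \<le> C}"
    by (rule bounded_norm[OF assms(1)])
  have le: "w \<in> E \<and> \<nu> w \<le> absval K c * C" if c: "c \<in> carrier K - {\<zero>}" for c
  proof -
    obtain s where s: "s \<in> S" "w = c \<odot>\<^bsub>V\<^esub> s" using assms(2)[OF c] by blast
    have "c \<odot>\<^bsub>V\<^esub> s \<in> E"
      using submodule_smult[OF module_V _ banach_submodule[OF E(1)]] s E(3) c by blast
    moreover have "\<nu> (c \<odot>\<^bsub>V\<^esub> s) = absval K c * \<nu> s"
      using banach_smult[OF E(1)] c s E(3) by blast
    moreover have "absval K c * \<nu> s \<le> absval K c * C"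
      using s E(3) absval_nonneg[of c] c by (intro mult_left_mono) auto
    ultimately show ?thesis using s by simp
  qed
  \<comment> \<open>The scalar 1 shows that \<open>w\<close> lies in the Banach subspace at all, so
    that its norm makes sense.\<close>
  have wE: "w \<in> E" using le[of \<one>] by simp
  have "\<nu> w \<le> 0"
  proof (rule ccontr)
    assume "\<not> \<nu> w \<le> 0"
    then have "0 < \<nu> w / C" using E(2) by simp
    then obtain c where "c \<in> carrier K - {\<zero>}" "absval K c < \<nu> w / C" using ex_small_scalar by blast
    then show False using le[of c] E(2) by (simp add: field_simps)
  qed
  then have "\<nu> w = 0" using banach_nonneg[OF E(1) wE] by simp
  then show ?thesis using banach_zero_iff[OF E(1) wE] by simp
qed

text \<open>Subtracting the sequence from itself gives the zero sequence converging to
  \<open>l - m\<close> for one gauge, so \<open>l - m\<close> lies in every \<open>c B\<close> up to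
  sign and vanishes by \<open>separated\<close>.\<close>

lemma limit_unique:
  assumes "born_convergent K V x l" "born_convergent K V x m" "range x \<subseteq> carrier V"
    "l \<in> carrier V" "m \<in> carrier V"
  shows "l = m"
proof -
  have "born_convergent K V (\<lambda>i. x i \<oplus>\<^bsub>V\<^esub> (\<ominus> \<one> \<odot>\<^bsub>V\<^esub> x i)) (l \<oplus>\<^bsub>V\<^esub> (\<ominus> \<one> \<odot>\<^bsub>V\<^esub> m))"
    using assms by (intro born_convergent_add born_convergent_smult) auto
  moreover have "x i \<oplus>\<^bsub>V\<^esub> (\<ominus> \<one> \<odot>\<^bsub>V\<^esub> x i) = \<zero>\<^bsub>V\<^esub>" for i
    using assms(3) by (simp add: smult_l_minus M.r_neg range_subsetD)
  moreover have "l \<oplus>\<^bsub>V\<^esub> (\<ominus> \<one> \<odot>\<^bsub>V\<^esub> m) = l \<ominus>\<^bsub>V\<^esub> m"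
    using assms by (simp add: smult_l_minus M.minus_eq)
  ultimately have "born_convergent K V (\<lambda>i. \<zero>\<^bsub>V\<^esub>) (l \<ominus>\<^bsub>V\<^esub> m)" by simp
  then obtain B where B: "B \<in> bounded_submodules K V" "gauge_convergent K V B (\<lambda>i. \<zero>\<^bsub>V\<^esub>) (l \<ominus>\<^bsub>V\<^esub> m)"
    unfolding born_convergent_def by blast
  have "\<zero>\<^bsub>V\<^esub> \<ominus>\<^bsub>V\<^esub> (l \<ominus>\<^bsub>V\<^esub> m) = \<zero>\<^bsub>V\<^esub>"
  proof (rule separated[OF bsub_bounded[OF B(1)]])
    fix c assume "c \<in> carrier K - {\<zero>}"
    then show "\<zero>\<^bsub>V\<^esub> \<ominus>\<^bsub>V\<^esub> (l \<ominus>\<^bsub>V\<^esub> m) \<in> (\<lambda>x. c \<odot>\<^bsub>V\<^esub> x) ` B"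
      using gauge_convergentD[OF B(2)] by blast
  qed
  then have "\<zero>\<^bsub>V\<^esub> = l \<ominus>\<^bsub>V\<^esub> m" using M.minus_eq_zero_iff assms by simp
  then show ?thesis using M.minus_eq_zero_iff[of l m] assms by simp
qed

text \<open>\<open>B'\<close> is a closed ball around 0 containing \<open>B\<close>. By the
  ultrametric inequality it also contains the limits, and the same ball serves every sequence. This
  uniformity later makes extensions to the completion bounded.\<close>

lemma limits_bounded:
  assumes "B \<in> bounded_submodules K V"
  obtains B' where "B' \<in> bounded_submodules K V"
    "\<And>x. range x \<subseteq> B \<Longrightarrow> gauge_cauchy K V B x \<Longrightarrow> \<exists>l\<in>B'. born_convergent K V x l"
proof -
  obtain E \<nu> C where E: "banach_on K V E \<nu>" "0 < C" "B \<subseteq> {x \<in> E. \<nu> x \<le> C}"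
    "\<forall>D. {x \<in> E. \<nu> x \<le> D} \<in> bornology V"
    by (rule bounded_norm[OF bsub_bounded[OF assms]])
  let ?B = "{x \<in> E. \<nu> x \<le> C}"
  note sm = submodule_subset[OF module_V _ banach_submodule[OF E(1)], simplified]
    submodule_zero[OF module_V _ banach_submodule[OF E(1)], simplified]
    submodule_add[OF module_V _ banach_submodule[OF E(1)], simplified]
    submodule_smult[OF module_V _ banach_submodule[OF E(1)], simplified]
    submodule_minus[OF module_V _ banach_submodule[OF E(1)], simplified]
    submodule_uminus[OF module_V _ banach_submodule[OF E(1)], simplified]
  have "submodule ?B (val_ring K) V"
    unfolding submodule_iff[OF module_V insertI2[OF singletonI]]
  proof (intro conjI ballI)
    show "?B \<subseteq> carrier V" using sm(1) by blast
    have "\<nu> \<zero>\<^bsub>V\<^esub> = 0" using banach_zero_iff[OF E(1) sm(2)] by simp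
    then show "\<zero>\<^bsub>V\<^esub> \<in> ?B" using sm(2) E(2) by simp
    fix x assume x: "x \<in> ?B"
    show "x \<oplus>\<^bsub>V\<^esub> y \<in> ?B" if y: "y \<in> ?B" for y
      using banach_add[OF E(1), of x y] x y sm(3) by (auto split: if_splits simp: max_def)
    show "c \<odot>\<^bsub>V\<^esub> x \<in> ?B" if c: "c \<in> carrier (val_ring K)" for c
    proof -
      have c': "c \<in> carrier K" "absval K c \<le> 1" using c by (auto simp: val_ring_def)
      have "absval K c * \<nu> x \<le> 1 * C"
        using c' x banach_nonneg[OF E(1)] absval_nonneg by (intro mult_mono) auto
      then show ?thesis using banach_smult[OF E(1) c'(1)] sm(4)[OF c'(1)] x by simp
    qed
  qed
  then have bs: "?B \<in> bounded_submodules K V" using E(4) by (simp add: bounded_submodules_def)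
  have "\<exists>l\<in>?B. born_convergent K V x l" if x: "range x \<subseteq> B" "gauge_cauchy K V B x" for x
  proof -
    have xB: "x i \<in> B" "x i \<in> E" "\<nu> (x i) \<le> C" "x i \<in> carrier V" for i
      using x(1) E(3) sm(1) by auto
    \<comment> \<open>From the gauge to the norm: \<open>B\<close> lies in the ball of radius
      \<open>C\<close>, so \<open>c B\<close> has norms below \<open>e\<close> once the absolute
      value of \<open>c\<close> is below \<open>e / C\<close>.\<close>
    have "\<exists>N. \<forall>i\<ge>N. \<forall>j\<ge>N. \<nu> (x i \<ominus>\<^bsub>V\<^esub> x j) < e" if "0 < e" for e
    proof -
      have "0 < e / C" using that E(2) by simp
      then obtain c where c: "c \<in> carrier K - {\<zero>}" "absval K c < e / C" using ex_small_scalar by blast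
      obtain N where N: "\<forall>i\<ge>N. \<forall>j\<ge>N. x i \<ominus>\<^bsub>V\<^esub> x j \<in> (\<lambda>b. c \<odot>\<^bsub>V\<^esub> b) ` B"
        using gauge_cauchyD[OF x(2) c(1)] ..
      have "\<nu> (x i \<ominus>\<^bsub>V\<^esub> x j) < e" if ij: "i \<ge> N" "j \<ge> N" for i j
      proof -
        obtain b where b: "b \<in> B" "x i \<ominus>\<^bsub>V\<^esub> x j = c \<odot>\<^bsub>V\<^esub> b" using N[rule_format, OF ij] by blast
        have "absval K c * \<nu> b \<le> absval K c * C"
          using b E(3) absval_nonneg[of c] c by (intro mult_left_mono) auto
        moreover have "absval K c * C < e" using c E(2) by (simp add: field_simps)
        ultimately show ?thesis using b banach_smult[OF E(1), of c b] c E(3) by auto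
      qed
      then show ?thesis by blast
    qed
    then obtain l where l: "l \<in> E" "(\<lambda>i. \<nu> (x i \<ominus>\<^bsub>V\<^esub> l)) \<longlonglongrightarrow> 0"
      using banach_cauchy[OF E(1)] xB unfolding cauchy_complete_def by blast
    have small: "\<exists>N. \<forall>i\<ge>N. \<nu> (x i \<ominus>\<^bsub>V\<^esub> l) < e" if "0 < e" for e
      using LIMSEQ_D[OF l(2) that] by fastforce
    have lc: "l \<in> carrier V" using l sm(1) by blast
    \<comment> \<open>A single index with \<open>x i\<close> within distance \<open>C\<close> of
      \<open>l\<close> is enough, because the norm of a sum is at most the larger of the two
      norms.\<close>
    have "\<nu> l \<le> C"
    proof -
      obtain i where i: "\<nu> (x i \<ominus>\<^bsub>V\<^esub> l) < C" using small[OF E(2)] by blast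
      have d: "x i \<ominus>\<^bsub>V\<^esub> l \<in> E" using sm(5) xB l by blast
      have "l = x i \<oplus>\<^bsub>V\<^esub> (\<ominus>\<^bsub>V\<^esub> (x i \<ominus>\<^bsub>V\<^esub> l))" using xB(4)[of i] lc by (simp add: M.ag_simps)
      then have "\<nu> l \<le> max (\<nu> (x i)) (\<nu> (\<ominus>\<^bsub>V\<^esub> (x i \<ominus>\<^bsub>V\<^esub> l)))"
        using banach_add[OF E(1) xB(2)[of i] sm(6)[OF d]] by simp
      then show ?thesis using i xB(3)[of i] banach_uminus[OF E(1) d] by simp
    qed
    moreover have "gauge_convergent K V ?B x l"
      unfolding gauge_convergent_def
    proof
      fix c assume c: "c \<in> carrier K - {\<zero>}"
      \<comment> \<open>From the norm back to the gauge: division by \<open>c\<close> carries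
        elements of norm below \<open>absval K c * C\<close> into \<open>?B\<close>.\<close>
      have pos: "0 < absval K c" using c absval_eq_0[of c] absval_nonneg[of c] by auto
      then obtain N where N: "\<forall>i\<ge>N. \<nu> (x i \<ominus>\<^bsub>V\<^esub> l) < absval K c * C"
        using small[of "absval K c * C"] E(2) by auto
      have "x i \<ominus>\<^bsub>V\<^esub> l \<in> (\<lambda>b. c \<odot>\<^bsub>V\<^esub> b) ` ?B" if "i \<ge> N" for i
      proof -
        let ?d = "x i \<ominus>\<^bsub>V\<^esub> l"
        have d: "?d \<in> E" using sm(5) xB l by blast
        have "?d \<in> carrier V" using d sm(1) by blast
        then have e: "?d = c \<odot>\<^bsub>V\<^esub> (inv c \<odot>\<^bsub>V\<^esub> ?d)"
          using scalar_inv[OF c] c by (simp add: smult_assoc1[symmetric])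
        have i: "inv c \<odot>\<^bsub>V\<^esub> ?d \<in> E" using sm(4) scalar_inv[OF c] d by blast
        have "\<nu> ?d = absval K c * \<nu> (inv c \<odot>\<^bsub>V\<^esub> ?d)"
          using banach_smult[OF E(1) _ i, of c] e c by simp
        then have "\<nu> (inv c \<odot>\<^bsub>V\<^esub> ?d) \<le> C" using N that pos
          by (metis less_imp_le mult_le_cancel_left_pos)
        then show ?thesis using e i by blast
      qed
      then show "\<exists>N. \<forall>i\<ge>N. x i \<ominus>\<^bsub>V\<^esub> l \<in> (\<lambda>b. c \<odot>\<^bsub>V\<^esub> b) ` ?B" by blast
    qed
    ultimately show ?thesis using bs l(1) unfolding born_convergent_def by blast
  qed
  then show ?thesis using that[OF bs] by blast
qed

end

section \<open>Cauchy sequences modulo the closed span of null sequences\<close>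

context bornological
begin

definition cauchy_set :: "'v set \<Rightarrow> (nat \<Rightarrow> 'v) set" where
  "cauchy_set B = {x. range x \<subseteq> B \<and> gauge_cauchy K V B x}"

abbreviation CS :: "('k, nat \<Rightarrow> 'v) born_space" where
  "CS \<equiv> cauchy_space K V"

abbreviation null_closure :: "(nat \<Rightarrow> 'v) set" where
  "null_closure \<equiv> closed_span K CS (null_sequences K V)"

lemma cauchy_space_simps:
  "carrier CS = (\<Union>B\<in>bounded_submodules K V. cauchy_set B)"
  "zero CS = (\<lambda>_. \<zero>\<^bsub>V\<^esub>)"
  "add CS = (\<lambda>x y i. x i \<oplus>\<^bsub>V\<^esub> y i)"
  "smult CS = (\<lambda>c x i. c \<odot>\<^bsub>V\<^esub> x i)"
  "bornology CS = {S. \<exists>B\<in>bounded_submodules K V. S \<subseteq> cauchy_set B}"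
  by (simp_all add: cauchy_space_def Let_def cauchy_set_def)

lemma cauchy_set_mono: "B \<subseteq> B' \<Longrightarrow> cauchy_set B \<subseteq> cauchy_set B'"
  unfolding cauchy_set_def using gauge_cauchy_mono by blast

lemma cauchy_set_range: "x \<in> cauchy_set B \<Longrightarrow> x i \<in> B"
  unfolding cauchy_set_def by blast

lemma cauchy_setD:
  assumes "x \<in> cauchy_set B" "c \<in> carrier K - {\<zero>}"
  shows "\<exists>N. \<forall>i\<ge>N. \<forall>j\<ge>N. x i \<ominus>\<^bsub>V\<^esub> x j \<in> (\<lambda>b. c \<odot>\<^bsub>V\<^esub> b) ` B"
  using assms by (intro gauge_cauchyD) (simp_all add: cauchy_set_def)

lemma cauchy_setI:
  assumes "\<And>i. x i \<in> B"
    "\<And>c. c \<in> carrier K - {\<zero>} \<Longrightarrow> \<exists>N. \<forall>i\<ge>N. \<forall>j\<ge>N. x i \<ominus>\<^bsub>V\<^esub> x j \<in> (\<lambda>b. c \<odot>\<^bsub>V\<^esub> b) ` B"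
  shows "x \<in> cauchy_set B"
  using assms unfolding cauchy_set_def gauge_cauchy_def by auto

lemma cauchy_carrierE:
  assumes "x \<in> carrier CS"
  obtains B where "B \<in> bounded_submodules K V" "x \<in> cauchy_set B"
  using assms unfolding cauchy_space_simps by blast

lemma cauchy_carrierI: "B \<in> bounded_submodules K V \<Longrightarrow> x \<in> cauchy_set B \<Longrightarrow> x \<in> carrier CS"
  unfolding cauchy_space_simps by blast

lemma cauchy_carrier_range:
  assumes "x \<in> carrier CS"
  shows "x i \<in> carrier V"
proof -
  obtain B where "B \<in> bounded_submodules K V" "x \<in> cauchy_set B"
    using assms by (rule cauchy_carrierE)
  then show ?thesis using cauchy_set_range[of x B i] bsub_subset[of B] by blast
qed

lemma cauchy_set_add:
  assumes "B \<in> bounded_submodules K V" "x \<in> cauchy_set B" "y \<in> cauchy_set B"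
  shows "(\<lambda>i. x i \<oplus>\<^bsub>V\<^esub> y i) \<in> cauchy_set B"
proof (rule cauchy_setI)
  note r = cauchy_set_range[OF assms(2)] cauchy_set_range[OF assms(3)]
  then have rc: "x i \<in> carrier V" "y i \<in> carrier V" for i using bsub_subset[OF assms(1)] by blast+
  show "x i \<oplus>\<^bsub>V\<^esub> y i \<in> B" for i using r bsub_add[OF assms(1)] by blast
  fix c assume c: "c \<in> carrier K - {\<zero>}"
  obtain N1 where N1: "\<forall>i\<ge>N1. \<forall>j\<ge>N1. x i \<ominus>\<^bsub>V\<^esub> x j \<in> (\<lambda>b. c \<odot>\<^bsub>V\<^esub> b) ` B"
    using cauchy_setD[OF assms(2) c] ..
  obtain N2 where N2: "\<forall>i\<ge>N2. \<forall>j\<ge>N2. y i \<ominus>\<^bsub>V\<^esub> y j \<in> (\<lambda>b. c \<odot>\<^bsub>V\<^esub> b) ` B"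
    using cauchy_setD[OF assms(3) c] ..
  have "(x i \<oplus>\<^bsub>V\<^esub> y i) \<ominus>\<^bsub>V\<^esub> (x j \<oplus>\<^bsub>V\<^esub> y j) \<in> (\<lambda>b. c \<odot>\<^bsub>V\<^esub> b) ` B"
    if "i \<ge> max N1 N2" "j \<ge> max N1 N2" for i j
    using scaled_bsub_add(1)[OF assms(1) _ N1[rule_format, of i j] N2[rule_format, of i j]] c that rc by (simp add: minus_add_minus)
  then show "\<exists>N. \<forall>i\<ge>N. \<forall>j\<ge>N. (x i \<oplus>\<^bsub>V\<^esub> y i) \<ominus>\<^bsub>V\<^esub> (x j \<oplus>\<^bsub>V\<^esub> y j) \<in> (\<lambda>b. c \<odot>\<^bsub>V\<^esub> b) ` B"
    by blast
qed

text \<open>The gauge is scaled together with the sequence: the multiple need not stay in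
  \<open>B\<close>, but it is Cauchy for the bounded submodule \<open>d B\<close>.\<close>

lemma cauchy_set_smult:
  assumes "B \<in> bounded_submodules K V" "x \<in> cauchy_set B" "d \<in> carrier K"
  shows "(\<lambda>i. d \<odot>\<^bsub>V\<^esub> x i) \<in> cauchy_set ((\<lambda>b. d \<odot>\<^bsub>V\<^esub> b) ` B)"
proof (rule cauchy_setI)
  note r = cauchy_set_range[OF assms(2)]
  then have rc: "x i \<in> carrier V" for i using bsub_subset[OF assms(1)] by blast
  show "d \<odot>\<^bsub>V\<^esub> x i \<in> (\<lambda>b. d \<odot>\<^bsub>V\<^esub> b) ` B" for i using r by blast
  fix c assume c: "c \<in> carrier K - {\<zero>}"
  obtain N where N: "\<forall>i\<ge>N. \<forall>j\<ge>N. x i \<ominus>\<^bsub>V\<^esub> x j \<in> (\<lambda>b. c \<odot>\<^bsub>V\<^esub> b) ` B"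
    using cauchy_setD[OF assms(2) c] ..
  have "d \<odot>\<^bsub>V\<^esub> x i \<ominus>\<^bsub>V\<^esub> d \<odot>\<^bsub>V\<^esub> x j \<in> (\<lambda>b. c \<odot>\<^bsub>V\<^esub> b) ` (\<lambda>b. d \<odot>\<^bsub>V\<^esub> b) ` B"
    if "i \<ge> N" "j \<ge> N" for i j
    using smult_image_commute[OF _ assms(3) bsub_subset[OF assms(1)] N[rule_format, OF that]] c rc assms(3)
    by (simp add: smult_minus)
  then show "\<exists>N. \<forall>i\<ge>N. \<forall>j\<ge>N. d \<odot>\<^bsub>V\<^esub> x i \<ominus>\<^bsub>V\<^esub> d \<odot>\<^bsub>V\<^esub> x j \<in> (\<lambda>b. c \<odot>\<^bsub>V\<^esub> b) ` (\<lambda>b. d \<odot>\<^bsub>V\<^esub> b) ` B"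
    by blast
qed

lemma cauchy_set_const:
  assumes "B \<in> bounded_submodules K V" "v \<in> B"
  shows "(\<lambda>_. v) \<in> cauchy_set B"
proof (rule cauchy_setI)
  have v: "v \<in> carrier V" using assms bsub_subset by blast
  fix c assume c: "c \<in> carrier K - {\<zero>}"
  have "v \<ominus>\<^bsub>V\<^esub> v = c \<odot>\<^bsub>V\<^esub> \<zero>\<^bsub>V\<^esub>" using v c by (simp add: M.minus_eq M.r_neg)
  then show "\<exists>N. \<forall>i\<ge>N. \<forall>j\<ge>N. v \<ominus>\<^bsub>V\<^esub> v \<in> (\<lambda>b. c \<odot>\<^bsub>V\<^esub> b) ` B" using bsub_zero[OF assms(1)] by blast
qed (rule assms)

lemma module_CS: "module K CS"
proof (rule moduleI)
  show "cring K" ..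
  have add: "(\<lambda>i. x i \<oplus>\<^bsub>V\<^esub> y i) \<in> carrier CS" if xy: "x \<in> carrier CS" "y \<in> carrier CS" for x y
  proof -
    obtain S where S: "S \<in> bounded_submodules K V" "x \<in> cauchy_set S"
      using xy(1) by (rule cauchy_carrierE)
    obtain T where T: "T \<in> bounded_submodules K V" "y \<in> cauchy_set T"
      using xy(2) by (rule cauchy_carrierE)
    obtain B where B: "B \<in> bounded_submodules K V" "S \<subseteq> B" "T \<subseteq> B"
      using S(1) T(1) by (rule bsub_directed)
    show ?thesis
      using cauchy_set_mono[OF B(2)] cauchy_set_mono[OF B(3)] S(2) T(2)
      by (intro cauchy_carrierI[OF B(1)] cauchy_set_add[OF B(1)]) blast+
  qed
  have sm: "(\<lambda>i. c \<odot>\<^bsub>V\<^esub> x i) \<in> carrier CS" if cx: "c \<in> carrier K" "x \<in> carrier CS" for c x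
  proof -
    obtain S where S: "S \<in> bounded_submodules K V" "x \<in> cauchy_set S"
      using cx(2) by (rule cauchy_carrierE)
    show ?thesis
      by (rule cauchy_carrierI[OF bsub_scale[OF cx(1) S(1)] cauchy_set_smult[OF S cx(1)]])
  qed
  note rng = cauchy_carrier_range
  show "abelian_group CS"
  proof (rule abelian_groupI)
    obtain B where "B \<in> bounded_submodules K V"
      using bounded_obtain_bsub bounded_singleton[of "\<zero>\<^bsub>V\<^esub>"] by blast
    then show "\<zero>\<^bsub>CS\<^esub> \<in> carrier CS"
      unfolding cauchy_space_simps(2)
      by (intro cauchy_carrierI cauchy_set_const bsub_zero)
    fix x assume x: "x \<in> carrier CS"
    have "(\<lambda>i. \<ominus> \<one> \<odot>\<^bsub>V\<^esub> x i) \<oplus>\<^bsub>CS\<^esub> x = \<zero>\<^bsub>CS\<^esub>"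
      using rng[OF x] by (simp add: cauchy_space_simps smult_l_minus M.l_neg)
    then show "\<exists>y\<in>carrier CS. y \<oplus>\<^bsub>CS\<^esub> x = \<zero>\<^bsub>CS\<^esub>" using sm[OF _ x, of "\<ominus> \<one>"] by auto
  qed (auto simp: cauchy_space_simps(2-4) rng M.a_ac add)
  show "c \<odot>\<^bsub>CS\<^esub> x \<in> carrier CS" if "c \<in> carrier K" "x \<in> carrier CS" for c x
    using sm[OF that] by (simp add: cauchy_space_simps(4))
qed (auto simp: cauchy_space_simps(2-4) cauchy_carrier_range smult_l_distr smult_r_distr smult_assoc1)

lemma minus_CS:
  assumes "x \<in> carrier CS" "y \<in> carrier CS"
  shows "x \<ominus>\<^bsub>CS\<^esub> y = (\<lambda>i. x i \<ominus>\<^bsub>V\<^esub> y i)"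
proof -
  interpret C: module K CS by (rule module_CS)
  have "\<ominus>\<^bsub>CS\<^esub> y = \<ominus> \<one> \<odot>\<^bsub>CS\<^esub> y" using assms by (simp add: C.smult_l_minus)
  then have "x \<ominus>\<^bsub>CS\<^esub> y = x \<oplus>\<^bsub>CS\<^esub> (\<ominus> \<one> \<odot>\<^bsub>CS\<^esub> y)" by (simp add: C.M.minus_eq)
  then show ?thesis using cauchy_carrier_range[OF assms(2)]
    by (simp add: cauchy_space_simps(3,4) M.minus_eq smult_l_minus)
qed

lemma null_subset: "null_sequences K V \<subseteq> carrier CS"
  by (auto simp: null_sequences_def)

lemma submodule_null_closure: "submodule null_closure K CS"
  and null_closure_superset: "null_sequences K V \<subseteq> null_closure"
proof -
  \<comment> \<open>The whole space is a closed subspace, so the intersection defining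
    \<open>null_closure\<close> is over a nonempty family.\<close>
  have "carrier CS \<in> {M. closed_subspace K CS M \<and> null_sequences K V \<subseteq> M}"
    using submodule_carrier[OF module_CS] null_subset by (simp add: closed_subspace_def)
  then have "{M. closed_subspace K CS M \<and> null_sequences K V \<subseteq> M} \<noteq> {}" by force
  then show "submodule null_closure K CS"
    unfolding closed_span_def by (intro submodule_Inter[OF module_CS]) (auto simp: closed_subspace_def)
  show "null_sequences K V \<subseteq> null_closure" unfolding closed_span_def by (rule Inter_greatest) simp
qed

sublocale N: module_quotient K CS null_closure
  by (intro module_quotient.intro module_quotient_axioms.intro module_CS submodule_null_closure)

lemma completion_simps:
  "carrier (completion K V) = (\<lambda>x. null_closure +>\<^bsub>CS\<^esub> x) ` carrier CS"
  "bornology (completion K V) = {(\<lambda>x. null_closure +>\<^bsub>CS\<^esub> x) ` S | S. S \<in> bornology CS}"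
  by (simp_all add: completion_def quotient_space_def N.carrier_Q)

lemma module_completion: "module K (completion K V)"
  unfolding completion_def quotient_space_def by (intro module_with_bornology N.module_Q)

lemma linear_map_completion_iff:
  "linear_map K (completion K V) W f \<longleftrightarrow> linear_map K N.Q W f"
  by (simp add: completion_def quotient_space_def)

lemma const_in_CS: "v \<in> carrier V \<Longrightarrow> (\<lambda>_. v) \<in> carrier CS"
proof -
  assume v: "v \<in> carrier V"
  obtain B where "B \<in> bounded_submodules K V" "{v} \<subseteq> B"
    using bounded_obtain_bsub[OF bounded_singleton[OF v]] by blast
  then show ?thesis by (intro cauchy_carrierI cauchy_set_const) auto
qed

lemma bounded_linear_to_completion: "bounded_linear_map K V (completion K V) (to_completion K V)"
proof (rule bounded_linear_mapI)
  show "linear_map K V (completion K V) (to_completion K V)"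
  proof (rule linear_mapI)
    fix x assume x: "x \<in> carrier V"
    show "to_completion K V x \<in> carrier (completion K V)"
      using const_in_CS[OF x] by (simp add: completion_simps to_completion_def)
    show "to_completion K V (x \<oplus>\<^bsub>V\<^esub> y) = to_completion K V x \<oplus>\<^bsub>completion K V\<^esub> to_completion K V y"
      if y: "y \<in> carrier V" for y
      using N.add_Q[OF const_in_CS[OF x] const_in_CS[OF y]]
      by (simp add: to_completion_def completion_def quotient_space_def cauchy_space_simps(3))
    show "to_completion K V (c \<odot>\<^bsub>V\<^esub> x) = c \<odot>\<^bsub>completion K V\<^esub> to_completion K V x"
      if c: "c \<in> carrier K" for c
      using N.smult_Q[OF c const_in_CS[OF x]]
      by (simp add: to_completion_def completion_def quotient_space_def cauchy_space_simps(4))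
  qed
  fix B assume "B \<in> bornology V"
  then obtain S where S: "S \<in> bounded_submodules K V" "B \<subseteq> S" using bounded_obtain_bsub by blast
  have "(\<lambda>v _. v) ` B \<in> bornology CS"
    unfolding cauchy_space_simps using cauchy_set_const[OF S(1)] S by blast
  moreover have "to_completion K V ` B = (\<lambda>x. null_closure +>\<^bsub>CS\<^esub> x) ` (\<lambda>v _. v) ` B"
    by (simp add: to_completion_def image_image)
  ultimately show "to_completion K V ` B \<in> bornology (completion K V)"
    unfolding completion_simps by blast
qed

end

section \<open>Universal property of the completion\<close>

locale bornological_complete_pair =
  bornological K p V + W: complete_bornological_space K p W
  for K :: "'k valued_ring" (structure) and p and V :: "('k, 'v) born_space"
    and W :: "('k, 'w) born_space"
begin

lemma linear_image_cauchy:
  assumes h: "linear_map K V W h" and "B \<in> bounded_submodules K V" "h ` B \<subseteq> T" "x \<in> cauchy_set B"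
  shows "(\<lambda>i. h (x i)) \<in> W.cauchy_set T"
proof (rule W.cauchy_setI)
  note r = cauchy_set_range[OF assms(4)]
  then have rc: "x i \<in> carrier V" for i using bsub_subset[OF assms(2)] by blast
  show "h (x i) \<in> T" for i using r assms(3) by blast
  fix c assume c: "c \<in> carrier K - {\<zero>}"
  obtain N where N: "\<forall>i\<ge>N. \<forall>j\<ge>N. x i \<ominus>\<^bsub>V\<^esub> x j \<in> (\<lambda>b. c \<odot>\<^bsub>V\<^esub> b) ` B"
    using cauchy_setD[OF assms(4) c] ..
  have "h (x i) \<ominus>\<^bsub>W\<^esub> h (x j) \<in> (\<lambda>b. c \<odot>\<^bsub>W\<^esub> b) ` T" if ij: "i \<ge> N" "j \<ge> N" for i j
  proof -
    obtain b where b: "b \<in> B" "x i \<ominus>\<^bsub>V\<^esub> x j = c \<odot>\<^bsub>V\<^esub> b" using N[rule_format, OF ij] by blast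
    have bc: "b \<in> carrier V" using b(1) bsub_subset[OF assms(2)] by blast
    have "h (x i) \<ominus>\<^bsub>W\<^esub> h (x j) = h (x i \<ominus>\<^bsub>V\<^esub> x j)"
      using linear_map_minus[OF h module_V W.module_V] rc by simp
    also have "\<dots> = c \<odot>\<^bsub>W\<^esub> h b" using b(2) linear_map_smult[OF h _ bc, of c] c by simp
    finally show ?thesis using assms(3) b(1) by blast
  qed
  then show "\<exists>N. \<forall>i\<ge>N. \<forall>j\<ge>N. h (x i) \<ominus>\<^bsub>W\<^esub> h (x j) \<in> (\<lambda>b. c \<odot>\<^bsub>W\<^esub> b) ` T" by blast
qed

text \<open>\<open>T\<close> depends on \<open>S\<close> alone and is found before \<open>B\<close>,
  \<open>h\<close> and \<open>x\<close>. With one map this bounds its extension; with varying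
  \<open>h\<close> it bounds a whole family of extensions at once.\<close>

lemma limit_in_bounded:
  assumes "S \<in> bornology W"
  obtains T where "T \<in> bounded_submodules K W"
    "\<forall>B h x. B \<in> bounded_submodules K V \<and> linear_map K V W h \<and> h ` B \<subseteq> S \<and> x \<in> cauchy_set B
      \<longrightarrow> (\<exists>l\<in>T. born_convergent K W (\<lambda>i. h (x i)) l)"
proof -
  obtain S' where S': "S' \<in> bounded_submodules K W" "S \<subseteq> S'"
    using assms by (rule W.bounded_obtain_bsub)
  obtain T where T: "T \<in> bounded_submodules K W"
    "\<forall>x. range x \<subseteq> S' \<longrightarrow> gauge_cauchy K W S' x \<longrightarrow> (\<exists>l\<in>T. born_convergent K W x l)"
    using W.limits_bounded[OF S'(1)] by blast
  have "\<exists>l\<in>T. born_convergent K W (\<lambda>i. h (x i)) l"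
    if h: "B \<in> bounded_submodules K V" "linear_map K V W h" "h ` B \<subseteq> S" "x \<in> cauchy_set B" for B h x
  proof -
    have "(\<lambda>i. h (x i)) \<in> W.cauchy_set S'"
      using h(3) S'(2) by (intro linear_image_cauchy[OF h(2,1) _ h(4)]) blast
    then show ?thesis using T(2) by (simp add: W.cauchy_set_def)
  qed
  then show ?thesis by (intro that[OF T(1)]) blast
qed

text \<open>The kernel of \<open>F\<close> is a closed subspace because \<open>W\<close> is
  separated, so with the null sequences it contains their closed span. Boundedness of
  \<open>F\<close> on each \<open>cauchy_set\<close> takes the place of continuity.\<close>

lemma null_closure_kernel:
  assumes F: "linear_map K CS W F"
    and bdd: "\<And>B. B \<in> bounded_submodules K V \<Longrightarrow> F ` cauchy_set B \<in> bornology W"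
    and null: "\<And>x. x \<in> null_sequences K V \<Longrightarrow> F x = \<zero>\<^bsub>W\<^esub>"
    and x: "x \<in> null_closure"
  shows "F x = \<zero>\<^bsub>W\<^esub>"
proof -
  let ?M = "{x \<in> carrier CS. F x \<in> {\<zero>\<^bsub>W\<^esub>}}"
  have "closed_subspace K CS ?M"
    unfolding closed_subspace_def
  proof (intro conjI allI impI)
    have "submodule {\<zero>\<^bsub>W\<^esub>} K W"
      by (subst submodule_iff[OF W.module_V]) auto
    then show "submodule ?M K CS"
      by (intro submodule_vimage[OF module_CS W.module_V _ F]) simp_all
    fix x l assume a: "range x \<subseteq> ?M \<and> l \<in> carrier CS \<and> born_convergent K CS x l"
    then obtain S where S: "S \<in> bounded_submodules K CS" "gauge_convergent K CS S x l"
      unfolding born_convergent_def by blast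
    obtain B where B: "B \<in> bounded_submodules K V" "S \<subseteq> cauchy_set B"
      using S(1) by (auto simp: bounded_submodules_def[of K CS] cauchy_space_simps(5))
    have l: "l \<in> carrier CS" using a by blast
    have Sc: "S \<subseteq> carrier CS" using B cauchy_carrierI by blast
    \<comment> \<open>For each nonzero \<open>c\<close> some \<open>x N - l\<close> equals
      \<open>c s\<close> with \<open>s\<close> in \<open>cauchy_set B\<close>; applying
      \<open>F\<close>, which kills \<open>x N\<close>, puts the negative of \<open>F l\<close> into
      \<open>c\<close> times one bounded set.\<close>
    have "\<ominus>\<^bsub>W\<^esub> F l = \<zero>\<^bsub>W\<^esub>"
    proof (rule W.separated[OF bdd[OF B(1)]])
      fix c assume c: "c \<in> carrier K - {\<zero>}"
      obtain N where "\<forall>i\<ge>N. x i \<ominus>\<^bsub>CS\<^esub> l \<in> (\<lambda>b. c \<odot>\<^bsub>CS\<^esub> b) ` S"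
        using gauge_convergentD[OF S(2) c] ..
      then have "x N \<ominus>\<^bsub>CS\<^esub> l \<in> (\<lambda>b. c \<odot>\<^bsub>CS\<^esub> b) ` S" by simp
      then obtain s where s: "s \<in> S" "x N \<ominus>\<^bsub>CS\<^esub> l = c \<odot>\<^bsub>CS\<^esub> s" by blast
      have xN: "x N \<in> carrier CS" "F (x N) = \<zero>\<^bsub>W\<^esub>" using a by auto
      have "F (x N) \<ominus>\<^bsub>W\<^esub> F l = c \<odot>\<^bsub>W\<^esub> F s"
        using linear_map_minus[OF F module_CS W.module_V xN(1) l] s linear_map_smult[OF F] Sc c by auto
      then have "\<ominus>\<^bsub>W\<^esub> F l = c \<odot>\<^bsub>W\<^esub> F s"
        using xN linear_map_closed[OF F l] by (simp add: W.M.minus_eq)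
      then show "\<ominus>\<^bsub>W\<^esub> F l \<in> (\<lambda>x. c \<odot>\<^bsub>W\<^esub> x) ` F ` cauchy_set B" using s B(2) by blast
    qed
    then have "F l = \<zero>\<^bsub>W\<^esub>" using linear_map_closed[OF F l] W.M.minus_minus[of "F l"] by simp
    then show "l \<in> ?M" using l by simp
  qed
  moreover have "null_sequences K V \<subseteq> ?M" using null null_subset by blast
  ultimately have "null_closure \<subseteq> ?M" unfolding closed_span_def by (intro Inter_lower) simp
  then show ?thesis using x by blast
qed

text \<open>\<open>F\<close> may be defined by a definite description because limits exist by
  \<open>limit_in_bounded\<close> and are unique by \<open>limit_unique\<close>. It is built on
  Cauchy sequences first and then descends to the quotient by
  \<open>null_closure_kernel\<close>.\<close>

theorem completion_extend:
  assumes g: "bounded_linear_map K V W g"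
  obtains G where "bounded_linear_map K (completion K V) W G"
    "\<And>v. v \<in> carrier V \<Longrightarrow> G (to_completion K V v) = g v"
proof -
  note gl = bounded_linear_map_linear[OF g]
  note gb = bounded_linear_map_bounded[OF g]
  note gc = linear_map_closed[OF gl]
  define F where "F x = (THE l. l \<in> carrier W \<and> born_convergent K W (\<lambda>i. g (x i)) l)" for x
  have rng: "range (\<lambda>i. g (x i)) \<subseteq> carrier W" if "x \<in> carrier CS" for x
    using cauchy_carrier_range[OF that] gc by blast
  have F_eq: "F x = l" if "x \<in> carrier CS" "l \<in> carrier W" "born_convergent K W (\<lambda>i. g (x i)) l" for x l
    unfolding F_def
    by (rule the_equality) (use that W.limit_unique[OF _ _ rng] in auto)
  \<comment> \<open>Existence of limits and boundedness are obtained together, since all limits for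
    sequences from \<open>B\<close> lie in the same \<open>T\<close>.\<close>
  have F_bdd: "F ` cauchy_set B \<in> bornology W"
    and F_lim: "\<And>x. x \<in> cauchy_set B \<Longrightarrow> F x \<in> carrier W \<and> born_convergent K W (\<lambda>i. g (x i)) (F x)"
    if B: "B \<in> bounded_submodules K V" for B
  proof -
    obtain T where T: "T \<in> bounded_submodules K W"
      "\<forall>B' h x. B' \<in> bounded_submodules K V \<and> linear_map K V W h \<and> h ` B' \<subseteq> g ` B \<and> x \<in> cauchy_set B'
      \<longrightarrow> (\<exists>l\<in>T. born_convergent K W (\<lambda>i. h (x i)) l)"
      by (rule limit_in_bounded[OF gb[OF bsub_bounded[OF B]]])
    have *: "F x \<in> T \<and> born_convergent K W (\<lambda>i. g (x i)) (F x)" if x: "x \<in> cauchy_set B" for x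
    proof -
      obtain l where l: "l \<in> T" "born_convergent K W (\<lambda>i. g (x i)) l"
        using T(2)[rule_format, of B g x] B gl x by blast
      have "l \<in> carrier W" using l(1) W.bsub_subset[OF T(1)] by blast
      then show ?thesis using F_eq[OF cauchy_carrierI[OF B x] _ l(2)] l by simp
    qed
    then show "\<And>x. x \<in> cauchy_set B \<Longrightarrow> F x \<in> carrier W \<and> born_convergent K W (\<lambda>i. g (x i)) (F x)"
      using W.bsub_subset[OF T(1)] by blast
    show "F ` cauchy_set B \<in> bornology W"
      using * W.bounded_mono[OF W.bsub_bounded[OF T(1)]] by blast
  qed
  have lim: "F x \<in> carrier W" "born_convergent K W (\<lambda>i. g (x i)) (F x)" if xc: "x \<in> carrier CS" for x
  proof -
    obtain B where "B \<in> bounded_submodules K V" "x \<in> cauchy_set B"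
      using xc by (rule cauchy_carrierE)
    then show "F x \<in> carrier W" "born_convergent K W (\<lambda>i. g (x i)) (F x)" using F_lim by blast+
  qed
  have Fl: "linear_map K CS W F"
  proof (rule linear_mapI)
    fix x assume x: "x \<in> carrier CS"
    show "F x \<in> carrier W" using lim x by blast
    note xr = cauchy_carrier_range[OF x]
    show "F (x \<oplus>\<^bsub>CS\<^esub> y) = F x \<oplus>\<^bsub>W\<^esub> F y" if y: "y \<in> carrier CS" for y
    proof (rule F_eq)
      note yr = cauchy_carrier_range[OF y]
      have "born_convergent K W (\<lambda>i. g (x i) \<oplus>\<^bsub>W\<^esub> g (y i)) (F x \<oplus>\<^bsub>W\<^esub> F y)"
        using lim x y rng by (intro W.born_convergent_add) auto
      then show "born_convergent K W (\<lambda>i. g ((x \<oplus>\<^bsub>CS\<^esub> y) i)) (F x \<oplus>\<^bsub>W\<^esub> F y)"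
        using xr yr linear_map_add[OF gl] by (simp add: cauchy_space_simps(3))
    qed (use x y lim in auto)
    show "F (c \<odot>\<^bsub>CS\<^esub> x) = c \<odot>\<^bsub>W\<^esub> F x" if c: "c \<in> carrier K" for c
    proof (rule F_eq)
      have "born_convergent K W (\<lambda>i. c \<odot>\<^bsub>W\<^esub> g (x i)) (c \<odot>\<^bsub>W\<^esub> F x)"
        using lim x c rng by (intro W.born_convergent_smult) auto
      then show "born_convergent K W (\<lambda>i. g ((c \<odot>\<^bsub>CS\<^esub> x) i)) (c \<odot>\<^bsub>W\<^esub> F x)"
        using xr c linear_map_smult[OF gl] by (simp add: cauchy_space_simps(4))
    qed (use x c lim in auto)
  qed
  have null: "F x = \<zero>\<^bsub>W\<^esub>" if x: "x \<in> null_sequences K V" for x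
  proof (rule F_eq)
    show xc: "x \<in> carrier CS" using x null_subset by blast
    note xr = cauchy_carrier_range[OF xc]
    obtain B where B: "B \<in> bounded_submodules K V" "gauge_convergent K V B x \<zero>\<^bsub>V\<^esub>"
      using x unfolding null_sequences_def born_convergent_def by blast
    obtain T where T: "T \<in> bounded_submodules K W" "g ` B \<subseteq> T"
      using gb[OF bsub_bounded[OF B(1)]] by (rule W.bounded_obtain_bsub)
    have "gauge_convergent K W T (\<lambda>i. g (x i)) \<zero>\<^bsub>W\<^esub>"
      unfolding gauge_convergent_def
    proof
      fix c assume c: "c \<in> carrier K - {\<zero>}"
      obtain N where N: "\<forall>i\<ge>N. x i \<ominus>\<^bsub>V\<^esub> \<zero>\<^bsub>V\<^esub> \<in> (\<lambda>b. c \<odot>\<^bsub>V\<^esub> b) ` B"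
        using gauge_convergentD[OF B(2) c] ..
      have "g (x i) \<ominus>\<^bsub>W\<^esub> \<zero>\<^bsub>W\<^esub> \<in> (\<lambda>b. c \<odot>\<^bsub>W\<^esub> b) ` T" if i: "i \<ge> N" for i
      proof -
        obtain b where b: "b \<in> B" "x i \<ominus>\<^bsub>V\<^esub> \<zero>\<^bsub>V\<^esub> = c \<odot>\<^bsub>V\<^esub> b" using N i by blast
        have "b \<in> carrier V" using b bsub_subset[OF B(1)] by blast
        then have "g (x i) = c \<odot>\<^bsub>W\<^esub> g b"
          using b(2) xr[of i] c linear_map_smult[OF gl, of c b]
          by (simp add: M.minus_zero_right)
        then have "g (x i) \<ominus>\<^bsub>W\<^esub> \<zero>\<^bsub>W\<^esub> = c \<odot>\<^bsub>W\<^esub> g b"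
          using gc[OF xr[of i]] by (simp add: W.M.minus_zero_right)
        then show ?thesis using T(2) b(1) by blast
      qed
      then show "\<exists>N. \<forall>i\<ge>N. g (x i) \<ominus>\<^bsub>W\<^esub> \<zero>\<^bsub>W\<^esub> \<in> (\<lambda>b. c \<odot>\<^bsub>W\<^esub> b) ` T" by blast
    qed
    then show "born_convergent K W (\<lambda>i. g (x i)) \<zero>\<^bsub>W\<^esub>" using T(1) unfolding born_convergent_def by blast
  qed simp
  obtain G where G: "linear_map K N.Q W G" "\<And>x. x \<in> carrier CS \<Longrightarrow> G (null_closure +>\<^bsub>CS\<^esub> x) = F x"
    using N.descend[OF Fl W.module_V null_closure_kernel[OF Fl F_bdd null]] by blast
  show ?thesis
  proof (rule that)
    show "bounded_linear_map K (completion K V) W G"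
    proof (rule bounded_linear_mapI)
      show "linear_map K (completion K V) W G" using G(1) by (simp add: linear_map_completion_iff)
      fix X assume "X \<in> bornology (completion K V)"
      then obtain S where S: "X = (\<lambda>x. null_closure +>\<^bsub>CS\<^esub> x) ` S" "S \<in> bornology CS"
        unfolding completion_simps by blast
      then obtain B where B: "B \<in> bounded_submodules K V" "S \<subseteq> cauchy_set B"
        unfolding cauchy_space_simps by blast
      have "G ` X = F ` S"
        unfolding S(1) image_image
        using B cauchy_carrierI[OF B(1)] G(2) by (intro image_cong) auto
      then show "G ` X \<in> bornology W"
        using W.bounded_mono[OF F_bdd[OF B(1)]] B(2) by (simp add: image_mono)
    qed
    fix v assume v: "v \<in> carrier V"
    have "F (\<lambda>_. v) = g v"
      using const_in_CS[OF v] gc[OF v] by (intro F_eq W.born_convergent_const[of _ 0]) auto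
    then show "G (to_completion K V v) = g v"
      using G(2)[OF const_in_CS[OF v]] by (simp add: to_completion_def)
  qed
qed

text \<open>Constant sequences converge to a given Cauchy sequence only up to an eventually vanishing
  sequence, which is why null sequences enter.\<close>

lemma completion_limit:
  assumes f: "bounded_linear_map K (completion K V) W f"
    and B: "B \<in> bounded_submodules K V" and x: "x \<in> cauchy_set B"
  shows "born_convergent K W (\<lambda>i. f (to_completion K V (x i))) (f (null_closure +>\<^bsub>CS\<^esub> x))"
proof -
  define F where "F y = f (null_closure +>\<^bsub>CS\<^esub> y)" for y
  have fl: "linear_map K N.Q W f"
    using bounded_linear_map_linear[OF f] by (simp add: linear_map_completion_iff)
  have Fl: "linear_map K CS W F" unfolding F_def by (rule linear_map_comp[OF N.linear_coset fl])
  have "cauchy_set B \<in> bornology CS" unfolding cauchy_space_simps using B by blast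
  then have "(\<lambda>y. null_closure +>\<^bsub>CS\<^esub> y) ` cauchy_set B \<in> bornology (completion K V)"
    unfolding completion_simps by blast
  then have "f ` (\<lambda>y. null_closure +>\<^bsub>CS\<^esub> y) ` cauchy_set B \<in> bornology W"
    by (rule bounded_linear_map_bounded[OF f])
  then have Fb: "F ` cauchy_set B \<in> bornology W" by (simp add: F_def image_image)
  obtain T where T: "T \<in> bounded_submodules K W" "F ` cauchy_set B \<subseteq> T"
    using Fb by (rule W.bounded_obtain_bsub)
  note r = cauchy_set_range[OF x]
  have rc: "x i \<in> carrier V" for i using r bsub_subset[OF B] by blast
  have xc: "x \<in> carrier CS" by (rule cauchy_carrierI[OF B x])
  \<comment> \<open>Sequences that vanish eventually are null, so \<open>F\<close> does not see
    finite initial segments.\<close>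
  have F0: "F y = \<zero>\<^bsub>W\<^esub>" if "y \<in> carrier CS" "\<And>j. j \<ge> n \<Longrightarrow> y j = \<zero>\<^bsub>V\<^esub>" for y and n :: nat
  proof -
    have "born_convergent K V y \<zero>\<^bsub>V\<^esub>" using that(2) by (intro born_convergent_const) auto
    then have "y \<in> null_sequences K V" using that(1) by (simp add: null_sequences_def)
    then have "y \<in> null_closure" using null_closure_superset by blast
    then have "null_closure +>\<^bsub>CS\<^esub> y = null_closure +>\<^bsub>CS\<^esub> \<zero>\<^bsub>CS\<^esub>"
      using that(1) by (subst N.coset_eq_iff) (auto simp: N.M.minus_zero_right)
    then show ?thesis using linear_map_zero[OF Fl module_CS W.module_V] by (simp add: F_def)
  qed
  have "gauge_convergent K W T (\<lambda>i. F (\<lambda>_. x i)) (F x)"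
    unfolding gauge_convergent_def
  proof
    fix c assume c: "c \<in> carrier K - {\<zero>}"
    have cinv: "inv c \<in> carrier K" "c \<in> carrier K" "c \<otimes> inv c = \<one>" "inv c \<otimes> c = \<one>"
      using scalar_inv[OF c] c by auto
    obtain N where N: "\<forall>i\<ge>N. \<forall>j\<ge>N. x i \<ominus>\<^bsub>V\<^esub> x j \<in> (\<lambda>b. c \<odot>\<^bsub>V\<^esub> b) ` B"
      using cauchy_setD[OF x c] ..
    have "F (\<lambda>_. x i) \<ominus>\<^bsub>W\<^esub> F x \<in> (\<lambda>b. c \<odot>\<^bsub>W\<^esub> b) ` T" if i: "i \<ge> N" for i
    proof -
      \<comment> \<open>From index \<open>i\<close> on, \<open>y\<close> is the constant sequence
        \<open>x i\<close> minus \<open>x\<close>. Replacing \<open>j\<close> by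
        \<open>max i j\<close> keeps both indices at least \<open>N\<close>, so that every entry,
        not only the late ones, lies in \<open>c B\<close> and \<open>z\<close> has all its values
        in \<open>B\<close>.\<close>
      define y where "y j = x i \<ominus>\<^bsub>V\<^esub> x (max i j)" for j
      define z where "z j = inv c \<odot>\<^bsub>V\<^esub> y j" for j
      have yc: "y j \<in> carrier V" for j using rc by (simp add: y_def)
      have yz: "y j = c \<odot>\<^bsub>V\<^esub> z j" for j
        using yc cinv by (simp add: z_def smult_assoc1[symmetric])
      have zB: "z \<in> cauchy_set B"
      proof (rule cauchy_setI)
        fix j
        obtain b where b: "b \<in> B" "y j = c \<odot>\<^bsub>V\<^esub> b"
          using N i unfolding y_def by (metis imageE max.cobounded1 order_trans)
        have "b \<in> carrier V" using b bsub_subset[OF B] by blast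
        then have "z j = b" using b(2) cinv by (simp add: z_def smult_assoc1[symmetric])
        then show "z j \<in> B" using b(1) by simp
      next
        fix d assume d: "d \<in> carrier K - {\<zero>}"
        \<comment> \<open>Since \<open>z\<close> is a difference of entries of \<open>x\<close>
          divided by \<open>c\<close>, precision \<open>d\<close> for \<open>z\<close> requires
          precision \<open>c \<otimes> d\<close> for \<open>x\<close>.\<close>
        have cd: "c \<otimes> d \<in> carrier K - {\<zero>}" using c d integral by auto
        obtain M where M: "\<forall>j\<ge>M. \<forall>k\<ge>M. x j \<ominus>\<^bsub>V\<^esub> x k \<in> (\<lambda>b. (c \<otimes> d) \<odot>\<^bsub>V\<^esub> b) ` B"
          using cauchy_setD[OF x cd] ..
        have "z j \<ominus>\<^bsub>V\<^esub> z k \<in> (\<lambda>b. d \<odot>\<^bsub>V\<^esub> b) ` B" if "j \<ge> M" "k \<ge> M" for j k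
        proof -
          have "max i k \<ge> M" "max i j \<ge> M" using that by auto
          then have "x (max i k) \<ominus>\<^bsub>V\<^esub> x (max i j) \<in> (\<lambda>b. (c \<otimes> d) \<odot>\<^bsub>V\<^esub> b) ` B" using M by blast
          then obtain b where b: "b \<in> B" "x (max i k) \<ominus>\<^bsub>V\<^esub> x (max i j) = (c \<otimes> d) \<odot>\<^bsub>V\<^esub> b"
            by blast
          have bc: "b \<in> carrier V" using b bsub_subset[OF B] by blast
          have "z j \<ominus>\<^bsub>V\<^esub> z k = inv c \<odot>\<^bsub>V\<^esub> (y j \<ominus>\<^bsub>V\<^esub> y k)"
            using yc cinv by (simp add: z_def smult_minus)
          also have "y j \<ominus>\<^bsub>V\<^esub> y k = x (max i k) \<ominus>\<^bsub>V\<^esub> x (max i j)"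
            using rc by (simp add: y_def M.ag_simps)
          also have "inv c \<odot>\<^bsub>V\<^esub> \<dots> = (inv c \<otimes> (c \<otimes> d)) \<odot>\<^bsub>V\<^esub> b"
            using b(2) bc cinv d by (simp add: smult_assoc1)
          also have "inv c \<otimes> (c \<otimes> d) = d" using cinv d by (simp add: m_assoc[symmetric])
          finally show ?thesis using b(1) by blast
        qed
        then show "\<exists>M. \<forall>j\<ge>M. \<forall>k\<ge>M. z j \<ominus>\<^bsub>V\<^esub> z k \<in> (\<lambda>b. d \<odot>\<^bsub>V\<^esub> b) ` B" by blast
      qed
      have zc: "z \<in> carrier CS" by (rule cauchy_carrierI[OF B zB])
      have y_eq: "y = c \<odot>\<^bsub>CS\<^esub> z" using yz by (auto simp: cauchy_space_simps(4))
      have yCS: "y \<in> carrier CS" unfolding y_eq using zc c by simp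
      have k: "(\<lambda>_. x i) \<in> carrier CS" by (rule const_in_CS[OF rc])
      have e: "((\<lambda>_. x i) \<ominus>\<^bsub>CS\<^esub> x) \<ominus>\<^bsub>CS\<^esub> y = (\<lambda>j. (x i \<ominus>\<^bsub>V\<^esub> x j) \<ominus>\<^bsub>V\<^esub> y j)"
        using minus_CS[OF k xc] minus_CS[OF N.M.minus_closed[OF k xc] yCS] by simp
      have "F (((\<lambda>_. x i) \<ominus>\<^bsub>CS\<^esub> x) \<ominus>\<^bsub>CS\<^esub> y) = \<zero>\<^bsub>W\<^esub>"
      proof (rule F0[where n = i])
        show "((\<lambda>_. x i) \<ominus>\<^bsub>CS\<^esub> x) \<ominus>\<^bsub>CS\<^esub> y \<in> carrier CS" using k xc yCS by simp
        show "(((\<lambda>_. x i) \<ominus>\<^bsub>CS\<^esub> x) \<ominus>\<^bsub>CS\<^esub> y) j = \<zero>\<^bsub>V\<^esub>" if "j \<ge> i" for j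
          using that rc unfolding e by (simp add: y_def max_absorb2 M.minus_eq_zero_iff)
      qed
      then have "(F (\<lambda>_. x i) \<ominus>\<^bsub>W\<^esub> F x) \<ominus>\<^bsub>W\<^esub> F y = \<zero>\<^bsub>W\<^esub>"
        using linear_map_minus[OF Fl module_CS W.module_V] k xc yCS by simp
      then have "F (\<lambda>_. x i) \<ominus>\<^bsub>W\<^esub> F x = F y"
        using linear_map_closed[OF Fl] k xc yCS by (simp add: W.M.minus_eq_zero_iff)
      also have "F y = c \<odot>\<^bsub>W\<^esub> F z" unfolding y_eq using linear_map_smult[OF Fl _ zc] c by simp
      finally show ?thesis using T(2) zB by blast
    qed
    then show "\<exists>N. \<forall>i\<ge>N. F (\<lambda>_. x i) \<ominus>\<^bsub>W\<^esub> F x \<in> (\<lambda>b. c \<odot>\<^bsub>W\<^esub> b) ` T" by blast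
  qed
  then show ?thesis using T(1) unfolding born_convergent_def F_def to_completion_def by blast
qed

lemma completion_map_closed:
  assumes "bounded_linear_map K (completion K V) W f" "x \<in> carrier CS"
  shows "f (null_closure +>\<^bsub>CS\<^esub> x) \<in> carrier W"
  using linear_map_closed[OF bounded_linear_map_linear[OF assms(1)]] assms(2)
  by (simp add: completion_simps)

lemma to_completion_closed: "v \<in> carrier V \<Longrightarrow> to_completion K V v \<in> carrier (completion K V)"
  using linear_map_closed[OF bounded_linear_map_linear[OF bounded_linear_to_completion]] .

theorem completion_unique:
  assumes f: "bounded_linear_map K (completion K V) W f"
    and g: "bounded_linear_map K (completion K V) W g"
    and eq: "\<And>v. v \<in> carrier V \<Longrightarrow> f (to_completion K V v) = g (to_completion K V v)"
    and X: "X \<in> carrier (completion K V)"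
  shows "f X = g X"
proof -
  obtain x where x: "x \<in> carrier CS" "X = null_closure +>\<^bsub>CS\<^esub> x" using X unfolding completion_simps by blast
  obtain B where B: "B \<in> bounded_submodules K V" "x \<in> cauchy_set B"
    using x(1) by (rule cauchy_carrierE)
  note rc = cauchy_carrier_range[OF x(1)]
  have "born_convergent K W (\<lambda>i. f (to_completion K V (x i))) (g (null_closure +>\<^bsub>CS\<^esub> x))"
    using completion_limit[OF g B] eq rc by simp
  moreover have "range (\<lambda>i. f (to_completion K V (x i))) \<subseteq> carrier W"
    using rc to_completion_closed linear_map_closed[OF bounded_linear_map_linear[OF f]] by blast
  ultimately show ?thesis
    unfolding x(2)
    using W.limit_unique[OF completion_limit[OF f B]] completion_map_closed[OF f x(1)]
      completion_map_closed[OF g x(1)] by blast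
qed

text \<open>Each value at a class is a limit of values at constant sequences. Since
  \<open>limit_in_bounded\<close> fixes its bound for all maps and sequences together, one
  \<open>T\<close> catches the values of the entire family.\<close>

theorem completion_equibounded:
  assumes U: "\<And>f. f \<in> U \<Longrightarrow> bounded_linear_map K (completion K V) W f"
    and bdd: "\<And>B. B \<in> bornology V \<Longrightarrow> (\<Union>f\<in>U. (\<lambda>v. f (to_completion K V v)) ` B) \<in> bornology W"
    and X: "X \<in> bornology (completion K V)"
  shows "(\<Union>f\<in>U. f ` X) \<in> bornology W"
proof -
  obtain S where S: "X = (\<lambda>x. null_closure +>\<^bsub>CS\<^esub> x) ` S" "S \<in> bornology CS"
    using X unfolding completion_simps by blast
  obtain B where B: "B \<in> bounded_submodules K V" "S \<subseteq> cauchy_set B"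
    using S(2) unfolding cauchy_space_simps by blast
  obtain T where T: "T \<in> bounded_submodules K W"
    "\<forall>B' h x. B' \<in> bounded_submodules K V \<and> linear_map K V W h
        \<and> h ` B' \<subseteq> (\<Union>f\<in>U. (\<lambda>v. f (to_completion K V v)) ` B) \<and> x \<in> cauchy_set B'
      \<longrightarrow> (\<exists>l\<in>T. born_convergent K W (\<lambda>i. h (x i)) l)"
    by (rule limit_in_bounded[OF bdd[OF bsub_bounded[OF B(1)]]])
  have "f (null_closure +>\<^bsub>CS\<^esub> x) \<in> T" if fx: "f \<in> U" "x \<in> S" for f x
  proof -
    let ?h = "\<lambda>v. f (to_completion K V v)"
    have xB: "x \<in> cauchy_set B" using fx B by blast
    have hl: "linear_map K V W ?h"
      by (rule linear_map_comp[OF bounded_linear_map_linear[OF bounded_linear_to_completion]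
            bounded_linear_map_linear[OF U[OF fx(1)]]])
    have "?h ` B \<subseteq> (\<Union>f\<in>U. (\<lambda>v. f (to_completion K V v)) ` B)" using fx(1) by blast
    then obtain l where l: "l \<in> T" "born_convergent K W (\<lambda>i. ?h (x i)) l"
      using T(2)[rule_format, of B ?h x] B(1) hl xB by blast
    have xc: "x \<in> carrier CS" by (rule cauchy_carrierI[OF B(1) xB])
    have "range (\<lambda>i. ?h (x i)) \<subseteq> carrier W"
      using cauchy_carrier_range[OF xc] linear_map_closed[OF hl] by blast
    then have "f (null_closure +>\<^bsub>CS\<^esub> x) = l"
      using W.limit_unique[OF completion_limit[OF U[OF fx(1)] B(1) xB] l(2)]
        completion_map_closed[OF U[OF fx(1)] xc] l(1) W.bsub_subset[OF T(1)] by blast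
    then show ?thesis using l by simp
  qed
  then have "(\<Union>f\<in>U. f ` X) \<subseteq> T" unfolding S(1) by blast
  then show ?thesis by (rule W.bounded_mono[OF W.bsub_bounded[OF T(1)]])
qed

end

section \<open>Tensor powers\<close>

context mixed_char_complete_field
begin

lemma free_module_simps:
  "carrier (free_module K S) = {\<phi>. (\<forall>s. \<phi> s \<in> carrier K) \<and> finite {s. \<phi> s \<noteq> \<zero>} \<and> {s. \<phi> s \<noteq> \<zero>} \<subseteq> S}"
  "zero (free_module K S) = (\<lambda>_. \<zero>)"
  "add (free_module K S) = (\<lambda>\<phi> \<psi> s. \<phi> s \<oplus> \<psi> s)"
  "smult (free_module K S) = (\<lambda>c \<phi> s. c \<otimes> \<phi> s)"
  by (simp_all add: free_module_def)

lemma free_add_closed: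
  assumes "\<phi> \<in> carrier (free_module K S)" "\<psi> \<in> carrier (free_module K S)"
  shows "(\<lambda>s. \<phi> s \<oplus> \<psi> s) \<in> carrier (free_module K S)"
proof -
  have "{s. \<phi> s \<oplus> \<psi> s \<noteq> \<zero>} \<subseteq> {s. \<phi> s \<noteq> \<zero>} \<union> {s. \<psi> s \<noteq> \<zero>}" by auto
  then show ?thesis using assms unfolding free_module_simps by (auto intro: finite_subset)
qed

lemma free_smult_closed:
  assumes "\<phi> \<in> carrier (free_module K S)" "c \<in> carrier K"
  shows "(\<lambda>s. c \<otimes> \<phi> s) \<in> carrier (free_module K S)"
proof -
  have "{s. c \<otimes> \<phi> s \<noteq> \<zero>} \<subseteq> {s. \<phi> s \<noteq> \<zero>}" using assms(2) by auto
  then show ?thesis using assms unfolding free_module_simps by (auto intro: finite_subset)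
qed

lemma module_free: "module K (free_module K S)"
proof (rule moduleI)
  show "cring K" ..
  have cl: "\<phi> s \<in> carrier K" if "\<phi> \<in> carrier (free_module K S)" for \<phi> s
    using that by (simp add: free_module_simps)
  show "abelian_group (free_module K S)"
  proof (rule abelian_groupI)
    show "\<zero>\<^bsub>free_module K S\<^esub> \<in> carrier (free_module K S)" by (simp add: free_module_simps)
    fix \<phi> assume \<phi>: "\<phi> \<in> carrier (free_module K S)"
    show "\<exists>\<psi>\<in>carrier (free_module K S). \<psi> \<oplus>\<^bsub>free_module K S\<^esub> \<phi> = \<zero>\<^bsub>free_module K S\<^esub>"
      using free_smult_closed[OF \<phi>, of "\<ominus> \<one>"] cl[OF \<phi>]
      by (intro bexI[of _ "\<lambda>s. \<ominus> \<one> \<otimes> \<phi> s"]) (simp_all add: free_module_simps(2,3) l_minus l_neg)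
  qed (use cl free_add_closed in \<open>auto simp: free_module_simps(2,3) a_ac\<close>)
  show "c \<odot>\<^bsub>free_module K S\<^esub> \<phi> \<in> carrier (free_module K S)"
    if "c \<in> carrier K" "\<phi> \<in> carrier (free_module K S)" for c \<phi>
    using free_smult_closed[OF that(2,1)] by (simp add: free_module_simps(4))
qed (auto simp: free_module_simps l_distr r_distr m_assoc)

lemma free_gen_closed: "s \<in> S \<Longrightarrow> free_gen K s \<in> carrier (free_module K S)"
  by (auto simp: free_module_simps free_gen_def)

text \<open>Elements have finite support, and induction on the support splits off one generator at a
  time.\<close>

lemma free_submodule_eq:
  assumes N: "submodule N K (free_module K S)" and gen: "\<And>s. s \<in> S \<Longrightarrow> free_gen K s \<in> N"
  shows "carrier (free_module K S) \<subseteq> N"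
proof
  have R: "K \<in> {K, val_ring K}" by simp
  note n = submodule_zero[OF module_free R N] submodule_add[OF module_free R N]
    submodule_smult[OF module_free R N]
  have *: "\<phi> \<in> carrier (free_module K S) \<Longrightarrow> {s. \<phi> s \<noteq> \<zero>} = T \<Longrightarrow> \<phi> \<in> N" if "finite T" for \<phi> T
    using that
  proof (induction T arbitrary: \<phi>)
    case empty
    then have "\<phi> = (\<lambda>_. \<zero>)" by auto
    then show ?case using n(1) by (simp add: free_module_simps)
  next
    case (insert t T)
    let ?\<psi> = "\<lambda>s. if s = t then \<zero> else \<phi> s"
    have cl: "\<phi> s \<in> carrier K" for s using insert.prems by (simp add: free_module_simps)
    have supp: "{s. ?\<psi> s \<noteq> \<zero>} = T" using insert.prems(2) insert.hyps(2) by auto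
    have t: "t \<in> S" using insert.prems by (auto simp: free_module_simps)
    have "T \<subseteq> S" using insert.prems by (auto simp: free_module_simps)
    then have "?\<psi> \<in> carrier (free_module K S)"
      using supp insert.hyps(1) cl by (simp add: free_module_simps)
    then have \<psi>N: "?\<psi> \<in> N" using insert.IH supp by blast
    have "\<phi> = ?\<psi> \<oplus>\<^bsub>free_module K S\<^esub> (\<phi> t \<odot>\<^bsub>free_module K S\<^esub> free_gen K t)"
      using cl by (auto simp: free_module_simps free_gen_def)
    also have "\<dots> \<in> N" by (intro n(2) \<psi>N n(3) cl gen t)
    finally show ?case .
  qed
  fix \<phi> assume "\<phi> \<in> carrier (free_module K S)"
  then show "\<phi> \<in> N" using * by (auto simp: free_module_simps)
qed

lemma free_extend:
  assumes "module K W" and \<phi>: "\<And>s. s \<in> S \<Longrightarrow> \<phi> s \<in> carrier W"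
  obtains L where "linear_map K (free_module K S) W L" "\<And>s. s \<in> S \<Longrightarrow> L (free_gen K s) = \<phi> s"
proof -
  interpret W: module K W by fact
  define L where "L \<xi> = (\<Oplus>\<^bsub>W\<^esub>s\<in>{s. \<xi> s \<noteq> \<zero>}. \<xi> s \<odot>\<^bsub>W\<^esub> \<phi> s)" for \<xi>
  \<comment> \<open>The support changes under addition and scaling. Any finite superset inside
    \<open>S\<close> gives the same sum, so two elements can be expanded over a common index
    set.\<close>
  have L_eq: "L \<xi> = (\<Oplus>\<^bsub>W\<^esub>s\<in>T. \<xi> s \<odot>\<^bsub>W\<^esub> \<phi> s)"
    if "\<xi> \<in> carrier (free_module K S)" "finite T" "{s. \<xi> s \<noteq> \<zero>} \<subseteq> T" "T \<subseteq> S" for \<xi> T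
    unfolding L_def using that \<phi>
    by (intro W.M.add.finprod_mono_neutral_cong_left)
      (auto simp: free_module_simps subset_iff)
  have "linear_map K (free_module K S) W L"
  proof (rule linear_mapI)
    fix \<xi> assume \<xi>: "\<xi> \<in> carrier (free_module K S)"
    then have \<xi>c: "\<xi> s \<in> carrier K" for s by (simp add: free_module_simps)
    have \<xi>f: "finite {s. \<xi> s \<noteq> \<zero>}" "{s. \<xi> s \<noteq> \<zero>} \<subseteq> S" using \<xi> by (auto simp: free_module_simps)
    show "L \<xi> \<in> carrier W"
      unfolding L_def using \<xi>f \<xi>c \<phi> by (intro W.M.finsum_closed) auto
    show "L (\<xi> \<oplus>\<^bsub>free_module K S\<^esub> \<eta>) = L \<xi> \<oplus>\<^bsub>W\<^esub> L \<eta>" if \<eta>: "\<eta> \<in> carrier (free_module K S)" for \<eta>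
    proof -
      let ?T = "{s. \<xi> s \<noteq> \<zero>} \<union> {s. \<eta> s \<noteq> \<zero>}"
      have \<eta>c: "\<eta> s \<in> carrier K" for s using \<eta> by (simp add: free_module_simps)
      have T: "finite ?T" "?T \<subseteq> S" using \<xi>f \<eta> by (auto simp: free_module_simps)
      have "L (\<xi> \<oplus>\<^bsub>free_module K S\<^esub> \<eta>) = (\<Oplus>\<^bsub>W\<^esub>s\<in>?T. (\<xi> s \<oplus> \<eta> s) \<odot>\<^bsub>W\<^esub> \<phi> s)"
        unfolding free_module_simps(3)
        by (rule L_eq[OF free_add_closed[OF \<xi> \<eta>] T(1) _ T(2)]) auto
      also have "\<dots> = (\<Oplus>\<^bsub>W\<^esub>s\<in>?T. \<xi> s \<odot>\<^bsub>W\<^esub> \<phi> s \<oplus>\<^bsub>W\<^esub> \<eta> s \<odot>\<^bsub>W\<^esub> \<phi> s)"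
        using T(2) \<xi>c \<eta>c \<phi> by (intro W.M.add.finprod_cong') (auto simp: W.smult_l_distr subset_iff)
      also have "\<dots> = (\<Oplus>\<^bsub>W\<^esub>s\<in>?T. \<xi> s \<odot>\<^bsub>W\<^esub> \<phi> s) \<oplus>\<^bsub>W\<^esub> (\<Oplus>\<^bsub>W\<^esub>s\<in>?T. \<eta> s \<odot>\<^bsub>W\<^esub> \<phi> s)"
        using T(2) \<xi>c \<eta>c \<phi> by (intro W.M.finsum_addf) (auto simp: subset_iff)
      also have "\<dots> = L \<xi> \<oplus>\<^bsub>W\<^esub> L \<eta>"
        using L_eq[OF \<xi> T(1) _ T(2)] L_eq[OF \<eta> T(1) _ T(2)] by simp
      finally show ?thesis .
    qed
    show "L (c \<odot>\<^bsub>free_module K S\<^esub> \<xi>) = c \<odot>\<^bsub>W\<^esub> L \<xi>" if c: "c \<in> carrier K" for c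
    proof -
      let ?T = "{s. \<xi> s \<noteq> \<zero>}"
      have "L (c \<odot>\<^bsub>free_module K S\<^esub> \<xi>) = (\<Oplus>\<^bsub>W\<^esub>s\<in>?T. (c \<otimes> \<xi> s) \<odot>\<^bsub>W\<^esub> \<phi> s)"
        unfolding free_module_simps(4)
        by (rule L_eq[OF free_smult_closed[OF \<xi> c] \<xi>f(1) _ \<xi>f(2)]) (use c in auto)
      also have "\<dots> = (\<Oplus>\<^bsub>W\<^esub>s\<in>?T. c \<odot>\<^bsub>W\<^esub> (\<xi> s \<odot>\<^bsub>W\<^esub> \<phi> s))"
        using \<xi>f \<xi>c \<phi> c by (intro W.M.add.finprod_cong') (auto simp: W.smult_assoc1 subset_iff)
      also have "\<dots> = c \<odot>\<^bsub>W\<^esub> L \<xi>"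
        unfolding L_def using \<xi>f \<xi>c \<phi> c by (intro W.finsum_smult_ldistr[symmetric]) auto
      finally show ?thesis .
    qed
  qed
  moreover have "L (free_gen K s) = \<phi> s" if "s \<in> S" for s
  proof -
    have "L (free_gen K s) = (\<Oplus>\<^bsub>W\<^esub>t\<in>{s}. free_gen K s t \<odot>\<^bsub>W\<^esub> \<phi> t)"
      using that by (intro L_eq free_gen_closed) (auto simp: free_gen_def)
    also have "\<dots> = \<phi> s" using \<phi>[OF that] by (simp add: free_gen_def)
    finally show ?thesis .
  qed
  ultimately show ?thesis using that by blast
qed

text \<open>\<open>is_bornology\<close> tests the family it is given and ignores the bornology field
  of the record, so \<open>\<B>'\<close> and \<open>\<B>\<close> are independent.\<close>

lemma is_bornology_with_bornology:
  assumes "module K M"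
  shows "is_bornology K (with_bornology M \<B>') \<B> \<longleftrightarrow> is_bornology K M \<B>"
proof -
  have "submodule H (val_ring K) (with_bornology M \<B>') \<longleftrightarrow> submodule H (val_ring K) M" for H
    by (simp add: submodule_iff[OF assms] submodule_iff[OF module_with_bornology[OF assms]])
  then have "module_span (val_ring K) (with_bornology M \<B>') = module_span (val_ring K) M"
    by (simp add: module_span_def fun_eq_iff)
  then show ?thesis by (simp add: is_bornology_def)
qed

end

section \<open>Multilinear maps on tuples\<close>

lemma in_listset_iff: "xs \<in> listset As \<longleftrightarrow> list_all2 (\<in>) xs As"
proof (induction As arbitrary: xs)
  case (Cons A As)
  then show ?case by (cases xs) (auto simp: set_Cons_def)
qed simp

text \<open>Slots are addressed by list updates, exactly as in \<open>multilinear_relations\<close>,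
  so that each condition is the vanishing of the linear extension on one family of
  relations.\<close>

definition multilinear ::
    "'k valued_ring \<Rightarrow> ('k, 'v) born_space \<Rightarrow> nat \<Rightarrow> ('k, 'w, 'm) module_scheme \<Rightarrow> ('v list \<Rightarrow> 'w) \<Rightarrow> bool"
  where
  "multilinear K V n W F \<longleftrightarrow>
     (\<forall>xs\<in>tuples V n. F xs \<in> carrier W) \<and>
     (\<forall>xs\<in>tuples V n. \<forall>i<n. \<forall>a\<in>carrier V. \<forall>b\<in>carrier V.
        F (xs[i := a \<oplus>\<^bsub>V\<^esub> b]) = F (xs[i := a]) \<oplus>\<^bsub>W\<^esub> F (xs[i := b])) \<and>
     (\<forall>xs\<in>tuples V n. \<forall>i<n. \<forall>c\<in>carrier K. \<forall>a\<in>carrier V.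
        F (xs[i := c \<odot>\<^bsub>V\<^esub> a]) = c \<odot>\<^bsub>W\<^esub> F (xs[i := a]))"

text \<open>Boundedness is tested on products of bounded submodules because their images span the
  generators of the bornology on the tensor power.\<close>

definition bounded_multilinear ::
    "'k valued_ring \<Rightarrow> ('k, 'v) born_space \<Rightarrow> nat \<Rightarrow> ('k, 'w) born_space \<Rightarrow> ('v list \<Rightarrow> 'w) \<Rightarrow> bool"
  where
  "bounded_multilinear K V n W F \<longleftrightarrow>
     multilinear K V n W F \<and>
     (\<forall>Bs. length Bs = n \<and> set Bs \<subseteq> bounded_submodules K V \<longrightarrow> F ` listset Bs \<in> bornology W)"

lemma tuples_update: "xs \<in> tuples V n \<Longrightarrow> a \<in> carrier V \<Longrightarrow> xs[i := a] \<in> tuples V n"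
  unfolding tuples_def using set_update_subset_insert by fastforce

section \<open>The algebraic tensor power and its bornology\<close>

locale tensor_power_space = bornological K p V
  for K :: "'k valued_ring" (structure) and p and V :: "('k, 'v) born_space" +
  fixes n :: nat
begin

abbreviation "F \<equiv> free_module K (tuples V n)"

abbreviation "T \<equiv> algebraic_tensor_power K V n"

definition relations :: "('v list \<Rightarrow> 'k) set" where
  "relations = module_span K F (multilinear_relations K V n)"

sublocale Fm: module K F by (rule module_free)

lemma multilinear_relations_eq:
  "multilinear_relations K V n =
      {free_gen K (xs[i := a \<oplus>\<^bsub>V\<^esub> b]) \<ominus>\<^bsub>F\<^esub> (free_gen K (xs[i := a]) \<oplus>\<^bsub>F\<^esub> free_gen K (xs[i := b])) | xs i a b.
         xs \<in> tuples V n \<and> i < n \<and> a \<in> carrier V \<and> b \<in> carrier V} \<union>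
      {free_gen K (xs[i := c \<odot>\<^bsub>V\<^esub> a]) \<ominus>\<^bsub>F\<^esub> (c \<odot>\<^bsub>F\<^esub> free_gen K (xs[i := a])) | xs i c a.
         xs \<in> tuples V n \<and> i < n \<and> c \<in> carrier K \<and> a \<in> carrier V}"
  by (simp add: multilinear_relations_def Let_def)

lemma relations_subset: "multilinear_relations K V n \<subseteq> carrier F"
proof
  fix \<phi> assume "\<phi> \<in> multilinear_relations K V n"
  then show "\<phi> \<in> carrier F"
    unfolding multilinear_relations_eq
    by (elim UnE CollectE exE conjE) (simp_all add: free_gen_closed tuples_update)
qed

lemma submodule_relations: "submodule relations K F"
  unfolding relations_def by (rule submodule_span[OF module_free _ relations_subset]) simp

lemma relations_superset: "multilinear_relations K V n \<subseteq> relations"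
  unfolding relations_def by (rule span_superset[OF module_free _ relations_subset]) simp

sublocale R: module_quotient K F relations
  by (intro module_quotient.intro module_quotient_axioms.intro module_free submodule_relations)

lemma T_eq: "T = R.Q"
  by (simp add: algebraic_tensor_power_def relations_def Let_def)

lemma module_T: "module K T"
  unfolding T_eq by (rule R.module_Q)

lemma pure_tensor_eq: "xs \<in> tuples V n \<Longrightarrow> pure_tensor K V xs = relations +>\<^bsub>F\<^esub> free_gen K xs"
  by (simp add: pure_tensor_def relations_def tuples_def Let_def)

lemma multilinear_pure: "multilinear K V n T (pure_tensor K V)"
  unfolding multilinear_def
proof (intro conjI ballI allI impI)
  fix xs assume xs: "xs \<in> tuples V n"
  show "pure_tensor K V xs \<in> carrier T"
    unfolding pure_tensor_eq[OF xs] T_eq R.carrier_Q using free_gen_closed[OF xs] by blast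
  fix i assume i: "i < n"
  have g: "free_gen K (xs[i := a]) \<in> carrier F" if "a \<in> carrier V" for a
    using xs that free_gen_closed tuples_update by metis
  fix a assume a: "a \<in> carrier V"
  show "pure_tensor K V (xs[i := a \<oplus>\<^bsub>V\<^esub> b]) = pure_tensor K V (xs[i := a]) \<oplus>\<^bsub>T\<^esub> pure_tensor K V (xs[i := b])"
    if b: "b \<in> carrier V" for b
  proof -
    have "free_gen K (xs[i := a \<oplus>\<^bsub>V\<^esub> b]) \<ominus>\<^bsub>F\<^esub> (free_gen K (xs[i := a]) \<oplus>\<^bsub>F\<^esub> free_gen K (xs[i := b]))
        \<in> multilinear_relations K V n"
      unfolding multilinear_relations_eq using xs i a b by blast
    then have "relations +>\<^bsub>F\<^esub> free_gen K (xs[i := a \<oplus>\<^bsub>V\<^esub> b])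
        = relations +>\<^bsub>F\<^esub> (free_gen K (xs[i := a]) \<oplus>\<^bsub>F\<^esub> free_gen K (xs[i := b]))"
      using relations_superset g a b by (subst R.coset_eq_iff) auto
    then show ?thesis
      using xs a b g unfolding T_eq by (simp add: pure_tensor_eq tuples_update R.add_Q)
  qed
  show "pure_tensor K V (xs[i := c \<odot>\<^bsub>V\<^esub> a]) = c \<odot>\<^bsub>T\<^esub> pure_tensor K V (xs[i := a])"
    if c: "c \<in> carrier K" for c
  proof -
    have "free_gen K (xs[i := c \<odot>\<^bsub>V\<^esub> a]) \<ominus>\<^bsub>F\<^esub> (c \<odot>\<^bsub>F\<^esub> free_gen K (xs[i := a]))
        \<in> multilinear_relations K V n"
      unfolding multilinear_relations_eq using xs i a c by blast
    then have "relations +>\<^bsub>F\<^esub> free_gen K (xs[i := c \<odot>\<^bsub>V\<^esub> a])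
        = relations +>\<^bsub>F\<^esub> (c \<odot>\<^bsub>F\<^esub> free_gen K (xs[i := a]))"
      using relations_superset g a c by (subst R.coset_eq_iff) auto
    then show ?thesis
      using xs a c g unfolding T_eq by (simp add: pure_tensor_eq tuples_update R.smult_Q)
  qed
qed

lemma pure_closed: "xs \<in> tuples V n \<Longrightarrow> pure_tensor K V xs \<in> carrier T"
  using multilinear_pure unfolding multilinear_def by blast

text \<open>The preimage of \<open>N\<close> in the free module is a subspace containing the
  generators, hence everything. This is the induction principle that reduces statements about
  tensors to pure tensors.\<close>

lemma tensor_submodule_eq:
  assumes N: "submodule N K T" and pure: "\<And>xs. xs \<in> tuples V n \<Longrightarrow> pure_tensor K V xs \<in> N"
  shows "carrier T \<subseteq> N"
proof -
  have "submodule {\<phi> \<in> carrier F. relations +>\<^bsub>F\<^esub> \<phi> \<in> N} K F"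
    using N unfolding T_eq
    by (intro submodule_vimage[OF module_free R.module_Q _ R.linear_coset]) simp_all
  moreover have "free_gen K xs \<in> {\<phi> \<in> carrier F. relations +>\<^bsub>F\<^esub> \<phi> \<in> N}" if "xs \<in> tuples V n" for xs
    using pure[OF that] free_gen_closed[OF that] pure_tensor_eq[OF that] by simp
  ultimately have "carrier F \<subseteq> {\<phi> \<in> carrier F. relations +>\<^bsub>F\<^esub> \<phi> \<in> N}"
    by (rule free_submodule_eq)
  then show ?thesis unfolding T_eq R.carrier_Q by blast
qed

lemma tensor_unique:
  assumes "module K W" "linear_map K T W f" "linear_map K T W g"
    "\<And>xs. xs \<in> tuples V n \<Longrightarrow> f (pure_tensor K V xs) = g (pure_tensor K V xs)" "x \<in> carrier T"
  shows "f x = g x"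
proof -
  interpret W: module K W by fact
  interpret T: module K T by (rule module_T)
  have "submodule {x \<in> carrier T. f x = g x} K T"
    using assms(2,3)
    by (subst submodule_iff[OF module_T])
      (auto simp: linear_map_def linear_map_zero[OF _ module_T assms(1)])
  then have "carrier T \<subseteq> {x \<in> carrier T. f x = g x}"
    by (rule tensor_submodule_eq) (use assms(4) pure_closed in blast)
  then show ?thesis using assms(5) by blast
qed

lemma tensor_extend:
  assumes W: "module K W" and f: "multilinear K V n W f"
  obtains L where "linear_map K T W L" "\<And>xs. xs \<in> tuples V n \<Longrightarrow> L (pure_tensor K V xs) = f xs"
proof -
  interpret W: module K W by fact
  have fc: "f xs \<in> carrier W" if "xs \<in> tuples V n" for xs
    using f that unfolding multilinear_def by blast
  obtain L where L: "linear_map K F W L" "\<And>xs. xs \<in> tuples V n \<Longrightarrow> L (free_gen K xs) = f xs"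
    using free_extend[of W "tuples V n" f] W fc by blast
  note Lm = linear_map_minus[OF L(1) module_free W] linear_map_add[OF L(1)] linear_map_smult[OF L(1)]
  \<comment> \<open>The kernel of the linear extension is a subspace, so it contains all relations
    as soon as it contains the two generating families.\<close>
  have sub: "submodule {\<phi> \<in> carrier F. L \<phi> \<in> {\<zero>\<^bsub>W\<^esub>}} K F"
    by (rule submodule_vimage[OF module_free W _ L(1)]) (simp_all add: submodule_iff[OF W])
  have "multilinear_relations K V n \<subseteq> {\<phi> \<in> carrier F. L \<phi> \<in> {\<zero>\<^bsub>W\<^esub>}}"
  proof
    fix \<phi> assume \<phi>: "\<phi> \<in> multilinear_relations K V n"
    have "L \<phi> = \<zero>\<^bsub>W\<^esub>"
      using \<phi> unfolding multilinear_relations_eq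
    proof (elim UnE CollectE exE conjE)
      fix xs i a b assume e: "\<phi> = free_gen K (xs[i := a \<oplus>\<^bsub>V\<^esub> b]) \<ominus>\<^bsub>F\<^esub> (free_gen K (xs[i := a]) \<oplus>\<^bsub>F\<^esub> free_gen K (xs[i := b]))"
        and x: "xs \<in> tuples V n" "i < n" "a \<in> carrier V" "b \<in> carrier V"
      have u: "xs[i := a \<oplus>\<^bsub>V\<^esub> b] \<in> tuples V n" "xs[i := a] \<in> tuples V n" "xs[i := b] \<in> tuples V n"
        using x by (simp_all add: tuples_update)
      then have "L \<phi> = f (xs[i := a \<oplus>\<^bsub>V\<^esub> b]) \<ominus>\<^bsub>W\<^esub> (f (xs[i := a]) \<oplus>\<^bsub>W\<^esub> f (xs[i := b]))"
        unfolding e by (simp add: Lm free_gen_closed L(2))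
      also have "f (xs[i := a \<oplus>\<^bsub>V\<^esub> b]) = f (xs[i := a]) \<oplus>\<^bsub>W\<^esub> f (xs[i := b])"
        using f x unfolding multilinear_def by blast
      finally show ?thesis using fc u by (simp add: W.M.minus_eq_zero_iff)
    next
      fix xs i c a assume e: "\<phi> = free_gen K (xs[i := c \<odot>\<^bsub>V\<^esub> a]) \<ominus>\<^bsub>F\<^esub> (c \<odot>\<^bsub>F\<^esub> free_gen K (xs[i := a]))"
        and x: "xs \<in> tuples V n" "i < n" "c \<in> carrier K" "a \<in> carrier V"
      have u: "xs[i := c \<odot>\<^bsub>V\<^esub> a] \<in> tuples V n" "xs[i := a] \<in> tuples V n"
        using x by (simp_all add: tuples_update)
      then have "L \<phi> = f (xs[i := c \<odot>\<^bsub>V\<^esub> a]) \<ominus>\<^bsub>W\<^esub> (c \<odot>\<^bsub>W\<^esub> f (xs[i := a]))"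
        unfolding e using x(3) by (simp add: Lm free_gen_closed L(2))
      also have "f (xs[i := c \<odot>\<^bsub>V\<^esub> a]) = c \<odot>\<^bsub>W\<^esub> f (xs[i := a])"
        using f x unfolding multilinear_def by blast
      finally show ?thesis using fc u x(3) by (simp add: W.M.minus_eq_zero_iff)
    qed
    then show "\<phi> \<in> {\<phi> \<in> carrier F. L \<phi> \<in> {\<zero>\<^bsub>W\<^esub>}}" using \<phi> relations_subset by blast
  qed
  then have "relations \<subseteq> {\<phi> \<in> carrier F. L \<phi> \<in> {\<zero>\<^bsub>W\<^esub>}}"
    unfolding relations_def by (rule span_least[OF sub])
  then have ker: "\<And>\<phi>. \<phi> \<in> relations \<Longrightarrow> L \<phi> = \<zero>\<^bsub>W\<^esub>" by blast
  obtain G where G: "linear_map K R.Q W G" "\<And>\<phi>. \<phi> \<in> carrier F \<Longrightarrow> G (relations +>\<^bsub>F\<^esub> \<phi>) = L \<phi>"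
    using R.descend[OF L(1) W ker] by blast
  show ?thesis
  proof (rule that)
    show "linear_map K T W G" using G(1) by (simp add: T_eq)
    show "G (pure_tensor K V xs) = f xs" if "xs \<in> tuples V n" for xs
      using G(2)[OF free_gen_closed[OF that]] L(2)[OF that] pure_tensor_eq[OF that] by simp
  qed
qed

abbreviation "TP \<equiv> tensor_power K V n"

definition generators :: "('v list \<Rightarrow> 'k) set set set" where
  "generators = {module_span (val_ring K) T (pure_tensor K V ` listset Bs) | Bs.
           length Bs = n \<and> set Bs \<subseteq> bounded_submodules K V}"

lemma TP_eq: "TP = with_bornology T (generated_bornology K T generators)"
  by (simp add: tensor_power_def Let_def generators_def)

lemma listset_subset_tuples:
  assumes "length Bs = n" "set Bs \<subseteq> bounded_submodules K V"
  shows "listset Bs \<subseteq> tuples V n"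
proof
  fix xs assume "xs \<in> listset Bs"
  then have xs: "list_all2 (\<in>) xs Bs" by (simp add: in_listset_iff)
  have "x \<in> carrier V" if x: "x \<in> set xs" for x
  proof -
    obtain i where i: "i < length xs" "x = xs ! i" using x by (metis in_set_conv_nth)
    then have "xs ! i \<in> Bs ! i" "Bs ! i \<in> set Bs" using xs by (auto simp: list_all2_conv_all_nth)
    then show ?thesis using assms(2) bsub_subset i by blast
  qed
  then show "xs \<in> tuples V n" using xs assms(1) by (auto simp: tuples_def dest: list_all2_lengthD)
qed

text \<open>Each entry lies in the bounded submodule spanned by itself, so a single pure tensor
  always lies in one of the boxes on which boundedness is tested.\<close>

lemma tuple_in_listset:
  assumes "xs \<in> tuples V n"
  obtains Bs where "length Bs = n" "set Bs \<subseteq> bounded_submodules K V" "xs \<in> listset Bs"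
proof (rule that[of "map (\<lambda>x. module_span (val_ring K) V {x}) xs"])
  have c: "x \<in> carrier V" if "x \<in> set xs" for x using assms that by (auto simp: tuples_def)
  show "length (map (\<lambda>x. module_span (val_ring K) V {x}) xs) = n" using assms by (simp add: tuples_def)
  show "set (map (\<lambda>x. module_span (val_ring K) V {x}) xs) \<subseteq> bounded_submodules K V"
    using bsub_span[OF bounded_singleton[OF c]] by auto
  show "xs \<in> listset (map (\<lambda>x. module_span (val_ring K) V {x}) xs)"
    using span_superset[OF module_V, of "val_ring K" "{x}" for x] c
    by (auto simp: in_listset_iff list_all2_conv_all_nth)
qed

lemma pure_listset_subset:
  assumes "length Bs = n" "set Bs \<subseteq> bounded_submodules K V"
  shows "pure_tensor K V ` listset Bs \<subseteq> carrier T"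
  using listset_subset_tuples[OF assms] pure_closed by blast

lemma generators_subset: "generators \<subseteq> Pow (carrier T)"
proof
  fix X assume "X \<in> generators"
  then obtain Bs where Bs: "length Bs = n" "set Bs \<subseteq> bounded_submodules K V"
    "X = module_span (val_ring K) T (pure_tensor K V ` listset Bs)"
    unfolding generators_def by blast
  have "submodule X (val_ring K) T"
    unfolding Bs(3) by (rule submodule_span[OF module_T _ pure_listset_subset[OF Bs(1,2)]]) simp
  then show "X \<in> Pow (carrier T)" using submodule_subset[OF module_T] by blast
qed

lemma bornological_TP: "bornological K p TP"
proof (intro bornological.intro bornological_axioms.intro)
  show "mixed_char_complete_field K p" by (rule mixed_char_complete_field_axioms)
  show "module K TP" unfolding TP_eq by (rule module_with_bornology[OF module_T])
  show "is_bornology K TP (bornology TP)"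
    unfolding TP_eq
    using is_bornology_generated[OF module_T generators_subset]
    by (simp add: is_bornology_with_bornology[OF module_T])
qed

lemma pure_listset_bounded:
  assumes "length Bs = n" "set Bs \<subseteq> bounded_submodules K V"
  shows "pure_tensor K V ` listset Bs \<in> bornology TP"
proof -
  interpret TP: bornological K p TP by (rule bornological_TP)
  let ?S = "module_span (val_ring K) T (pure_tensor K V ` listset Bs)"
  have "?S \<in> generators" unfolding generators_def using assms by blast
  then have "?S \<in> bornology TP"
    using generated_superset[OF module_T generators_subset] by (simp add: TP_eq subset_iff)
  then show ?thesis
    by (rule TP.bounded_mono[OF _ span_superset[OF module_T _ pure_listset_subset[OF assms]]]) simp
qed

lemma carrier_TP: "carrier TP = carrier T"
  by (simp add: TP_eq)

lemma linear_map_TP_iff: "linear_map K TP W f \<longleftrightarrow> linear_map K T W f"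
  by (simp add: TP_eq)

text \<open>A generated bornology gives no description of its members. The sets on which
  \<open>U\<close> is equibounded are therefore shown to form a bornology containing the generators,
  and minimality does the rest. A one-element \<open>U\<close> gives the boundedness of a single
  map.\<close>

lemma tensor_equibounded:
  assumes W: "bornological K p W"
    and U: "\<And>f. f \<in> U \<Longrightarrow> linear_map K T W f"
    and bdd: "\<And>Bs. length Bs = n \<Longrightarrow> set Bs \<subseteq> bounded_submodules K V \<Longrightarrow>
       (\<Union>f\<in>U. f ` pure_tensor K V ` listset Bs) \<in> bornology W"
    and S: "S \<in> bornology TP"
  shows "(\<Union>f\<in>U. f ` S) \<in> bornology W"
proof -
  interpret W: bornological K p W by (rule W)
  interpret T: module K T by (rule module_T)
  let ?\<B> = "{S. S \<subseteq> carrier T \<and> (\<Union>f\<in>U. f ` S) \<in> bornology W}"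
  \<comment> \<open>Linear maps send a span into the span of the image, and the span of the bounded
    union on the right is bounded and independent of \<open>f\<close>.\<close>
  have span: "module_span (val_ring K) T S \<in> ?\<B>" if SB: "S \<subseteq> carrier T" "(\<Union>f\<in>U. f ` S) \<in> bornology W" for S
  proof -
    have sub: "submodule (module_span (val_ring K) T S) (val_ring K) T"
      by (rule submodule_span[OF module_T _ SB(1)]) simp
    let ?M = "module_span (val_ring K) W (\<Union>f\<in>U. f ` S)"
    have "f ` module_span (val_ring K) T S \<subseteq> ?M" if f: "f \<in> U" for f
    proof -
      have "module_span (val_ring K) T S \<subseteq> {x \<in> carrier T. f x \<in> ?M}"
      proof (rule span_least)
        show "submodule {x \<in> carrier T. f x \<in> ?M} (val_ring K) T"
          by (rule submodule_vimage[OF module_T W.module_V _ U[OF f]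
                submodule_span[OF W.module_V _ W.bounded_subset_carrier[OF SB(2)]]]) simp_all
        have "(\<Union>f\<in>U. f ` S) \<subseteq> ?M"
          by (rule span_superset[OF W.module_V _ W.bounded_subset_carrier[OF SB(2)]]) simp
        then show "S \<subseteq> {x \<in> carrier T. f x \<in> ?M}" using f SB(1) by blast
      qed
      then show ?thesis by blast
    qed
    then have "(\<Union>f\<in>U. f ` module_span (val_ring K) T S) \<subseteq> ?M" by (rule UN_least)
    then have "(\<Union>f\<in>U. f ` module_span (val_ring K) T S) \<in> bornology W"
      by (rule W.bounded_mono[OF W.bounded_span[OF SB(2)]])
    then show ?thesis using submodule_subset[OF module_T _ sub] by simp
  qed
  have "is_bornology K T ?\<B>"
  proof (rule is_bornologyI)
    fix x assume x: "x \<in> carrier T"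
    let ?N = "{x \<in> carrier T. (\<lambda>f. f x) ` U \<in> bornology W}"
    \<comment> \<open>Boundedness at a single point is given only for pure tensors. It is stable
      under sums and scalars, so the points where it holds form a subspace and exhaust the tensor
      power.\<close>
    have "carrier T \<subseteq> ?N"
    proof (rule tensor_submodule_eq)
      have z: "(\<lambda>f. f \<zero>\<^bsub>T\<^esub>) ` U \<in> bornology W"
        using linear_map_zero[OF U module_T W.module_V]
        by (intro W.bounded_mono[OF W.bounded_singleton[OF W.M.zero_closed]]) auto
      have a: "(\<lambda>f. f (x \<oplus>\<^bsub>T\<^esub> y)) ` U \<in> bornology W" if "x \<in> ?N" "y \<in> ?N" for x y
      proof (rule W.bounded_mono[OF W.bounded_sum])
        show "(\<lambda>f. f x) ` U \<in> bornology W" "(\<lambda>f. f y) ` U \<in> bornology W" using that by auto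
        show "(\<lambda>f. f (x \<oplus>\<^bsub>T\<^esub> y)) ` U \<subseteq> {a \<oplus>\<^bsub>W\<^esub> b |a b. a \<in> (\<lambda>f. f x) ` U \<and> b \<in> (\<lambda>f. f y) ` U}"
          using linear_map_add[OF U] that by blast
      qed
      have s: "(\<lambda>f. f (c \<odot>\<^bsub>T\<^esub> x)) ` U \<in> bornology W" if "x \<in> ?N" "c \<in> carrier K" for c x
      proof (rule W.bounded_mono[OF W.bounded_scale[OF that(2)]])
        show "(\<lambda>f. f x) ` U \<in> bornology W" using that by auto
        show "(\<lambda>f. f (c \<odot>\<^bsub>T\<^esub> x)) ` U \<subseteq> (\<lambda>x. c \<odot>\<^bsub>W\<^esub> x) ` (\<lambda>f. f x) ` U"
          using linear_map_smult[OF U] that by blast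
      qed
      show "submodule ?N K T"
        by (subst submodule_iff[OF module_T]) (use z a s in auto)
      fix xs assume xs: "xs \<in> tuples V n"
      obtain Bs where Bs: "length Bs = n" "set Bs \<subseteq> bounded_submodules K V" "xs \<in> listset Bs"
        using xs by (rule tuple_in_listset)
      have "(\<lambda>f. f (pure_tensor K V xs)) ` U \<in> bornology W"
        by (rule W.bounded_mono[OF bdd[OF Bs(1,2)]]) (use Bs(3) in blast)
      then show "pure_tensor K V xs \<in> ?N" using pure_closed[OF xs] by blast
    qed
    then have "(\<lambda>f. f x) ` U \<in> bornology W" using x by blast
    moreover have "(\<Union>f\<in>U. f ` {x}) = (\<lambda>f. f x) ` U" by blast
    ultimately show "{x} \<in> ?\<B>" using x by simp
  next
    fix B B' assume B: "B \<in> ?\<B>" and B': "B' \<subseteq> B"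
    have "(\<Union>f\<in>U. f ` B') \<subseteq> (\<Union>f\<in>U. f ` B)" using B' by blast
    then show "B' \<in> ?\<B>" using B B' W.bounded_mono by auto
  next
    fix B B' assume BB': "B \<in> ?\<B>" "B' \<in> ?\<B>"
    have "(\<Union>f\<in>U. f ` (B \<union> B')) = (\<Union>f\<in>U. f ` B) \<union> (\<Union>f\<in>U. f ` B')" by blast
    then show "B \<union> B' \<in> ?\<B>" using BB' W.bounded_Un by simp
  next
    fix c B assume c: "c \<in> carrier K" and B: "B \<in> ?\<B>"
    have "(\<Union>f\<in>U. f ` (\<lambda>x. c \<odot>\<^bsub>T\<^esub> x) ` B) \<subseteq> (\<lambda>x. c \<odot>\<^bsub>W\<^esub> x) ` (\<Union>f\<in>U. f ` B)"
      using linear_map_smult[OF U c] B by blast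
    then have "(\<Union>f\<in>U. f ` (\<lambda>x. c \<odot>\<^bsub>T\<^esub> x) ` B) \<in> bornology W"
      using W.bounded_mono[OF W.bounded_scale[OF c]] B by blast
    then show "(\<lambda>x. c \<odot>\<^bsub>T\<^esub> x) ` B \<in> ?\<B>" using B c by auto
  qed (use span in auto)
  moreover have "generators \<subseteq> ?\<B>"
  proof
    fix X assume "X \<in> generators"
    then obtain Bs where Bs: "length Bs = n" "set Bs \<subseteq> bounded_submodules K V"
      "X = module_span (val_ring K) T (pure_tensor K V ` listset Bs)"
      unfolding generators_def by blast
    show "X \<in> ?\<B>" unfolding Bs(3) by (rule span[OF pure_listset_subset[OF Bs(1,2)] bdd[OF Bs(1,2)]])
  qed
  ultimately have "generated_bornology K T generators \<subseteq> ?\<B>" by (rule generated_least)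
  then show ?thesis using S by (simp add: TP_eq subset_iff)
qed

end

section \<open>Bounded maps on completed tensor powers as bounded multilinear maps\<close>

locale tensor_power_complete_pair = tensor_power_space K p V n + W: complete_bornological_space K p W
  for K :: "'k valued_ring" (structure) and p and V :: "('k, 'v) born_space" and n
    and W :: "('k, 'w) born_space"
begin

sublocale CT: bornological_complete_pair K p TP W
  by (intro bornological_complete_pair.intro bornological_TP W.complete_bornological_space_axioms)

abbreviation "H \<equiv> hom_space K (completed_tensor_power K V n) W"

lemma H_carrier:
  "f \<in> carrier H \<longleftrightarrow> bounded_linear_map K (completion K TP) W f \<and> f \<in> extensional (carrier (completion K TP))"
  by (simp add: hom_space_simps completed_tensor_power_def)

lemma ctensor_eq: "xs \<in> tuples V n \<Longrightarrow> ctensor K V xs = to_completion K TP (pure_tensor K V xs)"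
  by (simp add: ctensor_def tuples_def)

lemma hom_space_linear_TP:
  assumes "f \<in> carrier H"
  shows "bounded_linear_map K TP W (\<lambda>x. f (to_completion K TP x))"
  using assms by (intro bounded_linear_map_comp[OF CT.bounded_linear_to_completion]) (simp add: H_carrier)

lemma bounded_multilinear_restrict:
  assumes f: "f \<in> carrier H"
  shows "bounded_multilinear K V n W (\<lambda>xs. f (ctensor K V xs))"
proof -
  let ?g = "\<lambda>x. f (to_completion K TP x)"
  have g: "linear_map K T W ?g"
    using bounded_linear_map_linear[OF hom_space_linear_TP[OF f]] by (simp add: linear_map_TP_iff)
  note gl = linear_map_closed[OF g] linear_map_add[OF g] linear_map_smult[OF g]
  have pa: "pure_tensor K V (xs[i := a \<oplus>\<^bsub>V\<^esub> b]) = pure_tensor K V (xs[i := a]) \<oplus>\<^bsub>T\<^esub> pure_tensor K V (xs[i := b])"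
    if "xs \<in> tuples V n" "i < n" "a \<in> carrier V" "b \<in> carrier V" for xs i a b
    using multilinear_pure that unfolding multilinear_def by blast
  have ps: "pure_tensor K V (xs[i := c \<odot>\<^bsub>V\<^esub> a]) = c \<odot>\<^bsub>T\<^esub> pure_tensor K V (xs[i := a])"
    if "xs \<in> tuples V n" "i < n" "a \<in> carrier V" "c \<in> carrier K" for xs i a c
    using multilinear_pure that unfolding multilinear_def by blast
  show ?thesis
    unfolding bounded_multilinear_def multilinear_def
  proof (intro conjI ballI allI impI)
    fix Bs assume Bs: "length Bs = n \<and> set Bs \<subseteq> bounded_submodules K V"
    have "(\<lambda>xs. f (ctensor K V xs)) ` listset Bs = ?g ` pure_tensor K V ` listset Bs"
      unfolding image_image using listset_subset_tuples[of Bs] Bs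
      by (intro image_cong refl) (simp add: ctensor_eq subset_iff)
    then show "(\<lambda>xs. f (ctensor K V xs)) ` listset Bs \<in> bornology W"
      using bounded_linear_map_bounded[OF hom_space_linear_TP[OF f] pure_listset_bounded] Bs by simp
  qed (use gl pa ps pure_closed in \<open>simp_all add: ctensor_eq tuples_update\<close>)
qed

lemma ctensor_closed: "xs \<in> tuples V n \<Longrightarrow> ctensor K V xs \<in> carrier (completed_tensor_power K V n)"
  using pure_closed CT.to_completion_closed carrier_TP
  by (simp add: ctensor_eq completed_tensor_power_def)

lemma module_completed: "module K (completed_tensor_power K V n)"
  unfolding completed_tensor_power_def by (rule CT.module_completion)

text \<open>Elements of \<open>hom_space\<close> are extensional, so an arbitrary bounded map has to
  be cut down to the carrier. This leaves images of bounded sets alone, as these lie in the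
  carrier.\<close>

lemma hom_space_restrict:
  assumes g: "bounded_linear_map K (completed_tensor_power K V n) W g"
  shows "restrict g (carrier (completed_tensor_power K V n)) \<in> carrier H"
proof -
  let ?C = "completion K TP"
  define f where "f = restrict g (carrier ?C)"
  have g: "bounded_linear_map K ?C W g" using g by (simp add: completed_tensor_power_def)
  have "bounded_linear_map K ?C W f"
  proof (rule bounded_linear_mapI)
    show "linear_map K ?C W f"
      by (rule linear_map_cong[OF bounded_linear_map_linear[OF g] _ CT.module_completion])
        (simp add: f_def)
    fix X assume X: "X \<in> bornology ?C"
    then have "X \<subseteq> carrier ?C"
      unfolding CT.completion_simps CT.cauchy_space_simps by blast
    then have "f ` X = g ` X" unfolding f_def by (intro image_cong) auto
    then show "f ` X \<in> bornology W" using bounded_linear_map_bounded[OF g X] by simp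
  qed
  then show ?thesis by (subst H_carrier) (simp add: f_def completed_tensor_power_def)
qed

lemma hom_space_extend:
  assumes F: "bounded_multilinear K V n W G"
  obtains f where "f \<in> carrier H" "\<forall>xs\<in>tuples V n. f (ctensor K V xs) = G xs"
proof -
  obtain L where L: "linear_map K T W L" "\<And>xs. xs \<in> tuples V n \<Longrightarrow> L (pure_tensor K V xs) = G xs"
    using tensor_extend[OF W.module_V] F unfolding bounded_multilinear_def by blast
  have img: "L ` pure_tensor K V ` listset Bs = G ` listset Bs"
    if "length Bs = n" "set Bs \<subseteq> bounded_submodules K V" for Bs
    unfolding image_image using listset_subset_tuples[OF that] L(2) by (intro image_cong) auto
  have "bounded_linear_map K TP W L"
  proof (rule bounded_linear_mapI)
    show "linear_map K TP W L" using L(1) by (simp add: linear_map_TP_iff)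
    fix S assume S: "S \<in> bornology TP"
    \<comment> \<open>Boundedness of \<open>L\<close> is the equiboundedness of the family
      consisting of \<open>L\<close> alone.\<close>
    have "(\<Union>f\<in>{L}. f ` S) \<in> bornology W"
    proof (rule tensor_equibounded[OF W.bornological_axioms _ _ S])
      show "(\<Union>f\<in>{L}. f ` pure_tensor K V ` listset Bs) \<in> bornology W"
        if "length Bs = n" "set Bs \<subseteq> bounded_submodules K V" for Bs
        using F img[OF that] that unfolding bounded_multilinear_def by simp
    qed (use L(1) in simp)
    then show "L ` S \<in> bornology W" by simp
  qed
  then obtain g where g: "bounded_linear_map K (completion K TP) W g"
    "\<And>v. v \<in> carrier TP \<Longrightarrow> g (to_completion K TP v) = L v"
    using CT.completion_extend by blast
  let ?C = "completion K TP"
  define f where "f = restrict g (carrier ?C)"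
  have "f \<in> carrier H"
    unfolding f_def using hom_space_restrict g(1) by (simp add: completed_tensor_power_def)
  moreover have "f (ctensor K V xs) = G xs" if "xs \<in> tuples V n" for xs
    using that g(2) L(2) pure_closed CT.to_completion_closed carrier_TP
    by (simp add: ctensor_eq f_def)
  ultimately show ?thesis using that by blast
qed

text \<open>Pure tensors span the algebraic tensor power, and the constant sequences from it
  determine a bounded map on the completion. This supplies the uniqueness required by the definite
  description in \<open>differential\<close>.\<close>

lemma hom_space_eqI:
  assumes f: "f \<in> carrier H" and g: "g \<in> carrier H"
    and eq: "\<And>xs. xs \<in> tuples V n \<Longrightarrow> f (ctensor K V xs) = g (ctensor K V xs)"
  shows "f = g"
proof -
  note fg = hom_space_linear_TP[OF f, THEN bounded_linear_map_linear, unfolded linear_map_TP_iff]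
    hom_space_linear_TP[OF g, THEN bounded_linear_map_linear, unfolded linear_map_TP_iff]
  have "f (to_completion K TP v) = g (to_completion K TP v)" if "v \<in> carrier TP" for v
    using tensor_unique[OF W.module_V fg, of v] eq ctensor_eq that by (simp add: carrier_TP)
  then have "f X = g X" if "X \<in> carrier (completion K TP)" for X
    using CT.completion_unique[of f g X] f g that by (simp add: H_carrier)
  then show ?thesis using f g by (intro extensionalityI) (auto simp: H_carrier)
qed

text \<open>The definition of the left side quantifies over bounded sets of the completion. The
  criterion replaces them by boxes of tuples, in two stages: constant sequences control the
  completion, pure tensors control the tensor power.\<close>

lemma hom_space_bounded_iff:
  "U \<in> bornology H \<longleftrightarrow> U \<subseteq> carrier H \<and>
    (\<forall>Bs. length Bs = n \<and> set Bs \<subseteq> bounded_submodules K V \<longrightarrow>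
       (\<Union>f\<in>U. (\<lambda>xs. f (ctensor K V xs)) ` listset Bs) \<in> bornology W)"
proof -
  have img: "(\<Union>f\<in>U. (\<lambda>xs. f (ctensor K V xs)) ` listset Bs)
      = (\<Union>f\<in>U. (\<lambda>v. f (to_completion K TP v)) ` pure_tensor K V ` listset Bs)"
    if "length Bs = n \<and> set Bs \<subseteq> bounded_submodules K V" for Bs
    unfolding image_image using listset_subset_tuples[of Bs] that
    by (intro SUP_cong refl image_cong) (simp add: ctensor_eq subset_iff)
  show ?thesis
  proof (intro iffI conjI allI impI)
    assume U: "U \<in> bornology H"
    then show "U \<subseteq> carrier H" by (simp add: hom_space_simps)
    fix Bs assume Bs: "length Bs = n \<and> set Bs \<subseteq> bounded_submodules K V"
    have "to_completion K TP ` pure_tensor K V ` listset Bs \<in> bornology (completion K TP)"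
      using bounded_linear_map_bounded[OF CT.bounded_linear_to_completion pure_listset_bounded] Bs by simp
    then have "(\<Union>f\<in>U. f ` to_completion K TP ` pure_tensor K V ` listset Bs) \<in> bornology W"
      using U by (simp add: hom_space_simps completed_tensor_power_def)
    then show "(\<Union>f\<in>U. (\<lambda>xs. f (ctensor K V xs)) ` listset Bs) \<in> bornology W"
      unfolding img[OF Bs] by (simp add: image_image)
  next
    assume U: "U \<subseteq> carrier H \<and>
    (\<forall>Bs. length Bs = n \<and> set Bs \<subseteq> bounded_submodules K V \<longrightarrow>
       (\<Union>f\<in>U. (\<lambda>xs. f (ctensor K V xs)) ` listset Bs) \<in> bornology W)"
    have "(\<Union>f\<in>U. f ` X) \<in> bornology W" if X: "X \<in> bornology (completion K TP)" for X
    proof (rule CT.completion_equibounded[OF _ _ X])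
      show "bounded_linear_map K (completion K TP) W f" if "f \<in> U" for f
        using U that H_carrier by blast
      fix B assume B: "B \<in> bornology TP"
      \<comment> \<open>The family is replaced by its restrictions to the uncompleted tensor power,
        where the generators of the bornology are available.\<close>
      have "(\<Union>h\<in>(\<lambda>f v. f (to_completion K TP v)) ` U. h ` B) \<in> bornology W"
      proof (rule tensor_equibounded[OF W.bornological_axioms _ _ B])
        show "linear_map K T W h" if "h \<in> (\<lambda>f v. f (to_completion K TP v)) ` U" for h
          using that U hom_space_linear_TP bounded_linear_map_linear linear_map_TP_iff by blast
        show "(\<Union>h\<in>(\<lambda>f v. f (to_completion K TP v)) ` U. h ` pure_tensor K V ` listset Bs) \<in> bornology W"
          if "length Bs = n" "set Bs \<subseteq> bounded_submodules K V" for Bs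
        proof -
          have "(\<Union>f\<in>U. (\<lambda>xs. f (ctensor K V xs)) ` listset Bs) \<in> bornology W"
            using U that by blast
          then show ?thesis using img[of Bs] that by simp
        qed
      qed
      then show "(\<Union>f\<in>U. (\<lambda>v. f (to_completion K TP v)) ` B) \<in> bornology W" by simp
    qed
    then show "U \<in> bornology H" using U by (simp add: hom_space_simps completed_tensor_power_def)
  qed
qed

end

section \<open>The Hochschild complex\<close>

context bornological
begin

text \<open>That bounded sets of \<open>C\<close> lie in its carrier is needed because sums and
  multiples in the hom space are pointwise only there and are \<open>undefined\<close>
  elsewhere.\<close>

lemma module_hom_space:
  assumes C: "module K C" and bounded_subset: "\<And>B. B \<in> bornology C \<Longrightarrow> B \<subseteq> carrier C"
  shows "module K (hom_space K C V)"
proof -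
  interpret C: module K C by (rule C)
  let ?H = "hom_space K C V"
  have mem: "f \<in> carrier ?H \<longleftrightarrow> bounded_linear_map K C V f \<and> f \<in> extensional (carrier C)" for f
    by (simp add: hom_space_simps)
  have lin: "linear_map K C V f" if "f \<in> carrier ?H" for f
    using that bounded_linear_map_linear by (auto simp: mem)
  note cl = linear_map_closed[OF lin] and ad = linear_map_add[OF lin] and sm = linear_map_smult[OF lin]
  have ext: "f = g" if "f \<in> carrier ?H" "g \<in> extensional (carrier C)" "\<And>x. x \<in> carrier C \<Longrightarrow> f x = g x" for f g
    using that by (intro extensionalityI[where A = "carrier C"]) (auto simp: mem)
  have add_closed: "f \<oplus>\<^bsub>?H\<^esub> g \<in> carrier ?H" if f: "f \<in> carrier ?H" and g: "g \<in> carrier ?H" for f g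
    unfolding mem
  proof (intro conjI bounded_linear_mapI)
    show "linear_map K C V (f \<oplus>\<^bsub>?H\<^esub> g)"
      by (rule linear_mapI)
        (auto simp: hom_space_simps(2) cl[OF f] cl[OF g] ad[OF f] ad[OF g] sm[OF f] sm[OF g] M.a_ac smult_r_distr)
    fix B assume B: "B \<in> bornology C"
    have "(f \<oplus>\<^bsub>?H\<^esub> g) ` B \<subseteq> {x \<oplus>\<^bsub>V\<^esub> y |x y. x \<in> f ` B \<and> y \<in> g ` B}"
      using bounded_subset[OF B] by (auto simp: hom_space_simps(2))
    then show "(f \<oplus>\<^bsub>?H\<^esub> g) ` B \<in> bornology V"
      using f g B by (elim bounded_mono[OF bounded_sum, rotated 2])
        (auto simp: mem bounded_linear_map_bounded)
  qed (simp add: hom_space_simps(2))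
  have smult_closed': "c \<odot>\<^bsub>?H\<^esub> f \<in> carrier ?H" if f: "f \<in> carrier ?H" and c: "c \<in> carrier K" for f c
    unfolding mem
  proof (intro conjI bounded_linear_mapI)
    show "linear_map K C V (c \<odot>\<^bsub>?H\<^esub> f)"
      by (rule linear_mapI)
        (auto simp: hom_space_simps(4) cl[OF f] ad[OF f] sm[OF f] c smult_r_distr smult_assoc1[symmetric] m_comm)
    fix B assume B: "B \<in> bornology C"
    have "(c \<odot>\<^bsub>?H\<^esub> f) ` B \<subseteq> (\<lambda>x. c \<odot>\<^bsub>V\<^esub> x) ` f ` B"
      using bounded_subset[OF B] by (auto simp: hom_space_simps(4))
    then show "(c \<odot>\<^bsub>?H\<^esub> f) ` B \<in> bornology V"
      using f c B by (elim bounded_mono[OF bounded_scale, rotated 2])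
        (auto simp: mem bounded_linear_map_bounded)
  qed (simp add: hom_space_simps(4))
  have zero_closed': "\<zero>\<^bsub>?H\<^esub> \<in> carrier ?H"
    unfolding mem
  proof (intro conjI bounded_linear_mapI)
    show "linear_map K C V \<zero>\<^bsub>?H\<^esub>"
      by (rule linear_mapI) (auto simp: hom_space_simps(3))
    fix B assume B: "B \<in> bornology C"
    have "\<zero>\<^bsub>?H\<^esub> ` B \<subseteq> {\<zero>\<^bsub>V\<^esub>}"
      using bounded_subset[OF B] by (auto simp: hom_space_simps(3))
    then show "\<zero>\<^bsub>?H\<^esub> ` B \<in> bornology V"
      by (rule bounded_mono[OF bounded_singleton[OF M.zero_closed]])
  qed (simp add: hom_space_simps(3))
  have "abelian_group ?H"
  proof (rule abelian_groupI)
    fix f assume f: "f \<in> carrier ?H"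
    have "(\<ominus> \<one> \<odot>\<^bsub>?H\<^esub> f) \<oplus>\<^bsub>?H\<^esub> f = \<zero>\<^bsub>?H\<^esub>"
      using cl[OF f] by (auto simp: hom_space_simps(2-4) fun_eq_iff smult_l_minus M.l_neg)
    then show "\<exists>g\<in>carrier ?H. g \<oplus>\<^bsub>?H\<^esub> f = \<zero>\<^bsub>?H\<^esub>"
      using smult_closed'[OF f, of "\<ominus> \<one>"] by auto
    have "f = \<zero>\<^bsub>?H\<^esub> \<oplus>\<^bsub>?H\<^esub> f"
      by (rule ext[OF f]) (simp_all add: hom_space_simps(2,3) cl[OF f])
    then show "\<zero>\<^bsub>?H\<^esub> \<oplus>\<^bsub>?H\<^esub> f = f" by simp
  qed (use add_closed zero_closed' cl in \<open>auto simp: hom_space_simps(2) fun_eq_iff M.a_ac\<close>)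
  moreover have "\<one> \<odot>\<^bsub>?H\<^esub> f = f" if f: "f \<in> carrier ?H" for f
    by (rule ext[OF f, symmetric]) (simp_all add: hom_space_simps(4) cl[OF f])
  moreover have "cring K" ..
  ultimately show ?thesis
    using smult_closed' cl
    by (intro moduleI)
      (auto simp: hom_space_simps(2,4) fun_eq_iff smult_l_distr smult_r_distr smult_assoc1)
qed

end

section \<open>Criteria for isomorphisms of bornological spaces\<close>

lemma linear_map_inverse:
  assumes f: "linear_map K V W f" and bij: "bij_betw f (carrier V) (carrier W)" and V: "module K V"
  shows "linear_map K W V (inv_into (carrier V) f)"
proof -
  interpret V: module K V by (rule V)
  let ?g = "inv_into (carrier V) f"
  have g: "?g y \<in> carrier V" "f (?g y) = y" if "y \<in> carrier W" for y
    using that bij by (auto simp: bij_betw_def inv_into_into f_inv_into_f)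
  have gi: "?g y = x" if "x \<in> carrier V" "f x = y" for x y
    using that bij by (auto simp: bij_betw_def)
  show ?thesis
    by (rule linear_mapI) (use g linear_map_add[OF f] linear_map_smult[OF f] in \<open>auto intro!: gi\<close>)
qed

text \<open>Equality of the bornologies under direct image covers both directions: one inclusion
  bounds \<open>f\<close>, the other bounds its inverse.\<close>

lemma born_isoI:
  assumes f: "linear_map K V W f" and bij: "bij_betw f (carrier V) (carrier W)" and V: "module K V"
    and sub: "\<And>B. B \<in> bornology V \<Longrightarrow> B \<subseteq> carrier V"
    and born: "bornology W = (\<lambda>B. f ` B) ` bornology V"
  shows "born_iso K V W f"
  unfolding born_iso_def
proof (intro conjI bounded_linear_mapI)
  show "linear_map K W V (inv_into (carrier V) f)" by (rule linear_map_inverse[OF f bij V])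
  fix B assume "B \<in> bornology W"
  then obtain B' where B': "B' \<in> bornology V" "B = f ` B'" using born by blast
  have "inv_into (carrier V) f ` f ` B' = B'"
    using bij sub[OF B'(1)] by (simp add: bij_betw_def inv_into_image_cancel)
  then show "inv_into (carrier V) f ` B \<in> bornology V" using B' by simp
qed (use f bij born in auto)

text \<open>The isomorphism theorem with bornologies. A bounded linear bijection may have an
  unbounded inverse, hence the demand that the bounded sets of \<open>W\<close> be exactly the
  images of bounded sets, which is the quotient bornology.\<close>

lemma born_iso_quotient:
  assumes V: "module K V" and W: "module K W" and N: "submodule N K V"
    and \<pi>: "linear_map K V W \<pi>" and surj: "\<pi> ` carrier V = carrier W"
    and ker: "\<And>x. x \<in> carrier V \<Longrightarrow> \<pi> x = \<zero>\<^bsub>W\<^esub> \<longleftrightarrow> x \<in> N"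
    and sub: "\<And>B. B \<in> bornology V \<Longrightarrow> B \<subseteq> carrier V"
    and born: "bornology W = (\<lambda>B. \<pi> ` B) ` bornology V"
  obtains \<Phi> where "born_iso K (quotient_space V N) W \<Phi>"
    "\<forall>x\<in>carrier V. \<Phi> (N +>\<^bsub>V\<^esub> x) = \<pi> x"
proof -
  interpret Q: module_quotient K V N
    by (intro module_quotient.intro module_quotient_axioms.intro V N)
  interpret W: module K W by (rule W)
  have Nz: "\<pi> x = \<zero>\<^bsub>W\<^esub>" if "x \<in> N" for x using ker Q.N_subset that by blast
  obtain \<Phi> where \<Phi>: "linear_map K Q.Q W \<Phi>" "\<And>x. x \<in> carrier V \<Longrightarrow> \<Phi> (N +>\<^bsub>V\<^esub> x) = \<pi> x"
    using Q.descend[OF \<pi> W Nz] by blast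
  have bij: "bij_betw \<Phi> (carrier Q.Q) (carrier W)"
    unfolding bij_betw_def
  proof
    show "inj_on \<Phi> (carrier Q.Q)"
    proof (rule inj_onI)
      fix X Y assume XY: "X \<in> carrier Q.Q" "Y \<in> carrier Q.Q" and eq: "\<Phi> X = \<Phi> Y"
      then obtain x y where x: "x \<in> carrier V" "X = N +>\<^bsub>V\<^esub> x" "y \<in> carrier V" "Y = N +>\<^bsub>V\<^esub> y"
        unfolding Q.carrier_Q by blast
      then have "\<pi> x \<ominus>\<^bsub>W\<^esub> \<pi> y = \<zero>\<^bsub>W\<^esub>"
        using eq \<Phi>(2) linear_map_closed[OF \<pi>] by (simp add: W.M.minus_eq_zero_iff)
      then have "x \<ominus>\<^bsub>V\<^esub> y \<in> N"
        using ker[of "x \<ominus>\<^bsub>V\<^esub> y"] x linear_map_minus[OF \<pi> V W] by simp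
      then show "X = Y" using x Q.coset_eq_iff by simp
    qed
    have "\<Phi> ` carrier Q.Q = \<pi> ` carrier V"
      unfolding Q.carrier_Q image_image using \<Phi>(2) by simp
    then show "\<Phi> ` carrier Q.Q = carrier W" using surj by simp
  qed
  have "born_iso K (quotient_space V N) W \<Phi>"
  proof (rule born_isoI)
    show "linear_map K (quotient_space V N) W \<Phi>" using \<Phi>(1) by (simp add: quotient_space_def)
    show "bij_betw \<Phi> (carrier (quotient_space V N)) (carrier W)" using bij by (simp add: quotient_space_def)
    show "module K (quotient_space V N)"
      unfolding quotient_space_def by (rule module_with_bornology[OF Q.module_Q])
    have qb: "bornology (quotient_space V N) = (\<lambda>B. (\<lambda>x. N +>\<^bsub>V\<^esub> x) ` B) ` bornology V"
      by (auto simp: quotient_space_def)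
    show "B \<subseteq> carrier (quotient_space V N)" if "B \<in> bornology (quotient_space V N)" for B
      using that sub unfolding qb by (auto simp: quotient_space_def Q.carrier_Q)
    show "bornology W = (\<lambda>B. \<Phi> ` B) ` bornology (quotient_space V N)"
    proof -
      have "\<Phi> ` (\<lambda>x. N +>\<^bsub>V\<^esub> x) ` B = \<pi> ` B" if "B \<in> bornology V" for B
        unfolding image_image using sub[OF that] \<Phi>(2) by (intro image_cong) auto
      then show ?thesis
        unfolding born qb image_image[where g = "\<lambda>B. (\<lambda>x. N +>\<^bsub>V\<^esub> x) ` B"]
        by (intro image_cong refl) simp
    qed
  qed
  then show ?thesis using \<Phi>(2) that by blast
qed

context tensor_power_complete_pair
begin

lemma completed_bounded_subset:
  "B \<in> bornology (completed_tensor_power K V n) \<Longrightarrow> B \<subseteq> carrier (completed_tensor_power K V n)"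
  unfolding completed_tensor_power_def CT.completion_simps CT.cauchy_space_simps by blast

lemma module_H: "module K H"
  by (rule W.module_hom_space[OF module_completed completed_bounded_subset])

end

text \<open>The curried form of \<open>bounded_multilinear\<close> for two slots, tested on all
  bounded sets instead of bounded submodules; \<open>bounded_multilinear_2\<close> shows that this
  makes no difference.\<close>

definition bounded_bilinear_map ::
    "'k valued_ring \<Rightarrow> ('k, 'v) born_space \<Rightarrow> ('k, 'w) born_space \<Rightarrow> ('v \<Rightarrow> 'v \<Rightarrow> 'w) \<Rightarrow> bool"
  where
  "bounded_bilinear_map K V W f \<longleftrightarrow>
     (\<forall>a\<in>carrier V. linear_map K V W (\<lambda>b. f a b)) \<and>
     (\<forall>b\<in>carrier V. linear_map K V W (\<lambda>a. f a b)) \<and>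
     (\<forall>S\<in>bornology V. \<forall>T\<in>bornology V. {f a b | a b. a \<in> S \<and> b \<in> T} \<in> bornology W)"

lemma
  assumes "bounded_multilinear K V n W G"
  shows bounded_multilinear_closed: "xs \<in> tuples V n \<Longrightarrow> G xs \<in> carrier W"
    and bounded_multilinear_update_add: "xs \<in> tuples V n \<Longrightarrow> i < n \<Longrightarrow> a \<in> carrier V \<Longrightarrow> b \<in> carrier V \<Longrightarrow>
      G (xs[i := a \<oplus>\<^bsub>V\<^esub> b]) = G (xs[i := a]) \<oplus>\<^bsub>W\<^esub> G (xs[i := b])"
    and bounded_multilinear_update_smult: "xs \<in> tuples V n \<Longrightarrow> i < n \<Longrightarrow> c \<in> carrier K \<Longrightarrow> a \<in> carrier V \<Longrightarrow>
      G (xs[i := c \<odot>\<^bsub>V\<^esub> a]) = c \<odot>\<^bsub>W\<^esub> G (xs[i := a])"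
    and bounded_multilinear_bounded: "length Bs = n \<Longrightarrow> set Bs \<subseteq> bounded_submodules K V \<Longrightarrow>
      G ` listset Bs \<in> bornology W"
  using assms unfolding bounded_multilinear_def multilinear_def by simp_all

lemma bounded_multilinearI:
  assumes "\<And>xs. xs \<in> tuples V n \<Longrightarrow> G xs \<in> carrier W"
    "\<And>xs i a b. xs \<in> tuples V n \<Longrightarrow> i < n \<Longrightarrow> a \<in> carrier V \<Longrightarrow> b \<in> carrier V \<Longrightarrow>
      G (xs[i := a \<oplus>\<^bsub>V\<^esub> b]) = G (xs[i := a]) \<oplus>\<^bsub>W\<^esub> G (xs[i := b])"
    "\<And>xs i c a. xs \<in> tuples V n \<Longrightarrow> i < n \<Longrightarrow> c \<in> carrier K \<Longrightarrow> a \<in> carrier V \<Longrightarrow>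
      G (xs[i := c \<odot>\<^bsub>V\<^esub> a]) = c \<odot>\<^bsub>W\<^esub> G (xs[i := a])"
    "\<And>Bs. length Bs = n \<Longrightarrow> set Bs \<subseteq> bounded_submodules K V \<Longrightarrow> G ` listset Bs \<in> bornology W"
  shows "bounded_multilinear K V n W G"
  using assms unfolding bounded_multilinear_def multilinear_def by simp

lemma tuples_0 [simp]: "tuples V 0 = {[]}"
  by (auto simp: tuples_def)

lemma tuples_Suc: "tuples V (Suc n) = {x # xs | x xs. x \<in> carrier V \<and> xs \<in> tuples V n}"
  by (auto simp: tuples_def length_Suc_conv)

lemma tuples_1: "tuples V 1 = {[a] | a. a \<in> carrier V}"
  by (auto simp: tuples_Suc)

lemma tuples_2: "tuples V 2 = {[a, b] | a b. a \<in> carrier V \<and> b \<in> carrier V}"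
  by (auto simp: tuples_Suc numeral_2_eq_2)

lemma tuples_3: "tuples V 3 = {[a, b, c] | a b c. a \<in> carrier V \<and> b \<in> carrier V \<and> c \<in> carrier V}"
  by (auto simp: tuples_Suc numeral_3_eq_3)

section \<open>Bounded multilinear maps in low degree, and their sums\<close>

context bornological
begin

lemma bounded_multilinear_0: "bounded_multilinear K V 0 W G \<longleftrightarrow> G [] \<in> carrier W \<and> {G []} \<in> bornology W"
  by (simp add: bounded_multilinear_def multilinear_def)

lemma bounded_multilinear_1:
  assumes W: "bornological K p W"
  shows "bounded_multilinear K V 1 W G \<longleftrightarrow> bounded_linear_map K V W (\<lambda>a. G [a])"
proof -
  interpret W: bornological K p W by (rule W)
  have img: "G ` listset [B] = (\<lambda>a. G [a]) ` B" for B by (auto simp: set_Cons_def)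
  have "multilinear K V 1 W G \<longleftrightarrow> linear_map K V W (\<lambda>a. G [a])"
    unfolding multilinear_def linear_map_def tuples_1 by auto
  moreover have "(\<forall>Bs. length Bs = 1 \<and> set Bs \<subseteq> bounded_submodules K V \<longrightarrow> G ` listset Bs \<in> bornology W)
    \<longleftrightarrow> (\<forall>B\<in>bornology V. (\<lambda>a. G [a]) ` B \<in> bornology W)" (is "?l \<longleftrightarrow> ?r")
  proof
    assume l: ?l
    show ?r
    proof
      fix B assume "B \<in> bornology V"
      \<comment> \<open>Every bounded set lies in a bounded submodule, so testing on submodules is
        as strong as testing on all bounded sets.\<close>
      then obtain S where S: "S \<in> bounded_submodules K V" "B \<subseteq> S" by (rule bounded_obtain_bsub)
      have "G ` listset [S] \<in> bornology W" using l[rule_format, of "[S]"] S(1) by simp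
      then show "(\<lambda>a. G [a]) ` B \<in> bornology W"
        using W.bounded_mono[OF _ image_mono[OF S(2)]] unfolding img by blast
    qed
  next
    assume r: ?r
    show ?l
    proof (intro allI impI)
      fix Bs assume Bs: "length Bs = 1 \<and> set Bs \<subseteq> bounded_submodules K V"
      then obtain B where B: "Bs = [B]" by (auto simp: length_Suc_conv)
      show "G ` listset Bs \<in> bornology W" unfolding B img using r Bs B bsub_bounded by simp
    qed
  qed
  ultimately show ?thesis unfolding bounded_multilinear_def bounded_linear_map_iff by blast
qed

lemma bounded_multilinear_2:
  assumes W: "bornological K p W"
  shows "bounded_multilinear K V 2 W G \<longleftrightarrow> bounded_bilinear_map K V W (\<lambda>a b. G [a, b])"
proof -
  interpret W: bornological K p W by (rule W)
  have img: "G ` listset [S, T] = {G [a, b] | a b. a \<in> S \<and> b \<in> T}" for S T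
    by (auto simp: set_Cons_def)
  have i2: "(\<forall>i<2. P i) \<longleftrightarrow> P 0 \<and> P (Suc 0)" for P :: "nat \<Rightarrow> bool"
    by (auto simp: less_2_cases_iff)
  have "multilinear K V 2 W G \<longleftrightarrow> (\<forall>a\<in>carrier V. linear_map K V W (\<lambda>b. G [a, b])) \<and>
     (\<forall>b\<in>carrier V. linear_map K V W (\<lambda>a. G [a, b]))"
  proof -
    have ne: "\<exists>x. x \<in> carrier V" using M.zero_closed by blast
    have t2: "(\<forall>xs\<in>tuples V 2. P xs) \<longleftrightarrow> (\<forall>a\<in>carrier V. \<forall>b\<in>carrier V. P [a, b])" for P
      unfolding tuples_2 by blast
    have t2: "multilinear K V 2 W G \<longleftrightarrow>
        (\<forall>a\<in>carrier V. \<forall>b\<in>carrier V. G [a, b] \<in> carrier W) \<and>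
        (\<forall>b\<in>carrier V. \<forall>x\<in>carrier V. \<forall>y\<in>carrier V. G [x \<oplus>\<^bsub>V\<^esub> y, b] = G [x, b] \<oplus>\<^bsub>W\<^esub> G [y, b]) \<and>
        (\<forall>a\<in>carrier V. \<forall>x\<in>carrier V. \<forall>y\<in>carrier V. G [a, x \<oplus>\<^bsub>V\<^esub> y] = G [a, x] \<oplus>\<^bsub>W\<^esub> G [a, y]) \<and>
        (\<forall>b\<in>carrier V. \<forall>c\<in>carrier K. \<forall>x\<in>carrier V. G [c \<odot>\<^bsub>V\<^esub> x, b] = c \<odot>\<^bsub>W\<^esub> G [x, b]) \<and>
        (\<forall>a\<in>carrier V. \<forall>c\<in>carrier K. \<forall>x\<in>carrier V. G [a, c \<odot>\<^bsub>V\<^esub> x] = c \<odot>\<^bsub>W\<^esub> G [a, x])"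
      unfolding multilinear_def t2 i2 by (simp add: ball_conj_distrib ne)
    show ?thesis
      unfolding t2 linear_map_def ball_conj_distrib by (intro iffI conjI) (elim conjE, assumption | blast)+
  qed
  moreover have "(\<forall>Bs. length Bs = 2 \<and> set Bs \<subseteq> bounded_submodules K V \<longrightarrow> G ` listset Bs \<in> bornology W)
    \<longleftrightarrow> (\<forall>S\<in>bornology V. \<forall>T\<in>bornology V. {G [a, b] | a b. a \<in> S \<and> b \<in> T} \<in> bornology W)" (is "?l \<longleftrightarrow> ?r")
  proof
    assume l: ?l
    show ?r
    proof (intro ballI)
      fix S T assume "S \<in> bornology V" "T \<in> bornology V"
      then obtain S' T' where S: "S' \<in> bounded_submodules K V" "S \<subseteq> S'"
        and T: "T' \<in> bounded_submodules K V" "T \<subseteq> T'" by (meson bounded_obtain_bsub)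
      have "G ` listset [S', T'] \<in> bornology W" using l[rule_format, of "[S', T']"] S(1) T(1) by simp
      then show "{G [a, b] | a b. a \<in> S \<and> b \<in> T} \<in> bornology W"
        unfolding img by (rule W.bounded_mono) (use S T in blast)
    qed
  next
    assume r: ?r
    show ?l
    proof (intro allI impI)
      fix Bs assume Bs: "length Bs = 2 \<and> set Bs \<subseteq> bounded_submodules K V"
      then obtain S T where B: "Bs = [S, T]" by (auto simp: length_Suc_conv numeral_2_eq_2)
      show "G ` listset Bs \<in> bornology W" unfolding B img using r Bs B bsub_bounded by simp
    qed
  qed
  ultimately show ?thesis unfolding bounded_multilinear_def bounded_bilinear_map_def by blast
qed

text \<open>Agreement on tuples suffices, because every box of bounded submodules consists of
  tuples. It is used where a formula simplifies only for entries in the carrier.\<close>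

lemma bounded_multilinear_cong:
  assumes G: "bounded_multilinear K V n W G" and eq: "\<And>xs. xs \<in> tuples V n \<Longrightarrow> G' xs = G xs"
  shows "bounded_multilinear K V n W G'"
proof -
  interpret T: tensor_power_space K p V n
    by (intro tensor_power_space.intro bornological_axioms)
  show ?thesis
  proof (rule bounded_multilinearI)
    fix Bs assume Bs: "length Bs = n" "set Bs \<subseteq> bounded_submodules K V"
    have "G' ` listset Bs = G ` listset Bs"
      using T.listset_subset_tuples[OF Bs] eq by (intro image_cong) auto
    then show "G' ` listset Bs \<in> bornology W" using bounded_multilinear_bounded[OF G Bs] by simp
  qed (simp_all add: eq tuples_update bounded_multilinear_closed[OF G]
      bounded_multilinear_update_add[OF G] bounded_multilinear_update_smult[OF G])
qed

lemma bounded_multilinear_add: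
  assumes W: "bornological K p W"
    and G: "bounded_multilinear K V n W G" and H: "bounded_multilinear K V n W H"
  shows "bounded_multilinear K V n W (\<lambda>xs. G xs \<oplus>\<^bsub>W\<^esub> H xs)"
proof -
  interpret W: bornological K p W by (rule W)
  show ?thesis
  proof (rule bounded_multilinearI)
    fix Bs assume Bs: "length Bs = n" "set Bs \<subseteq> bounded_submodules K V"
    show "(\<lambda>xs. G xs \<oplus>\<^bsub>W\<^esub> H xs) ` listset Bs \<in> bornology W"
      by (rule W.bounded_mono[OF W.bounded_sum[OF bounded_multilinear_bounded[OF G Bs]
              bounded_multilinear_bounded[OF H Bs]]]) blast
  qed (simp_all add: tuples_update W.M.a_ac W.smult_r_distr
      bounded_multilinear_closed[OF G] bounded_multilinear_closed[OF H]
      bounded_multilinear_update_add[OF G] bounded_multilinear_update_smult[OF G]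
      bounded_multilinear_update_add[OF H] bounded_multilinear_update_smult[OF H])
qed

lemma bounded_multilinear_smult:
  assumes W: "bornological K p W" and G: "bounded_multilinear K V n W G" and d: "d \<in> carrier K"
  shows "bounded_multilinear K V n W (\<lambda>xs. d \<odot>\<^bsub>W\<^esub> G xs)"
proof -
  interpret W: bornological K p W by (rule W)
  show ?thesis
  proof (rule bounded_multilinearI)
    fix Bs assume Bs: "length Bs = n" "set Bs \<subseteq> bounded_submodules K V"
    show "(\<lambda>xs. d \<odot>\<^bsub>W\<^esub> G xs) ` listset Bs \<in> bornology W"
      using W.bounded_scale[OF d bounded_multilinear_bounded[OF G Bs]] by (simp add: image_image)
  qed (simp_all add: d tuples_update W.smult_r_distr W.smult_assoc1[symmetric] m_comm
      bounded_multilinear_closed[OF G]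
      bounded_multilinear_update_add[OF G] bounded_multilinear_update_smult[OF G])
qed

lemma bounded_multilinear_zero:
  assumes W: "bornological K p W"
  shows "bounded_multilinear K V n W (\<lambda>xs. \<zero>\<^bsub>W\<^esub>)"
proof -
  interpret W: bornological K p W by (rule W)
  have "(\<lambda>xs. \<zero>\<^bsub>W\<^esub>) ` S \<in> bornology W" for S :: "'v list set"
    by (rule W.bounded_mono[OF W.bounded_singleton[OF W.M.zero_closed]]) auto
  then show ?thesis by (intro bounded_multilinearI) simp_all
qed

lemma bounded_multilinear_finsum:
  assumes W: "bornological K p W" and "finite I" "\<And>i. i \<in> I \<Longrightarrow> bounded_multilinear K V n W (G i)"
  shows "bounded_multilinear K V n W (\<lambda>xs. \<Oplus>\<^bsub>W\<^esub>i\<in>I. G i xs)"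
  using assms(2,3)
proof (induction I)
  case empty
  interpret W: bornological K p W by (rule W)
  show ?case using bounded_multilinear_zero[OF W] by simp
next
  case (insert i I)
  interpret W: bornological K p W by (rule W)
  have cl: "G j xs \<in> carrier W" if "xs \<in> tuples V n" "j \<in> insert i I" for xs j
    using bounded_multilinear_closed[OF insert.prems[OF that(2)] that(1)] .
  have "bounded_multilinear K V n W (\<lambda>xs. G i xs \<oplus>\<^bsub>W\<^esub> (\<Oplus>\<^bsub>W\<^esub>i\<in>I. G i xs))"
    using insert by (intro bounded_multilinear_add[OF W]) auto
  then show ?case
    by (rule bounded_multilinear_cong) (use insert.hyps cl in \<open>simp add: Pi_iff\<close>)
qed

end

text \<open>The formula specifying \<open>differential\<close>, freed from tensors. For functions on
  lists it can be shown multilinear and additive before any map on a tensor power is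
  constructed.\<close>

definition hochschild ::
    "'k valued_ring \<Rightarrow> ('k, 'a) born_space \<Rightarrow> nat \<Rightarrow> ('a list \<Rightarrow> 'a) \<Rightarrow> 'a list \<Rightarrow> 'a" where
  "hochschild K A n F xs =
     hd xs \<otimes>\<^bsub>A\<^esub> F (tl xs)
     \<oplus>\<^bsub>A\<^esub> (\<Oplus>\<^bsub>A\<^esub>i\<in>{1..n}. ((\<ominus>\<^bsub>K\<^esub> \<one>\<^bsub>K\<^esub>) [^]\<^bsub>K\<^esub> i) \<odot>\<^bsub>A\<^esub> F (contract A i xs))
     \<oplus>\<^bsub>A\<^esub> ((\<ominus>\<^bsub>K\<^esub> \<one>\<^bsub>K\<^esub>) [^]\<^bsub>K\<^esub> Suc n) \<odot>\<^bsub>A\<^esub> (F (butlast xs) \<otimes>\<^bsub>A\<^esub> last xs)"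

section \<open>The multiplication and the Hochschild formula on tuples\<close>

locale complete_algebra = complete_bornological_space K p A
  for K :: "'k valued_ring" (structure) and p and A :: "('k, 'a) born_space" +
  assumes algebra: "complete_born_algebra K A"
begin

sublocale A: ring A
  using algebra by (simp add: complete_born_algebra_def)

lemma pair: "tensor_power_complete_pair K p A A"
  by (intro tensor_power_complete_pair.intro tensor_power_space.intro bornological_axioms
      complete_bornological_space_axioms)

text \<open>The algebra structure is given as a ring together with a bounded map on the completed
  tensor square. Reading that map on pure tensors recovers the compatibility of the product with
  scalars and its boundedness.\<close>

lemma bounded_bilinear_mult: "bounded_bilinear_map K A A (\<lambda>a b. a \<otimes>\<^bsub>A\<^esub> b)"
proof -
  interpret P: tensor_power_complete_pair K p A 2 A by (rule pair)
  obtain \<mu> where \<mu>: "bounded_linear_map K (completed_tensor_power K A 2) A \<mu>"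
    "\<And>a b. a \<in> carrier A \<Longrightarrow> b \<in> carrier A \<Longrightarrow> \<mu> (ctensor K A [a, b]) = a \<otimes>\<^bsub>A\<^esub> b"
    using algebra unfolding complete_born_algebra_def by blast
  have "bounded_multilinear K A 2 A (\<lambda>xs. hd xs \<otimes>\<^bsub>A\<^esub> last xs)"
  proof (rule bounded_multilinear_cong[OF P.bounded_multilinear_restrict[OF P.hom_space_restrict[OF \<mu>(1)]]])
    fix xs assume xs: "xs \<in> tuples A 2"
    then show "hd xs \<otimes>\<^bsub>A\<^esub> last xs
        = restrict \<mu> (carrier (completed_tensor_power K A 2)) (ctensor K A xs)"
      using P.ctensor_closed[OF xs] \<mu>(2) by (auto simp: tuples_2)
  qed
  then show ?thesis unfolding bounded_multilinear_2[OF bornological_axioms] by simp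
qed

lemma smult_mult:
  assumes "c \<in> carrier K" "a \<in> carrier A" "b \<in> carrier A"
  shows "(c \<odot>\<^bsub>A\<^esub> a) \<otimes>\<^bsub>A\<^esub> b = c \<odot>\<^bsub>A\<^esub> (a \<otimes>\<^bsub>A\<^esub> b)"
    and "a \<otimes>\<^bsub>A\<^esub> (c \<odot>\<^bsub>A\<^esub> b) = c \<odot>\<^bsub>A\<^esub> (a \<otimes>\<^bsub>A\<^esub> b)"
  using bounded_bilinear_mult assms unfolding bounded_bilinear_map_def linear_map_def by auto

lemma bounded_mult:
  "S \<in> bornology A \<Longrightarrow> T \<in> bornology A \<Longrightarrow> {a \<otimes>\<^bsub>A\<^esub> b | a b. a \<in> S \<and> b \<in> T} \<in> bornology A"
  using bounded_bilinear_mult unfolding bounded_bilinear_map_def by blast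

lemma bounded_multilinear_hd_mult:
  assumes G: "bounded_multilinear K A n A G"
  shows "bounded_multilinear K A (Suc n) A (\<lambda>xs. hd xs \<otimes>\<^bsub>A\<^esub> G (tl xs))"
proof (rule bounded_multilinearI)
  note g = bounded_multilinear_closed[OF G] bounded_multilinear_update_add[OF G]
    bounded_multilinear_update_smult[OF G]
  fix xs assume xs: "xs \<in> tuples A (Suc n)"
  then obtain y ys where y: "xs = y # ys" "y \<in> carrier A" "ys \<in> tuples A n" by (auto simp: tuples_Suc)
  then show "hd xs \<otimes>\<^bsub>A\<^esub> G (tl xs) \<in> carrier A" using g(1) by simp
  fix i assume "i < Suc n"
  fix a assume a: "a \<in> carrier A"
  show "hd (xs[i := a \<oplus>\<^bsub>A\<^esub> b]) \<otimes>\<^bsub>A\<^esub> G (tl (xs[i := a \<oplus>\<^bsub>A\<^esub> b])) =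
    hd (xs[i := a]) \<otimes>\<^bsub>A\<^esub> G (tl (xs[i := a])) \<oplus>\<^bsub>A\<^esub> hd (xs[i := b]) \<otimes>\<^bsub>A\<^esub> G (tl (xs[i := b]))"
    if "b \<in> carrier A" for b
    using y a that \<open>i < Suc n\<close> g
    by (cases i) (simp_all add: A.l_distr A.r_distr tuples_update)
  show "hd (xs[i := c \<odot>\<^bsub>A\<^esub> a]) \<otimes>\<^bsub>A\<^esub> G (tl (xs[i := c \<odot>\<^bsub>A\<^esub> a])) =
    c \<odot>\<^bsub>A\<^esub> (hd (xs[i := a]) \<otimes>\<^bsub>A\<^esub> G (tl (xs[i := a])))" if "c \<in> carrier K" for c
    using y a that \<open>i < Suc n\<close> g
    by (cases i) (simp_all add: smult_mult tuples_update)
next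
  fix Bs assume Bs: "length Bs = Suc n" "set Bs \<subseteq> bounded_submodules K A"
  then obtain B Cs where B: "Bs = B # Cs" "length Cs = n" by (auto simp: length_Suc_conv)
  have "B \<in> bornology A" "G ` listset Cs \<in> bornology A"
    using Bs B bsub_bounded bounded_multilinear_bounded[OF G] by auto
  then show "(\<lambda>xs. hd xs \<otimes>\<^bsub>A\<^esub> G (tl xs)) ` listset Bs \<in> bornology A"
    by (rule bounded_mono[OF bounded_mult]) (fastforce simp: B set_Cons_def)
qed

lemma bounded_multilinear_mult_last:
  assumes G: "bounded_multilinear K A n A G"
  shows "bounded_multilinear K A (Suc n) A (\<lambda>xs. G (butlast xs) \<otimes>\<^bsub>A\<^esub> last xs)"
proof (rule bounded_multilinearI)
  note g = bounded_multilinear_closed[OF G] bounded_multilinear_update_add[OF G]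
    bounded_multilinear_update_smult[OF G]
  fix xs assume xs: "xs \<in> tuples A (Suc n)"
  then have "xs \<noteq> []" by (auto simp: tuples_def)
  then obtain y ys where y: "xs = ys @ [y]" by (cases xs rule: rev_cases) auto
  have ys: "y \<in> carrier A" "ys \<in> tuples A n" "length ys = n" using xs by (auto simp: y tuples_def)
  show "G (butlast xs) \<otimes>\<^bsub>A\<^esub> last xs \<in> carrier A" using g(1) y ys by simp
  fix i assume i: "i < Suc n"
  fix a assume a: "a \<in> carrier A"
  show "G (butlast (xs[i := a \<oplus>\<^bsub>A\<^esub> b])) \<otimes>\<^bsub>A\<^esub> last (xs[i := a \<oplus>\<^bsub>A\<^esub> b]) =
    G (butlast (xs[i := a])) \<otimes>\<^bsub>A\<^esub> last (xs[i := a]) \<oplus>\<^bsub>A\<^esub> G (butlast (xs[i := b])) \<otimes>\<^bsub>A\<^esub> last (xs[i := b])"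
    if "b \<in> carrier A" for b
    using y ys a that i g
    by (cases "i < n") (simp_all add: A.l_distr A.r_distr tuples_update list_update_append split: nat.split)
  show "G (butlast (xs[i := c \<odot>\<^bsub>A\<^esub> a])) \<otimes>\<^bsub>A\<^esub> last (xs[i := c \<odot>\<^bsub>A\<^esub> a]) =
    c \<odot>\<^bsub>A\<^esub> (G (butlast (xs[i := a])) \<otimes>\<^bsub>A\<^esub> last (xs[i := a]))" if "c \<in> carrier K" for c
    using y ys a that i g
    by (cases "i < n") (simp_all add: smult_mult tuples_update list_update_append split: nat.split)
next
  fix Bs assume Bs: "length Bs = Suc n" "set Bs \<subseteq> bounded_submodules K A"
  then have "Bs \<noteq> []" by auto
  then obtain B Cs where B: "Bs = Cs @ [B]" by (cases Bs rule: rev_cases) auto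
  have *: "B \<in> bornology A" "G ` listset Cs \<in> bornology A"
    using Bs B bsub_bounded bounded_multilinear_bounded[OF G] by auto
  have "(\<lambda>xs. G (butlast xs) \<otimes>\<^bsub>A\<^esub> last xs) ` listset Bs \<subseteq> {a \<otimes>\<^bsub>A\<^esub> b | a b. a \<in> G ` listset Cs \<and> b \<in> B}"
    by (fastforce simp: B in_listset_iff list_all2_append2 list_all2_Cons2)
  then show "(\<lambda>xs. G (butlast xs) \<otimes>\<^bsub>A\<^esub> last xs) ` listset Bs \<in> bornology A"
    by (rule bounded_mono[OF bounded_mult[OF *(2,1)]])
qed

text \<open>Positions in \<open>contract\<close> count from 1. Writing the index as
  \<open>Suc m\<close> makes the merged entries those at \<open>m\<close> and \<open>Suc m\<close>
  and removes the subtraction.\<close>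

lemma contract_closed:
  assumes "xs \<in> tuples A (Suc n)" "m < n"
  shows "contract A (Suc m) xs \<in> tuples A n"
proof -
  have "xs ! m \<in> carrier A" "xs ! Suc m \<in> carrier A"
    using assms by (auto simp: tuples_def)
  then show ?thesis
    using assms by (auto simp: tuples_def contract_def dest!: in_set_takeD in_set_dropD)
qed

text \<open>These four cases reduce multilinearity of a contracted map to that of \<open>G\<close>:
  outside the merged pair an update stays an update, shifted by one behind the pair, and inside the
  pair it becomes an update by a product, which is linear in either factor.\<close>

lemma contract_update:
  assumes "length xs = Suc n" "m < n"
  shows "k < m \<Longrightarrow> contract A (Suc m) (xs[k := a]) = (contract A (Suc m) xs)[k := a]"
    and "contract A (Suc m) (xs[m := a]) = (contract A (Suc m) xs)[m := a \<otimes>\<^bsub>A\<^esub> (xs ! Suc m)]"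
    and "contract A (Suc m) (xs[Suc m := a]) = (contract A (Suc m) xs)[m := (xs ! m) \<otimes>\<^bsub>A\<^esub> a]"
    and "Suc m < k \<Longrightarrow> contract A (Suc m) (xs[k := a]) = (contract A (Suc m) xs)[k - 1 := a]"
proof -
  show "contract A (Suc m) (xs[k := a]) = (contract A (Suc m) xs)[k := a]" if "k < m"
    using assms that by (simp add: contract_def list_update_append take_update_swap)
  show "contract A (Suc m) (xs[m := a]) = (contract A (Suc m) xs)[m := a \<otimes>\<^bsub>A\<^esub> (xs ! Suc m)]"
    using assms by (simp add: contract_def list_update_append)
  show "contract A (Suc m) (xs[Suc m := a]) = (contract A (Suc m) xs)[m := (xs ! m) \<otimes>\<^bsub>A\<^esub> a]"
    using assms by (simp add: contract_def list_update_append)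
  show "contract A (Suc m) (xs[k := a]) = (contract A (Suc m) xs)[k - 1 := a]" if "Suc m < k"
  proof -
    have "\<exists>d. k = Suc (Suc (m + d))" using less_imp_Suc_add[OF that] by simp
    then obtain d where d: "k = Suc (Suc (m + d))" ..
    show ?thesis
      using assms by (simp add: d contract_def list_update_append drop_update_swap)
  qed
qed

lemma bounded_multilinear_contract:
  assumes G: "bounded_multilinear K A n A G" and m: "m < n"
  shows "bounded_multilinear K A (Suc n) A (\<lambda>xs. G (contract A (Suc m) xs))"
proof (rule bounded_multilinearI)
  note g = bounded_multilinear_closed[OF G] bounded_multilinear_update_add[OF G]
    bounded_multilinear_update_smult[OF G]
  fix xs assume xs: "xs \<in> tuples A (Suc n)"
  note cc = contract_closed[OF xs m]
  then show "G (contract A (Suc m) xs) \<in> carrier A" by (rule g(1))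
  have len: "length xs = Suc n" using xs by (simp add: tuples_def)
  note cu = contract_update[OF len m]
  have e: "xs ! m \<in> carrier A" "xs ! Suc m \<in> carrier A"
    using xs m by (auto simp: tuples_def)
  fix i assume i: "i < Suc n"
  fix a assume a: "a \<in> carrier A"
  consider "i < m" | "i = m" | "i = Suc m" | "Suc m < i" by linarith
  note cases = this
  show "G (contract A (Suc m) (xs[i := a \<oplus>\<^bsub>A\<^esub> b])) =
    G (contract A (Suc m) (xs[i := a])) \<oplus>\<^bsub>A\<^esub> G (contract A (Suc m) (xs[i := b]))"
    if b: "b \<in> carrier A" for b
    using cases
    by cases (use cc g(2) i m a b e in \<open>simp_all add: cu A.l_distr A.r_distr\<close>)
  show "G (contract A (Suc m) (xs[i := c \<odot>\<^bsub>A\<^esub> a])) = c \<odot>\<^bsub>A\<^esub> G (contract A (Suc m) (xs[i := a]))"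
    if c: "c \<in> carrier K" for c
    using cases
    by cases (use cc g(3) i m a c e in \<open>simp_all add: cu smult_mult\<close>)
next
  fix Bs assume Bs: "length Bs = Suc n" "set Bs \<subseteq> bounded_submodules K A"
  let ?P = "{a \<otimes>\<^bsub>A\<^esub> b | a b. a \<in> Bs ! m \<and> b \<in> Bs ! Suc m}"
  have "Bs ! m \<in> bornology A" "Bs ! Suc m \<in> bornology A"
    using Bs m bsub_bounded by (auto simp: subset_iff)
  then have "?P \<in> bornology A" by (rule bounded_mult)
  then obtain S where S: "S \<in> bounded_submodules K A" "?P \<subseteq> S" by (rule bounded_obtain_bsub)
  \<comment> \<open>The set of products need not be a submodule, so a bounded submodule
    \<open>S\<close> containing it replaces the two merged factors and the box keeps its
    shape.\<close>
  let ?Cs = "take m Bs @ [S] @ drop (Suc (Suc m)) Bs"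
  have "contract A (Suc m) ` listset Bs \<subseteq> listset ?Cs"
  proof
    fix ys assume "ys \<in> contract A (Suc m) ` listset Bs"
    then obtain xs where xs: "list_all2 (\<in>) xs Bs" "ys = contract A (Suc m) xs"
      by (auto simp: in_listset_iff)
    then have "xs ! m \<in> Bs ! m" "xs ! Suc m \<in> Bs ! Suc m"
      using m Bs(1) by (auto simp: list_all2_conv_all_nth)
    then have "xs ! m \<otimes>\<^bsub>A\<^esub> (xs ! Suc m) \<in> S" using S(2) by blast
    then show "ys \<in> listset ?Cs"
      unfolding in_listset_iff xs(2) contract_def
      using xs(1) by (intro list_all2_appendI) auto
  qed
  moreover have "G ` listset ?Cs \<in> bornology A"
    using Bs m S(1) by (intro bounded_multilinear_bounded[OF G])
      (auto dest!: in_set_takeD in_set_dropD)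
  ultimately have "G ` contract A (Suc m) ` listset Bs \<in> bornology A"
    using bounded_mono image_mono by metis
  then show "(\<lambda>xs. G (contract A (Suc m) xs)) ` listset Bs \<in> bornology A" by (simp add: image_image)
qed

text \<open>The existence half of the definite description in \<open>differential\<close>: the
  formula extends to a bounded map on the next completed tensor power.\<close>

lemma bounded_multilinear_hochschild:
  assumes G: "bounded_multilinear K A n A G"
  shows "bounded_multilinear K A (Suc n) A (hochschild K A n G)"
proof -
  have s: "(\<ominus> \<one>) [^] (i::nat) \<in> carrier K" for i by simp
  have "bounded_multilinear K A (Suc n) A (\<lambda>xs. ((\<ominus> \<one>) [^] i) \<odot>\<^bsub>A\<^esub> G (contract A i xs))"
    if "i \<in> {1..n}" for i
  proof -
    obtain m where "i = Suc m" "m < n" using \<open>i \<in> {1..n}\<close> by (cases i) auto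
    then show ?thesis
      using bounded_multilinear_smult[OF bornological_axioms bounded_multilinear_contract[OF G] s] by blast
  qed
  then have "bounded_multilinear K A (Suc n) A
      (\<lambda>xs. \<Oplus>\<^bsub>A\<^esub>i\<in>{1..n}. ((\<ominus> \<one>) [^] i) \<odot>\<^bsub>A\<^esub> G (contract A i xs))"
    by (intro bounded_multilinear_finsum[OF bornological_axioms]) simp_all
  then show ?thesis
    unfolding hochschild_def
    by (intro bounded_multilinear_add[OF bornological_axioms] bounded_multilinear_hd_mult[OF G]
        bounded_multilinear_smult[OF bornological_axioms bounded_multilinear_mult_last[OF G] s])
qed

lemma hochschild_add:
  assumes G: "bounded_multilinear K A n A G" and H: "bounded_multilinear K A n A H"
    and xs: "xs \<in> tuples A (Suc n)"
  shows "hochschild K A n (\<lambda>xs. G xs \<oplus>\<^bsub>A\<^esub> H xs) xs = hochschild K A n G xs \<oplus>\<^bsub>A\<^esub> hochschild K A n H xs"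
proof -
  have t: "tl xs \<in> tuples A n" "butlast xs \<in> tuples A n" "hd xs \<in> carrier A" "last xs \<in> carrier A"
    using xs by (cases xs; auto simp: tuples_def dest: in_set_butlastD)+
  have c: "contract A i xs \<in> tuples A n" if "i \<in> {1..n}" for i
    using contract_closed[OF xs, of "i - 1"] that by (cases i) simp_all
  note cl = bounded_multilinear_closed[OF G] bounded_multilinear_closed[OF H]
  have s: "(\<ominus> \<one>) [^] (i::nat) \<in> carrier K" for i by simp
  have "(\<Oplus>\<^bsub>A\<^esub>i\<in>{1..n}. ((\<ominus> \<one>) [^] i) \<odot>\<^bsub>A\<^esub> (G (contract A i xs) \<oplus>\<^bsub>A\<^esub> H (contract A i xs)))
    = (\<Oplus>\<^bsub>A\<^esub>i\<in>{1..n}. ((\<ominus> \<one>) [^] i) \<odot>\<^bsub>A\<^esub> G (contract A i xs) \<oplus>\<^bsub>A\<^esub> ((\<ominus> \<one>) [^] i) \<odot>\<^bsub>A\<^esub> H (contract A i xs))"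
    using c cl s by (intro M.add.finprod_cong') (auto simp: smult_r_distr)
  also have "\<dots> = (\<Oplus>\<^bsub>A\<^esub>i\<in>{1..n}. ((\<ominus> \<one>) [^] i) \<odot>\<^bsub>A\<^esub> G (contract A i xs))
     \<oplus>\<^bsub>A\<^esub> (\<Oplus>\<^bsub>A\<^esub>i\<in>{1..n}. ((\<ominus> \<one>) [^] i) \<odot>\<^bsub>A\<^esub> H (contract A i xs))"
    using c cl s by (intro M.finsum_addf) auto
  moreover have "(\<Oplus>\<^bsub>A\<^esub>i\<in>{1..n}. ((\<ominus> \<one>) [^] i) \<odot>\<^bsub>A\<^esub> G (contract A i xs)) \<in> carrier A"
     "(\<Oplus>\<^bsub>A\<^esub>i\<in>{1..n}. ((\<ominus> \<one>) [^] i) \<odot>\<^bsub>A\<^esub> H (contract A i xs)) \<in> carrier A"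
    using c cl s by (auto intro!: M.finsum_closed)
  \<comment> \<open>The sign powers stay folded so that the last coefficient is treated as one
    scalar on both sides.\<close>
  ultimately show ?thesis
    unfolding hochschild_def using t cl s
    by (simp add: A.l_distr A.r_distr smult_r_distr M.a_ac del: nat_pow_Suc)
qed

lemma hochschild_smult:
  assumes G: "bounded_multilinear K A n A G" and d: "d \<in> carrier K" and xs: "xs \<in> tuples A (Suc n)"
  shows "hochschild K A n (\<lambda>xs. d \<odot>\<^bsub>A\<^esub> G xs) xs = d \<odot>\<^bsub>A\<^esub> hochschild K A n G xs"
proof -
  have t: "tl xs \<in> tuples A n" "butlast xs \<in> tuples A n" "hd xs \<in> carrier A" "last xs \<in> carrier A"
    using xs by (cases xs; auto simp: tuples_def dest: in_set_butlastD)+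
  have c: "contract A i xs \<in> tuples A n" if "i \<in> {1..n}" for i
    using contract_closed[OF xs, of "i - 1"] that by (cases i) simp_all
  note cl = bounded_multilinear_closed[OF G]
  have s: "(\<ominus> \<one>) [^] (i::nat) \<in> carrier K" for i by simp
  have sc: "e \<odot>\<^bsub>A\<^esub> (d \<odot>\<^bsub>A\<^esub> x) = d \<odot>\<^bsub>A\<^esub> (e \<odot>\<^bsub>A\<^esub> x)" if "e \<in> carrier K" "x \<in> carrier A" for e x
    using that d by (simp add: smult_assoc1[symmetric] m_comm)
  have "(\<Oplus>\<^bsub>A\<^esub>i\<in>{1..n}. ((\<ominus> \<one>) [^] i) \<odot>\<^bsub>A\<^esub> (d \<odot>\<^bsub>A\<^esub> G (contract A i xs)))
    = (\<Oplus>\<^bsub>A\<^esub>i\<in>{1..n}. d \<odot>\<^bsub>A\<^esub> (((\<ominus> \<one>) [^] i) \<odot>\<^bsub>A\<^esub> G (contract A i xs)))"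
    using c cl s d by (intro M.add.finprod_cong') (auto simp: sc)
  also have "\<dots> = d \<odot>\<^bsub>A\<^esub> (\<Oplus>\<^bsub>A\<^esub>i\<in>{1..n}. ((\<ominus> \<one>) [^] i) \<odot>\<^bsub>A\<^esub> G (contract A i xs))"
    using c cl s d by (intro finsum_smult_ldistr[symmetric]) auto
  moreover have "(\<Oplus>\<^bsub>A\<^esub>i\<in>{1..n}. ((\<ominus> \<one>) [^] i) \<odot>\<^bsub>A\<^esub> G (contract A i xs)) \<in> carrier A"
    using c cl s by (auto intro!: M.finsum_closed)
  ultimately show ?thesis
    unfolding hochschild_def using t cl s d
    by (simp add: smult_mult smult_r_distr sc del: nat_pow_Suc)
qed

lemma hochschild_0:
  assumes "a \<in> carrier A" "G [] \<in> carrier A"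
  shows "hochschild K A 0 G [a] = a \<otimes>\<^bsub>A\<^esub> G [] \<ominus>\<^bsub>A\<^esub> G [] \<otimes>\<^bsub>A\<^esub> a"
  using assms by (simp add: hochschild_def smult_l_minus M.minus_eq)

lemma hochschild_1:
  assumes "a \<in> carrier A" "b \<in> carrier A" "\<And>x. x \<in> carrier A \<Longrightarrow> G [x] \<in> carrier A"
  shows "hochschild K A 1 G [a, b] = (a \<otimes>\<^bsub>A\<^esub> G [b] \<ominus>\<^bsub>A\<^esub> G [a \<otimes>\<^bsub>A\<^esub> b]) \<oplus>\<^bsub>A\<^esub> G [a] \<otimes>\<^bsub>A\<^esub> b"
proof -
  have "\<ominus> \<one> \<otimes> \<ominus> \<one> = \<one>" by (simp add: l_minus)
  then show ?thesis
    using assms by (simp add: hochschild_def contract_def smult_l_minus M.minus_eq)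
qed

lemma hochschild_2:
  assumes "a \<in> carrier A" "b \<in> carrier A" "c \<in> carrier A"
    "\<And>x y. x \<in> carrier A \<Longrightarrow> y \<in> carrier A \<Longrightarrow> G [x, y] \<in> carrier A"
  shows "hochschild K A 2 G [a, b, c] =
    ((a \<otimes>\<^bsub>A\<^esub> G [b, c] \<ominus>\<^bsub>A\<^esub> G [a \<otimes>\<^bsub>A\<^esub> b, c]) \<oplus>\<^bsub>A\<^esub> G [a, b \<otimes>\<^bsub>A\<^esub> c]) \<ominus>\<^bsub>A\<^esub> G [a, b] \<otimes>\<^bsub>A\<^esub> c"
proof -
  have m: "\<ominus> \<one> \<otimes> \<ominus> \<one> = \<one>" by (simp add: l_minus)
  have "{1..2} = {1, 2::nat}" by auto
  then show ?thesis
    using assms m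
    by (simp add: hochschild_def contract_def smult_l_minus M.minus_eq numeral_2_eq_2 M.a_ac)
qed

end

context mixed_char_complete_field
begin

text \<open>Lets coboundaries and inner derivations be recognised as subspaces of the ambient space
  and then used inside cocycles and derivations.\<close>

lemma submodule_sub_space_iff:
  assumes V: "module K V" and S: "submodule S K V" and "N \<subseteq> S"
  shows "submodule N K (sub_space V S) \<longleftrightarrow> submodule N K V"
proof -
  have "S \<subseteq> carrier V" using submodule_subset[OF V _ S] by simp
  then have "N \<subseteq> carrier V" using assms(3) by blast
  then show ?thesis
    using assms(3) by (simp add: submodule_iff[OF V] submodule_iff[OF module_sub_space[OF V S]])
qed

end

section \<open>Cochains, cocycles and coboundaries\<close>

context complete_algebra
begin

abbreviation "ct \<equiv> ctensor K A"

text \<open>From here on cochains are handled through these facts: they are determined by their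
  values on tensors of tuples, they add and scale pointwise there, and bounded families are
  recognised there. The completion itself no longer appears.\<close>

lemma
  fixes n :: nat
  shows module_cochains: "module K (cochains K A n)"
    and cochain_multilinear: "f \<in> carrier (cochains K A n) \<Longrightarrow> bounded_multilinear K A n A (\<lambda>xs. f (ct xs))"
    and cochain_eqI: "f \<in> carrier (cochains K A n) \<Longrightarrow> g \<in> carrier (cochains K A n) \<Longrightarrow>
      (\<And>xs. xs \<in> tuples A n \<Longrightarrow> f (ct xs) = g (ct xs)) \<Longrightarrow> f = g"
    and cochain_add: "xs \<in> tuples A n \<Longrightarrow> (f \<oplus>\<^bsub>cochains K A n\<^esub> g) (ct xs) = f (ct xs) \<oplus>\<^bsub>A\<^esub> g (ct xs)"
    and cochain_smult: "xs \<in> tuples A n \<Longrightarrow> (c \<odot>\<^bsub>cochains K A n\<^esub> f) (ct xs) = c \<odot>\<^bsub>A\<^esub> f (ct xs)"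
    and cochain_zero: "xs \<in> tuples A n \<Longrightarrow> \<zero>\<^bsub>cochains K A n\<^esub> (ct xs) = \<zero>\<^bsub>A\<^esub>"
    and cochains_bounded_iff: "U \<in> bornology (cochains K A n) \<longleftrightarrow> U \<subseteq> carrier (cochains K A n) \<and>
      (\<forall>Bs. length Bs = n \<and> set Bs \<subseteq> bounded_submodules K A \<longrightarrow>
         (\<Union>f\<in>U. (\<lambda>xs. f (ct xs)) ` listset Bs) \<in> bornology A)"
proof -
  interpret P: tensor_power_complete_pair K p A n A by (rule pair)
  show "module K (cochains K A n)" unfolding cochains_def by (rule P.module_H)
  show "f \<in> carrier (cochains K A n) \<Longrightarrow> bounded_multilinear K A n A (\<lambda>xs. f (ct xs))"
    unfolding cochains_def by (rule P.bounded_multilinear_restrict)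
  show "f \<in> carrier (cochains K A n) \<Longrightarrow> g \<in> carrier (cochains K A n) \<Longrightarrow>
      (\<And>xs. xs \<in> tuples A n \<Longrightarrow> f (ct xs) = g (ct xs)) \<Longrightarrow> f = g"
    unfolding cochains_def by (rule P.hom_space_eqI)
  show "U \<in> bornology (cochains K A n) \<longleftrightarrow> U \<subseteq> carrier (cochains K A n) \<and>
      (\<forall>Bs. length Bs = n \<and> set Bs \<subseteq> bounded_submodules K A \<longrightarrow>
         (\<Union>f\<in>U. (\<lambda>xs. f (ct xs)) ` listset Bs) \<in> bornology A)"
    unfolding cochains_def by (rule P.hom_space_bounded_iff)
qed (simp_all add: cochains_def hom_space_simps tensor_power_complete_pair.ctensor_closed[OF pair])

lemma cochain_extend:
  assumes "bounded_multilinear K A n A G"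
  obtains f where "f \<in> carrier (cochains K A n)" "\<forall>xs\<in>tuples A n. f (ct xs) = G xs"
proof -
  interpret P: tensor_power_complete_pair K p A n A by (rule pair)
  show ?thesis by (rule P.hom_space_extend[OF assms, folded cochains_def]) (rule that)
qed

lemma cochain_closed: "f \<in> carrier (cochains K A n) \<Longrightarrow> xs \<in> tuples A n \<Longrightarrow> f (ct xs) \<in> carrier A"
  using bounded_multilinear_closed[OF cochain_multilinear] .

text \<open>Existence by \<open>bounded_multilinear_hochschild\<close> and
  \<open>cochain_extend\<close>, together with uniqueness by \<open>cochain_eqI\<close>, makes the
  definite description meaningful.\<close>

lemma
  assumes f: "f \<in> carrier (cochains K A n)"
  shows differential_closed: "differential K A n f \<in> carrier (cochains K A (Suc n))"
    and differential_eval: "xs \<in> tuples A (Suc n) \<Longrightarrow>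
      differential K A n f (ct xs) = hochschild K A n (\<lambda>xs. f (ct xs)) xs"
proof -
  let ?P = "\<lambda>g. g \<in> carrier (cochains K A (Suc n)) \<and>
    (\<forall>xs\<in>tuples A (Suc n). g (ct xs) = hochschild K A n (\<lambda>xs. f (ct xs)) xs)"
  obtain g where g: "g \<in> carrier (cochains K A (Suc n))"
    "\<forall>xs\<in>tuples A (Suc n). g (ct xs) = hochschild K A n (\<lambda>xs. f (ct xs)) xs"
    using bounded_multilinear_hochschild[OF cochain_multilinear[OF f]] by (rule cochain_extend)
  have "?P g" using g by blast
  moreover have "h = g" if "?P h" for h
    using that g by (intro cochain_eqI[of h "Suc n" g]) auto
  ultimately have "?P (THE g. ?P g)" by (rule theI)
  moreover have "differential K A n f = (THE g. ?P g)"
    by (simp only: differential_def hochschild_def)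
  ultimately have "?P (differential K A n f)" by simp
  then show "differential K A n f \<in> carrier (cochains K A (Suc n))"
    "xs \<in> tuples A (Suc n) \<Longrightarrow> differential K A n f (ct xs) = hochschild K A n (\<lambda>xs. f (ct xs)) xs"
    by blast+
qed

text \<open>Sums and multiples of cochains equal the pointwise ones on tuples only. All arguments
  inside the formula are tuples, so that is sufficient.\<close>

lemma hochschild_cong:
  assumes xs: "xs \<in> tuples A (Suc n)" and eq: "\<And>ys. ys \<in> tuples A n \<Longrightarrow> G ys = G' ys"
    and G: "\<And>ys. ys \<in> tuples A n \<Longrightarrow> G' ys \<in> carrier A"
  shows "hochschild K A n G xs = hochschild K A n G' xs"
proof -
  have t: "tl xs \<in> tuples A n" "butlast xs \<in> tuples A n"
    using xs by (cases xs; auto simp: tuples_def dest: in_set_butlastD)+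
  have c: "contract A i xs \<in> tuples A n" if "i \<in> {1..n}" for i
    using contract_closed[OF xs, of "i - 1"] that by (cases i) simp_all
  have "(\<Oplus>\<^bsub>A\<^esub>i\<in>{1..n}. ((\<ominus> \<one>) [^] i) \<odot>\<^bsub>A\<^esub> G (contract A i xs)) =
      (\<Oplus>\<^bsub>A\<^esub>i\<in>{1..n}. ((\<ominus> \<one>) [^] i) \<odot>\<^bsub>A\<^esub> G' (contract A i xs))"
    using c eq G by (intro M.add.finprod_cong') auto
  then show ?thesis unfolding hochschild_def using eq t by simp
qed

lemma linear_differential: "linear_map K (cochains K A n) (cochains K A (Suc n)) (differential K A n)"
proof -
  interpret C: module K "cochains K A n" by (rule module_cochains)
  interpret D: module K "cochains K A (Suc n)" by (rule module_cochains)
  show ?thesis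
  proof (rule linear_mapI)
    fix f assume f: "f \<in> carrier (cochains K A n)"
    show "differential K A n f \<in> carrier (cochains K A (Suc n))" by (rule differential_closed[OF f])
    note fm = cochain_multilinear[OF f]
    show "differential K A n (f \<oplus>\<^bsub>cochains K A n\<^esub> g) =
       differential K A n f \<oplus>\<^bsub>cochains K A (Suc n)\<^esub> differential K A n g"
      if g: "g \<in> carrier (cochains K A n)" for g
    proof (rule cochain_eqI)
      fix xs assume xs: "xs \<in> tuples A (Suc n)"
      note gm = cochain_multilinear[OF g]
      have "hochschild K A n (\<lambda>xs. (f \<oplus>\<^bsub>cochains K A n\<^esub> g) (ct xs)) xs
        = hochschild K A n (\<lambda>xs. f (ct xs) \<oplus>\<^bsub>A\<^esub> g (ct xs)) xs"
        by (rule hochschild_cong[OF xs]) (simp_all add: cochain_add cochain_closed[OF f] cochain_closed[OF g])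
      then show "differential K A n (f \<oplus>\<^bsub>cochains K A n\<^esub> g) (ct xs) =
         (differential K A n f \<oplus>\<^bsub>cochains K A (Suc n)\<^esub> differential K A n g) (ct xs)"
        using f g xs by (simp add: differential_eval cochain_add hochschild_add[OF fm gm xs])
    qed (use f g differential_closed in auto)
    show "differential K A n (c \<odot>\<^bsub>cochains K A n\<^esub> f) = c \<odot>\<^bsub>cochains K A (Suc n)\<^esub> differential K A n f"
      if c: "c \<in> carrier K" for c
    proof (rule cochain_eqI)
      fix xs assume xs: "xs \<in> tuples A (Suc n)"
      have "hochschild K A n (\<lambda>xs. (c \<odot>\<^bsub>cochains K A n\<^esub> f) (ct xs)) xs
        = hochschild K A n (\<lambda>xs. c \<odot>\<^bsub>A\<^esub> f (ct xs)) xs"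
        by (rule hochschild_cong[OF xs]) (simp_all add: cochain_smult cochain_closed[OF f] c)
      then show "differential K A n (c \<odot>\<^bsub>cochains K A n\<^esub> f) (ct xs) =
         (c \<odot>\<^bsub>cochains K A (Suc n)\<^esub> differential K A n f) (ct xs)"
        using f c xs by (simp add: differential_eval cochain_smult hochschild_smult[OF fm c xs])
    qed (use f c differential_closed in auto)
  qed
qed

lemma cocycles_carrier:
  "carrier (cocycles K A n) =
    {f \<in> carrier (cochains K A n). differential K A n f \<in> {\<zero>\<^bsub>cochains K A (Suc n)\<^esub>}}"
  by (simp add: cocycles_def a_kernel_def kernel_def)

lemma cocycles_eq: "cocycles K A n = sub_space (cochains K A n) (carrier (cocycles K A n))"
  by (simp add: cocycles_def)

lemma cocycle_iff:
  "f \<in> carrier (cocycles K A n) \<longleftrightarrow> f \<in> carrier (cochains K A n) \<and>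
    (\<forall>xs\<in>tuples A (Suc n). hochschild K A n (\<lambda>xs. f (ct xs)) xs = \<zero>\<^bsub>A\<^esub>)"
proof -
  interpret D: module K "cochains K A (Suc n)" by (rule module_cochains)
  have "differential K A n f = \<zero>\<^bsub>cochains K A (Suc n)\<^esub> \<longleftrightarrow>
    (\<forall>xs\<in>tuples A (Suc n). hochschild K A n (\<lambda>xs. f (ct xs)) xs = \<zero>\<^bsub>A\<^esub>)"
    if f: "f \<in> carrier (cochains K A n)"
  proof
    assume "differential K A n f = \<zero>\<^bsub>cochains K A (Suc n)\<^esub>"
    then show "\<forall>xs\<in>tuples A (Suc n). hochschild K A n (\<lambda>xs. f (ct xs)) xs = \<zero>\<^bsub>A\<^esub>"
      using differential_eval[OF f] cochain_zero by metis
  next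
    assume "\<forall>xs\<in>tuples A (Suc n). hochschild K A n (\<lambda>xs. f (ct xs)) xs = \<zero>\<^bsub>A\<^esub>"
    then show "differential K A n f = \<zero>\<^bsub>cochains K A (Suc n)\<^esub>"
      using f differential_closed
      by (intro cochain_eqI[of _ "Suc n"]) (simp_all add: differential_eval cochain_zero)
  qed
  then show ?thesis unfolding cocycles_carrier by auto
qed

lemma submodule_cocycles: "submodule (carrier (cocycles K A n)) K (cochains K A n)"
proof -
  interpret D: module K "cochains K A (Suc n)" by (rule module_cochains)
  have "submodule {\<zero>\<^bsub>cochains K A (Suc n)\<^esub>} K (cochains K A (Suc n))"
    by (simp add: submodule_iff[OF module_cochains])
  then show ?thesis
    unfolding cocycles_carrier
    by (intro submodule_vimage[OF module_cochains module_cochains _ linear_differential]) simp_all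
qed

lemma module_cocycles: "module K (cocycles K A n)"
  by (subst cocycles_eq) (rule module_sub_space[OF module_cochains submodule_cocycles])

lemma cocycles_simps:
  "add (cocycles K A n) = add (cochains K A n)" "zero (cocycles K A n) = zero (cochains K A n)"
  "smult (cocycles K A n) = smult (cochains K A n)"
  "bornology (cocycles K A n) = {B \<in> bornology (cochains K A n). B \<subseteq> carrier (cocycles K A n)}"
  by (subst cocycles_eq, simp)+

lemma submodule_coboundaries: "submodule (coboundaries K A n) K (cochains K A n)"
proof (cases n)
  case 0
  interpret D: module K "cochains K A 0" by (rule module_cochains)
  show ?thesis using 0 by (simp add: coboundaries_def submodule_iff[OF module_cochains])
next
  case (Suc m)
  have "submodule (carrier (cochains K A m)) K (cochains K A m)"
    by (rule submodule_carrier[OF module_cochains]) simp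
  then show ?thesis
    using Suc submodule_image[OF module_cochains module_cochains _ linear_differential]
    by (simp add: coboundaries_def)
qed

text \<open>The identity \<delta>_1 \<delta>_0 = 0 on a pair, with a 0-cochain replaced by its value
  \<open>g\<close>; by associativity the terms cancel in pairs.\<close>

lemma hochschild_01:
  assumes "a \<in> carrier A" "b \<in> carrier A" "g \<in> carrier A"
  shows "(a \<otimes>\<^bsub>A\<^esub> (b \<otimes>\<^bsub>A\<^esub> g \<ominus>\<^bsub>A\<^esub> g \<otimes>\<^bsub>A\<^esub> b) \<ominus>\<^bsub>A\<^esub> ((a \<otimes>\<^bsub>A\<^esub> b) \<otimes>\<^bsub>A\<^esub> g \<ominus>\<^bsub>A\<^esub> g \<otimes>\<^bsub>A\<^esub> (a \<otimes>\<^bsub>A\<^esub> b)))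
      \<oplus>\<^bsub>A\<^esub> (a \<otimes>\<^bsub>A\<^esub> g \<ominus>\<^bsub>A\<^esub> g \<otimes>\<^bsub>A\<^esub> a) \<otimes>\<^bsub>A\<^esub> b = \<zero>\<^bsub>A\<^esub>"
  using assms
  by (simp add: M.minus_eq A.l_distr A.r_distr A.l_minus A.r_minus A.m_assoc M.minus_add
      M.a_ac M.r_neg M.l_neg M.r_neg1 M.r_neg2)

lemma coboundaries_1_subset: "coboundaries K A 1 \<subseteq> carrier (cocycles K A 1)"
proof
  fix f assume "f \<in> coboundaries K A 1"
  then obtain g where g: "g \<in> carrier (cochains K A 0)" "f = differential K A 0 g"
    by (auto simp: coboundaries_def)
  have gc: "g (ct []) \<in> carrier A" using cochain_closed[OF g(1)] by simp
  have fe: "f (ct [a]) = a \<otimes>\<^bsub>A\<^esub> g (ct []) \<ominus>\<^bsub>A\<^esub> g (ct []) \<otimes>\<^bsub>A\<^esub> a" if "a \<in> carrier A" for a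
    unfolding g(2) using that gc by (simp add: differential_eval[OF g(1)] tuples_Suc hochschild_0)
  have f: "f \<in> carrier (cochains K A 1)" unfolding g(2) using differential_closed[OF g(1)] by simp
  have "hochschild K A 1 (\<lambda>xs. f (ct xs)) [a, b] = \<zero>\<^bsub>A\<^esub>" if "a \<in> carrier A" "b \<in> carrier A" for a b
    using that gc by (subst hochschild_1) (simp_all add: fe hochschild_01)
  then show "f \<in> carrier (cocycles K A 1)"
    unfolding cocycle_iff using f by (auto simp: tuples_Suc)
qed

text \<open>The identity \<delta>_2 \<delta>_1 = 0 on a triple, where \<open>F\<close> stands for
  \<delta>_1 of \<open>g\<close>.\<close>

lemma hochschild_12:
  assumes abc: "a \<in> carrier A" "b \<in> carrier A" "c \<in> carrier A"
    and g: "\<And>x. x \<in> carrier A \<Longrightarrow> g x \<in> carrier A"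
    and F: "\<And>x y. x \<in> carrier A \<Longrightarrow> y \<in> carrier A \<Longrightarrow>
      F x y = (x \<otimes>\<^bsub>A\<^esub> g y \<ominus>\<^bsub>A\<^esub> g (x \<otimes>\<^bsub>A\<^esub> y)) \<oplus>\<^bsub>A\<^esub> g x \<otimes>\<^bsub>A\<^esub> y"
  shows "((a \<otimes>\<^bsub>A\<^esub> F b c \<ominus>\<^bsub>A\<^esub> F (a \<otimes>\<^bsub>A\<^esub> b) c) \<oplus>\<^bsub>A\<^esub> F a (b \<otimes>\<^bsub>A\<^esub> c)) \<ominus>\<^bsub>A\<^esub> F a b \<otimes>\<^bsub>A\<^esub> c = \<zero>\<^bsub>A\<^esub>"
    (is "?lhs = _")
proof -
  \<comment> \<open>The six distinct terms of the expansion, each of which occurs once with each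
    sign; the whole expression is therefore \<open>?s\<close> minus itself.\<close>
  let ?s = "a \<otimes>\<^bsub>A\<^esub> (b \<otimes>\<^bsub>A\<^esub> g c) \<oplus>\<^bsub>A\<^esub> (a \<otimes>\<^bsub>A\<^esub> (g b \<otimes>\<^bsub>A\<^esub> c) \<oplus>\<^bsub>A\<^esub> (a \<otimes>\<^bsub>A\<^esub> g (b \<otimes>\<^bsub>A\<^esub> c) \<oplus>\<^bsub>A\<^esub>
    (g a \<otimes>\<^bsub>A\<^esub> (b \<otimes>\<^bsub>A\<^esub> c) \<oplus>\<^bsub>A\<^esub> (g (a \<otimes>\<^bsub>A\<^esub> b) \<otimes>\<^bsub>A\<^esub> c \<oplus>\<^bsub>A\<^esub> g (a \<otimes>\<^bsub>A\<^esub> (b \<otimes>\<^bsub>A\<^esub> c))))))"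
  have s: "?s \<in> carrier A" using abc g by simp
  have "?lhs = ?s \<oplus>\<^bsub>A\<^esub> \<ominus>\<^bsub>A\<^esub> ?s"
    using abc g
    by (simp add: F M.minus_eq A.l_distr A.r_distr A.l_minus A.r_minus A.m_assoc M.minus_add M.a_ac)
  then show ?thesis using M.r_neg[OF s] by simp
qed

lemma coboundaries_2_subset: "coboundaries K A 2 \<subseteq> carrier (cocycles K A 2)"
proof
  fix f assume "f \<in> coboundaries K A 2"
  then obtain g where g: "g \<in> carrier (cochains K A 1)" "f = differential K A 1 g"
    by (auto simp: coboundaries_def numeral_2_eq_2)
  have gc: "g (ct [x]) \<in> carrier A" if "x \<in> carrier A" for x
    using cochain_closed[OF g(1), of "[x]"] that by (simp add: tuples_Suc)
  have fe: "f (ct [a, b]) = (a \<otimes>\<^bsub>A\<^esub> g (ct [b]) \<ominus>\<^bsub>A\<^esub> g (ct [a \<otimes>\<^bsub>A\<^esub> b])) \<oplus>\<^bsub>A\<^esub> g (ct [a]) \<otimes>\<^bsub>A\<^esub> b"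
    if "a \<in> carrier A" "b \<in> carrier A" for a b
  proof -
    have "[a, b] \<in> tuples A (Suc 1)" using that by (simp add: tuples_Suc)
    then show ?thesis unfolding g(2) differential_eval[OF g(1)]
      using that gc by (subst differential_eval[OF g(1)]) (simp_all add: hochschild_1[simplified])
  qed
  have f: "f \<in> carrier (cochains K A 2)"
    unfolding g(2) using differential_closed[OF g(1)] by (simp add: numeral_2_eq_2)
  have fc: "f (ct [x, y]) \<in> carrier A" if "x \<in> carrier A" "y \<in> carrier A" for x y
    using cochain_closed[OF f, of "[x, y]"] that by (simp add: tuples_2)
  have "hochschild K A 2 (\<lambda>xs. f (ct xs)) [a, b, c] = \<zero>\<^bsub>A\<^esub>"
    if "a \<in> carrier A" "b \<in> carrier A" "c \<in> carrier A" for a b c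
    using that fc hochschild_12[of a b c "\<lambda>x. g (ct [x])" "\<lambda>x y. f (ct [x, y])"] gc fe
    by (subst hochschild_2) simp_all
  then show "f \<in> carrier (cocycles K A 2)"
    unfolding cocycle_iff using f by (auto simp: tuples_3)
qed

lemma submodule_coboundaries_cocycles:
  assumes "coboundaries K A n \<subseteq> carrier (cocycles K A n)"
  shows "submodule (coboundaries K A n) K (cocycles K A n)"
  using submodule_sub_space_iff[OF module_cochains submodule_cocycles assms] submodule_coboundaries
    cocycles_eq[of n] by simp

section \<open>Degree zero: the center\<close>

theorem HH_0:
  "\<exists>\<Phi>. born_iso K (HH K A 0) (algebra_center A) \<Phi> \<and>
     (\<forall>f\<in>carrier (cocycles K A 0). \<Phi> (cohomology_class K A 0 f) = f (ct []))"
proof -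
  let ?Z = "{z \<in> carrier A. \<forall>a\<in>carrier A. a \<otimes>\<^bsub>A\<^esub> z = z \<otimes>\<^bsub>A\<^esub> a}"
  interpret C: module K "cochains K A 0" by (rule module_cochains)
  have Z: "submodule ?Z K A"
    by (simp add: submodule_iff[OF module_V] A.l_distr A.r_distr smult_mult)
  have ev: "f (ct []) \<in> carrier A" if "f \<in> carrier (cochains K A 0)" for f
    using cochain_closed[OF that] by simp
  have cocycle: "f \<in> carrier (cocycles K A 0) \<longleftrightarrow> f \<in> carrier (cochains K A 0) \<and> f (ct []) \<in> ?Z" for f
  proof -
    have "hochschild K A 0 (\<lambda>xs. f (ct xs)) [a] = \<zero>\<^bsub>A\<^esub> \<longleftrightarrow> a \<otimes>\<^bsub>A\<^esub> f (ct []) = f (ct []) \<otimes>\<^bsub>A\<^esub> a"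
      if "f \<in> carrier (cochains K A 0)" "a \<in> carrier A" for a
      using that ev by (simp add: hochschild_0 M.minus_eq_zero_iff)
    then show ?thesis unfolding cocycle_iff using ev by (auto simp: tuples_Suc)
  qed
  have ex: "\<exists>f\<in>carrier (cocycles K A 0). f (ct []) = z" if z: "z \<in> ?Z" for z
  proof -
    have "bounded_multilinear K A 0 A (\<lambda>_. z)"
      using z bounded_singleton by (simp add: bounded_multilinear_0)
    then obtain f where "f \<in> carrier (cochains K A 0)" "\<forall>xs\<in>tuples A 0. f (ct xs) = z"
      by (rule cochain_extend)
    then show ?thesis using z by (intro bexI[of _ f]) (auto simp: cocycle)
  qed
  \<comment> \<open>With no tensor factors the only box is the one containing just the empty list,
    so a family is bounded exactly when its set of values is.\<close>
  have bdd: "U \<in> bornology (cocycles K A 0) \<longleftrightarrow>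
      U \<subseteq> carrier (cocycles K A 0) \<and> (\<lambda>f. f (ct [])) ` U \<in> bornology A" for U
  proof -
    have "(\<Union>f\<in>U. {f (ct [])}) = (\<lambda>f. f (ct [])) ` U" by blast
    then show ?thesis
      using cocycle by (auto simp: cocycles_simps(4) cochains_bounded_iff)
  qed
  obtain \<Phi> where \<Phi>: "born_iso K (quotient_space (cocycles K A 0) (coboundaries K A 0)) (algebra_center A) \<Phi>"
    "\<forall>f\<in>carrier (cocycles K A 0). \<Phi> (coboundaries K A 0 +>\<^bsub>cocycles K A 0\<^esub> f) = f (ct [])"
  proof (rule born_iso_quotient)
    show "module K (cocycles K A 0)" by (rule module_cocycles)
    show "module K (algebra_center A)"
      unfolding algebra_center_def by (rule module_sub_space[OF module_V Z])
    have "coboundaries K A 0 \<subseteq> carrier (cocycles K A 0)"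
      using submodule_zero[OF module_cochains _ submodule_cocycles] by (simp add: coboundaries_def)
    then show "submodule (coboundaries K A 0) K (cocycles K A 0)"
      by (rule submodule_coboundaries_cocycles)
    show "linear_map K (cocycles K A 0) (algebra_center A) (\<lambda>f. f (ct []))"
      by (rule linear_mapI) (auto simp: algebra_center_def cocycle cocycles_simps cochain_add cochain_smult)
    show "(\<lambda>f. f (ct [])) ` carrier (cocycles K A 0) = carrier (algebra_center A)"
    proof
      show "carrier (algebra_center A) \<subseteq> (\<lambda>f. f (ct [])) ` carrier (cocycles K A 0)"
        using ex unfolding algebra_center_def by (auto simp: image_iff)
    qed (auto simp: algebra_center_def cocycle)
    \<comment> \<open>There are no coboundaries besides zero, so this is injectivity of the
      evaluation: a 0-cochain is determined by its value at the empty tensor.\<close>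
    show "f (ct []) = \<zero>\<^bsub>algebra_center A\<^esub> \<longleftrightarrow> f \<in> coboundaries K A 0" if "f \<in> carrier (cocycles K A 0)" for f
    proof
      assume "f (ct []) = \<zero>\<^bsub>algebra_center A\<^esub>"
      then have "f = \<zero>\<^bsub>cochains K A 0\<^esub>"
        using that cocycle by (intro cochain_eqI[of f 0]) (simp_all add: cochain_zero algebra_center_def)
      then show "f \<in> coboundaries K A 0" by (simp add: coboundaries_def)
    qed (simp add: coboundaries_def cochain_zero algebra_center_def)
    show "B \<subseteq> carrier (cocycles K A 0)" if "B \<in> bornology (cocycles K A 0)" for B
      using that by (simp add: cocycles_simps(4))
    show "bornology (algebra_center A) = (\<lambda>B. (\<lambda>f. f (ct [])) ` B) ` bornology (cocycles K A 0)"
    proof (intro equalityI subsetI)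
      fix B assume "B \<in> bornology (algebra_center A)"
      then have B: "B \<in> bornology A" "B \<subseteq> ?Z" by (simp_all add: algebra_center_def)
      \<comment> \<open>The full preimage of \<open>B\<close>; by surjectivity its values fill
        \<open>B\<close>, which also makes it bounded.\<close>
      let ?U = "{f \<in> carrier (cocycles K A 0). f (ct []) \<in> B}"
      have "(\<lambda>f. f (ct [])) ` ?U = B"
      proof
        show "B \<subseteq> (\<lambda>f. f (ct [])) ` ?U"
        proof
          fix b assume b: "b \<in> B"
          then obtain f where "f \<in> carrier (cocycles K A 0)" "f (ct []) = b" using ex B(2) by blast
          then show "b \<in> (\<lambda>f. f (ct [])) ` ?U" using b by blast
        qed
      qed auto
      moreover from this have "?U \<in> bornology (cocycles K A 0)" using B(1) by (simp add: bdd)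
      ultimately show "B \<in> (\<lambda>B. (\<lambda>f. f (ct [])) ` B) ` bornology (cocycles K A 0)" by blast
    next
      fix B assume "B \<in> (\<lambda>B. (\<lambda>f. f (ct [])) ` B) ` bornology (cocycles K A 0)"
      then obtain U where U: "B = (\<lambda>f. f (ct [])) ` U" "B \<in> bornology A" "U \<subseteq> carrier (cocycles K A 0)"
        by (auto simp: bdd)
      then have "B \<subseteq> ?Z" using cocycle by blast
      then show "B \<in> bornology (algebra_center A)" using U(2) by (simp add: algebra_center_def)
    qed
  qed
  then show ?thesis unfolding HH_def cohomology_class_def by blast
qed

section \<open>Degree one: derivations\<close>

lemma module_hom_A: "module K (hom_space K A A)"
  by (rule module_hom_space[OF module_V bounded_subset_carrier])

text \<open>Restricted to the carrier because members of \<open>hom_space\<close> are extensional;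
  only then is the passage from 1-cochains to maps a bijection.\<close>

definition linearize :: "(('k, 'a) ctensor \<Rightarrow> 'a) \<Rightarrow> 'a \<Rightarrow> 'a" where
  "linearize f = (\<lambda>a\<in>carrier A. f (ct [a]))"

lemma linearize_apply: "a \<in> carrier A \<Longrightarrow> linearize f a = f (ct [a])"
  by (simp add: linearize_def)

lemma linearize_closed:
  assumes f: "f \<in> carrier (cochains K A 1)"
  shows "linearize f \<in> carrier (hom_space K A A)"
proof -
  have b: "bounded_linear_map K A A (\<lambda>a. f (ct [a]))"
    using cochain_multilinear[OF f] unfolding bounded_multilinear_1[OF bornological_axioms] .
  have "bounded_linear_map K A A (linearize f)"
  proof (rule bounded_linear_mapI)
    show "linear_map K A A (linearize f)"
      by (rule linear_map_cong[OF bounded_linear_map_linear[OF b] _ module_V]) (rule linearize_apply)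
    fix B assume B: "B \<in> bornology A"
    have "linearize f ` B = (\<lambda>a. f (ct [a])) ` B"
      using bounded_subset_carrier[OF B] linearize_apply by (intro image_cong) auto
    then show "linearize f ` B \<in> bornology A" using bounded_linear_map_bounded[OF b B] by simp
  qed
  then show ?thesis by (simp add: hom_space_simps linearize_def)
qed

lemma linearize_inj:
  assumes "f \<in> carrier (cochains K A 1)" "g \<in> carrier (cochains K A 1)" "linearize f = linearize g"
  shows "f = g"
proof (rule cochain_eqI[OF assms(1,2)])
  fix xs assume "xs \<in> tuples A 1"
  then obtain a where "a \<in> carrier A" "xs = [a]" by (auto simp: tuples_Suc)
  then show "f (ct xs) = g (ct xs)" using linearize_apply[of a] assms(3) by metis
qed

lemma linearize_surj:
  assumes "h \<in> carrier (hom_space K A A)"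
  obtains f where "f \<in> carrier (cochains K A 1)" "linearize f = h"
proof -
  have h: "bounded_linear_map K A A h" "h \<in> extensional (carrier A)"
    using assms by (simp_all add: hom_space_simps)
  have "bounded_multilinear K A 1 A (\<lambda>xs. h (hd xs))"
    unfolding bounded_multilinear_1[OF bornological_axioms] using h(1) by simp
  then obtain f where f: "f \<in> carrier (cochains K A 1)" "\<forall>xs\<in>tuples A 1. f (ct xs) = h (hd xs)"
    by (rule cochain_extend)
  have "linearize f = h"
    using h(2) f(2) by (intro extensionalityI[where A = "carrier A"]) (simp_all add: linearize_def tuples_Suc)
  then show ?thesis using f(1) that by blast
qed

lemma linear_linearize: "linear_map K (cochains K A 1) (hom_space K A A) linearize"
proof (rule linear_mapI)
  have t: "[a] \<in> tuples A 1" if "a \<in> carrier A" for a using that by (simp add: tuples_Suc)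
  show "linearize (f \<oplus>\<^bsub>cochains K A 1\<^esub> g) = linearize f \<oplus>\<^bsub>hom_space K A A\<^esub> linearize g" for f g
    using t by (auto simp: hom_space_simps(2) linearize_def fun_eq_iff cochain_add[of _ "Suc 0"])
  show "linearize (c \<odot>\<^bsub>cochains K A 1\<^esub> f) = c \<odot>\<^bsub>hom_space K A A\<^esub> linearize f" for c f
    using t by (auto simp: hom_space_simps(4) linearize_def fun_eq_iff cochain_smult[of _ "Suc 0"])
qed (rule linearize_closed)

text \<open>Boxes with one factor are bounded submodules, and every bounded set lies in such a
  submodule, so the two notions of equiboundedness coincide.\<close>

lemma linearize_bounded_iff:
  assumes U: "U \<subseteq> carrier (cochains K A 1)"
  shows "linearize ` U \<in> bornology (hom_space K A A) \<longleftrightarrow> U \<in> bornology (cochains K A 1)"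
proof -
  have img: "(\<Union>f\<in>U. (\<lambda>xs. f (ct xs)) ` listset [B]) = (\<Union>f\<in>linearize ` U. f ` B)"
    if "B \<subseteq> carrier A" for B
  proof -
    have "(\<lambda>xs. f (ct xs)) ` listset [B] = linearize f ` B" for f
    proof -
      have "listset [B] = (\<lambda>a. [a]) ` B" by (auto simp: set_Cons_def)
      then show ?thesis unfolding image_image using that
        by (simp add: image_image) (intro image_cong refl, auto simp: linearize_apply)
    qed
    then show ?thesis by simp
  qed
  have sub: "linearize ` U \<subseteq> carrier (hom_space K A A)" using U linearize_closed by blast
  show ?thesis
  proof
    assume l: "linearize ` U \<in> bornology (hom_space K A A)"
    show "U \<in> bornology (cochains K A 1)"
      unfolding cochains_bounded_iff
    proof (intro conjI allI impI U)
      fix Bs assume Bs: "length Bs = 1 \<and> set Bs \<subseteq> bounded_submodules K A"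
      then obtain B where B: "Bs = [B]" "B \<in> bounded_submodules K A" by (auto simp: length_Suc_conv)
      show "(\<Union>f\<in>U. (\<lambda>xs. f (ct xs)) ` listset Bs) \<in> bornology A"
        unfolding B(1) img[OF bsub_subset[OF B(2)]]
        using l bsub_bounded[OF B(2)] by (simp add: hom_space_simps(5))
    qed
  next
    assume r: "U \<in> bornology (cochains K A 1)"
    have "(\<Union>f\<in>linearize ` U. f ` B) \<in> bornology A" if B: "B \<in> bornology A" for B
    proof -
      obtain S where S: "S \<in> bounded_submodules K A" "B \<subseteq> S" using B by (rule bounded_obtain_bsub)
      have "(\<Union>f\<in>U. (\<lambda>xs. f (ct xs)) ` listset [S]) \<in> bornology A"
        using r[unfolded cochains_bounded_iff, THEN conjunct2, rule_format, of "[S]"] S(1) by simp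
      then have "(\<Union>f\<in>linearize ` U. f ` S) \<in> bornology A"
        unfolding img[OF bsub_subset[OF S(1)]] .
      then show ?thesis by (rule bounded_mono) (use S(2) in blast)
    qed
    then show "linearize ` U \<in> bornology (hom_space K A A)"
      using sub by (simp add: hom_space_simps(5))
  qed
qed

lemma derivations_simps:
  "carrier (derivations K A) = {f \<in> carrier (hom_space K A A). \<forall>a\<in>carrier A. \<forall>b\<in>carrier A.
        f (a \<otimes>\<^bsub>A\<^esub> b) = a \<otimes>\<^bsub>A\<^esub> f b \<oplus>\<^bsub>A\<^esub> f a \<otimes>\<^bsub>A\<^esub> b}"
  "derivations K A = sub_space (hom_space K A A) (carrier (derivations K A))"
  by (simp_all add: derivations_def)

lemma cocycle_1_iff:
  assumes f: "f \<in> carrier (cochains K A 1)"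
  shows "f \<in> carrier (cocycles K A 1) \<longleftrightarrow> linearize f \<in> carrier (derivations K A)"
proof -
  have fc: "f (ct [x]) \<in> carrier A" if "x \<in> carrier A" for x
    using cochain_closed[OF f, of "[x]"] that by (simp add: tuples_Suc)
  have "hochschild K A 1 (\<lambda>xs. f (ct xs)) [a, b] = \<zero>\<^bsub>A\<^esub> \<longleftrightarrow>
     f (ct [a \<otimes>\<^bsub>A\<^esub> b]) = a \<otimes>\<^bsub>A\<^esub> f (ct [b]) \<oplus>\<^bsub>A\<^esub> f (ct [a]) \<otimes>\<^bsub>A\<^esub> b"
    if ab: "a \<in> carrier A" "b \<in> carrier A" for a b
  proof -
    have h: "hochschild K A 1 (\<lambda>xs. f (ct xs)) [a, b] =
      (a \<otimes>\<^bsub>A\<^esub> f (ct [b]) \<oplus>\<^bsub>A\<^esub> f (ct [a]) \<otimes>\<^bsub>A\<^esub> b) \<ominus>\<^bsub>A\<^esub> f (ct [a \<otimes>\<^bsub>A\<^esub> b])"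
      using ab fc by (subst hochschild_1) (simp_all add: M.minus_eq M.a_ac)
    show ?thesis
      unfolding h using ab fc by (subst M.minus_eq_zero_iff) (simp_all add: eq_commute)
  qed
  moreover have "(\<forall>xs\<in>tuples A (Suc 1). P xs) \<longleftrightarrow> (\<forall>a\<in>carrier A. \<forall>b\<in>carrier A. P [a, b])" for P
    by (auto simp: tuples_Suc)
  ultimately show ?thesis
    unfolding cocycle_iff derivations_simps(1) using f linearize_closed[OF f]
    by (simp add: linearize_apply)
qed

text \<open>The coboundary of a 0-cochain is the commutator with its value at the empty tensor, and
  every element of \<open>A\<close> is such a value.\<close>

lemma coboundaries_1_image: "linearize ` coboundaries K A 1 = carrier (inner_derivations K A)"
proof -
  have d: "linearize (differential K A 0 g) = (\<lambda>a\<in>carrier A. a \<otimes>\<^bsub>A\<^esub> g (ct []) \<ominus>\<^bsub>A\<^esub> g (ct []) \<otimes>\<^bsub>A\<^esub> a)"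
    if g: "g \<in> carrier (cochains K A 0)" for g
  proof -
    have "g (ct []) \<in> carrier A" using cochain_closed[OF g] by simp
    then show ?thesis
      by (auto simp: linearize_def fun_eq_iff differential_eval[OF g] tuples_Suc hochschild_0)
  qed
  have "\<exists>g\<in>carrier (cochains K A 0). g (ct []) = m" if "m \<in> carrier A" for m
  proof -
    have "bounded_multilinear K A 0 A (\<lambda>_. m)"
      using that bounded_singleton by (simp add: bounded_multilinear_0)
    then obtain g where "g \<in> carrier (cochains K A 0)" "\<forall>xs\<in>tuples A 0. g (ct xs) = m"
      by (rule cochain_extend)
    then show ?thesis by (intro bexI[of _ g]) auto
  qed
  then have ev: "(\<lambda>g. g (ct [])) ` carrier (cochains K A 0) = carrier A"
    using cochain_closed[of _ 0 "[]"] by (auto simp: image_iff)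
  have "linearize ` coboundaries K A 1 =
     (\<lambda>m. \<lambda>a\<in>carrier A. a \<otimes>\<^bsub>A\<^esub> m \<ominus>\<^bsub>A\<^esub> m \<otimes>\<^bsub>A\<^esub> a) ` (\<lambda>g. g (ct [])) ` carrier (cochains K A 0)"
    unfolding image_image using d by (simp add: coboundaries_def image_image)
  also have "\<dots> = carrier (inner_derivations K A)"
    unfolding ev inner_derivations_def by auto
  finally show ?thesis .
qed

text \<open>\<open>linearize\<close> carries cocycles, coboundaries and bounded families to
  derivations, inner derivations and bounded families. Followed by the coset map it has exactly the
  coboundaries as kernel.\<close>

theorem HH_1:
  "\<exists>\<Phi>. born_iso K (HH K A 1) (outer_derivations K A) \<Phi> \<and>
     (\<forall>f\<in>carrier (cocycles K A 1). \<Phi> (cohomology_class K A 1 f) =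
        carrier (inner_derivations K A) +>\<^bsub>derivations K A\<^esub> (\<lambda>a\<in>carrier A. f (ct [a])))"
proof -
  let ?D = "derivations K A" and ?I = "carrier (inner_derivations K A)"
  have lin: "linear_map K (cocycles K A 1) (hom_space K A A) linearize"
    using linear_linearize cocycle_iff by (simp add: linear_map_def cocycles_simps)
  have Der: "linearize ` carrier (cocycles K A 1) = carrier ?D"
  proof (intro equalityI subsetI)
    fix h assume h: "h \<in> carrier ?D"
    then have "h \<in> carrier (hom_space K A A)" by (simp add: derivations_simps(1))
    then obtain f where f: "f \<in> carrier (cochains K A 1)" "linearize f = h" by (rule linearize_surj)
    then have "f \<in> carrier (cocycles K A 1)" using h f(2) cocycle_1_iff[OF f(1)] by blast
    then show "h \<in> linearize ` carrier (cocycles K A 1)" using f(2) by blast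
  next
    fix h assume "h \<in> linearize ` carrier (cocycles K A 1)"
    then obtain f where f: "f \<in> carrier (cocycles K A 1)" "h = linearize f" by blast
    then have "f \<in> carrier (cochains K A 1)" by (simp add: cocycle_iff)
    then show "h \<in> carrier ?D" using cocycle_1_iff f by blast
  qed
  have mc: "module K (cocycles K A 1)" by (rule module_cocycles)
  have cs: "submodule (carrier (cocycles K A 1)) K (cocycles K A 1)"
    by (rule submodule_carrier[OF mc]) simp
  \<comment> \<open>Derivations form a subspace as the linear image of the cocycles, so the Leibniz
    rule does not have to be checked for sums and multiples. Inner derivations are treated
    alike.\<close>
  have Ds: "submodule (carrier ?D) K (hom_space K A A)"
    using submodule_image[OF mc module_hom_A _ lin cs] Der by simp
  have mD: "module K ?D" by (subst derivations_simps(2)) (rule module_sub_space[OF module_hom_A Ds])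
  have bs: "submodule (coboundaries K A 1) K (cocycles K A 1)"
    by (rule submodule_coboundaries_cocycles[OF coboundaries_1_subset])
  have Is: "submodule ?I K (hom_space K A A)"
    using submodule_image[OF mc module_hom_A _ lin bs] coboundaries_1_image by simp
  have ID: "?I \<subseteq> carrier ?D"
    using coboundaries_1_subset Der coboundaries_1_image by blast
  have Is: "submodule ?I K ?D"
    using submodule_sub_space_iff[OF module_hom_A Ds ID] Is derivations_simps(2) by simp
  have linD: "linear_map K (cocycles K A 1) ?D linearize"
    using lin Der by (subst derivations_simps(2)) (auto simp: linear_map_def)
  have bornD: "bornology ?D = (\<lambda>B. linearize ` B) ` bornology (cocycles K A 1)"
  proof (intro equalityI subsetI)
    fix S assume "S \<in> bornology ?D"
    then have S: "S \<in> bornology (hom_space K A A)" "S \<subseteq> carrier ?D"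
      by (simp_all add: derivations_def)
    \<comment> \<open>The full preimage of \<open>S\<close> maps onto \<open>S\<close>, and it is
      bounded because \<open>linearize\<close> detects boundedness.\<close>
    let ?U = "{f \<in> carrier (cocycles K A 1). linearize f \<in> S}"
    have U: "linearize ` ?U = S"
    proof
      show "S \<subseteq> linearize ` ?U"
      proof
        fix s assume s: "s \<in> S"
        then obtain f where "f \<in> carrier (cocycles K A 1)" "s = linearize f" using S(2) Der by blast
        then show "s \<in> linearize ` ?U" using s by blast
      qed
    qed auto
    have "?U \<subseteq> carrier (cochains K A 1)" by (auto simp: cocycle_iff)
    then have "?U \<in> bornology (cochains K A 1)" using linearize_bounded_iff[of ?U] U S(1) by simp
    then have "?U \<in> bornology (cocycles K A 1)" by (simp add: cocycles_simps(4))
    then show "S \<in> (\<lambda>B. linearize ` B) ` bornology (cocycles K A 1)" using U by blast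
  next
    fix S assume "S \<in> (\<lambda>B. linearize ` B) ` bornology (cocycles K A 1)"
    then obtain U where U: "S = linearize ` U" "U \<in> bornology (cochains K A 1)"
      "U \<subseteq> carrier (cocycles K A 1)" by (auto simp: cocycles_simps(4))
    then have "U \<subseteq> carrier (cochains K A 1)" by (auto simp: cocycle_iff)
    then have "S \<in> bornology (hom_space K A A)" using linearize_bounded_iff U(1,2) by simp
    moreover have "S \<subseteq> carrier ?D" using U Der by blast
    ultimately show "S \<in> bornology ?D" by (subst derivations_simps(2)) simp
  qed
  interpret Q: module_quotient K ?D ?I
    by (intro module_quotient.intro module_quotient_axioms.intro mD Is)
  let ?\<pi> = "\<lambda>f. ?I +>\<^bsub>?D\<^esub> linearize f"
  have lc: "linearize f \<in> carrier ?D" if "f \<in> carrier (cocycles K A 1)" for f using that Der by blast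
  obtain \<Phi> where "born_iso K (quotient_space (cocycles K A 1) (coboundaries K A 1)) (outer_derivations K A) \<Phi>"
    "\<forall>f\<in>carrier (cocycles K A 1). \<Phi> (coboundaries K A 1 +>\<^bsub>cocycles K A 1\<^esub> f) = ?\<pi> f"
  proof (rule born_iso_quotient[where \<pi> = ?\<pi>])
    show "module K (outer_derivations K A)"
      unfolding outer_derivations_def quotient_space_def by (rule module_with_bornology[OF Q.module_Q])
    show "linear_map K (cocycles K A 1) (outer_derivations K A) ?\<pi>"
      unfolding outer_derivations_def quotient_space_def
      using linear_map_comp[OF linD Q.linear_coset] by simp
    show "?\<pi> ` carrier (cocycles K A 1) = carrier (outer_derivations K A)"
    proof -
      have "carrier (outer_derivations K A) = (\<lambda>x. ?I +>\<^bsub>?D\<^esub> x) ` linearize ` carrier (cocycles K A 1)"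
        unfolding Der by (simp add: outer_derivations_def quotient_space_def Q.carrier_Q)
      then show ?thesis by (simp add: image_image)
    qed
    show "?\<pi> f = \<zero>\<^bsub>outer_derivations K A\<^esub> \<longleftrightarrow> f \<in> coboundaries K A 1"
      if f: "f \<in> carrier (cocycles K A 1)" for f
    proof -
      have "?\<pi> f = \<zero>\<^bsub>outer_derivations K A\<^esub> \<longleftrightarrow> ?I +>\<^bsub>?D\<^esub> linearize f = ?I +>\<^bsub>?D\<^esub> \<zero>\<^bsub>?D\<^esub>"
        by (simp add: outer_derivations_def quotient_space_def Q.zero_Q)
      also have "\<dots> \<longleftrightarrow> linearize f \<in> ?I"
        using Q.coset_eq_iff[OF lc[OF f] Q.M.zero_closed] lc[OF f] by (simp add: Q.M.minus_zero_right)
      also have "\<dots> \<longleftrightarrow> f \<in> coboundaries K A 1"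
      proof
        assume "linearize f \<in> ?I"
        then obtain g where g: "g \<in> coboundaries K A 1" "linearize f = linearize g"
          unfolding coboundaries_1_image[symmetric] by blast
        have "g \<in> carrier (cochains K A 1)" "f \<in> carrier (cochains K A 1)"
          using g(1) coboundaries_1_subset f by (auto simp: cocycle_iff)
        then show "f \<in> coboundaries K A 1" using linearize_inj g by metis
      qed (use coboundaries_1_image in blast)
      finally show ?thesis .
    qed
    show "B \<subseteq> carrier (cocycles K A 1)" if "B \<in> bornology (cocycles K A 1)" for B
      using that by (simp add: cocycles_simps(4))
    show "bornology (outer_derivations K A) = (\<lambda>B. ?\<pi> ` B) ` bornology (cocycles K A 1)"
    proof -
      have "bornology (outer_derivations K A) = (\<lambda>B. (\<lambda>x. ?I +>\<^bsub>?D\<^esub> x) ` B) ` bornology ?D"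
        by (auto simp: outer_derivations_def quotient_space_def)
      then show ?thesis unfolding bornD by (simp add: image_image)
    qed
  qed (rule mc bs)+
  then show ?thesis unfolding HH_def cohomology_class_def linearize_def by blast
qed

end

section \<open>Infinitesimal deformations\<close>

definition square_zero_extension :: "('k, 'a) born_space \<Rightarrow> ('a \<Rightarrow> 'a \<Rightarrow> 'a) \<Rightarrow> ('k, 'a \<times> 'a) born_space" where
  "square_zero_extension A g = (dual_numbers A)
    \<lparr>mult := \<lambda>(a, b) (c, d). (a \<otimes>\<^bsub>A\<^esub> c, (g a c \<oplus>\<^bsub>A\<^esub> a \<otimes>\<^bsub>A\<^esub> d) \<oplus>\<^bsub>A\<^esub> b \<otimes>\<^bsub>A\<^esub> c),
     one := (\<one>\<^bsub>A\<^esub>, \<ominus>\<^bsub>A\<^esub> g \<one>\<^bsub>A\<^esub> \<one>\<^bsub>A\<^esub>)\<rparr>"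

text \<open>Forgets the product and the unit, so that the module structure, bornology and
  completeness of \<open>A + A t\<close> are available before the product is known to be a ring
  structure.\<close>

definition dual_like :: "('k, 'a) born_space \<Rightarrow> ('k, 'a \<times> 'a) born_space \<Rightarrow> bool" where
  "dual_like A B \<longleftrightarrow> (\<exists>m e. B = (dual_numbers A)\<lparr>mult := m, one := e\<rparr>)"

lemma dual_like_simps:
  assumes "dual_like A B"
  shows "carrier B = carrier A \<times> carrier A" "\<zero>\<^bsub>B\<^esub> = (\<zero>\<^bsub>A\<^esub>, \<zero>\<^bsub>A\<^esub>)"
    "(a, b) \<oplus>\<^bsub>B\<^esub> (a', b') = (a \<oplus>\<^bsub>A\<^esub> a', b \<oplus>\<^bsub>A\<^esub> b')"
    "c \<odot>\<^bsub>B\<^esub> (a, b) = (c \<odot>\<^bsub>A\<^esub> a, c \<odot>\<^bsub>A\<^esub> b)"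
    "S \<in> bornology B \<longleftrightarrow> S \<subseteq> carrier A \<times> carrier A \<and> fst ` S \<in> bornology A \<and> snd ` S \<in> bornology A"
  using assms by (auto simp: dual_like_def dual_numbers_def)

section \<open>Completeness of the space of dual numbers\<close>

context complete_bornological_space
begin

lemma module_dual:
  assumes dl: "dual_like V B"
  shows "module K B"
proof (rule moduleI)
  note s = dual_like_simps[OF dl]
  show "cring K" ..
  show "abelian_group B"
  proof (rule abelian_groupI)
    fix x assume "x \<in> carrier B"
    then obtain a b where x: "x = (a, b)" "a \<in> carrier V" "b \<in> carrier V" by (auto simp: s)
    then show "\<exists>y\<in>carrier B. y \<oplus>\<^bsub>B\<^esub> x = \<zero>\<^bsub>B\<^esub>"
      by (intro bexI[of _ "(\<ominus>\<^bsub>V\<^esub> a, \<ominus>\<^bsub>V\<^esub> b)"]) (simp_all add: s M.l_neg)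
  qed (auto simp: s M.a_ac)
qed (auto simp: smult_l_distr smult_r_distr smult_assoc1 dual_like_simps[OF dl])

lemma dual_minus:
  assumes dl: "dual_like V B" and "a \<in> carrier V" "b \<in> carrier V" "a' \<in> carrier V" "b' \<in> carrier V"
  shows "(a, b) \<ominus>\<^bsub>B\<^esub> (a', b') = (a \<ominus>\<^bsub>V\<^esub> a', b \<ominus>\<^bsub>V\<^esub> b')"
proof -
  interpret B: module K B by (rule module_dual[OF dl])
  note s = dual_like_simps[OF dl]
  have "\<ominus>\<^bsub>B\<^esub> (a', b') = \<ominus> \<one> \<odot>\<^bsub>B\<^esub> (a', b')"
    using assms B.smult_l_minus[of \<one> "(a', b')"] by (simp add: s(1))
  then show ?thesis using assms by (simp add: s B.M.minus_eq M.minus_eq smult_l_minus)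
qed

lemma submodule_dual:
  assumes dl: "dual_like V B" and R: "R \<in> {K, val_ring K}" and S: "submodule S R V" and T: "submodule T R V"
  shows "submodule (S \<times> T) R B"
  unfolding submodule_iff[OF module_dual[OF dl] R]
  using submodule_subset[OF module_V R S] submodule_subset[OF module_V R T]
    submodule_zero[OF module_V R S] submodule_zero[OF module_V R T]
    submodule_add[OF module_V R S] submodule_add[OF module_V R T]
    submodule_smult[OF module_V R S] submodule_smult[OF module_V R T]
  by (auto simp: dual_like_simps[OF dl])

lemma dual_bounded_subset:
  assumes dl: "dual_like V B" and "S \<in> bornology V" "T \<in> bornology V" "X \<subseteq> S \<times> T"
  shows "X \<in> bornology B"
proof -
  have "fst ` X \<subseteq> S" "snd ` X \<subseteq> T" using assms(4) by auto
  then show ?thesis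
    using assms(4) bounded_mono[OF assms(2)] bounded_mono[OF assms(3)]
      bounded_subset_carrier[OF assms(2)] bounded_subset_carrier[OF assms(3)]
    by (auto simp: dual_like_simps[OF dl])
qed

lemma bornological_dual:
  assumes dl: "dual_like V B"
  shows "bornological K p B"
proof (intro bornological.intro bornological_axioms.intro)
  show "mixed_char_complete_field K p" by (rule mixed_char_complete_field_axioms)
  show mB: "module K B" by (rule module_dual[OF dl])
  note s = dual_like_simps[OF dl]
  show "is_bornology K B (bornology B)"
  proof (rule is_bornologyI)
    fix x assume "x \<in> carrier B"
    then show "{x} \<in> bornology B" by (auto simp: s bounded_singleton)
  next
    fix S T assume S: "S \<in> bornology B" and T: "T \<subseteq> S"
    then show "T \<in> bornology B"
      using bounded_mono[of "fst ` S" "fst ` T"] bounded_mono[of "snd ` S" "snd ` T"] by (auto simp: s)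
  next
    fix S T assume "S \<in> bornology B" "T \<in> bornology B"
    then show "S \<union> T \<in> bornology B" by (simp add: s image_Un bounded_Un)
  next
    fix c S assume c: "c \<in> carrier K" and S: "S \<in> bornology B"
    have "(\<lambda>x. c \<odot>\<^bsub>B\<^esub> x) ` S \<subseteq> (\<lambda>x. c \<odot>\<^bsub>V\<^esub> x) ` fst ` S \<times> (\<lambda>x. c \<odot>\<^bsub>V\<^esub> x) ` snd ` S"
      by (auto simp: s image_iff) (metis fst_conv snd_conv)+
    then show "(\<lambda>x. c \<odot>\<^bsub>B\<^esub> x) ` S \<in> bornology B"
      using S c by (intro dual_bounded_subset[OF dl bounded_scale bounded_scale]) (auto simp: s)
  next
    fix S assume S: "S \<in> bornology B"
    then have b: "fst ` S \<in> bornology V" "snd ` S \<in> bornology V" by (simp_all add: s)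
    let ?X = "module_span (val_ring K) V (fst ` S)" and ?Y = "module_span (val_ring K) V (snd ` S)"
    have "fst ` S \<subseteq> ?X" "snd ` S \<subseteq> ?Y"
      by (rule span_superset[OF module_V _ bounded_subset_carrier], simp, rule b)+
    then have "S \<subseteq> ?X \<times> ?Y" by force
    then have "module_span (val_ring K) B S \<subseteq> ?X \<times> ?Y"
      using submodule_span[OF module_V _ bounded_subset_carrier[OF b(1)]]
        submodule_span[OF module_V _ bounded_subset_carrier[OF b(2)]]
      by (intro span_least submodule_dual[OF dl]) simp_all
    then show "module_span (val_ring K) B S \<in> bornology B"
      by (rule dual_bounded_subset[OF dl bounded_span[OF b(1)] bounded_span[OF b(2)]])
  qed (simp add: s)
qed

text \<open>The maximum of two ultrametric norms is again one, and a sequence of pairs is Cauchy or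
  convergent exactly when both components are.\<close>

lemma banach_dual:
  assumes dl: "dual_like V B" and E: "banach_on K V E \<nu>"
  shows "banach_on K B (E \<times> E) (\<lambda>(x, y). max (\<nu> x) (\<nu> y))" (is "banach_on K B ?E ?\<nu>")
proof -
  note s = dual_like_simps[OF dl]
  have sE: "submodule E K V" by (rule banach_submodule[OF E])
  have Ec: "x \<in> carrier V" if "x \<in> E" for x
    using submodule_subset[OF module_V _ sE] that by blast
  have Em: "x \<ominus>\<^bsub>V\<^esub> y \<in> E" if "x \<in> E" "y \<in> E" for x y
    using submodule_minus[OF module_V _ sE] that by simp
  have z: "0 \<le> ?\<nu> x \<and> (?\<nu> x = 0 \<longleftrightarrow> x = \<zero>\<^bsub>B\<^esub>)" if xE: "x \<in> ?E" for x
  proof -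
    obtain a b where x: "x = (a, b)" "a \<in> E" "b \<in> E" using xE by blast
    have "0 \<le> \<nu> a" "0 \<le> \<nu> b" using x banach_nonneg[OF E] by auto
    moreover have "max (\<nu> a) (\<nu> b) = 0 \<longleftrightarrow> \<nu> a = 0 \<and> \<nu> b = 0" using calculation by linarith
    ultimately show ?thesis
      using x banach_zero_iff[OF E, of a] banach_zero_iff[OF E, of b] by (simp add: s)
  qed
  have sm: "?\<nu> (c \<odot>\<^bsub>B\<^esub> x) = absval K c * ?\<nu> x" if "c \<in> carrier K" "x \<in> ?E" for c x
    using that banach_smult[OF E] absval_nonneg by (auto simp: s max_mult_distrib_left)
  have ad: "?\<nu> (x \<oplus>\<^bsub>B\<^esub> y) \<le> max (?\<nu> x) (?\<nu> y)" if xy: "x \<in> ?E" "y \<in> ?E" for x y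
  proof -
    obtain a b c d where x: "x = (a, b)" "y = (c, d)" "a \<in> E" "b \<in> E" "c \<in> E" "d \<in> E"
      using xy by blast
    then show ?thesis using banach_add[OF E, of a c] banach_add[OF E, of b d]
      by (simp add: s) linarith
  qed
  have "cauchy_complete B ?E ?\<nu>"
    unfolding cauchy_complete_def
  proof (intro allI impI)
    fix x :: "nat \<Rightarrow> _" assume x: "range x \<subseteq> ?E \<and> (\<forall>e>0. \<exists>N. \<forall>i\<ge>N. \<forall>j\<ge>N. ?\<nu> (x i \<ominus>\<^bsub>B\<^esub> x j) < e)"
    define u where "u i = fst (x i)" for i
    define v where "v i = snd (x i)" for i
    have uv: "x i = (u i, v i)" "u i \<in> E" "v i \<in> E" for i
    proof -
      have "x i \<in> ?E" using x by blast
      then show "x i = (u i, v i)" "u i \<in> E" "v i \<in> E" by (auto simp: u_def v_def)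
    qed
    have mn: "?\<nu> (x i \<ominus>\<^bsub>B\<^esub> x j) = max (\<nu> (u i \<ominus>\<^bsub>V\<^esub> u j)) (\<nu> (v i \<ominus>\<^bsub>V\<^esub> v j))" for i j
      using uv Ec by (simp add: dual_minus[OF dl])
    have cu: "\<forall>e>0. \<exists>N. \<forall>i\<ge>N. \<forall>j\<ge>N. \<nu> (u i \<ominus>\<^bsub>V\<^esub> u j) < e"
      and cv: "\<forall>e>0. \<exists>N. \<forall>i\<ge>N. \<forall>j\<ge>N. \<nu> (v i \<ominus>\<^bsub>V\<^esub> v j) < e"
    proof -
      have *: "\<exists>N. \<forall>i\<ge>N. \<forall>j\<ge>N. \<nu> (u i \<ominus>\<^bsub>V\<^esub> u j) < e \<and> \<nu> (v i \<ominus>\<^bsub>V\<^esub> v j) < e" if "0 < e" for e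
        using x[THEN conjunct2, unfolded mn, rule_format, OF that] by simp
      show "\<forall>e>0. \<exists>N. \<forall>i\<ge>N. \<forall>j\<ge>N. \<nu> (u i \<ominus>\<^bsub>V\<^esub> u j) < e"
        "\<forall>e>0. \<exists>N. \<forall>i\<ge>N. \<forall>j\<ge>N. \<nu> (v i \<ominus>\<^bsub>V\<^esub> v j) < e"
        using * by meson+
    qed
    have r: "range u \<subseteq> E" "range v \<subseteq> E" using uv by auto
    note lim = spec[OF banach_cauchy[OF E, unfolded cauchy_complete_def], THEN mp, OF conjI]
    obtain l where l: "l \<in> E" "(\<lambda>i. \<nu> (u i \<ominus>\<^bsub>V\<^esub> l)) \<longlonglongrightarrow> 0"
      using lim[OF r(1) cu] ..
    obtain m where m: "m \<in> E" "(\<lambda>i. \<nu> (v i \<ominus>\<^bsub>V\<^esub> m)) \<longlonglongrightarrow> 0"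
      using lim[OF r(2) cv] ..
    have "?\<nu> (x i \<ominus>\<^bsub>B\<^esub> (l, m)) = max (\<nu> (u i \<ominus>\<^bsub>V\<^esub> l)) (\<nu> (v i \<ominus>\<^bsub>V\<^esub> m))" for i
      using uv Ec l m by (simp add: dual_minus[OF dl])
    moreover have "(\<lambda>i. max (\<nu> (u i \<ominus>\<^bsub>V\<^esub> l)) (\<nu> (v i \<ominus>\<^bsub>V\<^esub> m))) \<longlonglongrightarrow> 0"
      using tendsto_max[OF l(2) m(2)] by simp
    ultimately show "\<exists>l\<in>?E. (\<lambda>i. ?\<nu> (x i \<ominus>\<^bsub>B\<^esub> l)) \<longlonglongrightarrow> 0"
      using l(1) m(1) by (intro bexI[of _ "(l, m)"]) simp_all
  qed
  then show ?thesis
    unfolding banach_on_def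
    by (intro conjI ballI submodule_dual[OF dl _ sE sE] z[THEN conjunct1] z[THEN conjunct2] sm ad)
      simp_all
qed

text \<open>Squares \<open>E \<times> E\<close> suffice as Banach members: by directedness the two
  components of an element lie in a common \<open>E\<close>, and for a bounded set the union of both
  projections is bounded in one \<open>E\<close>.\<close>

lemma complete_dual:
  assumes dl: "dual_like V B"
  shows "complete_bornological K B"
proof -
  note s = dual_like_simps[OF dl]
  interpret B: bornological K p B by (rule bornological_dual[OF dl])
  obtain \<E> where ne: "\<E> \<noteq> {}" and ban: "\<forall>(E, \<nu>)\<in>\<E>. banach_on K V E \<nu>"
    and dir: "\<forall>(E, \<nu>)\<in>\<E>. \<forall>(E', \<nu>')\<in>\<E>. \<exists>(E'', \<nu>'')\<in>\<E>.
           E \<subseteq> E'' \<and> (\<exists>C. \<forall>x\<in>E. \<nu>'' x \<le> C * \<nu> x) \<and>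
           E' \<subseteq> E'' \<and> (\<exists>C. \<forall>x\<in>E'. \<nu>'' x \<le> C * \<nu>' x)"
    and car: "carrier V = (\<Union>(E, \<nu>)\<in>\<E>. E)"
    and bor: "bornology V = {B. \<exists>(E, \<nu>)\<in>\<E>. B \<subseteq> E \<and> (\<exists>C. \<forall>x\<in>B. \<nu> x \<le> C)}"
    using complete unfolding complete_bornological_def by (elim conjE exE)
  define Q :: "('b \<Rightarrow> real) \<Rightarrow> 'b \<times> 'b \<Rightarrow> real" where "Q \<nu> = (\<lambda>(x, y). max (\<nu> x) (\<nu> y))" for \<nu>
  let ?\<E> = "(\<lambda>(E, \<nu>). (E \<times> E, Q \<nu>)) ` \<E>"
  have dir': "\<exists>E'' \<nu>''. (E'', \<nu>'') \<in> \<E> \<and> E \<subseteq> E'' \<and> (\<exists>C. \<forall>x\<in>E. \<nu>'' x \<le> C * \<nu> x) \<and>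
           E' \<subseteq> E'' \<and> (\<exists>C. \<forall>x\<in>E'. \<nu>'' x \<le> C * \<nu>' x)" if "(E, \<nu>) \<in> \<E>" "(E', \<nu>') \<in> \<E>" for E \<nu> E' \<nu>'
  proof -
    have "\<forall>(E', \<nu>')\<in>\<E>. \<exists>(E'', \<nu>'')\<in>\<E>.
           E \<subseteq> E'' \<and> (\<exists>C. \<forall>x\<in>E. \<nu>'' x \<le> C * \<nu> x) \<and>
           E' \<subseteq> E'' \<and> (\<exists>C. \<forall>x\<in>E'. \<nu>'' x \<le> C * \<nu>' x)"
      using bspec[OF dir that(1)] by simp
    from bspec[OF this that(2)] show ?thesis by (simp add: Bex_def split_paired_Ex)
  qed
  have ban': "banach_on K V E \<nu>" if "(E, \<nu>) \<in> \<E>" for E \<nu>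
    using bspec[OF ban that] by simp
  have nonneg: "0 \<le> \<nu> x" if "(E, \<nu>) \<in> \<E>" "x \<in> E" for E \<nu> x
    using banach_nonneg[OF ban'[OF that(1)] that(2)] .
  have bor': "B \<in> bornology V \<longleftrightarrow> (\<exists>E \<nu> C. (E, \<nu>) \<in> \<E> \<and> B \<subseteq> E \<and> (\<forall>x\<in>B. \<nu> x \<le> C))" for B
    unfolding bor by (simp add: Bex_def split_paired_Ex)
  have dom: "\<exists>C. \<forall>x\<in>E \<times> E. Q \<nu>' x \<le> C * Q \<nu> x"
    if E: "(E, \<nu>) \<in> \<E>" and C: "\<forall>x\<in>E. \<nu>' x \<le> C * \<nu> x" for E \<nu> \<nu>' C
  \<comment> \<open>The constant \<open>C\<close> may be negative on a trivial space, and the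
    estimate needs multiplication by it to be monotone.\<close>
  proof (intro exI[of _ "max C 0"] ballI)
    fix x assume "x \<in> E \<times> E"
    then obtain a b where x: "x = (a, b)" "a \<in> E" "b \<in> E" by blast
    have le: "\<nu>' a \<le> max C 0 * Q \<nu> x" if "a \<in> E" "\<nu> a \<le> Q \<nu> x" for a
    proof -
      have "\<nu>' a \<le> C * \<nu> a" using C that by blast
      also have "\<dots> \<le> max C 0 * \<nu> a" using nonneg[OF E that(1)] by (intro mult_right_mono) auto
      also have "\<dots> \<le> max C 0 * Q \<nu> x" using that(2) by (intro mult_left_mono) auto
      finally show ?thesis .
    qed
    have "\<nu>' a \<le> max C 0 * Q \<nu> x" "\<nu>' b \<le> max C 0 * Q \<nu> x"
      by (rule le; use x in \<open>simp add: Q_def\<close>)+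
    then show "Q \<nu>' x \<le> max C 0 * Q \<nu> x" using x(1) by (simp add: Q_def)
  qed
  show ?thesis
    unfolding complete_bornological_def
  proof (intro conjI exI[of _ ?\<E>])
    show "bornological_space K B"
      unfolding bornological_space_def using B.module_V B.born by blast
    show "?\<E> \<noteq> {}" using ne by simp
    show "\<forall>(E, \<nu>)\<in>?\<E>. banach_on K B E \<nu>"
      using banach_dual[OF dl ban'] by (auto simp: Q_def)
    have "\<exists>(E'', \<nu>'')\<in>?\<E>. E \<times> E \<subseteq> E'' \<and> (\<exists>C. \<forall>x\<in>E \<times> E. \<nu>'' x \<le> C * Q \<nu> x) \<and>
           E' \<times> E' \<subseteq> E'' \<and> (\<exists>C. \<forall>x\<in>E' \<times> E'. \<nu>'' x \<le> C * Q \<nu>' x)"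
      if E: "(E, \<nu>) \<in> \<E>" "(E', \<nu>') \<in> \<E>" for E \<nu> E' \<nu>'
    proof -
      obtain E'' \<nu>'' C C' where E'': "(E'', \<nu>'') \<in> \<E>" "E \<subseteq> E''" "\<forall>x\<in>E. \<nu>'' x \<le> C * \<nu> x"
        "E' \<subseteq> E''" "\<forall>x\<in>E'. \<nu>'' x \<le> C' * \<nu>' x"
        using dir'[OF E] by (elim exE conjE)
      have mem: "(E'' \<times> E'', Q \<nu>'') \<in> ?\<E>"
        by (rule image_eqI[OF _ E''(1)]) simp
      have sub: "E \<times> E \<subseteq> E'' \<times> E''" "E' \<times> E' \<subseteq> E'' \<times> E''" using E''(2,4) by auto
      show ?thesis
        by (rule bexI[OF _ mem], unfold prod.case)
          (intro conjI sub dom[OF E(1) E''(3)] dom[OF E(2) E''(5)])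
    qed
    then show "\<forall>(E, \<nu>)\<in>?\<E>. \<forall>(E', \<nu>')\<in>?\<E>. \<exists>(E'', \<nu>'')\<in>?\<E>.
           E \<subseteq> E'' \<and> (\<exists>C. \<forall>x\<in>E. \<nu>'' x \<le> C * \<nu> x) \<and>
           E' \<subseteq> E'' \<and> (\<exists>C. \<forall>x\<in>E'. \<nu>'' x \<le> C * \<nu>' x)"
      by (auto simp only: ball_simps prod.case split: prod.splits)
    show "carrier B = (\<Union>(E, \<nu>)\<in>?\<E>. E)"
    proof (intro equalityI subsetI)
      fix x assume "x \<in> carrier B"
      then obtain a b where x: "x = (a, b)" "a \<in> carrier V" "b \<in> carrier V" by (auto simp: s)
      then obtain E \<nu> E' \<nu>' where E: "(E, \<nu>) \<in> \<E>" "a \<in> E" "(E', \<nu>') \<in> \<E>" "b \<in> E'"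
        unfolding car by blast
      then obtain E'' \<nu>'' where "(E'', \<nu>'') \<in> \<E>" "E \<subseteq> E''" "E' \<subseteq> E''"
        using dir'[OF E(1,3)] by blast
      then show "x \<in> (\<Union>(E, \<nu>)\<in>?\<E>. E)" using x E by force
    next
      fix x assume "x \<in> (\<Union>(E, \<nu>)\<in>?\<E>. E)"
      then show "x \<in> carrier B" unfolding s car by auto
    qed
    have "S \<in> bornology B \<longleftrightarrow> (\<exists>E \<nu> C. (E, \<nu>) \<in> \<E> \<and> S \<subseteq> E \<times> E \<and> (\<forall>x\<in>S. Q \<nu> x \<le> C))" for S
    proof
      assume "S \<in> bornology B"
      then have "fst ` S \<union> snd ` S \<in> bornology V" using bounded_Un by (simp add: s)
      then obtain E \<nu> C where E: "(E, \<nu>) \<in> \<E>" "fst ` S \<union> snd ` S \<subseteq> E" "\<forall>x\<in>fst ` S \<union> snd ` S. \<nu> x \<le> C"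
        unfolding bor' by (elim exE conjE)
      have "S \<subseteq> E \<times> E" using E(2) by force
      moreover have "\<forall>x\<in>S. Q \<nu> x \<le> C" using E(3) by (force simp: Q_def)
      ultimately show "\<exists>E \<nu> C. (E, \<nu>) \<in> \<E> \<and> S \<subseteq> E \<times> E \<and> (\<forall>x\<in>S. Q \<nu> x \<le> C)" using E(1) by blast
    next
      assume "\<exists>E \<nu> C. (E, \<nu>) \<in> \<E> \<and> S \<subseteq> E \<times> E \<and> (\<forall>x\<in>S. Q \<nu> x \<le> C)"
      then obtain E \<nu> C where E: "(E, \<nu>) \<in> \<E>" "S \<subseteq> E \<times> E" "\<forall>x\<in>S. Q \<nu> x \<le> C" by blast
      have sub: "fst ` S \<subseteq> E" "snd ` S \<subseteq> E" using E(2) by auto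
      have "\<nu> a \<le> C \<and> \<nu> b \<le> C" if "(a, b) \<in> S" for a b
        using bspec[OF E(3) that] by (simp add: Q_def)
      then have le: "\<forall>x\<in>fst ` S. \<nu> x \<le> C" "\<forall>x\<in>snd ` S. \<nu> x \<le> C" by auto
      have "fst ` S \<in> bornology V" "snd ` S \<in> bornology V"
        by (rule bor'[THEN iffD2], intro exI conjI, rule E(1), rule sub, rule le)+
      then show "S \<in> bornology B" using dual_bounded_subset[OF dl, of "fst ` S" "snd ` S" S] by force
    qed
    then show "bornology B = {S. \<exists>(E, \<nu>)\<in>?\<E>. S \<subseteq> E \<and> (\<exists>C. \<forall>x\<in>S. \<nu> x \<le> C)}"
      by (auto simp: set_eq_iff Bex_def)
  qed
qed

end

lemma (in abelian_group) add_minus_cancel_right: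
  "x \<in> carrier G \<Longrightarrow> y \<in> carrier G \<Longrightarrow> (x \<oplus> y) \<ominus> y = x"
  by (simp add: minus_eq a_assoc r_neg)

lemma (in abelian_group) add_minus_add_cancel:
  assumes "d \<in> carrier G" "x \<in> carrier G" "y \<in> carrier G" "z \<in> carrier G"
  shows "(d \<oplus> ((x \<ominus> y) \<oplus> z)) \<oplus> y = d \<oplus> (x \<oplus> z)"
proof -
  have "(d \<oplus> ((x \<ominus> y) \<oplus> z)) \<oplus> y = (d \<oplus> (x \<oplus> z)) \<oplus> (\<ominus> y \<oplus> y)"
    using assms by (simp add: minus_eq a_ac del: l_neg)
  then show ?thesis using assms by (simp add: l_neg)
qed

text \<open>The \<open>t\<close> coefficient of the product of two elements without \<open>t\<close>
  part, in other words the cocycle belonging to the section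
  \<open>a \<mapsto> (a, 0)\<close>.\<close>

definition defect :: "('k, 'a) born_space \<Rightarrow> ('k, 'a \<times> 'a) born_space \<Rightarrow> 'a \<Rightarrow> 'a \<Rightarrow> 'a" where
  "defect A B a b = snd ((a, \<zero>\<^bsub>A\<^esub>) \<otimes>\<^bsub>B\<^esub> (b, \<zero>\<^bsub>A\<^esub>))"

lemma deformation_dual_like: "deformation K A B \<Longrightarrow> dual_like A B"
  unfolding deformation_def dual_like_def by blast

section \<open>The multiplication of a deformation and its cocycle\<close>

context complete_algebra
begin

lemma complete_algebra_deformation:
  assumes B: "deformation K A B"
  shows "complete_algebra K p B"
proof -
  have "complete_born_algebra K B" using B by (simp add: deformation_def)
  then show ?thesis
    by (intro complete_algebra.intro complete_bornological_space.intro complete_algebra_axioms.intro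
        complete_bornological_space_axioms.intro bornological_dual complete_dual
        deformation_dual_like[OF B])
qed

text \<open>Every \<open>(a, b)\<close> is \<open>(a, 0)\<close> plus \<open>t\<close> times
  \<open>(b, 0)\<close>. Compatibility with \<open>t\<close> and reduction modulo \<open>t\<close>
  determine all parts of the product except the \<open>t\<close> coefficient of
  \<open>(a, 0)\<close> times \<open>(c, 0)\<close>.\<close>

lemma
  assumes B: "deformation K A B"
  shows defect_closed: "a \<in> carrier A \<Longrightarrow> c \<in> carrier A \<Longrightarrow> defect A B a c \<in> carrier A"
    and deformation_mult: "a \<in> carrier A \<Longrightarrow> b \<in> carrier A \<Longrightarrow> c \<in> carrier A \<Longrightarrow> d \<in> carrier A \<Longrightarrow>
      (a, b) \<otimes>\<^bsub>B\<^esub> (c, d) = (a \<otimes>\<^bsub>A\<^esub> c, (defect A B a c \<oplus>\<^bsub>A\<^esub> a \<otimes>\<^bsub>A\<^esub> d) \<oplus>\<^bsub>A\<^esub> b \<otimes>\<^bsub>A\<^esub> c)"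
proof -
  note s = dual_like_simps[OF deformation_dual_like[OF B]]
  interpret B: complete_algebra K p B by (rule complete_algebra_deformation[OF B])
  have t: "t_mult A x \<otimes>\<^bsub>B\<^esub> y = t_mult A (x \<otimes>\<^bsub>B\<^esub> y)" "x \<otimes>\<^bsub>B\<^esub> t_mult A y = t_mult A (x \<otimes>\<^bsub>B\<^esub> y)"
    if "x \<in> carrier B" "y \<in> carrier B" for x y
    using B that by (auto simp: deformation_def)
  have hom: "fst \<in> ring_hom B A" using B by (simp add: deformation_def)
  have fm: "fst (x \<otimes>\<^bsub>B\<^esub> y) = fst x \<otimes>\<^bsub>A\<^esub> fst y" if "x \<in> carrier B" "y \<in> carrier B" for x y
    using ring_hom_mult[OF hom that] .
  have mc: "x \<otimes>\<^bsub>B\<^esub> y \<in> carrier A \<times> carrier A" if "x \<in> carrier B" "y \<in> carrier B" for x y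
    using B.A.m_closed[OF that] by (simp add: s(1))
  show dc: "defect A B a c \<in> carrier A" if "a \<in> carrier A" "c \<in> carrier A" for a c
    using mc[of "(a, \<zero>\<^bsub>A\<^esub>)" "(c, \<zero>\<^bsub>A\<^esub>)"] that by (auto simp: defect_def s(1))
  show "(a, b) \<otimes>\<^bsub>B\<^esub> (c, d) = (a \<otimes>\<^bsub>A\<^esub> c, (defect A B a c \<oplus>\<^bsub>A\<^esub> a \<otimes>\<^bsub>A\<^esub> d) \<oplus>\<^bsub>A\<^esub> b \<otimes>\<^bsub>A\<^esub> c)"
    if abcd: "a \<in> carrier A" "b \<in> carrier A" "c \<in> carrier A" "d \<in> carrier A"
  proof -
    let ?a = "(a, \<zero>\<^bsub>A\<^esub>)" and ?b = "(b, \<zero>\<^bsub>A\<^esub>)" and ?c = "(c, \<zero>\<^bsub>A\<^esub>)" and ?d = "(d, \<zero>\<^bsub>A\<^esub>)"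
    have cl: "?a \<in> carrier B" "?b \<in> carrier B" "?c \<in> carrier B" "?d \<in> carrier B" using abcd by (simp_all add: s(1))
    have tc: "t_mult A ?b \<in> carrier B" "t_mult A ?d \<in> carrier B" using abcd by (simp_all add: s(1) t_mult_def)
    have "(a, b) = ?a \<oplus>\<^bsub>B\<^esub> t_mult A ?b" "(c, d) = ?c \<oplus>\<^bsub>B\<^esub> t_mult A ?d"
      using abcd by (simp_all add: t_mult_def s)
    then have "(a, b) \<otimes>\<^bsub>B\<^esub> (c, d) = (?a \<otimes>\<^bsub>B\<^esub> ?c \<oplus>\<^bsub>B\<^esub> ?a \<otimes>\<^bsub>B\<^esub> t_mult A ?d) \<oplus>\<^bsub>B\<^esub>
        (t_mult A ?b \<otimes>\<^bsub>B\<^esub> ?c \<oplus>\<^bsub>B\<^esub> t_mult A ?b \<otimes>\<^bsub>B\<^esub> t_mult A ?d)"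
      using cl tc by (simp add: B.A.l_distr B.A.r_distr B.M.a_ac)
    moreover have "?a \<otimes>\<^bsub>B\<^esub> ?c = (a \<otimes>\<^bsub>A\<^esub> c, defect A B a c)"
      using fm[OF cl(1,3)] by (simp add: defect_def prod_eq_iff)
    moreover have "?a \<otimes>\<^bsub>B\<^esub> t_mult A ?d = (\<zero>\<^bsub>A\<^esub>, a \<otimes>\<^bsub>A\<^esub> d)"
      unfolding t(2)[OF cl(1,4)] using fm[OF cl(1,4)] by (simp add: t_mult_def)
    moreover have "t_mult A ?b \<otimes>\<^bsub>B\<^esub> ?c = (\<zero>\<^bsub>A\<^esub>, b \<otimes>\<^bsub>A\<^esub> c)"
      unfolding t(1)[OF cl(2,3)] using fm[OF cl(2,3)] by (simp add: t_mult_def)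
    \<comment> \<open>Both factors of \<open>t\<close> can be moved to the front, and applying
      \<open>t_mult\<close> twice gives zero.\<close>
    moreover have "t_mult A ?b \<otimes>\<^bsub>B\<^esub> t_mult A ?d = (\<zero>\<^bsub>A\<^esub>, \<zero>\<^bsub>A\<^esub>)"
      unfolding t(2)[OF tc(1) cl(4)] t(1)[OF cl(2,4)] by (simp add: t_mult_def)
    ultimately show ?thesis using abcd dc by (simp add: s M.a_ac)
  qed
qed

text \<open>The defect is the product of \<open>B\<close> composed with the embedding
  \<open>a \<mapsto> (a, 0)\<close> and the second projection, all of which are linear and preserve
  bounded sets.\<close>

lemma bounded_bilinear_defect:
  assumes B: "deformation K A B"
  shows "bounded_bilinear_map K A A (defect A B)"
proof -
  note s = dual_like_simps[OF deformation_dual_like[OF B]]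
  interpret B: complete_algebra K p B by (rule complete_algebra_deformation[OF B])
  note cl = defect_closed[OF B]
  have emb: "linear_map K A B (\<lambda>a. (a, \<zero>\<^bsub>A\<^esub>))" by (rule linear_mapI) (simp_all add: s)
  have proj: "linear_map K B A snd" by (rule linear_mapI) (auto simp: s)
  have bil: "linear_map K B B (\<lambda>y. x \<otimes>\<^bsub>B\<^esub> y)" "linear_map K B B (\<lambda>y. y \<otimes>\<^bsub>B\<^esub> x)" if "x \<in> carrier B" for x
    using B.bounded_bilinear_mult that unfolding bounded_bilinear_map_def by blast+
  have "linear_map K A A (\<lambda>b. defect A B a b)" "linear_map K A A (\<lambda>b. defect A B b a)"
    if a: "a \<in> carrier A" for a
  proof -
    have ac: "(a, \<zero>\<^bsub>A\<^esub>) \<in> carrier B" using a by (simp add: s(1))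
    show "linear_map K A A (\<lambda>b. defect A B a b)" "linear_map K A A (\<lambda>b. defect A B b a)"
      using linear_map_comp[OF emb linear_map_comp[OF bil(1)[OF ac] proj]]
        linear_map_comp[OF emb linear_map_comp[OF bil(2)[OF ac] proj]]
      by (simp_all add: defect_def)
  qed
  moreover have "{defect A B a b |a b. a \<in> S \<and> b \<in> T} \<in> bornology A"
    if S: "S \<in> bornology A" and T: "T \<in> bornology A" for S T
  proof -
    let ?e = "\<lambda>a. (a, \<zero>\<^bsub>A\<^esub>)"
    have e: "?e ` X \<in> bornology B" if "X \<in> bornology A" for X
      by (rule dual_bounded_subset[OF deformation_dual_like[OF B] that bounded_singleton[OF M.zero_closed]]) auto
    have "snd ` {x \<otimes>\<^bsub>B\<^esub> y |x y. x \<in> ?e ` S \<and> y \<in> ?e ` T} \<in> bornology A"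
      using B.bounded_mult[OF e[OF S] e[OF T]] by (simp add: s(5))
    then show ?thesis by (rule bounded_mono) (unfold defect_def, blast)
  qed
  ultimately show ?thesis unfolding bounded_bilinear_map_def by blast
qed

text \<open>The cocycle condition is sorted so that both sides are sums; this is the form in which
  comparing the two bracketings of a triple product delivers it.\<close>

lemma cocycle_2_iff:
  "f \<in> carrier (cocycles K A 2) \<longleftrightarrow> f \<in> carrier (cochains K A 2) \<and>
    (\<forall>a\<in>carrier A. \<forall>b\<in>carrier A. \<forall>c\<in>carrier A.
       a \<otimes>\<^bsub>A\<^esub> f (ct [b, c]) \<oplus>\<^bsub>A\<^esub> f (ct [a, b \<otimes>\<^bsub>A\<^esub> c]) = f (ct [a \<otimes>\<^bsub>A\<^esub> b, c]) \<oplus>\<^bsub>A\<^esub> f (ct [a, b]) \<otimes>\<^bsub>A\<^esub> c)"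
proof -
  have "hochschild K A 2 (\<lambda>xs. f (ct xs)) [a, b, c] = \<zero>\<^bsub>A\<^esub> \<longleftrightarrow>
      a \<otimes>\<^bsub>A\<^esub> f (ct [b, c]) \<oplus>\<^bsub>A\<^esub> f (ct [a, b \<otimes>\<^bsub>A\<^esub> c]) = f (ct [a \<otimes>\<^bsub>A\<^esub> b, c]) \<oplus>\<^bsub>A\<^esub> f (ct [a, b]) \<otimes>\<^bsub>A\<^esub> c"
    if f: "f \<in> carrier (cochains K A 2)" and abc: "a \<in> carrier A" "b \<in> carrier A" "c \<in> carrier A" for a b c
  proof -
    have fc: "f (ct [x, y]) \<in> carrier A" if "x \<in> carrier A" "y \<in> carrier A" for x y
      using cochain_closed[OF f, of "[x, y]"] that by (simp add: tuples_2)
    have h: "hochschild K A 2 (\<lambda>xs. f (ct xs)) [a, b, c] =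
      (a \<otimes>\<^bsub>A\<^esub> f (ct [b, c]) \<oplus>\<^bsub>A\<^esub> f (ct [a, b \<otimes>\<^bsub>A\<^esub> c])) \<ominus>\<^bsub>A\<^esub> (f (ct [a \<otimes>\<^bsub>A\<^esub> b, c]) \<oplus>\<^bsub>A\<^esub> f (ct [a, b]) \<otimes>\<^bsub>A\<^esub> c)"
      using abc fc by (subst hochschild_2) (simp_all add: M.minus_eq M.minus_add M.a_ac)
    show ?thesis unfolding h using abc fc by (subst M.minus_eq_zero_iff) simp_all
  qed
  moreover have "(\<forall>xs\<in>tuples A (Suc 2). P xs) \<longleftrightarrow>
    (\<forall>a\<in>carrier A. \<forall>b\<in>carrier A. \<forall>c\<in>carrier A. P [a, b, c])" for P
    by (auto simp: tuples_3)
  ultimately show ?thesis unfolding cocycle_iff by auto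
qed

lemma defect_cocycle:
  assumes B: "deformation K A B"
  shows "\<exists>f\<in>carrier (cocycles K A 2). \<forall>a\<in>carrier A. \<forall>b\<in>carrier A. f (ct [a, b]) = defect A B a b"
proof -
  note s = dual_like_simps[OF deformation_dual_like[OF B]]
  interpret B: complete_algebra K p B by (rule complete_algebra_deformation[OF B])
  have "bounded_multilinear K A 2 A (\<lambda>xs. defect A B (hd xs) (last xs))"
    unfolding bounded_multilinear_2[OF bornological_axioms] using bounded_bilinear_defect[OF B] by simp
  then obtain f where f: "f \<in> carrier (cochains K A 2)"
    "\<forall>xs\<in>tuples A 2. f (ct xs) = defect A B (hd xs) (last xs)" by (rule cochain_extend)
  have fe: "f (ct [a, b]) = defect A B a b" if "a \<in> carrier A" "b \<in> carrier A" for a b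
    using f(2) that by (simp add: tuples_2)
  note cl = defect_closed[OF B] and m = deformation_mult[OF B]
  have "a \<otimes>\<^bsub>A\<^esub> defect A B b c \<oplus>\<^bsub>A\<^esub> defect A B a (b \<otimes>\<^bsub>A\<^esub> c) =
      defect A B (a \<otimes>\<^bsub>A\<^esub> b) c \<oplus>\<^bsub>A\<^esub> defect A B a b \<otimes>\<^bsub>A\<^esub> c"
    if abc: "a \<in> carrier A" "b \<in> carrier A" "c \<in> carrier A" for a b c
  proof -
    \<comment> \<open>The second components of this equation are the two sides of the cocycle
      identity.\<close>
    have "((a, \<zero>\<^bsub>A\<^esub>) \<otimes>\<^bsub>B\<^esub> (b, \<zero>\<^bsub>A\<^esub>)) \<otimes>\<^bsub>B\<^esub> (c, \<zero>\<^bsub>A\<^esub>) = (a, \<zero>\<^bsub>A\<^esub>) \<otimes>\<^bsub>B\<^esub> ((b, \<zero>\<^bsub>A\<^esub>) \<otimes>\<^bsub>B\<^esub> (c, \<zero>\<^bsub>A\<^esub>))"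
      using abc by (intro B.A.m_assoc) (simp_all add: s(1))
    then show ?thesis using abc cl by (simp add: m M.a_ac)
  qed
  then have "f \<in> carrier (cocycles K A 2)" unfolding cocycle_2_iff using f(1) fe by simp
  then show ?thesis using fe by blast
qed

lemma differential_1_eval:
  assumes g: "g \<in> carrier (cochains K A 1)" and ab: "a \<in> carrier A" "b \<in> carrier A"
  shows "differential K A 1 g (ct [a, b]) =
    (a \<otimes>\<^bsub>A\<^esub> g (ct [b]) \<ominus>\<^bsub>A\<^esub> g (ct [a \<otimes>\<^bsub>A\<^esub> b])) \<oplus>\<^bsub>A\<^esub> g (ct [a]) \<otimes>\<^bsub>A\<^esub> b"
proof -
  have gc: "g (ct [x]) \<in> carrier A" if "x \<in> carrier A" for x
    using cochain_closed[OF g, of "[x]"] that by (simp add: tuples_Suc)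
  have "[a, b] \<in> tuples A (Suc 1)" using ab by (simp add: tuples_Suc)
  then have "differential K A 1 g (ct [a, b]) = hochschild K A 1 (\<lambda>xs. g (ct xs)) [a, b]"
    by (rule differential_eval[OF g])
  also have "\<dots> = (a \<otimes>\<^bsub>A\<^esub> g (ct [b]) \<ominus>\<^bsub>A\<^esub> g (ct [a \<otimes>\<^bsub>A\<^esub> b])) \<oplus>\<^bsub>A\<^esub> g (ct [a]) \<otimes>\<^bsub>A\<^esub> b"
    using ab gc by (rule hochschild_1)
  finally show ?thesis .
qed

lemma ex_cochain_1:
  assumes h: "bounded_linear_map K A A h"
  obtains g where "g \<in> carrier (cochains K A 1)" "\<forall>a\<in>carrier A. g (ct [a]) = h a"
proof -
  have "bounded_multilinear K A 1 A (\<lambda>xs. h (hd xs))"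
    unfolding bounded_multilinear_1[OF bornological_axioms] using h by simp
  then obtain g where "g \<in> carrier (cochains K A 1)" "\<forall>xs\<in>tuples A 1. g (ct xs) = h (hd xs)"
    by (rule cochain_extend)
  then show ?thesis by (intro that[of g]) (simp_all add: tuples_Suc)
qed

text \<open>Rewrites equality in degree 2 as the existence of a bounded linear \<open>h\<close>,
  which is literally the condition found for isomorphic deformations. One-cochains and such maps
  correspond by \<open>ex_cochain_1\<close>.\<close>

lemma cohomology_class_2_eq_iff:
  assumes F: "F \<in> carrier (cocycles K A 2)" and F': "F' \<in> carrier (cocycles K A 2)"
  shows "cohomology_class K A 2 F = cohomology_class K A 2 F' \<longleftrightarrow>
    (\<exists>h. bounded_linear_map K A A h \<and> (\<forall>a\<in>carrier A. \<forall>b\<in>carrier A.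
       F (ct [a, b]) = F' (ct [a, b]) \<oplus>\<^bsub>A\<^esub> ((a \<otimes>\<^bsub>A\<^esub> h b \<ominus>\<^bsub>A\<^esub> h (a \<otimes>\<^bsub>A\<^esub> b)) \<oplus>\<^bsub>A\<^esub> h a \<otimes>\<^bsub>A\<^esub> b)))"
    (is "?l \<longleftrightarrow> (\<exists>h. ?P h)")
proof -
  interpret Z: module K "cocycles K A 2" by (rule module_cocycles)
  interpret Q: module_quotient K "cocycles K A 2" "coboundaries K A 2"
    by (intro module_quotient.intro module_quotient_axioms.intro module_cocycles
        submodule_coboundaries_cocycles coboundaries_2_subset)
  let ?C = "cochains K A 2"
  interpret C: module K ?C by (rule module_cochains)
  have c: "F \<in> carrier ?C" "F' \<in> carrier ?C" using F F' by (auto simp: cocycle_iff)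
  have t: "[a, b] \<in> tuples A 2" if "a \<in> carrier A" "b \<in> carrier A" for a b using that by (simp add: tuples_2)
  let ?d = "differential K A 1"
  have dc: "?d g \<in> carrier ?C" if "g \<in> carrier (cochains K A 1)" for g
    using differential_closed[OF that] by (simp add: numeral_2_eq_2)
  have cb: "coboundaries K A 2 = ?d ` carrier (cochains K A 1)"
    by (simp add: coboundaries_def numeral_2_eq_2)
  note de = differential_1_eval
  have eq: "F = ?d g \<oplus>\<^bsub>?C\<^esub> F' \<longleftrightarrow> ?P (\<lambda>a. g (ct [a]))" if g: "g \<in> carrier (cochains K A 1)" for g
  proof -
    have b: "bounded_linear_map K A A (\<lambda>a. g (ct [a]))"
      using cochain_multilinear[OF g] unfolding bounded_multilinear_1[OF bornological_axioms] .
    have Fc: "F' (ct [x, y]) \<in> carrier A" "?d g (ct [x, y]) \<in> carrier A" if "x \<in> carrier A" "y \<in> carrier A" for x y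
      using cochain_closed[OF c(2) t[OF that]] cochain_closed[OF dc[OF g] t[OF that]] by auto
    have ev: "(?d g \<oplus>\<^bsub>?C\<^esub> F') (ct [a, b]) = F' (ct [a, b]) \<oplus>\<^bsub>A\<^esub> ?d g (ct [a, b])"
      if "a \<in> carrier A" "b \<in> carrier A" for a b
      using t[OF that] Fc[OF that] by (simp add: cochain_add M.a_comm)
    have "F = ?d g \<oplus>\<^bsub>?C\<^esub> F' \<longleftrightarrow>
        (\<forall>a\<in>carrier A. \<forall>b\<in>carrier A. F (ct [a, b]) = F' (ct [a, b]) \<oplus>\<^bsub>A\<^esub> ?d g (ct [a, b]))"
    proof
      assume *: "F = ?d g \<oplus>\<^bsub>?C\<^esub> F'"
      show "\<forall>a\<in>carrier A. \<forall>b\<in>carrier A. F (ct [a, b]) = F' (ct [a, b]) \<oplus>\<^bsub>A\<^esub> ?d g (ct [a, b])"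
        by (subst *) (simp add: ev del: One_nat_def)
    next
      assume *: "\<forall>a\<in>carrier A. \<forall>b\<in>carrier A. F (ct [a, b]) = F' (ct [a, b]) \<oplus>\<^bsub>A\<^esub> ?d g (ct [a, b])"
      show "F = ?d g \<oplus>\<^bsub>?C\<^esub> F'"
        using * ev c dc[OF g] by (intro cochain_eqI[of F 2]) (auto simp: tuples_2 simp del: One_nat_def)
    qed
    then show ?thesis using b de[OF g] by (simp del: One_nat_def)
  qed
  have "?l \<longleftrightarrow> F \<ominus>\<^bsub>cocycles K A 2\<^esub> F' \<in> coboundaries K A 2"
    unfolding cohomology_class_def by (rule Q.coset_eq_iff[OF F F'])
  also have "\<dots> \<longleftrightarrow> (\<exists>g\<in>carrier (cochains K A 1). F = ?d g \<oplus>\<^bsub>?C\<^esub> F')"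
  proof
    assume "F \<ominus>\<^bsub>cocycles K A 2\<^esub> F' \<in> coboundaries K A 2"
    then obtain g where g: "g \<in> carrier (cochains K A 1)" "F \<ominus>\<^bsub>cocycles K A 2\<^esub> F' = ?d g"
      unfolding cb by blast
    have "F = (F \<ominus>\<^bsub>cocycles K A 2\<^esub> F') \<oplus>\<^bsub>cocycles K A 2\<^esub> F'" using F F' by (simp add: Z.M.ag_simps)
    then show "\<exists>g\<in>carrier (cochains K A 1). F = ?d g \<oplus>\<^bsub>?C\<^esub> F'"
      using g by (intro bexI[of _ g]) (simp_all add: cocycles_simps del: One_nat_def)
  next
    assume "\<exists>g\<in>carrier (cochains K A 1). F = ?d g \<oplus>\<^bsub>?C\<^esub> F'"
    then obtain g where g: "g \<in> carrier (cochains K A 1)" "F = ?d g \<oplus>\<^bsub>cocycles K A 2\<^esub> F'"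
      by (auto simp: cocycles_simps simp del: One_nat_def)
    \<comment> \<open>The cancellation takes place in the module of cocycles, so the coboundary
      first has to be known to be a cocycle.\<close>
    have gz: "?d g \<in> carrier (cocycles K A 2)" using g(1) coboundaries_2_subset cb by blast
    have "F \<ominus>\<^bsub>cocycles K A 2\<^esub> F' = ?d g"
      unfolding g(2) by (rule Z.M.add_minus_cancel_right[OF gz F'])
    then show "F \<ominus>\<^bsub>cocycles K A 2\<^esub> F' \<in> coboundaries K A 2" using g(1) cb by blast
  qed
  also have "\<dots> \<longleftrightarrow> (\<exists>h. ?P h)"
  proof
    assume "\<exists>g\<in>carrier (cochains K A 1). F = ?d g \<oplus>\<^bsub>?C\<^esub> F'"
    then show "\<exists>h. ?P h" using eq by blast
  next
    assume "\<exists>h. ?P h"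
    then obtain h where h: "?P h" ..
    then obtain g where g: "g \<in> carrier (cochains K A 1)" "\<forall>a\<in>carrier A. g (ct [a]) = h a"
      using ex_cochain_1 by blast
    then have "\<forall>a\<in>carrier A. \<forall>b\<in>carrier A.
       F (ct [a, b]) = F' (ct [a, b]) \<oplus>\<^bsub>A\<^esub>
         ((a \<otimes>\<^bsub>A\<^esub> g (ct [b]) \<ominus>\<^bsub>A\<^esub> g (ct [a \<otimes>\<^bsub>A\<^esub> b])) \<oplus>\<^bsub>A\<^esub> g (ct [a]) \<otimes>\<^bsub>A\<^esub> b)"
      using h g(2) by simp
    moreover have "bounded_linear_map K A A (\<lambda>a. g (ct [a]))"
      using cochain_multilinear[OF g(1)] unfolding bounded_multilinear_1[OF bornological_axioms] .
    ultimately show "\<exists>g\<in>carrier (cochains K A 1). F = ?d g \<oplus>\<^bsub>?C\<^esub> F'" using eq[OF g(1)] g(1) by blast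
  qed
  finally show ?thesis .
qed

section \<open>Isomorphisms of deformations and changes of section\<close>

definition shear :: "('a \<Rightarrow> 'a) \<Rightarrow> 'a \<times> 'a \<Rightarrow> 'a \<times> 'a" where
  "shear h = (\<lambda>(a, b). (a, b \<oplus>\<^bsub>A\<^esub> h a))"

lemma bounded_linear_shear:
  assumes B: "dual_like A B" and B': "dual_like A B'" and h: "bounded_linear_map K A A h"
  shows "bounded_linear_map K B B' (shear h)"
proof (rule bounded_linear_mapI)
  note s = dual_like_simps[OF B] and s' = dual_like_simps[OF B']
  note hl = bounded_linear_map_linear[OF h]
  note hp = linear_map_closed[OF hl] linear_map_add[OF hl] linear_map_smult[OF hl]
  show "linear_map K B B' (shear h)"
    by (rule linear_mapI) (auto simp: s s' shear_def hp M.a_ac smult_r_distr)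
  fix S assume S: "S \<in> bornology B"
  then have b: "fst ` S \<in> bornology A" "snd ` S \<in> bornology A" by (simp_all add: s)
  have sub: "{x \<oplus>\<^bsub>A\<^esub> y |x y. x \<in> snd ` S \<and> y \<in> h ` fst ` S} \<in> bornology A"
    by (rule bounded_sum[OF b(2) bounded_linear_map_bounded[OF h b(1)]])
  have "shear h ` S \<subseteq> fst ` S \<times> {x \<oplus>\<^bsub>A\<^esub> y |x y. x \<in> snd ` S \<and> y \<in> h ` fst ` S}"
    unfolding shear_def by force
  then show "shear h ` S \<in> bornology B'" by (rule dual_bounded_subset[OF B' b(1) sub])
qed

text \<open>The inverse is the shear by the negative of \<open>h\<close>, again a bounded map, so
  the same lemma bounds both directions.\<close>

lemma born_iso_shear:
  assumes B: "dual_like A B" and B': "dual_like A B'" and h: "bounded_linear_map K A A h"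
  shows "born_iso K B B' (shear h)"
proof -
  note s = dual_like_simps[OF B] and s' = dual_like_simps[OF B']
  note hl = bounded_linear_map_linear[OF h]
  note hc = linear_map_closed[OF hl]
  let ?k = "\<lambda>a. \<ominus> \<one> \<odot>\<^bsub>A\<^esub> h a"
  have "bounded_linear_map K A A (\<lambda>x. \<ominus> \<one> \<odot>\<^bsub>A\<^esub> x)"
    by (rule bounded_linear_mapI[OF linear_scale bounded_scale]) simp_all
  then have k: "bounded_linear_map K A A ?k" by (rule bounded_linear_map_comp[OF h])
  have kh: "shear ?k (shear h x) = x" "shear h (shear ?k x) = x" if x: "x \<in> carrier A \<times> carrier A" for x
  proof -
    obtain a b where "x = (a, b)" "a \<in> carrier A" "b \<in> carrier A" using x by blast
    then show "shear ?k (shear h x) = x" "shear h (shear ?k x) = x"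
      using hc[of a] by (simp_all add: shear_def smult_l_minus M.a_assoc M.r_neg M.l_neg)
  qed
  note bl = bounded_linear_shear[OF B B' h] and bl' = bounded_linear_shear[OF B' B k]
  show ?thesis
  proof (rule born_isoI[OF bounded_linear_map_linear[OF bl]])
    show "bij_betw (shear h) (carrier B) (carrier B')"
    proof (rule bij_betw_byWitness[where f' = "shear ?k"])
      show "shear h ` carrier B \<subseteq> carrier B'" "shear ?k ` carrier B' \<subseteq> carrier B"
        using linear_map_closed[OF bounded_linear_map_linear[OF bl]]
          linear_map_closed[OF bounded_linear_map_linear[OF bl']] by blast+
    qed (use kh in \<open>simp_all add: s(1) s'(1)\<close>)
    show "module K B" by (rule module_dual[OF B])
    show "S \<subseteq> carrier B" if "S \<in> bornology B" for S using that by (simp add: s)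
    show "bornology B' = (\<lambda>S. shear h ` S) ` bornology B"
    proof (intro equalityI subsetI)
      fix S assume S: "S \<in> bornology B'"
      then have "S \<subseteq> carrier A \<times> carrier A" by (simp add: s')
      then have "(\<lambda>x. shear h (shear ?k x)) ` S = (\<lambda>x. x) ` S"
        using kh(2) by (intro image_cong refl) blast
      then have "shear h ` shear ?k ` S = S" by (simp add: image_image)
      then show "S \<in> (\<lambda>S. shear h ` S) ` bornology B"
        using bounded_linear_map_bounded[OF bl' S] by (metis image_eqI)
    next
      fix S assume "S \<in> (\<lambda>S. shear h ` S) ` bornology B"
      then show "S \<in> bornology B'" using bounded_linear_map_bounded[OF bl] by blast
    qed
  qed
qed

text \<open>An isomorphism is fixed by its effect on elements without \<open>t\<close> part, since
  it commutes with \<open>t\<close> and is the identity modulo \<open>t\<close>. Multiplicativity on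
  two such elements is the stated relation; conversely that relation makes the shear by
  \<open>h\<close> multiplicative.\<close>

lemma deformation_iso_iff:
  "(B, B') \<in> deformation_iso K A \<longleftrightarrow> deformation K A B \<and> deformation K A B' \<and>
    (\<exists>h. bounded_linear_map K A A h \<and> (\<forall>a\<in>carrier A. \<forall>b\<in>carrier A.
       defect A B a b = defect A B' a b \<oplus>\<^bsub>A\<^esub> ((a \<otimes>\<^bsub>A\<^esub> h b \<ominus>\<^bsub>A\<^esub> h (a \<otimes>\<^bsub>A\<^esub> b)) \<oplus>\<^bsub>A\<^esub> h a \<otimes>\<^bsub>A\<^esub> b)))"
    (is "_ \<longleftrightarrow> _ \<and> _ \<and> (\<exists>h. ?P h)")
proof -
  have "\<exists>h. ?P h" if B: "deformation K A B" and B': "deformation K A B'"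
    and \<phi>: "born_iso K B B' \<phi>" "\<phi> \<in> ring_hom B B'"
      "\<forall>x\<in>carrier B. \<phi> (t_mult A x) = t_mult A (\<phi> x) \<and> fst (\<phi> x) = fst x" for \<phi>
  proof -
    note dl = deformation_dual_like[OF B] deformation_dual_like[OF B']
    note s = dual_like_simps[OF dl(1)] and s' = dual_like_simps[OF dl(2)]
    note m = deformation_mult[OF B] and m' = deformation_mult[OF B']
    note dc = defect_closed[OF B] and dc' = defect_closed[OF B']
    have \<phi>b: "bounded_linear_map K B B' \<phi>" using \<phi>(1) by (simp add: born_iso_def)
    note \<phi>l = bounded_linear_map_linear[OF \<phi>b]
    \<comment> \<open>The only freedom in an isomorphism that is the identity modulo
      \<open>t\<close>.\<close>
    define h where "h a = snd (\<phi> (a, \<zero>\<^bsub>A\<^esub>))" for a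
    have emb: "bounded_linear_map K A B (\<lambda>a. (a, \<zero>\<^bsub>A\<^esub>))"
    proof (rule bounded_linear_mapI)
      show "linear_map K A B (\<lambda>a. (a, \<zero>\<^bsub>A\<^esub>))" by (rule linear_mapI) (simp_all add: s)
      show "(\<lambda>a. (a, \<zero>\<^bsub>A\<^esub>)) ` S \<in> bornology B" if "S \<in> bornology A" for S
        by (rule dual_bounded_subset[OF dl(1) that bounded_singleton[OF M.zero_closed]]) auto
    qed
    have proj: "bounded_linear_map K B' A snd"
      by (rule bounded_linear_mapI, rule linear_mapI) (auto simp: s')
    have hb: "bounded_linear_map K A A h"
      unfolding h_def by (rule bounded_linear_map_comp[OF emb bounded_linear_map_comp[OF \<phi>b proj]])
    note hc = linear_map_closed[OF bounded_linear_map_linear[OF hb]]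
    have \<phi>0: "\<phi> (a, \<zero>\<^bsub>A\<^esub>) = (a, h a)" if "a \<in> carrier A" for a
      using \<phi>(3) that by (simp add: h_def prod_eq_iff s(1))
    \<comment> \<open>On the part \<open>t (b, 0)\<close> the map only sees \<open>b\<close>: its
      image is \<open>t\<close> times \<open>(b, h b)\<close>, and \<open>t\<close> discards the
      second component.\<close>
    have \<phi>e: "\<phi> (a, b) = (a, h a \<oplus>\<^bsub>A\<^esub> b)" if ab: "a \<in> carrier A" "b \<in> carrier A" for a b
    proof -
      have cl: "(a, \<zero>\<^bsub>A\<^esub>) \<in> carrier B" "(b, \<zero>\<^bsub>A\<^esub>) \<in> carrier B" "t_mult A (b, \<zero>\<^bsub>A\<^esub>) \<in> carrier B"
        using ab by (simp_all add: s(1) t_mult_def)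
      have "(a, b) = (a, \<zero>\<^bsub>A\<^esub>) \<oplus>\<^bsub>B\<^esub> t_mult A (b, \<zero>\<^bsub>A\<^esub>)" using ab by (simp add: t_mult_def s)
      then have "\<phi> (a, b) = \<phi> (a, \<zero>\<^bsub>A\<^esub>) \<oplus>\<^bsub>B'\<^esub> \<phi> (t_mult A (b, \<zero>\<^bsub>A\<^esub>))"
        using linear_map_add[OF \<phi>l cl(1,3)] by simp
      also have "\<phi> (t_mult A (b, \<zero>\<^bsub>A\<^esub>)) = t_mult A (b, h b)"
        using \<phi>(3) cl(2) \<phi>0[OF ab(2)] by simp
      finally show ?thesis using ab hc \<phi>0 by (simp add: t_mult_def s')
    qed
    have "defect A B a b = defect A B' a b \<oplus>\<^bsub>A\<^esub> ((a \<otimes>\<^bsub>A\<^esub> h b \<ominus>\<^bsub>A\<^esub> h (a \<otimes>\<^bsub>A\<^esub> b)) \<oplus>\<^bsub>A\<^esub> h a \<otimes>\<^bsub>A\<^esub> b)"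
      if ab: "a \<in> carrier A" "b \<in> carrier A" for a b
    proof -
      have "\<phi> ((a, \<zero>\<^bsub>A\<^esub>) \<otimes>\<^bsub>B\<^esub> (b, \<zero>\<^bsub>A\<^esub>)) = \<phi> (a, \<zero>\<^bsub>A\<^esub>) \<otimes>\<^bsub>B'\<^esub> \<phi> (b, \<zero>\<^bsub>A\<^esub>)"
        using ab by (intro ring_hom_mult[OF \<phi>(2)]) (simp_all add: s(1))
      then have "h (a \<otimes>\<^bsub>A\<^esub> b) \<oplus>\<^bsub>A\<^esub> defect A B a b = (defect A B' a b \<oplus>\<^bsub>A\<^esub> a \<otimes>\<^bsub>A\<^esub> h b) \<oplus>\<^bsub>A\<^esub> h a \<otimes>\<^bsub>A\<^esub> b"
        using ab dc dc' hc by (simp add: m m' \<phi>e)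
      moreover have "defect A B a b = (h (a \<otimes>\<^bsub>A\<^esub> b) \<oplus>\<^bsub>A\<^esub> defect A B a b) \<ominus>\<^bsub>A\<^esub> h (a \<otimes>\<^bsub>A\<^esub> b)"
        using ab dc hc M.add_minus_cancel_right[of "defect A B a b" "h (a \<otimes>\<^bsub>A\<^esub> b)"] by (simp add: M.a_comm)
      ultimately have "defect A B a b = ((defect A B' a b \<oplus>\<^bsub>A\<^esub> a \<otimes>\<^bsub>A\<^esub> h b) \<oplus>\<^bsub>A\<^esub> h a \<otimes>\<^bsub>A\<^esub> b) \<ominus>\<^bsub>A\<^esub> h (a \<otimes>\<^bsub>A\<^esub> b)"
        by simp
      then show ?thesis using ab dc' hc by (simp add: M.minus_eq M.a_ac)
    qed
    then show ?thesis using hb by blast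
  qed
  moreover have "\<exists>\<phi>. born_iso K B B' \<phi> \<and> \<phi> \<in> ring_hom B B' \<and>
       (\<forall>x\<in>carrier B. \<phi> (t_mult A x) = t_mult A (\<phi> x) \<and> fst (\<phi> x) = fst x)"
    if B: "deformation K A B" and B': "deformation K A B'" and h: "?P h" for h
  proof -
    note dl = deformation_dual_like[OF B] deformation_dual_like[OF B']
    note s = dual_like_simps[OF dl(1)] and s' = dual_like_simps[OF dl(2)]
    note m = deformation_mult[OF B] and m' = deformation_mult[OF B']
    note dc = defect_closed[OF B] and dc' = defect_closed[OF B']
    interpret B: complete_algebra K p B by (rule complete_algebra_deformation[OF B])
    interpret B': complete_algebra K p B' by (rule complete_algebra_deformation[OF B'])
    have hb: "bounded_linear_map K A A h" using h by blast
    note hl = bounded_linear_map_linear[OF hb]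
    note hc = linear_map_closed[OF hl] and ha = linear_map_add[OF hl]
    have iso: "born_iso K B B' (shear h)" by (rule born_iso_shear[OF dl hb])
    then have sl: "linear_map K B B' (shear h)" and bij: "bij_betw (shear h) (carrier B) (carrier B')"
      by (simp_all add: born_iso_def bounded_linear_map_linear)
    have mult: "shear h (x \<otimes>\<^bsub>B\<^esub> y) = shear h x \<otimes>\<^bsub>B'\<^esub> shear h y" if "x \<in> carrier B" "y \<in> carrier B" for x y
    proof -
      obtain a b c d where x: "x = (a, b)" "y = (c, d)"
        and cl: "a \<in> carrier A" "b \<in> carrier A" "c \<in> carrier A" "d \<in> carrier A"
        using \<open>x \<in> carrier B\<close> \<open>y \<in> carrier B\<close> by (auto simp: s(1))
      have "defect A B a c \<oplus>\<^bsub>A\<^esub> h (a \<otimes>\<^bsub>A\<^esub> c) = defect A B' a c \<oplus>\<^bsub>A\<^esub> (a \<otimes>\<^bsub>A\<^esub> h c \<oplus>\<^bsub>A\<^esub> h a \<otimes>\<^bsub>A\<^esub> c)"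
      proof -
        have "defect A B a c = defect A B' a c \<oplus>\<^bsub>A\<^esub> ((a \<otimes>\<^bsub>A\<^esub> h c \<ominus>\<^bsub>A\<^esub> h (a \<otimes>\<^bsub>A\<^esub> c)) \<oplus>\<^bsub>A\<^esub> h a \<otimes>\<^bsub>A\<^esub> c)"
          using h cl by blast
        then have "defect A B a c \<oplus>\<^bsub>A\<^esub> h (a \<otimes>\<^bsub>A\<^esub> c) =
          (defect A B' a c \<oplus>\<^bsub>A\<^esub> ((a \<otimes>\<^bsub>A\<^esub> h c \<ominus>\<^bsub>A\<^esub> h (a \<otimes>\<^bsub>A\<^esub> c)) \<oplus>\<^bsub>A\<^esub> h a \<otimes>\<^bsub>A\<^esub> c)) \<oplus>\<^bsub>A\<^esub> h (a \<otimes>\<^bsub>A\<^esub> c)"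
          by simp
        also have "\<dots> = defect A B' a c \<oplus>\<^bsub>A\<^esub> (a \<otimes>\<^bsub>A\<^esub> h c \<oplus>\<^bsub>A\<^esub> h a \<otimes>\<^bsub>A\<^esub> c)"
          using cl dc' hc by (intro M.add_minus_add_cancel) simp_all
        finally show ?thesis .
      qed
      then have "(defect A B a c \<oplus>\<^bsub>A\<^esub> h (a \<otimes>\<^bsub>A\<^esub> c)) \<oplus>\<^bsub>A\<^esub> (a \<otimes>\<^bsub>A\<^esub> d \<oplus>\<^bsub>A\<^esub> b \<otimes>\<^bsub>A\<^esub> c) =
        (defect A B' a c \<oplus>\<^bsub>A\<^esub> (a \<otimes>\<^bsub>A\<^esub> h c \<oplus>\<^bsub>A\<^esub> h a \<otimes>\<^bsub>A\<^esub> c)) \<oplus>\<^bsub>A\<^esub> (a \<otimes>\<^bsub>A\<^esub> d \<oplus>\<^bsub>A\<^esub> b \<otimes>\<^bsub>A\<^esub> c)" by simp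
      then show ?thesis
        using cl dc dc' hc by (simp add: x shear_def m m' A.l_distr A.r_distr M.a_ac)
    qed
    \<comment> \<open>The units of \<open>B\<close> and \<open>B'\<close> are not given explicitly.
      A multiplicative surjection preserves the unit: multiply the image of the unit by the image of
      a preimage of the unit of \<open>B'\<close>.\<close>
    have "shear h \<one>\<^bsub>B\<^esub> = \<one>\<^bsub>B'\<^esub>"
    proof -
      have u: "shear h \<one>\<^bsub>B\<^esub> \<in> carrier B'" using linear_map_closed[OF sl] by simp
      obtain x where x: "x \<in> carrier B" "shear h x = \<one>\<^bsub>B'\<^esub>"
        using bij B'.A.one_closed unfolding bij_betw_def by (metis imageE)
      have "shear h \<one>\<^bsub>B\<^esub> = shear h \<one>\<^bsub>B\<^esub> \<otimes>\<^bsub>B'\<^esub> shear h x" using u x(2) by simp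
      also have "\<dots> = shear h (\<one>\<^bsub>B\<^esub> \<otimes>\<^bsub>B\<^esub> x)" using mult[OF B.A.one_closed x(1)] by simp
      also have "\<dots> = \<one>\<^bsub>B'\<^esub>" using x by simp
      finally show ?thesis .
    qed
    then have "shear h \<in> ring_hom B B'"
      using linear_map_closed[OF sl] linear_map_add[OF sl] mult by (intro ring_hom_memI) auto
    moreover have "shear h (t_mult A x) = t_mult A (shear h x) \<and> fst (shear h x) = fst x"
      if "x \<in> carrier B" for x
      using that linear_map_zero[OF hl module_V module_V] by (auto simp: s(1) shear_def t_mult_def)
    ultimately show ?thesis using iso by blast
  qed
  ultimately show ?thesis unfolding deformation_iso_def by blast
qed

text \<open>A section has the form \<open>a \<mapsto> (a, h a)\<close>. Expanding the product with
  \<open>deformation_mult\<close> adds to the defect precisely the coboundary of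
  \<open>h\<close>.\<close>

lemma section_defect:
  assumes B: "deformation K A B" and \<rho>: "is_section K A B \<rho>" and ab: "a \<in> carrier A" "b \<in> carrier A"
  shows "bounded_linear_map K A A (\<lambda>a. snd (\<rho> a))"
    and "\<rho> a \<otimes>\<^bsub>B\<^esub> \<rho> b \<ominus>\<^bsub>B\<^esub> \<rho> (a \<otimes>\<^bsub>A\<^esub> b) = (\<zero>\<^bsub>A\<^esub>, defect A B a b \<oplus>\<^bsub>A\<^esub>
      ((a \<otimes>\<^bsub>A\<^esub> snd (\<rho> b) \<ominus>\<^bsub>A\<^esub> snd (\<rho> (a \<otimes>\<^bsub>A\<^esub> b))) \<oplus>\<^bsub>A\<^esub> snd (\<rho> a) \<otimes>\<^bsub>A\<^esub> b))"
proof -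
  note dl = deformation_dual_like[OF B]
  note s = dual_like_simps[OF dl]
  have \<rho>b: "bounded_linear_map K A B \<rho>" using \<rho> by (simp add: is_section_def)
  have proj: "bounded_linear_map K B A snd"
    by (rule bounded_linear_mapI, rule linear_mapI) (auto simp: s)
  show h: "bounded_linear_map K A A (\<lambda>a. snd (\<rho> a))" by (rule bounded_linear_map_comp[OF \<rho>b proj])
  note hc = linear_map_closed[OF bounded_linear_map_linear[OF h]]
  have e: "\<rho> x = (x, snd (\<rho> x))" if "x \<in> carrier A" for x
    using \<rho> that by (simp add: is_section_def prod_eq_iff)
  have "\<rho> a \<otimes>\<^bsub>B\<^esub> \<rho> b \<ominus>\<^bsub>B\<^esub> \<rho> (a \<otimes>\<^bsub>A\<^esub> b) =
      (a, snd (\<rho> a)) \<otimes>\<^bsub>B\<^esub> (b, snd (\<rho> b)) \<ominus>\<^bsub>B\<^esub> (a \<otimes>\<^bsub>A\<^esub> b, snd (\<rho> (a \<otimes>\<^bsub>A\<^esub> b)))"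
    using e ab A.m_closed by metis
  also have "\<dots> = (\<zero>\<^bsub>A\<^esub>, defect A B a b \<oplus>\<^bsub>A\<^esub>
      ((a \<otimes>\<^bsub>A\<^esub> snd (\<rho> b) \<ominus>\<^bsub>A\<^esub> snd (\<rho> (a \<otimes>\<^bsub>A\<^esub> b))) \<oplus>\<^bsub>A\<^esub> snd (\<rho> a) \<otimes>\<^bsub>A\<^esub> b))"
    using ab hc defect_closed[OF B]
    by (simp add: deformation_mult[OF B] dual_minus[OF dl] M.minus_eq_zero_iff) (simp add: M.minus_eq M.a_ac)
  finally show "\<rho> a \<otimes>\<^bsub>B\<^esub> \<rho> b \<ominus>\<^bsub>B\<^esub> \<rho> (a \<otimes>\<^bsub>A\<^esub> b) = \<dots>" .
qed

section \<open>From cocycles to deformations\<close>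

lemma deformation_square_zero_extension:
  assumes f: "f \<in> carrier (cocycles K A 2)"
  defines "B \<equiv> square_zero_extension A (\<lambda>a b. f (ct [a, b]))"
  shows "deformation K A B"
    and "a \<in> carrier A \<Longrightarrow> b \<in> carrier A \<Longrightarrow> defect A B a b = f (ct [a, b])"
proof -
  define g where "g a b = f (ct [a, b])" for a b
  have dl: "dual_like A B" unfolding B_def square_zero_extension_def dual_like_def by blast
  note s = dual_like_simps[OF dl]
  have m: "(a, b) \<otimes>\<^bsub>B\<^esub> (c, d) = (a \<otimes>\<^bsub>A\<^esub> c, (g a c \<oplus>\<^bsub>A\<^esub> a \<otimes>\<^bsub>A\<^esub> d) \<oplus>\<^bsub>A\<^esub> b \<otimes>\<^bsub>A\<^esub> c)" for a b c d
    by (simp add: B_def square_zero_extension_def g_def)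
  have one: "\<one>\<^bsub>B\<^esub> = (\<one>\<^bsub>A\<^esub>, \<ominus>\<^bsub>A\<^esub> g \<one>\<^bsub>A\<^esub> \<one>\<^bsub>A\<^esub>)"
    by (simp add: B_def square_zero_extension_def g_def)
  have fc: "f \<in> carrier (cochains K A 2)" using f by (simp add: cocycle_iff)
  have gbil: "bounded_bilinear_map K A A g"
    using cochain_multilinear[OF fc] unfolding bounded_multilinear_2[OF bornological_axioms] g_def .
  then have gl: "linear_map K A A (\<lambda>b. g a b)" "linear_map K A A (\<lambda>b. g b a)" if "a \<in> carrier A" for a
    using that by (auto simp: bounded_bilinear_map_def)
  have gb: "{g a b |a b. a \<in> S \<and> b \<in> T} \<in> bornology A" if "S \<in> bornology A" "T \<in> bornology A" for S T
    using gbil that by (auto simp: bounded_bilinear_map_def)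
  have gc: "g a b \<in> carrier A" if "a \<in> carrier A" "b \<in> carrier A" for a b
    using linear_map_closed[OF gl(1)[OF that(1)] that(2)] .
  have ga: "g a (b \<oplus>\<^bsub>A\<^esub> c) = g a b \<oplus>\<^bsub>A\<^esub> g a c" "g (b \<oplus>\<^bsub>A\<^esub> c) a = g b a \<oplus>\<^bsub>A\<^esub> g c a"
    if "a \<in> carrier A" "b \<in> carrier A" "c \<in> carrier A" for a b c
    using linear_map_add[OF gl(1)[OF that(1)] that(2,3)] linear_map_add[OF gl(2)[OF that(1)] that(2,3)] by auto
  have gs: "g a (d \<odot>\<^bsub>A\<^esub> b) = d \<odot>\<^bsub>A\<^esub> g a b" "g (d \<odot>\<^bsub>A\<^esub> b) a = d \<odot>\<^bsub>A\<^esub> g b a"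
    if "a \<in> carrier A" "b \<in> carrier A" "d \<in> carrier K" for a b d
    using linear_map_smult[OF gl(1)[OF that(1)] that(3,2)] linear_map_smult[OF gl(2)[OF that(1)] that(3,2)] by auto
  have coc: "a \<otimes>\<^bsub>A\<^esub> g b c \<oplus>\<^bsub>A\<^esub> g a (b \<otimes>\<^bsub>A\<^esub> c) = g (a \<otimes>\<^bsub>A\<^esub> b) c \<oplus>\<^bsub>A\<^esub> g a b \<otimes>\<^bsub>A\<^esub> c"
    if "a \<in> carrier A" "b \<in> carrier A" "c \<in> carrier A" for a b c
    using f that unfolding cocycle_2_iff g_def by blast
  \<comment> \<open>The cocycle identity at \<open>(1, 1, a)\<close>, and below at
    \<open>(a, 1, 1)\<close>. Together they say that subtracting \<open>g(1, 1)\<close> in the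
    \<open>t\<close> part of the unit corrects the product from both sides.\<close>
  have g1: "g \<one>\<^bsub>A\<^esub> a = g \<one>\<^bsub>A\<^esub> \<one>\<^bsub>A\<^esub> \<otimes>\<^bsub>A\<^esub> a" if "a \<in> carrier A" for a
  proof -
    have "g \<one>\<^bsub>A\<^esub> a \<oplus>\<^bsub>A\<^esub> g \<one>\<^bsub>A\<^esub> a = g \<one>\<^bsub>A\<^esub> \<one>\<^bsub>A\<^esub> \<otimes>\<^bsub>A\<^esub> a \<oplus>\<^bsub>A\<^esub> g \<one>\<^bsub>A\<^esub> a"
      using coc[of "\<one>\<^bsub>A\<^esub>" "\<one>\<^bsub>A\<^esub>" a] that gc by (simp add: M.a_comm)
    then show ?thesis using that gc by (subst (asm) M.add.right_cancel) simp_all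
  qed
  have g2: "g a \<one>\<^bsub>A\<^esub> = a \<otimes>\<^bsub>A\<^esub> g \<one>\<^bsub>A\<^esub> \<one>\<^bsub>A\<^esub>" if "a \<in> carrier A" for a
  proof -
    have "a \<otimes>\<^bsub>A\<^esub> g \<one>\<^bsub>A\<^esub> \<one>\<^bsub>A\<^esub> \<oplus>\<^bsub>A\<^esub> g a \<one>\<^bsub>A\<^esub> = g a \<one>\<^bsub>A\<^esub> \<oplus>\<^bsub>A\<^esub> g a \<one>\<^bsub>A\<^esub>"
      using coc[of a "\<one>\<^bsub>A\<^esub>" "\<one>\<^bsub>A\<^esub>"] that gc by simp
    then show ?thesis using that gc by (subst (asm) M.add.right_cancel) simp_all
  qed
  have mod: "module K B" by (rule module_dual[OF dl])
  then interpret B: module K B .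
  have ring: "ring B"
  proof (rule ringI)
    show "abelian_group B" ..
    show "Group.monoid B"
    proof (rule monoidI)
      fix x y assume "x \<in> carrier B" "y \<in> carrier B"
      then show "x \<otimes>\<^bsub>B\<^esub> y \<in> carrier B" using gc by (auto simp: s(1) m)
    next
      show "\<one>\<^bsub>B\<^esub> \<in> carrier B" using gc by (simp add: s(1) one)
    next
      fix x y z assume "x \<in> carrier B" "y \<in> carrier B" "z \<in> carrier B"
      then obtain a b c d u v where x: "x = (a, b)" "y = (c, d)" "z = (u, v)"
        and cl: "a \<in> carrier A" "b \<in> carrier A" "c \<in> carrier A" "d \<in> carrier A" "u \<in> carrier A" "v \<in> carrier A"
        by (auto simp: s(1))
      \<comment> \<open>The terms free of \<open>g\<close>; they agree for both bracketings by
        associativity in \<open>A\<close>, and what remains is the cocycle identity at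
        \<open>(a, c, u)\<close>.\<close>
      let ?R = "(a \<otimes>\<^bsub>A\<^esub> (c \<otimes>\<^bsub>A\<^esub> v) \<oplus>\<^bsub>A\<^esub> a \<otimes>\<^bsub>A\<^esub> (d \<otimes>\<^bsub>A\<^esub> u)) \<oplus>\<^bsub>A\<^esub> b \<otimes>\<^bsub>A\<^esub> (c \<otimes>\<^bsub>A\<^esub> u)"
      have "(x \<otimes>\<^bsub>B\<^esub> y) \<otimes>\<^bsub>B\<^esub> z =
          (a \<otimes>\<^bsub>A\<^esub> (c \<otimes>\<^bsub>A\<^esub> u), (g (a \<otimes>\<^bsub>A\<^esub> c) u \<oplus>\<^bsub>A\<^esub> g a c \<otimes>\<^bsub>A\<^esub> u) \<oplus>\<^bsub>A\<^esub> ?R)"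
        using cl gc by (simp add: x m A.l_distr A.m_assoc M.a_ac)
      moreover have "x \<otimes>\<^bsub>B\<^esub> (y \<otimes>\<^bsub>B\<^esub> z) =
          (a \<otimes>\<^bsub>A\<^esub> (c \<otimes>\<^bsub>A\<^esub> u), (a \<otimes>\<^bsub>A\<^esub> g c u \<oplus>\<^bsub>A\<^esub> g a (c \<otimes>\<^bsub>A\<^esub> u)) \<oplus>\<^bsub>A\<^esub> ?R)"
        using cl gc by (simp add: x m A.r_distr M.a_ac)
      ultimately show "(x \<otimes>\<^bsub>B\<^esub> y) \<otimes>\<^bsub>B\<^esub> z = x \<otimes>\<^bsub>B\<^esub> (y \<otimes>\<^bsub>B\<^esub> z)" using coc[OF cl(1,3,5)] by simp
    next
      fix x assume "x \<in> carrier B"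
      then obtain a b where x: "x = (a, b)" and cl: "a \<in> carrier A" "b \<in> carrier A" by (auto simp: s(1))
      have z: "(y \<oplus>\<^bsub>A\<^esub> w) \<oplus>\<^bsub>A\<^esub> \<ominus>\<^bsub>A\<^esub> y = w" "(y \<oplus>\<^bsub>A\<^esub> \<ominus>\<^bsub>A\<^esub> y) \<oplus>\<^bsub>A\<^esub> w = w"
        if "y \<in> carrier A" "w \<in> carrier A" for y w
        using that M.add_minus_cancel_right[of w y] by (simp_all add: M.minus_eq M.a_comm M.r_neg M.l_neg)
      show "\<one>\<^bsub>B\<^esub> \<otimes>\<^bsub>B\<^esub> x = x"
        using cl gc by (simp add: x m one g1[OF cl(1)] A.l_minus z)
      show "x \<otimes>\<^bsub>B\<^esub> \<one>\<^bsub>B\<^esub> = x"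
        using cl gc by (simp add: x m one g2[OF cl(1)] A.r_minus z)
    qed
  next
    fix x y z assume "x \<in> carrier B" "y \<in> carrier B" "z \<in> carrier B"
    then obtain a b c d u v where x: "x = (a, b)" "y = (c, d)" "z = (u, v)"
      and cl: "a \<in> carrier A" "b \<in> carrier A" "c \<in> carrier A" "d \<in> carrier A" "u \<in> carrier A" "v \<in> carrier A"
      by (auto simp: s(1))
    show "(x \<oplus>\<^bsub>B\<^esub> y) \<otimes>\<^bsub>B\<^esub> z = x \<otimes>\<^bsub>B\<^esub> z \<oplus>\<^bsub>B\<^esub> y \<otimes>\<^bsub>B\<^esub> z"
      using cl gc by (simp add: x m s(3) ga A.l_distr M.a_ac)
    show "z \<otimes>\<^bsub>B\<^esub> (x \<oplus>\<^bsub>B\<^esub> y) = z \<otimes>\<^bsub>B\<^esub> x \<oplus>\<^bsub>B\<^esub> z \<otimes>\<^bsub>B\<^esub> y"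
      using cl gc by (simp add: x m s(3) ga A.r_distr M.a_ac)
  qed
  then interpret Br: ring B .
  have bil: "bounded_bilinear_map K B B (\<lambda>x y. x \<otimes>\<^bsub>B\<^esub> y)"
    unfolding bounded_bilinear_map_def
  proof (intro conjI ballI)
    fix x assume x: "x \<in> carrier B"
    have sm: "(d \<odot>\<^bsub>B\<^esub> y) \<otimes>\<^bsub>B\<^esub> z = d \<odot>\<^bsub>B\<^esub> (y \<otimes>\<^bsub>B\<^esub> z)" "y \<otimes>\<^bsub>B\<^esub> (d \<odot>\<^bsub>B\<^esub> z) = d \<odot>\<^bsub>B\<^esub> (y \<otimes>\<^bsub>B\<^esub> z)"
      if yz: "y \<in> carrier B" "z \<in> carrier B" and d: "d \<in> carrier K" for y z d
    proof -
      obtain a b c e where "y = (a, b)" "z = (c, e)"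
        "a \<in> carrier A" "b \<in> carrier A" "c \<in> carrier A" "e \<in> carrier A" using yz by (auto simp: s(1))
      then show "(d \<odot>\<^bsub>B\<^esub> y) \<otimes>\<^bsub>B\<^esub> z = d \<odot>\<^bsub>B\<^esub> (y \<otimes>\<^bsub>B\<^esub> z)" "y \<otimes>\<^bsub>B\<^esub> (d \<odot>\<^bsub>B\<^esub> z) = d \<odot>\<^bsub>B\<^esub> (y \<otimes>\<^bsub>B\<^esub> z)"
        using d gc by (simp_all add: m s(4) gs smult_mult smult_r_distr)
    qed
    show "linear_map K B B (\<lambda>y. x \<otimes>\<^bsub>B\<^esub> y)" "linear_map K B B (\<lambda>y. y \<otimes>\<^bsub>B\<^esub> x)"
      using x by (auto intro!: linear_mapI simp: Br.l_distr Br.r_distr sm)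
  next
    fix S T assume "S \<in> bornology B" "T \<in> bornology B"
    then have b: "fst ` S \<in> bornology A" "snd ` S \<in> bornology A" "fst ` T \<in> bornology A" "snd ` T \<in> bornology A"
      by (simp_all add: s(5))
    \<comment> \<open>A product of two bounded sets lies in a box: products of first components, and
      sums of the three kinds of terms in the \<open>t\<close> part, each kind ranging over a
      bounded set.\<close>
    let ?G = "{g a b |a b. a \<in> fst ` S \<and> b \<in> fst ` T}"
    let ?P = "{a \<otimes>\<^bsub>A\<^esub> b |a b. a \<in> fst ` S \<and> b \<in> snd ` T}"
    let ?Q = "{a \<otimes>\<^bsub>A\<^esub> b |a b. a \<in> snd ` S \<and> b \<in> fst ` T}"
    let ?GP = "{x \<oplus>\<^bsub>A\<^esub> y |x y. x \<in> ?G \<and> y \<in> ?P}"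
    let ?Y = "{x \<oplus>\<^bsub>A\<^esub> y |x y. x \<in> ?GP \<and> y \<in> ?Q}"
    let ?X = "{a \<otimes>\<^bsub>A\<^esub> b |a b. a \<in> fst ` S \<and> b \<in> fst ` T}"
    have "{x \<otimes>\<^bsub>B\<^esub> y |x y. x \<in> S \<and> y \<in> T} \<subseteq> ?X \<times> ?Y"
    proof
      fix z assume "z \<in> {x \<otimes>\<^bsub>B\<^esub> y |x y. x \<in> S \<and> y \<in> T}"
      then obtain a b c d where z: "z = (a, b) \<otimes>\<^bsub>B\<^esub> (c, d)" "(a, b) \<in> S" "(c, d) \<in> T" by auto
      then have i: "a \<in> fst ` S" "b \<in> snd ` S" "c \<in> fst ` T" "d \<in> snd ` T" by force+
      have "a \<otimes>\<^bsub>A\<^esub> c \<in> ?X" "g a c \<in> ?G" "a \<otimes>\<^bsub>A\<^esub> d \<in> ?P" "b \<otimes>\<^bsub>A\<^esub> c \<in> ?Q" using i by blast+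
      moreover from this have "g a c \<oplus>\<^bsub>A\<^esub> a \<otimes>\<^bsub>A\<^esub> d \<in> ?GP" by blast
      ultimately have "(g a c \<oplus>\<^bsub>A\<^esub> a \<otimes>\<^bsub>A\<^esub> d) \<oplus>\<^bsub>A\<^esub> b \<otimes>\<^bsub>A\<^esub> c \<in> ?Y" "a \<otimes>\<^bsub>A\<^esub> c \<in> ?X" by blast+
      then show "z \<in> ?X \<times> ?Y" unfolding z(1) m by blast
    qed
    then show "{x \<otimes>\<^bsub>B\<^esub> y |x y. x \<in> S \<and> y \<in> T} \<in> bornology B"
      by (rule dual_bounded_subset[OF dl bounded_mult[OF b(1,3)]
            bounded_sum[OF bounded_sum[OF gb[OF b(1,3)] bounded_mult[OF b(1,4)]] bounded_mult[OF b(2,3)]]])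
  qed
  have cB: "complete_bornological_space K p B"
    by (intro complete_bornological_space.intro bornological_dual[OF dl]
        complete_bornological_space_axioms.intro complete_dual[OF dl])
  then interpret Bc: complete_bornological_space K p B .
  \<comment> \<open>The algebra structure has to be a bounded map on the completed tensor square, so
    the bounded bilinear product is extended there by the universal property, now for
    \<open>B\<close> in place of \<open>A\<close>.\<close>
  interpret P: tensor_power_complete_pair K p B 2 B
    by (intro tensor_power_complete_pair.intro tensor_power_space.intro Bc.bornological_axioms cB)
  have "bounded_multilinear K B 2 B (\<lambda>xs. hd xs \<otimes>\<^bsub>B\<^esub> last xs)"
    unfolding Bc.bounded_multilinear_2[OF Bc.bornological_axioms] using bil by simp
  then obtain \<mu> where \<mu>: "\<mu> \<in> carrier P.H"
    "\<forall>xs\<in>tuples B 2. \<mu> (ctensor K B xs) = hd xs \<otimes>\<^bsub>B\<^esub> last xs"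
    by (rule P.hom_space_extend)
  have "complete_born_algebra K B"
    unfolding complete_born_algebra_def
  proof (intro conjI exI[of _ \<mu>] ballI complete_dual[OF dl] ring)
    show "bounded_linear_map K (completed_tensor_power K B 2) B \<mu>" using \<mu>(1) by (simp add: hom_space_simps)
    show "\<mu> (ctensor K B [a, b]) = a \<otimes>\<^bsub>B\<^esub> b" if "a \<in> carrier B" "b \<in> carrier B" for a b
      using bspec[OF \<mu>(2), of "[a, b]"] that by (simp add: tuples_def)
  qed
  moreover have "B = (dual_numbers A)\<lparr>mult := mult B, one := one B\<rparr>"
    by (simp add: B_def square_zero_extension_def)
  moreover have "fst \<in> ring_hom B A"
    by (rule ring_hom_memI) (auto simp: s m one)
  \<comment> \<open>Multiplication by \<open>t\<close> puts zero into the first component, where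
    bilinearity makes the contribution of \<open>g\<close> disappear.\<close>
  moreover have g0: "g \<zero>\<^bsub>A\<^esub> a = \<zero>\<^bsub>A\<^esub>" "g a \<zero>\<^bsub>A\<^esub> = \<zero>\<^bsub>A\<^esub>" if "a \<in> carrier A" for a
    using linear_map_zero[OF gl(1)[OF that] module_V module_V] linear_map_zero[OF gl(2)[OF that] module_V module_V] by auto
  moreover have "t_mult A x \<otimes>\<^bsub>B\<^esub> y = t_mult A (x \<otimes>\<^bsub>B\<^esub> y) \<and> x \<otimes>\<^bsub>B\<^esub> t_mult A y = t_mult A (x \<otimes>\<^bsub>B\<^esub> y)"
    if "x \<in> carrier B" "y \<in> carrier B" for x y
    using that by (auto simp: s(1) m t_mult_def g0)
  ultimately show "deformation K A B" unfolding deformation_def by blast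
  show "defect A B a b = f (ct [a, b])" if "a \<in> carrier A" "b \<in> carrier A"
    using that gc by (simp add: defect_def m g_def[symmetric])
qed

text \<open>Provides the coboundary of \<open>h\<close> as an actual cocycle, so that it can be
  added to the defect of a deformation.\<close>

lemma coboundary_of_map:
  assumes h: "bounded_linear_map K A A h"
  obtains d where "d \<in> carrier (cocycles K A 2)"
    "\<forall>a\<in>carrier A. \<forall>b\<in>carrier A. d (ct [a, b]) = (a \<otimes>\<^bsub>A\<^esub> h b \<ominus>\<^bsub>A\<^esub> h (a \<otimes>\<^bsub>A\<^esub> b)) \<oplus>\<^bsub>A\<^esub> h a \<otimes>\<^bsub>A\<^esub> b"
proof -
  obtain g where g: "g \<in> carrier (cochains K A 1)" "\<forall>a\<in>carrier A. g (ct [a]) = h a"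
    using h by (rule ex_cochain_1)
  have "differential K A 1 g (ct [a, b]) = (a \<otimes>\<^bsub>A\<^esub> h b \<ominus>\<^bsub>A\<^esub> h (a \<otimes>\<^bsub>A\<^esub> b)) \<oplus>\<^bsub>A\<^esub> h a \<otimes>\<^bsub>A\<^esub> b"
    if "a \<in> carrier A" "b \<in> carrier A" for a b
    using differential_1_eval[OF g(1) that] that g(2) by simp
  moreover have "differential K A 1 g \<in> carrier (cocycles K A 2)"
    using coboundaries_2_subset g(1) by (auto simp: coboundaries_def numeral_2_eq_2)
  ultimately show ?thesis by (intro that[of "differential K A 1 g"]) simp_all
qed

section \<open>The class of a deformation\<close>

lemma zero_section:
  assumes B: "deformation K A B"
  shows "is_section K A B (\<lambda>a. (a, \<zero>\<^bsub>A\<^esub>))"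
proof -
  note dl = deformation_dual_like[OF B]
  have "bounded_linear_map K A B (\<lambda>a. (a, \<zero>\<^bsub>A\<^esub>))"
  proof (rule bounded_linear_mapI)
    show "linear_map K A B (\<lambda>a. (a, \<zero>\<^bsub>A\<^esub>))" by (rule linear_mapI) (simp_all add: dual_like_simps[OF dl])
    show "(\<lambda>a. (a, \<zero>\<^bsub>A\<^esub>)) ` S \<in> bornology B" if "S \<in> bornology A" for S
      by (rule dual_bounded_subset[OF dl that bounded_singleton[OF M.zero_closed]]) auto
  qed
  then show ?thesis by (simp add: is_section_def)
qed

text \<open>The choice is unambiguous, since a 2-cochain is determined by its values on pairs. It
  fixes one cocycle for each deformation, to which all other sections are compared.\<close>

definition defect_cochain :: "('k, 'a \<times> 'a) born_space \<Rightarrow> ('k, 'a) ctensor \<Rightarrow> 'a" where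
  "defect_cochain B = (SOME f. f \<in> carrier (cocycles K A 2) \<and>
     (\<forall>a\<in>carrier A. \<forall>b\<in>carrier A. f (ct [a, b]) = defect A B a b))"

lemma
  assumes B: "deformation K A B"
  shows defect_cochain_cocycle: "defect_cochain B \<in> carrier (cocycles K A 2)"
    and defect_cochain_eval: "a \<in> carrier A \<Longrightarrow> b \<in> carrier A \<Longrightarrow> defect_cochain B (ct [a, b]) = defect A B a b"
proof -
  have "\<exists>f. f \<in> carrier (cocycles K A 2) \<and>
     (\<forall>a\<in>carrier A. \<forall>b\<in>carrier A. f (ct [a, b]) = defect A B a b)"
    using defect_cocycle[OF B] by blast
  then have "defect_cochain B \<in> carrier (cocycles K A 2) \<and>
     (\<forall>a\<in>carrier A. \<forall>b\<in>carrier A. defect_cochain B (ct [a, b]) = defect A B a b)"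
    unfolding defect_cochain_def by (rule someI_ex)
  then show "defect_cochain B \<in> carrier (cocycles K A 2)"
    "a \<in> carrier A \<Longrightarrow> b \<in> carrier A \<Longrightarrow> defect_cochain B (ct [a, b]) = defect A B a b"
    by blast+
qed

text \<open>Both conditions have been brought to the existence of the same \<open>h\<close>. As
  equality of an invariant on deformations, the relation is at once an equivalence, and the
  invariant separates its classes.\<close>

lemma deformation_iso_iff_class:
  "(B, B') \<in> deformation_iso K A \<longleftrightarrow> deformation K A B \<and> deformation K A B' \<and>
     cohomology_class K A 2 (defect_cochain B) = cohomology_class K A 2 (defect_cochain B')"
proof (cases "deformation K A B \<and> deformation K A B'")
  case True
  then have d: "deformation K A B" "deformation K A B'" by auto
  show ?thesis
    unfolding deformation_iso_iff
      cohomology_class_2_eq_iff[OF defect_cochain_cocycle[OF d(1)] defect_cochain_cocycle[OF d(2)]]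
    using d by (simp add: defect_cochain_eval)
qed (auto simp: deformation_iso_iff)

text \<open>Independence of the section: its cocycle differs from the one of the zero section by the
  coboundary of the \<open>t\<close> part of the section.\<close>

lemma section_class:
  assumes B: "deformation K A B" and \<rho>: "is_section K A B \<rho>"
  shows "\<exists>!f. f \<in> carrier (cochains K A 2) \<and> represents_defect K A B \<rho> f"
    and "f \<in> carrier (cochains K A 2) \<Longrightarrow> represents_defect K A B \<rho> f \<Longrightarrow>
      f \<in> carrier (cocycles K A 2) \<and>
      cohomology_class K A 2 (defect_cochain B) = cohomology_class K A 2 f"
proof -
  interpret Z: module K "cocycles K A 2" by (rule module_cocycles)
  define h where "h a = snd (\<rho> a)" for a
  have hb: "bounded_linear_map K A A h"
    unfolding h_def by (rule section_defect(1)[OF B \<rho> M.zero_closed M.zero_closed])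
  obtain d where d: "d \<in> carrier (cocycles K A 2)"
    "\<forall>a\<in>carrier A. \<forall>b\<in>carrier A. d (ct [a, b]) = (a \<otimes>\<^bsub>A\<^esub> h b \<ominus>\<^bsub>A\<^esub> h (a \<otimes>\<^bsub>A\<^esub> b)) \<oplus>\<^bsub>A\<^esub> h a \<otimes>\<^bsub>A\<^esub> b"
    using hb by (rule coboundary_of_map)
  let ?F = "defect_cochain B"
  \<comment> \<open>Being a sum of two cocycles, the candidate is one without further computation,
    and its values on pairs are those demanded by \<open>section_defect\<close>.\<close>
  let ?f = "?F \<oplus>\<^bsub>cocycles K A 2\<^esub> d"
  note F = defect_cochain_cocycle[OF B]
  have fz: "?f \<in> carrier (cocycles K A 2)" using F d(1) by simp
  have fc: "?f \<in> carrier (cochains K A 2)" using fz unfolding cocycle_iff by blast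
  have fe: "?f (ct [a, b]) = defect A B a b \<oplus>\<^bsub>A\<^esub> ((a \<otimes>\<^bsub>A\<^esub> h b \<ominus>\<^bsub>A\<^esub> h (a \<otimes>\<^bsub>A\<^esub> b)) \<oplus>\<^bsub>A\<^esub> h a \<otimes>\<^bsub>A\<^esub> b)"
    if ab: "a \<in> carrier A" "b \<in> carrier A" for a b
  proof -
    have "[a, b] \<in> tuples A 2" using ab by (simp add: tuples_2)
    then show ?thesis using ab d(2) by (simp add: cocycles_simps cochain_add defect_cochain_eval[OF B])
  qed
  have rep: "represents_defect K A B \<rho> f \<longleftrightarrow> (\<forall>a\<in>carrier A. \<forall>b\<in>carrier A. f (ct [a, b]) = ?f (ct [a, b]))" for f
    unfolding represents_defect_def using section_defect(2)[OF B \<rho>] fe by (auto simp: h_def)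
  have eq: "f = ?f" if "f \<in> carrier (cochains K A 2)" "represents_defect K A B \<rho> f" for f
    using that(2) unfolding rep by (intro cochain_eqI[OF that(1) fc]) (auto simp: tuples_2)
  have rf: "represents_defect K A B \<rho> ?f" unfolding rep by blast
  show "\<exists>!f. f \<in> carrier (cochains K A 2) \<and> represents_defect K A B \<rho> f"
    using fc rf eq by blast
  have "cohomology_class K A 2 ?f = cohomology_class K A 2 ?F"
    unfolding cohomology_class_2_eq_iff[OF fz F]
    using hb fe by (intro exI[of _ h]) (simp add: defect_cochain_eval[OF B])
  then show "f \<in> carrier (cocycles K A 2) \<and>
      cohomology_class K A 2 (defect_cochain B) = cohomology_class K A 2 f"
    if "f \<in> carrier (cochains K A 2)" "represents_defect K A B \<rho> f"
    using eq[OF that] fz by simp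
qed

text \<open>The map is well defined and injective because isomorphism is equality of classes, and
  surjective because the square-zero extension of a cocycle has that cocycle as its defect.\<close>

theorem HH_2:
  "\<exists>\<Phi>. bij_betw \<Phi> (Ext_classes K A) (carrier (HH K A 2)) \<and>
     (\<forall>B. deformation K A B \<longrightarrow>
        \<Phi> (deformation_iso K A `` {B}) = cohomology_class K A 2 (defect_cochain B))"
proof -
  interpret Q: module_quotient K "cocycles K A 2" "coboundaries K A 2"
    by (intro module_quotient.intro module_quotient_axioms.intro module_cocycles
        submodule_coboundaries_cocycles coboundaries_2_subset)
  let ?cls = "\<lambda>B. cohomology_class K A 2 (defect_cochain B)"
  let ?R = "deformation_iso K A"
  \<comment> \<open>Any member of the isomorphism class may be used, as all members have the same
    cohomology class.\<close>
  define \<Phi> where "\<Phi> X = ?cls (SOME B. B \<in> X)" for X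
  have \<Phi>: "\<Phi> (?R `` {B}) = ?cls B" if B: "deformation K A B" for B
  proof -
    have "B \<in> ?R `` {B}" using B by (simp add: deformation_iso_iff_class)
    then have "(SOME B'. B' \<in> ?R `` {B}) \<in> ?R `` {B}" by (rule someI)
    moreover have "?cls B' = ?cls B" if "B' \<in> ?R `` {B}" for B'
      using that by (simp add: deformation_iso_iff_class)
    ultimately show ?thesis unfolding \<Phi>_def by blast
  qed
  have Ext: "Ext_classes K A = (\<lambda>B. ?R `` {B}) ` {B. deformation K A B}"
    unfolding Ext_classes_def quotient_def by blast
  have HH2: "carrier (HH K A 2) = cohomology_class K A 2 ` carrier (cocycles K A 2)"
    by (simp add: HH_def quotient_space_def Q.carrier_Q cohomology_class_def)
  have "bij_betw \<Phi> (Ext_classes K A) (carrier (HH K A 2))"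
    unfolding bij_betw_def
  proof
    show "inj_on \<Phi> (Ext_classes K A)"
    proof (rule inj_onI)
      fix X Y assume "X \<in> Ext_classes K A" "Y \<in> Ext_classes K A" and eq: "\<Phi> X = \<Phi> Y"
      then obtain B B' where B: "X = ?R `` {B}" "deformation K A B" "Y = ?R `` {B'}" "deformation K A B'"
        unfolding Ext by blast
      then have "?cls B = ?cls B'" using eq \<Phi> by simp
      \<comment> \<open>Equal invariants of \<open>B\<close> and \<open>B'\<close> mean that the
        same deformations are related to both, so the two classes agree as sets.\<close>
      then show "X = Y" unfolding B(1,3) using B(2,4) by (auto simp: deformation_iso_iff_class)
    qed
    show "\<Phi> ` Ext_classes K A = carrier (HH K A 2)"
    proof
      show "\<Phi> ` Ext_classes K A \<subseteq> carrier (HH K A 2)"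
        unfolding Ext HH2 using \<Phi> defect_cochain_cocycle by auto
      show "carrier (HH K A 2) \<subseteq> \<Phi> ` Ext_classes K A"
      proof
        fix c assume "c \<in> carrier (HH K A 2)"
        then obtain f where f: "f \<in> carrier (cocycles K A 2)" "c = cohomology_class K A 2 f"
          unfolding HH2 by blast
        \<comment> \<open>Its \<open>defect_cochain\<close> is \<open>f\<close> itself and not only
          cohomologous to it, because both cochains agree on pairs.\<close>
        let ?B = "square_zero_extension A (\<lambda>a b. f (ct [a, b]))"
        note B = deformation_square_zero_extension[OF f(1)]
        have "defect_cochain ?B \<in> carrier (cochains K A 2)" "f \<in> carrier (cochains K A 2)"
          using defect_cochain_cocycle[OF B(1)] f(1) unfolding cocycle_iff by blast+
        then have "defect_cochain ?B = f"
          by (rule cochain_eqI) (auto simp: tuples_2 defect_cochain_eval[OF B(1)] B(2))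
        then have "c = \<Phi> (?R `` {?B})" using \<Phi>[OF B(1)] f(2) by simp
        then show "c \<in> \<Phi> ` Ext_classes K A" unfolding Ext using B(1) by blast
      qed
    qed
  qed
  then show ?thesis using \<Phi> by blast
qed

end

text \<open>The first two isomorphisms are pinned down by their values on cocycles. In the third
  part \<open>represents_defect\<close> constrains a cochain on pairs only, so the unique existence
  of \<open>f\<close> says that the formula in the claim defines a cochain, and the existence of a
  section keeps the description of the map from being vacuous.\<close>

theorem theorem5:
  fixes K :: "'k valued_ring" and p :: nat and A :: "('k, 'a) born_space"
  assumes "mixed_char_complete_field K p"
    and "complete_born_algebra K A"
  shows
    "(\<exists>\<Phi>. born_iso K (HH K A 0) (algebra_center A) \<Phi> \<and>
        (\<forall>f\<in>carrier (cocycles K A 0).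
           \<Phi> (cohomology_class K A 0 f) = f (ctensor K A [])))
     \<and>
     (\<exists>\<Phi>. born_iso K (HH K A 1) (outer_derivations K A) \<Phi> \<and>
        (\<forall>f\<in>carrier (cocycles K A 1).
           \<Phi> (cohomology_class K A 1 f) =
             carrier (inner_derivations K A)
               +>\<^bsub>derivations K A\<^esub> (\<lambda>a\<in>carrier A. f (ctensor K A [a]))))
     \<and>
     (\<exists>\<Phi>. bij_betw \<Phi> (Ext_classes K A) (carrier (HH K A 2)) \<and>
        (\<forall>B. deformation K A B \<longrightarrow>
           (\<exists>\<rho>. is_section K A B \<rho>) \<and>
           (\<forall>\<rho>. is_section K A B \<rho> \<longrightarrow>
              (\<exists>!f. f \<in> carrier (cochains K A 2) \<and> represents_defect K A B \<rho> f) \<and>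
              (\<forall>f\<in>carrier (cochains K A 2). represents_defect K A B \<rho> f \<longrightarrow>
                 f \<in> carrier (cocycles K A 2) \<and>
                 \<Phi> (deformation_iso K A `` {B}) = cohomology_class K A 2 f))))"
proof -
  interpret mixed_char_complete_field K p by (rule assms(1))
  have "complete_bornological K A" using assms(2) by (simp add: complete_born_algebra_def)
  then have "module K A" "is_bornology K A (bornology A)"
    by (simp_all add: complete_bornological_def bornological_space_def)
  then interpret complete_algebra K p A
    using assms \<open>complete_bornological K A\<close>
    by (intro complete_algebra.intro complete_bornological_space.intro bornological.intro
        bornological_axioms.intro complete_bornological_space_axioms.intro complete_algebra_axioms.intro)
  obtain \<Phi> where \<Phi>: "bij_betw \<Phi> (Ext_classes K A) (carrier (HH K A 2))"
    "\<forall>B. deformation K A B \<longrightarrow>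
        \<Phi> (deformation_iso K A `` {B}) = cohomology_class K A 2 (defect_cochain B)"
    using HH_2 by blast
  show ?thesis
  proof (intro conjI HH_0 HH_1 exI[of _ \<Phi>] \<Phi>(1) allI impI ballI)
    fix B assume B: "deformation K A B"
    show "\<exists>\<rho>. is_section K A B \<rho>" using zero_section[OF B] by blast
    fix \<rho> assume \<rho>: "is_section K A B \<rho>"
    show "\<exists>!f. f \<in> carrier (cochains K A 2) \<and> represents_defect K A B \<rho> f"
      by (rule section_class(1)[OF B \<rho>])
    fix f assume f: "f \<in> carrier (cochains K A 2)" "represents_defect K A B \<rho> f"
    show "f \<in> carrier (cocycles K A 2)" using section_class(2)[OF B \<rho> f] by blast
    show "\<Phi> (deformation_iso K A `` {B}) = cohomology_class K A 2 f"
      using section_class(2)[OF B \<rho> f] \<Phi>(2) B by simp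
  qed
qed

end
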